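(* Let $k$ be a field of characteristic different from $2$, let $(Q,S)$ be a quiver with potential and let $G=\{1,\sigma\}$ be a group of order two acting on the finite quiver $Q$, such that whenever two vertices $i,j$ are fixed by $G$ all arrows from $i$ to $j$ are fixed by $G$, and such that $S$ and $\sigma(S)$ are cyclically equivalent. Let $\widehat\Gamma=\widehat\Gamma_{Q,S}$ be the complete Ginzburg dg algebra. \begin{enumerate} \item The action of $G$ on $(Q,S)$ induces an action of $G$ on $\widehat\Gamma$ by dg automorphisms. \item The dg algebra $\bar e\,\widehat\Gamma G\,\bar e$ is isomorphic to the complete Ginzburg dg algebra of the quiver with potential $(Q_G,S_G)$, where $S_G=\iota'(S)$. \end{enumerate}
   Context: Arrows are composed from right to left; $s(\alpha),t(\alpha)$ are the source and target of $\alpha$. Ginzburg dg algebra. $\widehat\Gamma_{Q,S}$ is the completed graded path algebra of the graded quiver $\bar Q$ with the vertices of $Q$, the arrows $\alpha:i\to j$ of $Q$ in degree $0$, an arrow $\bar\alpha:j\to i$ of degree $-1$ for each arrow $\alpha:i\to j$ of $Q$, and a loop $t_i:i\to i$ of degree $-2$ for each vertex $i$. Its differential is continuous, satisfies the Leibniz rule, and $d(\alpha)=0$, $d(\bar\alpha)=\partial_\alpha S$ (cyclic derivative), $d(t_i)=e_i\big(\sum_{\alpha\in Q_1}(\alpha\bar\alpha-\bar\alpha\alpha)\big)e_i$. Skew group dg algebra. If a finite group $G$ acts on a dg algebra $\Gamma$ by dg automorphisms, $\Gamma G=\Gamma\otimes_k kG$ with $(x\otimes g)(y\otimes h)=x\,g(y)\otimes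 gh$ and $d(x\otimes g)=d(x)\otimes g$. Idempotent $\bar e$. Let $V$ (resp. $W$) be the set of vertices of $Q$ fixed (resp. not fixed) by $\sigma$, and $o(W)$ a set of representatives of the $G$-orbits in $W$. For $i\in V$ put $e_i^\pm=\frac12 e_i\otimes(1\pm\sigma)$; for $i\in W$ put $e_i^\pm=\frac12(e_i+e_{\sigma(i)})\otimes(1\pm\sigma)$ (so $e_i^\pm=e_{\sigma(i)}^\pm$). Put $\bar e=\sum_{i\in V}(e_i^++e_i^-)+\sum_{j\in o(W)}e_j^+$. Quiver $Q_G$. Its vertices are $i^+,i^-$ for $i\in V$ and $j^+$ for $j\in o(W)$ (with $\sigma(j)^+=j^+$), corresponding to the idempotents $e_i^\pm$, $e_j^+$. Fix a set $o(Q_1)$ of representatives of the $G$-orbits of arrows of $Q$. Each $\alpha:i\to j$ in $o(Q_1)$ gives: two arrows $\alpha^\pm:i^\pm\to j^\pm$ if $i,j\in V$; two arrows $\alpha^\pm:i^\pm\to j^+$ if $i\in V,j\in W$; two arrows $\alpha^\pm:i^+\to j^\pm$ if $i\in W,j\in V$; one arrow $\alpha^+:i^+\to j^+$ if $i,j\in W$. They correspond respectively to the elements $e_j^\pm(\alpha\otimes1)e_i^\pm$, $e_j^+(\alpha\otimes1)e_i^\pm$, $e_j^\pm(\alpha\otimes1)e_i^+$, $e_j^+(\alpha\otimes1)e_i^+$; in this way $\bar e(\widehat{kQ}\,G)\bar e$ is identified with the complete path algebra of $Q_G$. Maps $\iota,\iota'$. $\iota(\lambda)=\bar e(\lambda\otimes1)\bar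 e$. For a cyclic path $w$, $\iota'(w)=\iota(w)$ if its starting (= ending) vertex is in $V$, and $\iota'(w)=2\iota(w)$ if it is in $W$. This is well defined up to cyclic equivalence and extends linearly to potentials. *)

theory Defs
  imports
    "HOL-Algebra.Algebraic_Closure_Type"
    "HOL-Algebra.Group_Action"
    "HOL-Algebra.QuotRing"
    "Graph_Theory.Arc_Walk"
begin

section \<open>Graded and dg algebras over a field\<close>

record ('k, 'a) graded_alg = "('k, 'a) module" +
  grade :: "int \<Rightarrow> 'a set"

record ('k, 'a) dg_alg = "('k, 'a) graded_alg" +
  diff :: "'a \<Rightarrow> 'a"

text \<open>The ground field is the type \<open>'k\<close>, seen as the ring \<^const>\<open>ring_of_type_algebra\<close>.
  The grading is cohomological: differentials have degree \<open>+1\<close>.\<close>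

locale dg_algebra =
  ring A + module "ring_of_type_algebra :: 'k::field ring" A
  for A :: "('k::field, 'a, 'm) dg_alg_scheme" (structure) +
  assumes smult_mult_left:
      "x \<in> carrier A \<Longrightarrow> y \<in> carrier A \<Longrightarrow> (c \<odot> x) \<otimes> y = c \<odot> (x \<otimes> y)"
    and smult_mult_right:
      "x \<in> carrier A \<Longrightarrow> y \<in> carrier A \<Longrightarrow> x \<otimes> (c \<odot> y) = c \<odot> (x \<otimes> y)"
    and grade_submodule: "submodule (grade A n) (ring_of_type_algebra :: 'k ring) A"
    and grade_decomposition:
      "x \<in> carrier A \<Longrightarrow> \<exists>!h. (\<forall>n. h n \<in> grade A n) \<and> finite {n. h n \<noteq> \<zero>} \<and>
         x = (\<Oplus>n\<in>{n. h n \<noteq> \<zero>}. h n)"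
    and grade_one: "\<one> \<in> grade A 0"
    and grade_mult: "x \<in> grade A m \<Longrightarrow> y \<in> grade A n \<Longrightarrow> x \<otimes> y \<in> grade A (m + n)"
    and diff_add: "x \<in> carrier A \<Longrightarrow> y \<in> carrier A \<Longrightarrow> diff A (x \<oplus> y) = diff A x \<oplus> diff A y"
    and diff_smult: "x \<in> carrier A \<Longrightarrow> diff A (c \<odot> x) = c \<odot> diff A x"
    and diff_grade: "x \<in> grade A n \<Longrightarrow> diff A x \<in> grade A (n + 1)"
    and diff_diff: "x \<in> carrier A \<Longrightarrow> diff A (diff A x) = \<zero>"
    and diff_mult: "x \<in> grade A n \<Longrightarrow> y \<in> carrier A \<Longrightarrow>
         diff A (x \<otimes> y) = diff A x \<otimes> y \<oplus> ((-1) powi n) \<odot> (x \<otimes> diff A y)"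

text \<open>Isomorphisms of dg algebras are bijective; since a dg algebra is the direct sum of its
  homogeneous parts, mapping \<open>grade A n\<close> into \<open>grade B n\<close> for all \<open>n\<close> makes the inverse
  homogeneous too.\<close>

definition dg_iso ::
  "('k::field, 'a, 'm) dg_alg_scheme \<Rightarrow> ('k, 'b, 'n) dg_alg_scheme \<Rightarrow> ('a \<Rightarrow> 'b) set" where
  "dg_iso A B = {f \<in> ring_iso A B.
     (\<forall>c. \<forall>x\<in>carrier A. f (c \<odot>\<^bsub>A\<^esub> x) = c \<odot>\<^bsub>B\<^esub> f x) \<and>
     (\<forall>n. f ` grade A n \<subseteq> grade B n) \<and>
     (\<forall>x\<in>carrier A. f (diff A x) = diff B (f x))}"

definition dg_isomorphic ::
  "('k::field, 'a, 'm) dg_alg_scheme \<Rightarrow> ('k, 'b, 'n) dg_alg_scheme \<Rightarrow> bool" where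
  "dg_isomorphic A B \<longleftrightarrow> dg_algebra A \<and> dg_algebra B \<and> dg_iso A B \<noteq> {}"

definition acts_by_dg_automorphisms ::
  "('g, 'm) monoid_scheme \<Rightarrow> ('k::field, 'a, 'n) dg_alg_scheme \<Rightarrow> ('g \<Rightarrow> 'a \<Rightarrow> 'a) \<Rightarrow> bool" where
  "acts_by_dg_automorphisms G A act \<longleftrightarrow>
     dg_algebra A \<and> group_action G (carrier A) (\<lambda>g. restrict (act g) (carrier A)) \<and>
     (\<forall>g\<in>carrier G. act g \<in> dg_iso A A)"

definition corner :: "'a \<Rightarrow> ('k, 'a, 'm) dg_alg_scheme \<Rightarrow> ('k, 'a, 'm) dg_alg_scheme" where
  "corner e A = A\<lparr>
     carrier := {e \<otimes>\<^bsub>A\<^esub> x \<otimes>\<^bsub>A\<^esub> e | x. x \<in> carrier A},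
     one := e,
     grade := \<lambda>n. grade A n \<inter> {e \<otimes>\<^bsub>A\<^esub> x \<otimes>\<^bsub>A\<^esub> e | x. x \<in> carrier A}\<rparr>"


section \<open>Skew group algebras\<close>

text \<open>An element \<open>F\<close> of \<open>A \<otimes> kG\<close> is the function whose value at \<open>g\<close> is the
  coefficient in \<open>A\<close> of \<open>g\<close>, that is \<open>F = (\<Sum>g\<in>G. F g \<otimes> g)\<close>; it is \<open>undefined\<close> outside \<open>G\<close>.\<close>

definition skew_algebra ::
  "('g, 'm) monoid_scheme \<Rightarrow> ('g \<Rightarrow> 'a \<Rightarrow> 'a) \<Rightarrow> ('k, 'a, 'n) module_scheme \<Rightarrow> ('k, 'g \<Rightarrow> 'a) module"
  where
  "skew_algebra G act A = \<lparr>
     carrier = carrier G \<rightarrow>\<^sub>E carrier A,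
     monoid.mult = (\<lambda>F H. \<lambda>g\<in>carrier G.
       \<Oplus>\<^bsub>A\<^esub>h\<in>carrier G. F h \<otimes>\<^bsub>A\<^esub> act h (H (inv\<^bsub>G\<^esub> h \<otimes>\<^bsub>G\<^esub> g))),
     one = (\<lambda>g\<in>carrier G. if g = \<one>\<^bsub>G\<^esub> then \<one>\<^bsub>A\<^esub> else \<zero>\<^bsub>A\<^esub>),
     ring.zero = (\<lambda>g\<in>carrier G. \<zero>\<^bsub>A\<^esub>),
     add = (\<lambda>F H. \<lambda>g\<in>carrier G. F g \<oplus>\<^bsub>A\<^esub> H g),
     module.smult = (\<lambda>c F. \<lambda>g\<in>carrier G. c \<odot>\<^bsub>A\<^esub> F g)\<rparr>"

definition skew_dg_algebra ::
  "('g, 'm) monoid_scheme \<Rightarrow> ('g \<Rightarrow> 'a \<Rightarrow> 'a) \<Rightarrow> ('k, 'a, 'n) dg_alg_scheme \<Rightarrow> ('k, 'g \<Rightarrow> 'a) dg_alg"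
  where
  "skew_dg_algebra G act A = module.extend (skew_algebra G act A)
     \<lparr>grade = \<lambda>n. carrier G \<rightarrow>\<^sub>E grade A n, diff = \<lambda>F. \<lambda>g\<in>carrier G. diff A (F g)\<rparr>"

text \<open>The element \<open>x \<otimes> c\<close>, where \<open>c\<close> is an element of \<open>kG\<close> given by its coefficients.\<close>

definition skew_tensor ::
  "('g, 'm) monoid_scheme \<Rightarrow> ('k, 'a, 'n) module_scheme \<Rightarrow> 'a \<Rightarrow> ('g \<Rightarrow> 'k) \<Rightarrow> 'g \<Rightarrow> 'a" where
  "skew_tensor G A x c = (\<lambda>g\<in>carrier G. c g \<odot>\<^bsub>A\<^esub> x)"

definition grp_elt :: "'g \<Rightarrow> 'g \<Rightarrow> 'k::field" where
  "grp_elt g = (\<lambda>h. if h = g then 1 else 0)"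


section \<open>Quivers and complete path algebras\<close>

text \<open>Quivers are the multidigraphs \<^typ>\<open>('v, 'a) pre_digraph\<close>, with \<^const>\<open>tail\<close> as source and
  \<^const>\<open>head\<close> as target. A path is a pair of its starting vertex and the list of its arrows in
  the order in which they are traversed, so that, arrows being composed from right to left, the path
  \<open>\<alpha>\<^sub>n \<dots> \<alpha>\<^sub>1\<close> is \<open>(s(\<alpha>\<^sub>1), [\<alpha>\<^sub>1, \<dots>, \<alpha>\<^sub>n])\<close> and \<open>e\<^sub>i\<close> is \<open>(i, [])\<close>.\<close>

type_synonym ('v, 'b) path = "'v \<times> 'b list"
type_synonym ('v, 'b, 'k) pelt = "('v, 'b) path \<Rightarrow> 'k"

definition quiver_paths :: "('v, 'b) pre_digraph \<Rightarrow> ('v, 'b) path set" where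
  "quiver_paths Q = {(u, p). \<exists>v. pre_digraph.awalk Q u p v}"

definition cycles :: "('v, 'b) pre_digraph \<Rightarrow> ('v, 'b) path set" where
  "cycles Q = {(u, p). p \<noteq> [] \<and> pre_digraph.awalk Q u p u}"

definition path_degree :: "('b \<Rightarrow> int) \<Rightarrow> ('v, 'b) path \<Rightarrow> int" where
  "path_degree wt x = sum_list (map wt (snd x))"

text \<open>The completed graded path algebra of a finite quiver whose arrows are graded by \<open>wt\<close>:
  the degree \<open>n\<close> part consists of all, possibly infinite, linear combinations of paths of
  degree \<open>n\<close>, encoded by their coefficients, and an element has finitely many nonzero
  homogeneous components. If \<open>wt = (\<lambda>_. 0)\<close>, this is the ordinary complete path algebra.\<close>

definition path_algebra ::
  "('v, 'b) pre_digraph \<Rightarrow> ('b \<Rightarrow> int) \<Rightarrow> ('k::field, ('v, 'b, 'k) pelt) graded_alg" where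
  "path_algebra Q wt = \<lparr>
     carrier = {f. (\<forall>x. f x \<noteq> 0 \<longrightarrow> x \<in> quiver_paths Q) \<and>
                   finite (path_degree wt ` {x. f x \<noteq> 0})},
     monoid.mult = (\<lambda>f g (u, p).
       \<Sum>l\<le>length p. f (pre_digraph.awlast Q u (take l p), drop l p) * g (u, take l p)),
     one = (\<lambda>(u, p). if u \<in> verts Q \<and> p = [] then 1 else 0),
     ring.zero = (\<lambda>x. 0),
     add = (\<lambda>f g x. f x + g x),
     module.smult = (\<lambda>c f x. c * f x),
     grade = (\<lambda>n. {f. \<forall>x. f x \<noteq> 0 \<longrightarrow> x \<in> quiver_paths Q \<and> path_degree wt x = n})\<rparr>"

abbreviation complete_path_algebra ::
  "('v, 'a) pre_digraph \<Rightarrow> ('k::field, ('v, 'a, 'k) pelt) graded_alg" where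
  "complete_path_algebra Q \<equiv> path_algebra Q (\<lambda>_. 0)"

definition path_elt :: "('v, 'b) path \<Rightarrow> ('v, 'b, 'k::field) pelt" where
  "path_elt x = (\<lambda>y. if y = x then 1 else 0)"

abbreviation vertex_elt :: "'v \<Rightarrow> ('v, 'b, 'k::field) pelt" where
  "vertex_elt i \<equiv> path_elt (i, [])"

definition arrow_elt :: "('v, 'b) pre_digraph \<Rightarrow> 'b \<Rightarrow> ('v, 'b, 'k::field) pelt" where
  "arrow_elt Q \<alpha> = path_elt (tail Q \<alpha>, [\<alpha>])"


section \<open>Potentials and complete Ginzburg dg algebras\<close>

definition quiver_with_potential ::
  "('v, 'a) pre_digraph \<Rightarrow> ('v, 'a, 'k::field) pelt \<Rightarrow> bool" where
  "quiver_with_potential Q S \<longleftrightarrow> fin_digraph Q \<and> (\<forall>x. S x \<noteq> 0 \<longrightarrow> x \<in> cycles Q)"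

definition rotate_cycle :: "('v, 'a) pre_digraph \<Rightarrow> ('v, 'a) path \<Rightarrow> ('v, 'a) path" where
  "rotate_cycle Q = (\<lambda>(u, p). (head Q (hd p), tl p @ [hd p]))"

text \<open>The difference lies in the closure, for the topology given by path length, of the span of
  all \<open>\<alpha>\<^sub>n \<dots> \<alpha>\<^sub>1 - \<alpha>\<^sub>1\<alpha>\<^sub>n \<dots> \<alpha>\<^sub>2\<close> with \<open>\<alpha>\<^sub>n \<dots> \<alpha>\<^sub>1\<close> a cycle.\<close>

definition cyclically_equivalent ::
  "('v, 'a) pre_digraph \<Rightarrow> ('v, 'a, 'k::field) pelt \<Rightarrow> ('v, 'a, 'k) pelt \<Rightarrow> bool" where
  "cyclically_equivalent Q S T \<longleftrightarrow>
     (\<forall>N. \<exists>F c. finite F \<and> F \<subseteq> cycles Q \<and>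
        (\<forall>x. length (snd x) < N \<longrightarrow>
           S x - T x = (\<Sum>w\<in>F. c w * (path_elt w x - path_elt (rotate_cycle Q w) x))))"

text \<open>The continuous extension of \<open>\<partial>\<^sub>\<alpha> c = (\<Sum>c = u\<alpha>v. vu)\<close>: the coefficient of \<open>\<partial>\<^sub>\<alpha> S\<close>
  at a path from \<open>t(\<alpha>)\<close> to \<open>s(\<alpha>)\<close> is the sum, over its factorisations \<open>vu\<close>, of the
  coefficients of \<open>S\<close> at \<open>u\<alpha>v\<close>. Here \<open>u = take l p\<close> is traversed before \<open>v = drop l p\<close> in
  \<open>vu\<close>, and after it in \<open>u\<alpha>v\<close>.\<close>

definition cyclic_derivative ::
  "('v, 'a) pre_digraph \<Rightarrow> 'a \<Rightarrow> ('v, 'a, 'k::field) pelt \<Rightarrow> ('v, 'a, 'k) pelt" where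
  "cyclic_derivative Q \<alpha> S = (\<lambda>(b, p).
     if b = head Q \<alpha> \<and> pre_digraph.awalk Q b p (tail Q \<alpha>)
     then \<Sum>l\<le>length p. S (pre_digraph.awlast Q b (take l p), drop l p @ [\<alpha>] @ take l p)
     else 0)"

datatype ('v, 'a) ginzburg_arrow = Orig (orig: 'a) | Dual 'a | Loop 'v

primrec ginzburg_degree :: "('v, 'a) ginzburg_arrow \<Rightarrow> int" where
  "ginzburg_degree (Orig \<alpha>) = 0"
| "ginzburg_degree (Dual \<alpha>) = -1"
| "ginzburg_degree (Loop i) = -2"

definition ginzburg_quiver ::
  "('v, 'a) pre_digraph \<Rightarrow> ('v, ('v, 'a) ginzburg_arrow) pre_digraph" where
  "ginzburg_quiver Q = \<lparr>
     verts = verts Q,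
     arcs = Orig ` arcs Q \<union> Dual ` arcs Q \<union> Loop ` verts Q,
     tail = case_ginzburg_arrow (tail Q) (head Q) (\<lambda>i. i),
     head = case_ginzburg_arrow (head Q) (tail Q) (\<lambda>i. i)\<rparr>"

abbreviation ginzburg_graded ::
  "('v, 'a) pre_digraph \<Rightarrow> ('k::field, ('v, ('v, 'a) ginzburg_arrow, 'k) pelt) graded_alg" where
  "ginzburg_graded Q \<equiv> path_algebra (ginzburg_quiver Q) ginzburg_degree"

definition incl_ginzburg ::
  "('v, 'a, 'k::field) pelt \<Rightarrow> ('v, ('v, 'a) ginzburg_arrow, 'k) pelt" where
  "incl_ginzburg f = (\<lambda>(u, p). if set p \<subseteq> range Orig then f (u, map orig p) else 0)"

text \<open>The predicate characterising the differential. Continuity is that of graded maps: each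
  homogeneous part carries the topology given by path length, and for a linear map continuity at
  \<open>0\<close> is enough. The values outside the carrier are fixed so that \<open>d\<close> is unique as a function.\<close>

definition is_ginzburg_differential ::
  "('v, 'a) pre_digraph \<Rightarrow> ('v, 'a, 'k::field) pelt \<Rightarrow>
   (('v, ('v, 'a) ginzburg_arrow, 'k) pelt \<Rightarrow> ('v, ('v, 'a) ginzburg_arrow, 'k) pelt) \<Rightarrow> bool" where
  "is_ginzburg_differential Q S d \<longleftrightarrow>
     (let A = ginzburg_graded Q; arr = arrow_elt (ginzburg_quiver Q) in
      d \<in> extensional (carrier A) \<and>
      (\<forall>x\<in>carrier A. \<forall>y\<in>carrier A. d (x \<oplus>\<^bsub>A\<^esub> y) = d x \<oplus>\<^bsub>A\<^esub> d y) \<and>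
      (\<forall>c. \<forall>x\<in>carrier A. d (c \<odot>\<^bsub>A\<^esub> x) = c \<odot>\<^bsub>A\<^esub> d x) \<and>
      (\<forall>n. \<forall>x\<in>grade A n. d x \<in> grade A (n + 1)) \<and>
      (\<forall>n. \<forall>x\<in>grade A n. \<forall>y\<in>carrier A.
         d (x \<otimes>\<^bsub>A\<^esub> y) = d x \<otimes>\<^bsub>A\<^esub> y \<oplus>\<^bsub>A\<^esub> ((-1) powi n) \<odot>\<^bsub>A\<^esub> (x \<otimes>\<^bsub>A\<^esub> d y)) \<and>
      (\<forall>n M. \<exists>N. \<forall>x\<in>grade A n. (\<forall>w. length (snd w) < N \<longrightarrow> x w = 0) \<longrightarrow>
         (\<forall>w. length (snd w) < M \<longrightarrow> d x w = 0)) \<and>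
      (\<forall>\<alpha>\<in>arcs Q. d (arr (Orig \<alpha>)) = \<zero>\<^bsub>A\<^esub>) \<and>
      (\<forall>\<alpha>\<in>arcs Q. d (arr (Dual \<alpha>)) = incl_ginzburg (cyclic_derivative Q \<alpha> S)) \<and>
      (\<forall>i\<in>verts Q. d (arr (Loop i)) =
         vertex_elt i \<otimes>\<^bsub>A\<^esub>
         (\<Oplus>\<^bsub>A\<^esub>\<alpha>\<in>arcs Q. arr (Orig \<alpha>) \<otimes>\<^bsub>A\<^esub> arr (Dual \<alpha>) \<ominus>\<^bsub>A\<^esub> arr (Dual \<alpha>) \<otimes>\<^bsub>A\<^esub> arr (Orig \<alpha>))
         \<otimes>\<^bsub>A\<^esub> vertex_elt i))"

definition ginzburg_dg_algebra ::
  "('v, 'a) pre_digraph \<Rightarrow> ('v, 'a, 'k::field) pelt \<Rightarrow>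
   ('k, ('v, ('v, 'a) ginzburg_arrow, 'k) pelt) dg_alg" where
  "ginzburg_dg_algebra Q S =
     graded_alg.extend (ginzburg_graded Q) \<lparr>diff = (THE d. is_ginzburg_differential Q S d)\<rparr>"


section \<open>Group actions on quivers\<close>

definition quiver_action ::
  "('g, 'm) monoid_scheme \<Rightarrow> ('v, 'a) pre_digraph \<Rightarrow> ('g \<Rightarrow> 'v \<Rightarrow> 'v) \<Rightarrow> ('g \<Rightarrow> 'a \<Rightarrow> 'a) \<Rightarrow> bool"
  where
  "quiver_action G Q vact aact \<longleftrightarrow>
     group_action G (verts Q) vact \<and> group_action G (arcs Q) aact \<and>
     (\<forall>g\<in>carrier G. \<forall>\<alpha>\<in>arcs Q.
        tail Q (aact g \<alpha>) = vact g (tail Q \<alpha>) \<and> head Q (aact g \<alpha>) = vact g (head Q \<alpha>))"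

text \<open>The continuous linear extension of the action on paths: the coefficient of \<open>g f\<close> at a
  path \<open>x\<close> is that of \<open>f\<close> at \<open>g\<^sup>-\<^sup>1 x\<close>.\<close>

definition path_action ::
  "('g, 'm) monoid_scheme \<Rightarrow> ('v, 'b) pre_digraph \<Rightarrow> ('g \<Rightarrow> 'v \<Rightarrow> 'v) \<Rightarrow> ('g \<Rightarrow> 'b \<Rightarrow> 'b) \<Rightarrow>
   'g \<Rightarrow> ('v, 'b, 'k::field) pelt \<Rightarrow> ('v, 'b, 'k) pelt" where
  "path_action G Q vact aact g f = (\<lambda>(u, p).
     if (u, p) \<in> quiver_paths Q then f (vact (inv\<^bsub>G\<^esub> g) u, map (aact (inv\<^bsub>G\<^esub> g)) p) else 0)"

text \<open>On the arrows of the Ginzburg quiver, \<^const>\<open>map_ginzburg_arrow\<close> maps \<open>\<alpha>\<close>, the dual of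
  \<open>\<alpha>\<close> and \<open>t\<^sub>i\<close> to \<open>g\<alpha>\<close>, the dual of \<open>g\<alpha>\<close> and \<open>t\<close> at \<open>gi\<close>.\<close>

definition ginzburg_action ::
  "('g, 'm) monoid_scheme \<Rightarrow> ('v, 'a) pre_digraph \<Rightarrow> ('g \<Rightarrow> 'v \<Rightarrow> 'v) \<Rightarrow> ('g \<Rightarrow> 'a \<Rightarrow> 'a) \<Rightarrow>
   'g \<Rightarrow> ('v, ('v, 'a) ginzburg_arrow, 'k::field) pelt \<Rightarrow>
   ('v, ('v, 'a) ginzburg_arrow, 'k) pelt" where
  "ginzburg_action G Q vact aact =
     path_action G (ginzburg_quiver Q) vact (\<lambda>g. map_ginzburg_arrow (vact g) (aact g))"

definition orbit_representatives ::
  "('g, 'm) monoid_scheme \<Rightarrow> ('g \<Rightarrow> 'x \<Rightarrow> 'x) \<Rightarrow> 'x set \<Rightarrow> 'x set \<Rightarrow> bool" where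
  "orbit_representatives G act E R \<longleftrightarrow>
     R \<subseteq> E \<and> (\<forall>x\<in>E. \<exists>!r. r \<in> R \<and> r \<in> orbit G act x)"


section \<open>The quiver with potential of a group of order two\<close>

datatype sign = Plus | Minus

primrec sign_val :: "sign \<Rightarrow> 'k::field" where
  "sign_val Plus = 1"
| "sign_val Minus = -1"

text \<open>\<open>i\<^sup>\<plusminus>\<close> for a fixed vertex \<open>i\<close>, and \<open>j\<^sup>+\<close> otherwise, where \<open>j\<close> is the chosen
  representative of the orbit of \<open>i\<close>.\<close>

definition skew_vertex ::
  "('g, 'm) monoid_scheme \<Rightarrow> ('g \<Rightarrow> 'v \<Rightarrow> 'v) \<Rightarrow> 'g \<Rightarrow> 'v set \<Rightarrow> 'v \<Rightarrow> sign \<Rightarrow> 'v \<times> sign" where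
  "skew_vertex G vact \<sigma> oW i s =
     (if vact \<sigma> i = i then (i, s) else (THE j. j \<in> oW \<and> j \<in> orbit G vact i, Plus))"

text \<open>The arrows \<open>\<alpha>\<^sup>\<plusminus>\<close> are \<open>(\<alpha>, Plus)\<close> and \<open>(\<alpha>, Minus)\<close>; the latter is omitted if neither
  end of \<open>\<alpha>\<close> is fixed.\<close>

definition skew_quiver ::
  "('g, 'm) monoid_scheme \<Rightarrow> ('v, 'a) pre_digraph \<Rightarrow> ('g \<Rightarrow> 'v \<Rightarrow> 'v) \<Rightarrow> 'g \<Rightarrow> 'v set \<Rightarrow> 'a set \<Rightarrow>
   ('v \<times> sign, 'a \<times> sign) pre_digraph" where
  "skew_quiver G Q vact \<sigma> oW oQ1 = \<lparr>
     verts = invariants (verts Q) vact \<sigma> \<times> {Plus, Minus} \<union> oW \<times> {Plus},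
     arcs = {(\<alpha>, s). \<alpha> \<in> oQ1 \<and>
       (s = Plus \<or> vact \<sigma> (tail Q \<alpha>) = tail Q \<alpha> \<or> vact \<sigma> (head Q \<alpha>) = head Q \<alpha>)},
     tail = (\<lambda>(\<alpha>, s). skew_vertex G vact \<sigma> oW (tail Q \<alpha>) s),
     head = (\<lambda>(\<alpha>, s). skew_vertex G vact \<sigma> oW (head Q \<alpha>) s)\<rparr>"

text \<open>The idempotent of the vertex \<open>(i, s)\<close> in the skew group algebra of \<open>B\<close>, where \<open>B\<close> is either
  the complete path algebra or the Ginzburg dg algebra.\<close>

definition skew_idem ::
  "('g, 'm) monoid_scheme \<Rightarrow> ('k::field, ('v, 'b, 'k) pelt, 'n) module_scheme \<Rightarrow>
   ('g \<Rightarrow> 'v \<Rightarrow> 'v) \<Rightarrow> 'g \<Rightarrow> 'v \<times> sign \<Rightarrow> 'g \<Rightarrow> ('v, 'b, 'k) pelt" where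
  "skew_idem G B vact \<sigma> = (\<lambda>(i, s). skew_tensor G B
     ((1 / 2) \<odot>\<^bsub>B\<^esub>
       (if vact \<sigma> i = i then vertex_elt i else vertex_elt i \<oplus>\<^bsub>B\<^esub> vertex_elt (vact \<sigma> i)))
     (\<lambda>h. grp_elt \<one>\<^bsub>G\<^esub> h + sign_val s * grp_elt \<sigma> h))"

definition skew_ebar ::
  "('g, 'm) monoid_scheme \<Rightarrow> ('v, 'a) pre_digraph \<Rightarrow>
   ('k::field, ('v, 'b, 'k) pelt, 'n) module_scheme \<Rightarrow>
   ('k, 'g \<Rightarrow> ('v, 'b, 'k) pelt, 'l) module_scheme \<Rightarrow>
   ('g \<Rightarrow> 'v \<Rightarrow> 'v) \<Rightarrow> 'g \<Rightarrow> 'v set \<Rightarrow> 'g \<Rightarrow> ('v, 'b, 'k) pelt" where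
  "skew_ebar G Q B BG vact \<sigma> oW =
     (\<Oplus>\<^bsub>BG\<^esub>i\<in>invariants (verts Q) vact \<sigma>.
        skew_idem G B vact \<sigma> (i, Plus) \<oplus>\<^bsub>BG\<^esub> skew_idem G B vact \<sigma> (i, Minus))
     \<oplus>\<^bsub>BG\<^esub> (\<Oplus>\<^bsub>BG\<^esub>j\<in>oW. skew_idem G B vact \<sigma> (j, Plus))"

abbreviation skew_path_algebra ::
  "('g, 'm) monoid_scheme \<Rightarrow> ('v, 'a) pre_digraph \<Rightarrow> ('g \<Rightarrow> 'v \<Rightarrow> 'v) \<Rightarrow> ('g \<Rightarrow> 'a \<Rightarrow> 'a) \<Rightarrow>
   ('k::field, 'g \<Rightarrow> ('v, 'a, 'k) pelt) module" where
  "skew_path_algebra G Q vact aact \<equiv>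
     skew_algebra G (path_action G Q vact aact) (complete_path_algebra Q)"

definition skew_arrow_elt ::
  "('g, 'm) monoid_scheme \<Rightarrow> ('v, 'a) pre_digraph \<Rightarrow> ('g \<Rightarrow> 'v \<Rightarrow> 'v) \<Rightarrow> ('g \<Rightarrow> 'a \<Rightarrow> 'a) \<Rightarrow>
   'g \<Rightarrow> 'v set \<Rightarrow> 'a set \<Rightarrow> 'a \<times> sign \<Rightarrow> 'g \<Rightarrow> ('v, 'a, 'k::field) pelt" where
  "skew_arrow_elt G Q vact aact \<sigma> oW oQ1 a =
     (let B = complete_path_algebra Q; BG = skew_path_algebra G Q vact aact;
          QG = skew_quiver G Q vact \<sigma> oW oQ1 in
      skew_idem G B vact \<sigma> (head QG a) \<otimes>\<^bsub>BG\<^esub>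
      skew_tensor G B (arrow_elt Q (fst a)) (grp_elt \<one>\<^bsub>G\<^esub>) \<otimes>\<^bsub>BG\<^esub>
      skew_idem G B vact \<sigma> (tail QG a))"

text \<open>The image of a path of \<open>Q\<^sub>G\<close> under the identification with elements of the skew group
  algebra; the arrow traversed first is the rightmost factor.\<close>

fun skew_path_elt ::
  "('g, 'm) monoid_scheme \<Rightarrow> ('v, 'a) pre_digraph \<Rightarrow> ('g \<Rightarrow> 'v \<Rightarrow> 'v) \<Rightarrow> ('g \<Rightarrow> 'a \<Rightarrow> 'a) \<Rightarrow>
   'g \<Rightarrow> 'v set \<Rightarrow> 'a set \<Rightarrow> ('v \<times> sign, 'a \<times> sign) path \<Rightarrow> 'g \<Rightarrow> ('v, 'a, 'k::field) pelt" where
  "skew_path_elt G Q vact aact \<sigma> oW oQ1 (x, []) =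
     skew_idem G (complete_path_algebra Q) vact \<sigma> x"
| "skew_path_elt G Q vact aact \<sigma> oW oQ1 (x, a # p) =
     skew_path_elt G Q vact aact \<sigma> oW oQ1 (head (skew_quiver G Q vact \<sigma> oW oQ1) a, p)
     \<otimes>\<^bsub>skew_path_algebra G Q vact aact\<^esub> skew_arrow_elt G Q vact aact \<sigma> oW oQ1 a"

text \<open>The identification of the complete path algebra of \<open>Q\<^sub>G\<close> with the corner of the skew
  group algebra, as the coefficientwise sum of \<open>f x\<close> times the image of \<open>x\<close> over the paths \<open>x\<close>
  of \<open>Q\<^sub>G\<close>. Images of paths of length \<open>n\<close> are supported on paths of length \<open>n\<close>, so that only
  the finitely many \<open>x\<close> of the same length as \<open>y\<close> contribute to the coefficient at \<open>y\<close>.\<close>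

definition skew_identification ::
  "('g, 'm) monoid_scheme \<Rightarrow> ('v, 'a) pre_digraph \<Rightarrow> ('g \<Rightarrow> 'v \<Rightarrow> 'v) \<Rightarrow> ('g \<Rightarrow> 'a \<Rightarrow> 'a) \<Rightarrow>
   'g \<Rightarrow> 'v set \<Rightarrow> 'a set \<Rightarrow> ('v \<times> sign, 'a \<times> sign, 'k::field) pelt \<Rightarrow>
   'g \<Rightarrow> ('v, 'a, 'k) pelt" where
  "skew_identification G Q vact aact \<sigma> oW oQ1 f = (\<lambda>g\<in>carrier G. \<lambda>y.
     \<Sum>x\<in>{x \<in> quiver_paths (skew_quiver G Q vact \<sigma> oW oQ1). length (snd x) = length (snd y)}.
       f x * skew_path_elt G Q vact aact \<sigma> oW oQ1 x g y)"

definition skew_iota ::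
  "('g, 'm) monoid_scheme \<Rightarrow> ('v, 'a) pre_digraph \<Rightarrow> ('g \<Rightarrow> 'v \<Rightarrow> 'v) \<Rightarrow> ('g \<Rightarrow> 'a \<Rightarrow> 'a) \<Rightarrow>
   'g \<Rightarrow> 'v set \<Rightarrow> ('v, 'a, 'k::field) pelt \<Rightarrow> 'g \<Rightarrow> ('v, 'a, 'k) pelt" where
  "skew_iota G Q vact aact \<sigma> oW f =
     (let B = complete_path_algebra Q; BG = skew_path_algebra G Q vact aact;
          e = skew_ebar G Q B BG vact \<sigma> oW in
      e \<otimes>\<^bsub>BG\<^esub> skew_tensor G B f (grp_elt \<one>\<^bsub>G\<^esub>) \<otimes>\<^bsub>BG\<^esub> e)"

text \<open>\<open>\<iota>\<close> being linear and continuous, the extension of \<open>\<iota>'\<close> to potentials first multiplies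
  the coefficients at the cycles starting at a vertex that is not fixed by \<open>2\<close>.\<close>

definition skew_iota' ::
  "('g, 'm) monoid_scheme \<Rightarrow> ('v, 'a) pre_digraph \<Rightarrow> ('g \<Rightarrow> 'v \<Rightarrow> 'v) \<Rightarrow> ('g \<Rightarrow> 'a \<Rightarrow> 'a) \<Rightarrow>
   'g \<Rightarrow> 'v set \<Rightarrow> ('v, 'a, 'k::field) pelt \<Rightarrow> 'g \<Rightarrow> ('v, 'a, 'k) pelt" where
  "skew_iota' G Q vact aact \<sigma> oW S =
     skew_iota G Q vact aact \<sigma> oW (\<lambda>(u, p). (if vact \<sigma> u = u then 1 else 2) * S (u, p))"

text \<open>\<open>S\<^sub>G\<close> is the element of the complete path algebra of \<open>Q\<^sub>G\<close> identified with \<open>\<iota>'(S)\<close>. If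
  \<open>S\<close> is invariant only up to cyclic equivalence, then that element may involve paths from
  \<open>i\<^sup>\<plusminus>\<close> to \<open>i\<^sup>\<mp>\<close>. Such a path \<open>w\<close>, ending at \<open>x\<close>, is the commutator \<open>e\<^sub>x w - w e\<^sub>x\<close> and vanishes up to
  cyclic equivalence (all its cyclic derivatives are zero), so it is dropped from the
  representative.\<close>

definition skew_potential ::
  "('g, 'm) monoid_scheme \<Rightarrow> ('v, 'a) pre_digraph \<Rightarrow> ('g \<Rightarrow> 'v \<Rightarrow> 'v) \<Rightarrow> ('g \<Rightarrow> 'a \<Rightarrow> 'a) \<Rightarrow>
   'g \<Rightarrow> 'v set \<Rightarrow> 'a set \<Rightarrow> ('v, 'a, 'k::field) pelt \<Rightarrow> ('v \<times> sign, 'a \<times> sign, 'k) pelt" where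
  "skew_potential G Q vact aact \<sigma> oW oQ1 S =
     (let QG = skew_quiver G Q vact \<sigma> oW oQ1 in
      (\<lambda>x. if x \<in> cycles QG
         then the_inv_into (carrier (complete_path_algebra QG))
                (skew_identification G Q vact aact \<sigma> oW oQ1)
                (skew_iota' G Q vact aact \<sigma> oW S) x
         else 0))"

end

theory Submission
  imports Defs
begin

text \<open>Splitting the skew group algebra of \<open>A\<close> by \<open>(1 \<plusminus> \<sigma>) / 2\<close> on both sides identifies it with the
  matrices \<open>M\<close>, indexed by pairs of signs, such that \<open>\<sigma> M\<^sub>t\<^sub>s = t s M\<^sub>t\<^sub>s\<close>. The corner cut out by the
  idempotent consists of the \<open>M\<close> for which \<open>M\<^sub>t\<^sub>s\<close> only involves paths from vertices carrying the sign \<open>s\<close>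
  to vertices carrying the sign \<open>t\<close>, where a vertex that is not fixed carries only the sign \<open>+\<close>. The
  arrow \<open>b\<close> of the new quiver over \<open>\<alpha>\<close> becomes the matrix whose only entry is
  \<open>(\<alpha> + t s \<sigma>\<alpha>) / 2\<close>. As these entries are a basis, with dual coefficients \<open>L\<close>, an element of the corner is
  a series in the arrows \<open>b\<close>, found one arrow at a time. The symmetrised coefficient of the new potential
  at \<open>b\<^sub>1 \<dots> b\<^sub>n\<close> is the sum of those of \<open>S\<close> at \<open>c\<^sub>1 \<dots> c\<^sub>n\<close>, weighted by the product of the \<open>L b\<^sub>i c\<^sub>i\<close>;
  hence the cyclic derivatives correspond up to a factor. The same identification applies to the Ginzburg
  quivers, and rescaling the dual arrows and the loops makes the differentials agree.\<close>

section \<open>Complete path algebras and residuals\<close>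

text \<open>Elements are infinite sums, so maps cannot be defined by linear extension from paths.
  This obstacle shapes the proof: products, derivations and the maps between series and matrices are
  evaluated at one path, by recursion along its arrows from the one traversed first, and only
  finitely many terms occur at each step. Statements about arrows extend to series by induction on
  the path, generalising the series so that the hypothesis applies to its residuals. A second
  obstacle is that \<open>S\<close> is invariant only up to cyclic equivalence. Single coefficients
  are then not controlled, but sums over the rotations of a cycle are, and the cyclic derivatives
  depend on nothing else. The constants are sizes of orbits. The coordinates of a matrix along a
  path are divided by the size of the orbit at its end; the factor \<open>2\<close> of \<iota>'
  undoes this for the potential. For dual arrows and loops nothing undoes it, so the map that merely
  places their matrices would in general not commute with the differentials; the scalars on the
  arrows restore this.\<close>

definition supported :: "('v, 'b) pre_digraph \<Rightarrow> ('v, 'b, 'k::field) pelt \<Rightarrow> bool" where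
  "supported Q f \<longleftrightarrow> (\<forall>x. f x \<noteq> 0 \<longrightarrow> x \<in> quiver_paths Q)"

definition pmul ::
  "('v, 'b) pre_digraph \<Rightarrow> ('v, 'b, 'k::field) pelt \<Rightarrow> ('v, 'b, 'k) pelt \<Rightarrow> ('v, 'b, 'k) pelt" where
  "pmul Q f g = (\<lambda>(u, p). \<Sum>l\<le>length p.
     f (pre_digraph.awlast Q u (take l p), drop l p) * g (u, take l p))"

definition pone :: "('v, 'b) pre_digraph \<Rightarrow> ('v, 'b, 'k::field) pelt" where
  "pone Q = (\<lambda>(u, p). if u \<in> verts Q \<and> p = [] then 1 else 0)"

text \<open>Every series is \<open>f = \<Sum>\<^sub>i f(e\<^sub>i) e\<^sub>i + \<Sum>\<^sub>c f\<^sub>c c\<close>, where \<open>f\<^sub>c\<close> is the residual at \<open>c\<close>.\<close>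

definition residual ::
  "('v, 'b) pre_digraph \<Rightarrow> 'b \<Rightarrow> ('v, 'b, 'k::field) pelt \<Rightarrow> ('v, 'b, 'k) pelt" where
  "residual Q c f = (\<lambda>(v, q). if v = head Q c then f (tail Q c, c # q) else 0)"

text \<open>The grading automorphism, multiplication by \<open>(-1)^n\<close> in degree
  \<open>n\<close>. It expresses the signs of the graded Leibniz rule for series that need not be
  homogeneous, so that inductions need not split a series into homogeneous parts.\<close>

definition sign_twist :: "('b \<Rightarrow> int) \<Rightarrow> ('v, 'b, 'k::field) pelt \<Rightarrow> ('v, 'b, 'k) pelt" where
  "sign_twist wt f = (\<lambda>x. (-1) powi path_degree wt x * f x)"

lemma path_ext: "(\<And>u p. f (u, p) = g (u, p)) \<Longrightarrow> f = g"
  by (auto intro!: ext)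

lemma residual_simps [simp]:
  "residual Q c f (head Q c, q) = f (tail Q c, c # q)"
  "v \<noteq> head Q c \<Longrightarrow> residual Q c f (v, q) = 0"
  by (simp_all add: residual_def)

lemma residual_zero [simp]: "residual Q c (\<lambda>x. 0) = (\<lambda>x. 0)"
  by (auto simp: residual_def)

lemma residual_add:
  "residual Q c (\<lambda>x. f x + g x) = (\<lambda>x. residual Q c f x + residual Q c g x)"
  by (auto simp: residual_def)

lemma residual_scale: "residual Q c (\<lambda>x. a * f x) = (\<lambda>x. a * residual Q c f x)"
  by (auto simp: residual_def)

lemma pmul_add_left: "pmul Q (\<lambda>x. f x + g x) h = (\<lambda>x. pmul Q f h x + pmul Q g h x)"
  by (auto simp: pmul_def sum.distrib algebra_simps intro!: ext)

lemma pmul_add_right: "pmul Q h (\<lambda>x. f x + g x) = (\<lambda>x. pmul Q h f x + pmul Q h g x)"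
  by (auto simp: pmul_def sum.distrib algebra_simps intro!: ext)

lemma pmul_scale_left: "pmul Q (\<lambda>x. a * f x) h = (\<lambda>x. a * pmul Q f h x)"
  by (auto simp: pmul_def sum_distrib_left algebra_simps intro!: ext)

lemma pmul_scale_right: "pmul Q h (\<lambda>x. a * f x) = (\<lambda>x. a * pmul Q h f x)"
  by (auto simp: pmul_def sum_distrib_left algebra_simps intro!: ext)

lemma pmul_uminus_left: "pmul Q (\<lambda>x. - f x) h = (\<lambda>x. - pmul Q f h x)"
  by (auto simp: pmul_def sum_negf intro!: ext)

lemma pmul_zero_left [simp]: "pmul Q (\<lambda>x. 0) h = (\<lambda>x. 0)"
  and pmul_zero_right [simp]: "pmul Q h (\<lambda>x. 0) = (\<lambda>x. 0)"
  by (auto simp: pmul_def intro!: ext)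

lemma pmul_sum_left: "pmul Q (\<lambda>x. \<Sum>i\<in>I. f i x) h = (\<lambda>x. \<Sum>i\<in>I. pmul Q (f i) h x)"
  by (auto simp: pmul_def sum_distrib_right intro!: ext sum.swap)

lemma pmul_sum_right: "pmul Q h (\<lambda>x. \<Sum>i\<in>I. f i x) = (\<lambda>x. \<Sum>i\<in>I. pmul Q h (f i) x)"
  by (auto simp: pmul_def sum_distrib_left intro!: ext sum.swap)

lemma pmul_start_zero: "(\<And>q. g (u, q) = 0) \<Longrightarrow> pmul Q f g (u, p) = 0"
  by (simp add: pmul_def)

lemma pmul_start_cong: "(\<And>q. g (u, q) = h (u, q)) \<Longrightarrow> pmul Q f g (u, p) = pmul Q f h (u, p)"
  by (simp add: pmul_def)

lemma pmul_Nil: "pmul Q f g (u, []) = f (u, []) * g (u, [])"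
  by (simp add: pmul_def pre_digraph.awalk_verts.simps)

lemma pmul_nonzeroE:
  assumes "pmul Q f g x \<noteq> 0"
  obtains v p q where "f (v, q) \<noteq> 0" "g (fst x, p) \<noteq> 0" "snd x = p @ q"
    "v = pre_digraph.awlast Q (fst x) p"
proof -
  obtain u r where x: "x = (u, r)" by (cases x)
  from assms have "(\<Sum>l\<le>length r. f (pre_digraph.awlast Q u (take l r), drop l r) * g (u, take l r)) \<noteq> 0"
    by (simp add: pmul_def x)
  then obtain l where "f (pre_digraph.awlast Q u (take l r), drop l r) * g (u, take l r) \<noteq> 0"
    by (meson sum.not_neutral_contains_not_neutral)
  then show thesis by (intro that[of _ "drop l r" "take l r"]) (auto simp: x)
qed

lemma supported_zero [simp]: "supported Q (\<lambda>x. 0)"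
  by (simp add: supported_def)

lemma supported_add: "supported Q f \<Longrightarrow> supported Q g \<Longrightarrow> supported Q (\<lambda>x. f x + g x)"
  unfolding supported_def by (metis add_cancel_left_left)

lemma supported_scale: "supported Q f \<Longrightarrow> supported Q (\<lambda>x. a * f x)"
  by (simp add: supported_def)

lemma supported_uminus: "supported Q f \<Longrightarrow> supported Q (\<lambda>x. - f x)"
  by (simp add: supported_def)

lemma supported_sum: "(\<And>i. i \<in> I \<Longrightarrow> supported Q (f i)) \<Longrightarrow> supported Q (\<lambda>x. \<Sum>i\<in>I. f i x)"
  unfolding supported_def by (metis sum.not_neutral_contains_not_neutral)

lemma supported_sign_twist: "supported Q f \<Longrightarrow> supported Q (sign_twist wt f)"
  by (simp add: supported_def sign_twist_def)

lemma sign_twist_zero [simp]: "sign_twist wt (\<lambda>x. 0) = (\<lambda>x. 0)"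
  by (simp add: sign_twist_def)

lemma sign_twist_add: "sign_twist wt (\<lambda>x. f x + g x) = (\<lambda>x. sign_twist wt f x + sign_twist wt g x)"
  by (simp add: sign_twist_def algebra_simps)

lemma sign_twist_scale: "sign_twist wt (\<lambda>x. a * f x) = (\<lambda>x. a * sign_twist wt f x)"
  by (simp add: sign_twist_def algebra_simps)

lemma sign_twist_sum: "sign_twist wt (\<lambda>x. \<Sum>i\<in>I. f i x) = (\<lambda>x. \<Sum>i\<in>I. sign_twist wt (f i) x)"
  by (simp add: sign_twist_def sum_distrib_left)

lemma powi_minus_one_square: "((-1) powi n) * ((-1) powi n) = (1::'k::field)"
  by (simp add: power_int_mult_distrib[symmetric])

lemma sign_twist_twice [simp]: "sign_twist wt (sign_twist wt f) = f"
  by (simp add: sign_twist_def mult.assoc[symmetric] powi_minus_one_square)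

lemma path_degree_Nil [simp]: "path_degree wt (u, []) = 0"
  by (simp add: path_degree_def)

lemma path_degree_Cons: "path_degree wt (u, c # q) = wt c + path_degree wt (v, q)"
  by (simp add: path_degree_def)

lemma path_degree_append: "path_degree wt (u, p @ q) = path_degree wt (u, p) + path_degree wt (v, q)"
  by (simp add: path_degree_def)

lemma residual_sign_twist:
  "residual Q c (sign_twist wt f) = (\<lambda>x. (-1) powi wt c * sign_twist wt (residual Q c f) x)"
  by (auto simp: residual_def sign_twist_def path_degree_def power_int_add intro!: ext)

lemma sign_twist_pmul: "sign_twist wt (pmul Q f g) = pmul Q (sign_twist wt f) (sign_twist wt g)"
proof (rule path_ext)
  fix u p
  show "sign_twist wt (pmul Q f g) (u, p) = pmul Q (sign_twist wt f) (sign_twist wt g) (u, p)"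
    unfolding sign_twist_def pmul_def prod.case sum_distrib_left
  proof (rule sum.cong[OF refl])
    fix l
    have "path_degree wt (u, p) =
      path_degree wt (pre_digraph.awlast Q u (take l p), drop l p) + path_degree wt (u, take l p)"
      by (metis append_take_drop_id path_degree_append add.commute)
    then show "(-1) powi path_degree wt (u, p) *
        (f (pre_digraph.awlast Q u (take l p), drop l p) * g (u, take l p)) =
      (-1) powi path_degree wt (pre_digraph.awlast Q u (take l p), drop l p) *
        f (pre_digraph.awlast Q u (take l p), drop l p) *
        ((-1) powi path_degree wt (u, take l p) * g (u, take l p))"
      by (simp add: power_int_add)
  qed
qed

lemma pone_Nil [simp]: "u \<in> verts Q \<Longrightarrow> pone Q (u, []) = 1"
  and pone_Cons [simp]: "pone Q (u, c # p) = 0"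
  and residual_pone [simp]: "residual Q c (pone Q) = (\<lambda>x. 0)"
  by (auto simp: pone_def residual_def)

section \<open>Multiplication of series, one arrow at a time\<close>

locale quiver = fin_digraph Q for Q :: "('v, 'b) pre_digraph"
begin

lemma paths_Nil [simp]: "(u, []) \<in> quiver_paths Q \<longleftrightarrow> u \<in> verts Q"
  by (auto simp: quiver_paths_def awalk_Nil_iff)

lemma paths_Cons [simp]:
  "(u, c # p) \<in> quiver_paths Q \<longleftrightarrow> c \<in> arcs Q \<and> u = tail Q c \<and> (head Q c, p) \<in> quiver_paths Q"
  by (auto simp: quiver_paths_def awalk_Cons_iff)

lemma paths_start: "(u, p) \<in> quiver_paths Q \<Longrightarrow> u \<in> verts Q"
  by (cases p) auto

lemma supported_vert: "supported Q f \<Longrightarrow> u \<notin> verts Q \<Longrightarrow> f (u, p) = 0"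
  using paths_start unfolding supported_def by blast

lemma supported_Cons:
  assumes "supported Q f" "\<not> (c \<in> arcs Q \<and> u = tail Q c \<and> (head Q c, q) \<in> quiver_paths Q)"
  shows "f (u, c # q) = 0"
  using assms unfolding supported_def by (metis paths_Cons)

lemma residual_not_arc: "supported Q f \<Longrightarrow> c \<notin> arcs Q \<Longrightarrow> residual Q c f = (\<lambda>x. 0)"
  by (auto simp: residual_def supported_Cons intro!: ext)

lemma supported_residual [simp]: "supported Q f \<Longrightarrow> supported Q (residual Q c f)"
  unfolding supported_def by (auto simp: residual_def split: if_splits dest: paths_Cons[THEN iffD1])

lemma supported_pone [simp]: "supported Q (pone Q)"
  by (auto simp: supported_def pone_def)

text \<open>The right factor is traversed first. It contributes either the trivial path at
  \<open>u\<close> or a path that begins with \<open>c\<close>, whose remainder is recorded by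
  \<open>residual Q c g\<close>. The inductions on paths for products rest on this
  recursion.\<close>

lemma pmul_Cons:
  assumes "supported Q f" "supported Q g"
  shows "pmul Q f g (u, c # q) =
    (if u = tail Q c then f (u, c # q) * g (u, []) + pmul Q f (residual Q c g) (head Q c, q) else 0)"
proof (cases "u = tail Q c")
  case True
  have "pmul Q f g (u, c # q) = f (u, c # q) * g (u, []) +
    (\<Sum>l\<le>length q. f (awlast (head Q c) (take l q), drop l q) * g (u, c # take l q))"
    by (simp add: pmul_def sum.atMost_Suc_shift del: sum.atMost_Suc)
  with True show ?thesis by (simp add: pmul_def)
next
  case False
  \<comment> \<open>A path through \<open>c\<close> that does not start at the tail of
    \<open>c\<close> meets no support: for \<open>l = 0\<close> the left factor vanishes, otherwise
    the right one.\<close>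
  have "f (awlast u (take l (c # q)), drop l (c # q)) * g (u, take l (c # q)) = 0" for l
    using False assms by (cases l) (auto simp: supported_Cons)
  then have "pmul Q f g (u, c # q) = 0"
    unfolding pmul_def prod.case by (blast intro: sum.neutral)
  with False show ?thesis by simp
qed

text \<open>The product rule of Fox derivatives: \<open>c\<close> is split off the right factor,
  unless that factor contributes only a trivial path.\<close>

lemma residual_pmul:
  assumes "supported Q f" "supported Q g"
  shows "residual Q c (pmul Q f g) =
    (\<lambda>x. g (tail Q c, []) * residual Q c f x + pmul Q f (residual Q c g) x)"
proof (rule path_ext)
  fix v q
  show "residual Q c (pmul Q f g) (v, q) =
    g (tail Q c, []) * residual Q c f (v, q) + pmul Q f (residual Q c g) (v, q)"
    by (cases "v = head Q c") (simp_all add: pmul_Cons assms pmul_start_zero)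
qed

lemma supported_pmul [intro, simp]:
  assumes "supported Q f" "supported Q g"
  shows "supported Q (pmul Q f g)"
proof -
  have "(u, p) \<in> quiver_paths Q" if "pmul Q f g (u, p) \<noteq> 0" "supported Q g" for u p g
    using that
  proof (induction p arbitrary: u g)
    case Nil
    then have "f (u, []) \<noteq> 0" by (auto simp: pmul_Nil)
    then show ?case using assms(1) unfolding supported_def by blast
  next
    case (Cons c p)
    have u: "u = tail Q c" using Cons.prems by (auto simp: pmul_Cons assms split: if_splits)
    show ?case
    proof (cases "f (u, c # p) = 0")
      case True
      then have "pmul Q f (residual Q c g) (head Q c, p) \<noteq> 0"
        using Cons.prems by (auto simp: pmul_Cons assms split: if_splits)
      moreover from this have "c \<in> arcs Q"
        by (rule contrapos_np) (simp add: residual_not_arc[OF Cons.prems(2)])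
      ultimately show ?thesis using Cons.IH[of "residual Q c g"] Cons.prems(2) u by auto
    next
      case False
      then show ?thesis using assms(1) unfolding supported_def by blast
    qed
  qed
  with assms(2) show ?thesis unfolding supported_def by auto
qed

text \<open>Residuals move to the factor traversed first, so the induction generalises only
  \<open>h\<close>. The terms with a residual of \<open>g\<close> agree on both sides without the
  induction hypothesis.\<close>

lemma pmul_assoc:
  assumes "supported Q f" "supported Q g" "supported Q h"
  shows "pmul Q (pmul Q f g) h = pmul Q f (pmul Q g h)"
proof -
  have "pmul Q (pmul Q f g) h (u, p) = pmul Q f (pmul Q g h) (u, p)" if "supported Q h" for u p h
    using that
  proof (induction p arbitrary: u h)
    case Nil
    then show ?case by (simp add: pmul_Nil)
  next
    case (Cons c p)
    show ?case
      by (simp add: pmul_Cons residual_pmul assms Cons pmul_add_right pmul_scale_right pmul_Nil)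
        (simp add: algebra_simps)
  qed
  with assms(3) show ?thesis by (auto intro: path_ext)
qed

lemma pmul_one_right [simp]:
  assumes "supported Q f" shows "pmul Q f (pone Q) = f"
proof (rule path_ext)
  fix u p
  show "pmul Q f (pone Q) (u, p) = f (u, p)"
    using assms by (cases p; cases "u \<in> verts Q")
      (auto simp: pmul_Nil pmul_Cons supported_Cons supported_vert)
qed

lemma pmul_one_left [simp]:
  assumes "supported Q f" shows "pmul Q (pone Q) f = f"
proof -
  have "pmul Q (pone Q) f (u, p) = f (u, p)" if "supported Q f" for u p f
    using that
  proof (induction p arbitrary: u f)
    case Nil
    then show ?case by (cases "u \<in> verts Q") (auto simp: pmul_Nil supported_vert)
  next
    case (Cons c p)
    then show ?case by (auto simp: pmul_Cons supported_Cons)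
  qed
  with assms show ?thesis by (auto intro: path_ext)
qed

lemma pmul_vertex_left:
  "pmul Q (path_elt (i, [])) g (u, p) = (if awlast u p = i then g (u, p) else 0)"
proof -
  have "pmul Q (path_elt (i, [])) g (u, p) =
    (\<Sum>l\<le>length p. if l = length p then (if awlast u p = i then g (u, p) else 0) else 0)"
    unfolding pmul_def prod.case by (intro sum.cong) (auto simp: path_elt_def)
  then show ?thesis by (simp add: sum.delta)
qed

lemma pmul_vertex_right:
  "pmul Q f (path_elt (i, [])) (u, p) = (if u = i then f (u, p) else 0)"
proof -
  have "pmul Q f (path_elt (i, [])) (u, p) =
    (\<Sum>l\<le>length p. if l = 0 then (if u = i then f (u, p) else 0) else 0)"
    unfolding pmul_def prod.case by (intro sum.cong) (auto simp: path_elt_def)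
  then show ?thesis by (simp add: sum.delta)
qed

lemma pmul_arrow_right:
  "pmul Q f (arrow_elt Q c) (u, []) = 0"
  "pmul Q f (arrow_elt Q c) (u, c' # q) = (if c' = c \<and> u = tail Q c then f (head Q c, q) else 0)"
proof -
  show "pmul Q f (arrow_elt Q c) (u, []) = 0"
    by (simp add: pmul_Nil arrow_elt_def path_elt_def)
  have "pmul Q f (arrow_elt Q c) (u, c' # q) =
    (\<Sum>l\<le>length (c' # q). if l = 1 then (if c' = c \<and> u = tail Q c then f (head Q c, q) else 0) else 0)"
    unfolding pmul_def prod.case
  proof (intro sum.cong[OF refl])
    fix l assume "l \<in> {..length (c' # q)}"
    consider "l = 0" | "l = 1" | m where "l = Suc (Suc m)" "q \<noteq> []"
      using \<open>l \<in> _\<close> by (cases l; cases "l - 1"; cases q) auto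
    then show "f (awlast u (take l (c' # q)), drop l (c' # q)) * arrow_elt Q c (u, take l (c' # q)) =
      (if l = 1 then if c' = c \<and> u = tail Q c then f (head Q c, q) else 0 else 0)"
      by cases (auto simp: arrow_elt_def path_elt_def)
  qed
  then show "pmul Q f (arrow_elt Q c) (u, c' # q) = (if c' = c \<and> u = tail Q c then f (head Q c, q) else 0)"
    by (simp add: sum.delta del: sum.atMost_Suc)
qed

lemma supported_path_elt: "x \<in> quiver_paths Q \<Longrightarrow> supported Q (path_elt x)"
  by (simp add: supported_def path_elt_def)

lemma supported_vertex [simp]: "i \<in> verts Q \<Longrightarrow> supported Q (path_elt (i, []))"
  by (simp add: supported_path_elt)

lemma supported_arrow [simp]: "c \<in> arcs Q \<Longrightarrow> supported Q (arrow_elt Q c)"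
  by (simp add: supported_path_elt arrow_elt_def)

lemma residual_vertex [simp]: "residual Q c (path_elt (i, [])) = (\<lambda>x. 0)"
  by (auto simp: residual_def path_elt_def intro!: ext)

lemma residual_arrow:
  "residual Q c (arrow_elt Q b) = (if c = b then path_elt (head Q b, []) else (\<lambda>x. 0))"
  by (auto simp: residual_def path_elt_def arrow_elt_def intro!: ext)

text \<open>Both sums are finite although \<open>f\<close> is an infinite series. A map that is only
  known to be additive and to satisfy a product rule can therefore be evaluated on \<open>f\<close>,
  as in \<open>der_unique\<close>.\<close>

lemma residual_decomposition:
  assumes "supported Q f"
  shows "f x = (\<Sum>i\<in>verts Q. f (i, []) * path_elt (i, []) x)
    + (\<Sum>c\<in>arcs Q. pmul Q (residual Q c f) (arrow_elt Q c) x)"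
proof -
  obtain u p where x: "x = (u, p)" by (cases x)
  show ?thesis
  proof (cases p)
    case Nil
    then show ?thesis using assms
      by (cases "u \<in> verts Q")
        (simp_all add: x pmul_arrow_right path_elt_def if_distrib[of "\<lambda>y. _ * y"] sum.delta
          supported_vert cong: if_cong)
  next
    case (Cons c' q)
    have "(\<Sum>c\<in>arcs Q. pmul Q (residual Q c f) (arrow_elt Q c) x) =
      (\<Sum>c\<in>arcs Q. if c = c' then (if u = tail Q c' then f (u, c' # q) else 0) else 0)"
      by (intro sum.cong) (auto simp: x Cons pmul_arrow_right)
    then show ?thesis using assms
      by (cases "c' \<in> arcs Q"; cases "u = tail Q c'")
        (simp_all add: x Cons path_elt_def sum.delta supported_Cons)
  qed
qed

end

section \<open>Derivations with prescribed values on the arrows\<close>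

definition dpart ::
  "('v, 'b) pre_digraph \<Rightarrow> ('b \<Rightarrow> int) \<Rightarrow> ('b \<Rightarrow> ('v, 'b, 'k::field) pelt) \<Rightarrow>
   ('v, 'b, 'k) pelt \<Rightarrow> ('v, 'b, 'k) pelt" where
  "dpart Q wt D f = (\<lambda>x. \<Sum>b\<in>arcs Q. pmul Q (sign_twist wt (residual Q b f)) (D b) x)"

text \<open>The value of the derivation with \<open>b \<mapsto> D b\<close> is read off
  \<open>d f = \<Sum>\<^sub>c d(f\<^sub>c) c + \<Sum>\<^sub>b \<plusminus> f\<^sub>b D(b)\<close>.\<close>

primrec derl ::
  "('v, 'b) pre_digraph \<Rightarrow> ('b \<Rightarrow> int) \<Rightarrow> ('b \<Rightarrow> ('v, 'b, 'k::field) pelt) \<Rightarrow>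
   'b list \<Rightarrow> 'v \<Rightarrow> ('v, 'b, 'k) pelt \<Rightarrow> 'k" where
  "derl Q wt D [] u f = dpart Q wt D f (u, [])"
| "derl Q wt D (c # q) u f =
     (if u = tail Q c then derl Q wt D q (head Q c) (residual Q c f) else 0)
     + dpart Q wt D f (u, c # q)"

definition der ::
  "('v, 'b) pre_digraph \<Rightarrow> ('b \<Rightarrow> int) \<Rightarrow> ('b \<Rightarrow> ('v, 'b, 'k::field) pelt) \<Rightarrow>
   ('v, 'b, 'k) pelt \<Rightarrow> ('v, 'b, 'k) pelt" where
  "der Q wt D f = (\<lambda>(u, p). derl Q wt D p u f)"

text \<open>A derivation that kills the idempotents sends an arrow, which lies between two of them,
  to a combination of paths parallel to it; this is \<open>D_ends\<close>. Such a derivation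
  respects the starting vertex of paths. The degree condition supplies the signs.\<close>

locale derivation_data = quiver Q
  for Q :: "('v, 'b) pre_digraph" and wt :: "'b \<Rightarrow> int" and D :: "'b \<Rightarrow> ('v, 'b, 'k::field) pelt" +
  assumes D_supported: "b \<in> arcs Q \<Longrightarrow> supported Q (D b)"
    and D_ends: "b \<in> arcs Q \<Longrightarrow> D b (u, p) \<noteq> 0 \<Longrightarrow> u = tail Q b \<and> awlast u p = head Q b"
    and D_degree: "b \<in> arcs Q \<Longrightarrow> D b x \<noteq> 0 \<Longrightarrow> path_degree wt x = wt b + 1"
begin

abbreviation "dp \<equiv> dpart Q wt D"
abbreviation "dd \<equiv> der Q wt D"
abbreviation "sg \<equiv> sign_twist wt"

lemma der_Nil: "dd f (u, []) = dp f (u, [])"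
  by (simp add: der_def)

lemma der_Cons:
  "dd f (u, c # q) = (if u = tail Q c then dd (residual Q c f) (head Q c, q) else 0) + dp f (u, c # q)"
  by (simp add: der_def)

lemma dpart_add: "dp (\<lambda>x. f x + g x) = (\<lambda>x. dp f x + dp g x)"
  by (simp add: dpart_def residual_add sign_twist_add pmul_add_left sum.distrib)

lemma dpart_scale: "dp (\<lambda>x. a * f x) = (\<lambda>x. a * dp f x)"
  by (simp add: dpart_def residual_scale sign_twist_scale pmul_scale_left sum_distrib_left)

lemma der_add: "dd (\<lambda>x. f x + g x) = (\<lambda>x. dd f x + dd g x)"
proof (rule path_ext)
  fix u p show "dd (\<lambda>x. f x + g x) (u, p) = dd f (u, p) + dd g (u, p)"
    by (induction p arbitrary: u f g) (simp_all add: der_Nil der_Cons dpart_add residual_add)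
qed

lemma der_scale: "dd (\<lambda>x. a * f x) = (\<lambda>x. a * dd f x)"
proof (rule path_ext)
  fix u p show "dd (\<lambda>x. a * f x) (u, p) = a * dd f (u, p)"
    by (induction p arbitrary: u f)
      (simp_all add: der_Nil der_Cons dpart_scale residual_scale algebra_simps)
qed

lemma der_zero [simp]: "dd (\<lambda>x. 0) = (\<lambda>x. 0)"
  using der_scale[of 0 "\<lambda>x. 0"] by simp

lemma der_sum: "finite I \<Longrightarrow> dd (\<lambda>x. \<Sum>i\<in>I. f i x) = (\<lambda>x. \<Sum>i\<in>I. dd (f i) x)"
  by (induction I rule: finite_induct) (simp_all add: der_add)

lemma supported_dpart [simp]: "supported Q f \<Longrightarrow> supported Q (dp f)"
  unfolding dpart_def by (intro supported_sum supported_pmul supported_sign_twist supported_residual D_supported)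

lemma supported_der [simp]: assumes "supported Q f" shows "supported Q (dd f)"
proof -
  have "(u, p) \<in> quiver_paths Q" if "supported Q f" "dd f (u, p) \<noteq> 0" for u p f
    using that
  proof (induction p arbitrary: u f)
    case Nil
    then show ?case using supported_dpart[OF Nil(1)] unfolding supported_def der_Nil by blast
  next
    case (Cons c p)
    show ?case
    proof (cases "dp f (u, c # p) = 0")
      case True
      then have *: "dd (residual Q c f) (head Q c, p) \<noteq> 0" "u = tail Q c"
        using Cons.prems(2) by (auto simp: der_Cons split: if_splits)
      moreover from *(1) have "c \<in> arcs Q"
        by (rule contrapos_np) (simp add: residual_not_arc[OF Cons.prems(1)])
      ultimately show ?thesis using Cons.IH[of "residual Q c f"] Cons.prems by simp
    next
      case False
      then show ?thesis using supported_dpart[OF Cons.prems(1)] unfolding supported_def by blast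
    qed
  qed
  with assms show ?thesis unfolding supported_def by auto
qed

text \<open>The derivation commutes with right multiplication by idempotents, because each
  \<open>D b\<close> starts where \<open>b\<close> does.\<close>

lemma der_start_zero:
  assumes "\<And>p. g (v, p) = 0" shows "dd g (v, q) = 0"
proof -
  have dp0: "dp g (v, q) = 0" if "\<And>p. g (v, p) = 0" for g v q
    unfolding dpart_def
  proof (intro sum.neutral ballI)
    fix b assume b: "b \<in> arcs Q"
    show "pmul Q (sg (residual Q b g)) (D b) (v, q) = 0"
    proof (cases "v = tail Q b")
      case True
      then have "residual Q b g = (\<lambda>x. 0)" using that by (auto simp: residual_def)
      then show ?thesis by simp
    next
      case False
      then show ?thesis using D_ends[OF b] by (blast intro: pmul_start_zero)
    qed
  qed
  have dp: "dp g (v, q) = 0" for q by (rule dp0) (rule assms)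
  show ?thesis
  proof (cases q)
    case (Cons c q')
    have "residual Q c g = (\<lambda>x. 0)" if "v = tail Q c"
      using assms that by (auto simp: residual_def)
    then show ?thesis by (auto simp: Cons der_Cons dp)
  qed (simp add: der_Nil dp)
qed

lemma der_start_cong:
  assumes "\<And>p. g (v, p) = h (v, p)" shows "dd g (v, q) = dd h (v, q)"
proof -
  have "dd (\<lambda>x. g x + (-1) * h x) (v, q) = 0" by (rule der_start_zero) (simp add: assms)
  then show ?thesis unfolding der_add der_scale by simp
qed

text \<open>The residual at \<open>c\<close> does not commute with the derivation, since the
  summands that contain some \<open>D b\<close> may begin with \<open>c\<close> as well. Their
  residuals form the correction term.\<close>

lemma residual_der:
  "residual Q c (dd f) = (\<lambda>x. dd (residual Q c f) x + residual Q c (dp f) x)"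
proof (rule path_ext)
  fix v q
  show "residual Q c (dd f) (v, q) = dd (residual Q c f) (v, q) + residual Q c (dp f) (v, q)"
    by (cases "v = head Q c") (simp_all add: der_Cons der_start_zero)
qed

lemma dpart_pmul:
  assumes "supported Q f" "supported Q g"
  shows "dp (pmul Q f g) x = (\<Sum>b\<in>arcs Q. g (tail Q b, []) * pmul Q (sg (residual Q b f)) (D b) x)
    + pmul Q (sg f) (dp g) x"
  unfolding dpart_def
  by (simp add: residual_pmul assms sign_twist_add sign_twist_scale sign_twist_pmul
      pmul_add_left pmul_scale_left pmul_sum_right sum.distrib pmul_assoc D_supported
      supported_sign_twist)

text \<open>\<open>D b\<close> starts at the tail of \<open>b\<close>, so a nonzero value at a path
  from \<open>u\<close> forces this tail to be \<open>u\<close>, and the trivial coefficient of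
  \<open>g\<close> leaves the sum.\<close>

lemma dpart_start_factor:
  "(\<Sum>b\<in>arcs Q. g (tail Q b, []) * pmul Q (sg (residual Q b f)) (D b) (u, p)) = dp f (u, p) * g (u, [])"
  unfolding dpart_def sum_distrib_right
proof (rule sum.cong[OF refl])
  fix b assume b: "b \<in> arcs Q"
  show "g (tail Q b, []) * pmul Q (sg (residual Q b f)) (D b) (u, p) =
    pmul Q (sg (residual Q b f)) (D b) (u, p) * g (u, [])"
  proof (cases "u = tail Q b")
    case False
    then have "pmul Q (sg (residual Q b f)) (D b) (u, p) = 0"
      using D_ends[OF b] by (blast intro: pmul_start_zero)
    then show ?thesis by simp
  qed simp
qed

text \<open>The Leibniz rule for all series at once, \<open>sg f\<close> replacing the sign. Both
  sides are expanded at the first arrow of the path, and the induction generalises the factor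
  traversed first.\<close>

lemma der_pmul:
  assumes "supported Q f" "supported Q g"
  shows "dd (pmul Q f g) = (\<lambda>x. pmul Q (dd f) g x + pmul Q (sg f) (dd g) x)"
proof (rule path_ext)
  fix u p
  show "dd (pmul Q f g) (u, p) = pmul Q (dd f) g (u, p) + pmul Q (sg f) (dd g) (u, p)"
    using assms(2)
  proof (induction p arbitrary: u g)
    case Nil
    then show ?case
      using dpart_start_factor[of g f u "[]"] by (simp add: der_Nil dpart_pmul assms pmul_Nil)
  next
    case (Cons c q)
    show ?case
    proof (cases "u = tail Q c")
      case True
      have "dd (pmul Q f g) (u, c # q) =
        g (u, []) * dd (residual Q c f) (head Q c, q)
        + (pmul Q (dd f) (residual Q c g) (head Q c, q) + pmul Q (sg f) (dd (residual Q c g)) (head Q c, q))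
        + (dp f (u, c # q) * g (u, []) + pmul Q (sg f) (dp g) (u, c # q))"
        using True Cons.prems
        by (simp add: der_Cons dpart_pmul assms dpart_start_factor residual_pmul der_add der_scale Cons.IH)
      moreover have "pmul Q (dd f) g (u, c # q) =
        (dd (residual Q c f) (head Q c, q) + dp f (u, c # q)) * g (u, [])
        + pmul Q (dd f) (residual Q c g) (head Q c, q)"
        using True Cons.prems by (simp add: pmul_Cons assms der_Cons)
      moreover have "pmul Q (sg f) (dd g) (u, c # q) = sg f (u, c # q) * dd g (u, [])
        + (pmul Q (sg f) (dd (residual Q c g)) (head Q c, q) + pmul Q (sg f) (residual Q c (dp g)) (head Q c, q))"
        using True Cons.prems
        by (simp add: pmul_Cons assms supported_sign_twist residual_der pmul_add_right)
      \<comment> \<open>This expansion and the previous one share the value of \<open>dd g\<close>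
        at the trivial path and the residual of \<open>dp g\<close>. Their difference is exactly the
        second term produced by the induction hypothesis.\<close>
      moreover have "pmul Q (sg f) (dp g) (u, c # q) = sg f (u, c # q) * dd g (u, [])
        + pmul Q (sg f) (residual Q c (dp g)) (head Q c, q)"
        using True Cons.prems
        by (simp add: pmul_Cons assms supported_sign_twist der_Nil)
      ultimately show ?thesis by (simp add: algebra_simps)
    next
      case False
      then show ?thesis
        using Cons.prems assms supported_der[OF supported_pmul, of f g]
        by (simp add: pmul_Cons supported_sign_twist supported_Cons)
    qed
  qed
qed

lemma sign_twist_D: "b \<in> arcs Q \<Longrightarrow> sg (D b) = (\<lambda>x. (-1) powi (wt b + 1) * D b x)"
  unfolding sign_twist_def using D_degree by (metis mult_zero_right)

lemma sign_twist_dpart: "sg (dp f) x = (\<Sum>b\<in>arcs Q. (-1) powi (wt b + 1) * pmul Q (residual Q b f) (D b) x)"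
  unfolding dpart_def sign_twist_sum sign_twist_pmul
  by (intro sum.cong[OF refl]) (simp add: sign_twist_D pmul_scale_right)

text \<open>The degree of \<open>D b\<close> exceeds that of \<open>b\<close> by one, whence the
  sign.\<close>

lemma dpart_sign_twist: "dp (sg f) x = - sg (dp f) x"
  unfolding sign_twist_dpart
  by (simp add: dpart_def residual_sign_twist sign_twist_scale pmul_scale_left sum_negf[symmetric] power_int_add)

lemma der_sign_twist:
  assumes "supported Q f" shows "dd (sg f) x = - sg (dd f) x"
proof -
  have "dd (sg f) (u, p) = - sg (dd f) (u, p)" if "supported Q f" for u p
    using that
  proof (induction p arbitrary: u f)
    case Nil
    then show ?case using dpart_sign_twist[of f "(u, [])"] by (simp add: der_Nil sign_twist_def)
  next
    case (Cons c q)
    have "dd (sg f) (u, c # q) = (if u = tail Q c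
        then (-1) powi wt c * dd (sg (residual Q c f)) (head Q c, q) else 0) + dp (sg f) (u, c # q)"
      by (simp add: der_Cons residual_sign_twist der_scale)
    moreover have "sg (dd f) (u, c # q) = (if u = tail Q c
        then (-1) powi wt c * sg (dd (residual Q c f)) (head Q c, q) else 0) + sg (dp f) (u, c # q)"
      unfolding sign_twist_def der_Cons path_degree_Cons[of wt u c q "head Q c"]
      by (simp add: power_int_add algebra_simps)
    ultimately show ?case
      using Cons.IH[of "residual Q c f" "head Q c"] Cons.prems by (simp add: dpart_sign_twist)
  qed
  with assms show ?thesis by (cases x) auto
qed

text \<open>The square of an odd derivation is a derivation, so it vanishes once it kills the
  arrows. Concretely, the first arrow and the rest can be differentiated in either order; the two
  contributions have opposite signs by \<open>der_sign_twist\<close> and cancel, and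
  \<open>D0\<close> removes the terms in which the first arrow is hit twice.\<close>

lemma der_der:
  assumes "supported Q f" and D0: "\<And>b. b \<in> arcs Q \<Longrightarrow> dd (D b) = (\<lambda>x. 0)"
  shows "dd (dd f) = (\<lambda>x. 0)"
proof (rule path_ext)
  have dd_dp: "dd (dp f) x + (\<Sum>b\<in>arcs Q. pmul Q (sg (dd (residual Q b f))) (D b) x) = 0"
    if "supported Q f" for f x
  proof -
    have "dd (dp f) = (\<lambda>x. \<Sum>b\<in>arcs Q. dd (pmul Q (sg (residual Q b f)) (D b)) x)"
      unfolding dpart_def by (simp add: der_sum)
    also have "\<dots> = (\<lambda>x. \<Sum>b\<in>arcs Q. - pmul Q (sg (dd (residual Q b f))) (D b) x)"
    proof (intro ext sum.cong[OF refl])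
      fix b x assume b: "b \<in> arcs Q"
      have "dd (sg (residual Q b f)) = (\<lambda>x. - sg (dd (residual Q b f)) x)"
        using der_sign_twist[of "residual Q b f"] that by auto
      then show "dd (pmul Q (sg (residual Q b f)) (D b)) x = - pmul Q (sg (dd (residual Q b f))) (D b) x"
        using that b
        by (simp add: der_pmul supported_sign_twist D_supported D0 pmul_uminus_left)
    qed
    finally show ?thesis by (simp add: sum_negf)
  qed
  have dp_dd: "dp (dd f) x = (\<Sum>b\<in>arcs Q. pmul Q (sg (dd (residual Q b f))) (D b) x) + dp (dp f) x"
    if "supported Q f" for f x
    using that by (simp add: dpart_def residual_der sign_twist_add pmul_add_left sum.distrib)
  fix u p
  show "dd (dd f) (u, p) = 0"
    using assms(1)
  proof (induction p arbitrary: u f)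
    case Nil
    then show ?case using dd_dp[of f "(u, [])"] by (simp add: der_Nil dp_dd add.commute)
  next
    case (Cons c q)
    have "dd (dd f) (u, c # q) = (if u = tail Q c then dd (residual Q c (dp f)) (head Q c, q) else 0)
        + (\<Sum>b\<in>arcs Q. pmul Q (sg (dd (residual Q b f))) (D b) (u, c # q)) + dp (dp f) (u, c # q)"
      using Cons by (simp add: der_Cons[of "dd f"] residual_der der_add dp_dd)
    also have "\<dots> = dd (dp f) (u, c # q) + (\<Sum>b\<in>arcs Q. pmul Q (sg (dd (residual Q b f))) (D b) (u, c # q))"
      by (simp add: der_Cons[of "dp f"])
    finally show ?case using dd_dp[OF Cons.prems] by simp
  qed
qed

lemma der_vertex [simp]: "dd (path_elt (i, [])) = (\<lambda>x. 0)"
proof (rule path_ext)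
  fix u p show "dd (path_elt (i, [])) (u, p) = 0"
    by (cases p) (simp_all add: der_Nil der_Cons dpart_def)
qed

lemma der_arrow: assumes "b \<in> arcs Q" shows "dd (arrow_elt Q b) = D b"
proof (rule path_ext)
  fix u p
  have sgv: "sg (path_elt (i, [])) = path_elt (i, [])" for i
    by (auto simp: sign_twist_def path_elt_def intro!: ext)
  have "dp (arrow_elt Q b) (u, p) = (\<Sum>c\<in>arcs Q. if c = b then D b (u, p) else 0)"
    unfolding dpart_def using D_ends[OF assms, of u p]
    by (intro sum.cong) (auto simp: residual_arrow sgv pmul_vertex_left)
  then have *: "dp (arrow_elt Q b) (u, p) = D b (u, p)" using assms by (simp add: sum.delta)
  have "dd (if c = b then path_elt (head Q b, []) else (\<lambda>x. 0)) = (\<lambda>x. 0)" for c by simp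
  with * show "dd (arrow_elt Q b) (u, p) = D b (u, p)"
    by (cases p) (simp_all add: der_Nil der_Cons residual_arrow)
qed

lemma dpart_nonzeroE:
  assumes "supported Q f" "dp f x \<noteq> 0"
  obtains y where "f y \<noteq> 0" "path_degree wt x = path_degree wt y + 1"
proof -
  from assms(2) obtain b where b: "b \<in> arcs Q" and "pmul Q (sg (residual Q b f)) (D b) x \<noteq> 0"
    unfolding dpart_def by (meson sum.not_neutral_contains_not_neutral)
  then obtain v p q where *: "sg (residual Q b f) (v, q) \<noteq> 0" "D b (fst x, p) \<noteq> 0" "snd x = p @ q"
    by (elim pmul_nonzeroE)
  then have "f (tail Q b, b # q) \<noteq> 0" by (auto simp: sign_twist_def residual_def split: if_splits)
  moreover have "path_degree wt x = path_degree wt (tail Q b, b # q) + 1"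
    using *(3) D_degree[OF b *(2)] by (cases x) (simp add: path_degree_def)
  ultimately show thesis by (rule that)
qed

lemma der_nonzeroE:
  assumes "supported Q f" "dd f x \<noteq> 0"
  obtains y where "f y \<noteq> 0" "path_degree wt x = path_degree wt y + 1"
proof -
  have "\<exists>y. f y \<noteq> 0 \<and> path_degree wt (u, p) = path_degree wt y + 1" if "supported Q f" "dd f (u, p) \<noteq> 0" for u p
    using that
  proof (induction p arbitrary: u f)
    case Nil
    then show ?case by (metis der_Nil dpart_nonzeroE)
  next
    case (Cons c q)
    show ?case
    proof (cases "dp f (u, c # q) = 0")
      case True
      then have "dd (residual Q c f) (head Q c, q) \<noteq> 0"
        using Cons.prems by (auto simp: der_Cons split: if_splits)
      then obtain y where y: "residual Q c f y \<noteq> 0" "path_degree wt (head Q c, q) = path_degree wt y + 1"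
        using Cons by (metis supported_residual)
      obtain v r where "y = (v, r)" by (cases y)
      with y have "f (tail Q c, c # r) \<noteq> 0" "path_degree wt (u, c # q) = path_degree wt (tail Q c, c # r) + 1"
        by (auto simp: residual_def path_degree_def split: if_splits)
      then show ?thesis by blast
    next
      case False
      then show ?thesis using Cons.prems(1) by (metis dpart_nonzeroE)
    qed
  qed
  with assms show thesis by (metis surj_pair that)
qed

text \<open>An arrow can at worst be replaced by a trivial path, for instance when the potential
  contains a loop, so paths become shorter by at most one arrow. This is the continuity estimate for
  the differential.\<close>

lemma der_short:
  assumes "\<And>w. length (snd w) \<le> Suc (length p) \<Longrightarrow> f w = 0"
  shows "dd f (u, p) = 0"
proof -
  have dp0: "dp f (u, p) = 0" if "\<And>w. length (snd w) \<le> Suc (length p) \<Longrightarrow> f w = 0" for f u p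
  proof (rule ccontr)
    assume "dp f (u, p) \<noteq> 0"
    then obtain b where b: "pmul Q (sg (residual Q b f)) (D b) (u, p) \<noteq> 0"
      unfolding dpart_def by (meson sum.not_neutral_contains_not_neutral)
    then obtain v r q where *: "sg (residual Q b f) (v, q) \<noteq> 0" "snd (u, p) = r @ q"
      by (elim pmul_nonzeroE)
    then have "f (tail Q b, b # q) \<noteq> 0" by (auto simp: sign_twist_def residual_def split: if_splits)
    with that[of "(tail Q b, b # q)"] *(2) show False by simp
  qed
  show ?thesis using assms
  proof (induction p arbitrary: u f)
    case Nil
    then show ?case using dp0[of "[]" f u] by (simp add: der_Nil)
  next
    case (Cons c q)
    have "dd (residual Q c f) (head Q c, q) = 0"
      by (rule Cons.IH) (auto simp: residual_def Cons.prems)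
    then show ?case using dp0[of "c # q" f] Cons.prems by (simp add: der_Cons)
  qed
qed

end

section \<open>The graded algebra of series and its dg structure\<close>

context quiver begin

lemma carrier_path_algebra:
  "f \<in> carrier (path_algebra Q wt) \<longleftrightarrow> supported Q f \<and> finite (path_degree wt ` {x. f x \<noteq> 0})"
  by (simp add: path_algebra_def supported_def)

lemma grade_path_algebra:
  "f \<in> grade (path_algebra Q wt) n \<longleftrightarrow> supported Q f \<and> (\<forall>x. f x \<noteq> 0 \<longrightarrow> path_degree wt x = n)"
  by (auto simp: path_algebra_def supported_def)

lemma path_algebra_simps:
  "monoid.mult (path_algebra Q wt) = pmul Q"
  "one (path_algebra Q wt) = pone Q"
  "ring.zero (path_algebra Q wt) = (\<lambda>x. 0)"
  "add (path_algebra Q wt) = (\<lambda>f g x. f x + g x)"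
  "module.smult (path_algebra Q wt) = (\<lambda>c f x. c * f x)"
  by (simp_all add: path_algebra_def pmul_def[abs_def] pone_def)

lemma grade_subset: "grade (path_algebra Q wt) n \<subseteq> carrier (path_algebra Q wt)"
proof
  fix f :: "('v, 'b, 'k::field) pelt" assume "f \<in> grade (path_algebra Q wt) n"
  then have "supported Q f" "path_degree wt ` {x. f x \<noteq> 0} \<subseteq> {n}"
    by (auto simp: grade_path_algebra)
  then show "f \<in> carrier (path_algebra Q wt)"
    by (auto simp: carrier_path_algebra intro: finite_subset)
qed

lemma carrier_zero: "(\<lambda>x. 0) \<in> carrier (path_algebra Q wt)"
  by (simp add: carrier_path_algebra)

lemma carrier_scale: "f \<in> carrier (path_algebra Q wt) \<Longrightarrow> (\<lambda>x. a * f x) \<in> carrier (path_algebra Q wt)"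
  unfolding carrier_path_algebra by (auto simp: supported_scale elim!: rev_finite_subset)

lemma carrier_add:
  assumes "f \<in> carrier (path_algebra Q wt)" "g \<in> carrier (path_algebra Q wt)"
  shows "(\<lambda>x. f x + g x) \<in> carrier (path_algebra Q wt)"
proof -
  have "path_degree wt ` {x. f x + g x \<noteq> 0} \<subseteq>
      path_degree wt ` {x. f x \<noteq> 0} \<union> path_degree wt ` {x. g x \<noteq> 0}" by auto
  with assms show ?thesis
    unfolding carrier_path_algebra by (auto simp: supported_add intro: finite_subset)
qed

lemma carrier_pmul:
  assumes "f \<in> carrier (path_algebra Q wt)" "g \<in> carrier (path_algebra Q wt)"
  shows "pmul Q f g \<in> carrier (path_algebra Q wt)"
proof -
  let ?d = "\<lambda>f. path_degree wt ` {x. f x \<noteq> 0}"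
  have "?d (pmul Q f g) \<subseteq> (\<lambda>(a, b). a + b) ` (?d f \<times> ?d g)"
  proof clarify
    fix u r assume "pmul Q f g (u, r) \<noteq> 0"
    then obtain v p q where "f (v, q) \<noteq> 0" "g (u, p) \<noteq> 0" "r = p @ q"
      by (elim pmul_nonzeroE) auto
    then have "path_degree wt (u, r) = path_degree wt (v, q) + path_degree wt (u, p)"
      "path_degree wt (v, q) \<in> ?d f" "path_degree wt (u, p) \<in> ?d g"
      by (simp add: path_degree_def, blast, blast)
    then show "path_degree wt (u, r) \<in> (\<lambda>(a, b). a + b) ` (?d f \<times> ?d g)" by auto
  qed
  moreover have "finite (?d f \<times> ?d g)" using assms by (simp add: carrier_path_algebra)
  ultimately have "finite (?d (pmul Q f g))" by (metis finite_imageI finite_subset)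
  with assms show ?thesis by (simp add: carrier_path_algebra)
qed

lemma carrier_pone: "pone Q \<in> carrier (path_algebra Q wt)"
proof -
  have "path_degree wt ` {x. pone Q x \<noteq> (0::'k::field)} \<subseteq> {0}"
    by (auto simp: pone_def split: if_splits)
  then show ?thesis by (auto simp: carrier_path_algebra intro: finite_subset)
qed

lemma carrier_sum:
  assumes "finite I" "\<And>i. i \<in> I \<Longrightarrow> f i \<in> carrier (path_algebra Q wt)"
  shows "(\<lambda>x. \<Sum>i\<in>I. f i x) \<in> carrier (path_algebra Q wt)"
  using assms by (induction I rule: finite_induct) (simp_all add: carrier_zero carrier_add)

lemma carrier_vertex: "i \<in> verts Q \<Longrightarrow> path_elt (i, []) \<in> carrier (path_algebra Q wt)"
  and grade_vertex: "i \<in> verts Q \<Longrightarrow> path_elt (i, []) \<in> grade (path_algebra Q wt) 0"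
proof -
  show *: "path_elt (i, []) \<in> grade (path_algebra Q wt) 0" if "i \<in> verts Q"
    using that by (auto simp: grade_path_algebra path_elt_def supported_def split: if_splits)
  then show "path_elt (i, []) \<in> carrier (path_algebra Q wt)" if "i \<in> verts Q"
    using that grade_subset by blast
qed

lemma grade_arrow: "c \<in> arcs Q \<Longrightarrow> arrow_elt Q c \<in> grade (path_algebra Q wt) (wt c)"
  by (auto simp: grade_path_algebra arrow_elt_def path_elt_def path_degree_def supported_def split: if_splits)

lemma grade_residual:
  assumes "f \<in> grade (path_algebra Q wt) n"
  shows "residual Q c f \<in> grade (path_algebra Q wt) (n - wt c)"
proof -
  have "path_degree wt (v, q) = n - wt c" if "residual Q c f (v, q) \<noteq> 0" for v q
    using that assms path_degree_Cons[of wt "tail Q c" c q v]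
    by (auto simp: grade_path_algebra residual_def split: if_splits)
  then show ?thesis using assms by (auto simp: grade_path_algebra)
qed

text \<open>Sums in a ring depend on its record. The statement covers every record with these
  additive operations, hence the path algebra, its dg extension and the Ginzburg algebra
  alike.\<close>

lemma path_abelian_group:
  fixes R :: "(('v, 'b, 'k::field) pelt, 'm) ring_scheme"
  assumes "carrier R = carrier (path_algebra Q wt)" "add R = (\<lambda>f g x. f x + g x)"
    and "ring.zero R = (\<lambda>x. 0)"
  shows "abelian_group R"
proof (rule abelian_groupI; (unfold assms)?)
  fix f :: "('v, 'b, 'k) pelt" assume f: "f \<in> carrier (path_algebra Q wt)"
  show "\<exists>g\<in>carrier (path_algebra Q wt). (\<lambda>x. g x + f x) = (\<lambda>x. 0)"
    using carrier_scale[OF f, of "-1"] by (rule bexI[rotated]) simp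
qed (auto simp: carrier_add carrier_zero add_ac)

lemma path_finsum:
  fixes R :: "(('v, 'b, 'k::field) pelt, 'm) ring_scheme"
  assumes R: "carrier R = carrier (path_algebra Q wt)" "add R = (\<lambda>f g x. f x + g x)"
    "ring.zero R = (\<lambda>x. 0)"
    and "finite I" "\<And>i. i \<in> I \<Longrightarrow> h i \<in> carrier (path_algebra Q wt)"
  shows "(\<Oplus>\<^bsub>R\<^esub>i\<in>I. h i) = (\<lambda>x. \<Sum>i\<in>I. h i x)"
proof -
  interpret abelian_group R by (rule path_abelian_group[OF R])
  show ?thesis using assms(4,5)
    by (induction I rule: finite_induct) (auto simp: R finsum_insert Pi_iff)
qed

lemma path_minus:
  fixes R :: "(('v, 'b, 'k::field) pelt, 'm) ring_scheme"
  assumes R: "carrier R = carrier (path_algebra Q wt)" "add R = (\<lambda>f g x. f x + g x)"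
    "ring.zero R = (\<lambda>x. 0)"
    and fg: "f \<in> carrier R" "g \<in> carrier R"
  shows "f \<ominus>\<^bsub>R\<^esub> g = (\<lambda>x. f x - g x)"
proof -
  interpret abelian_group R by (rule path_abelian_group[OF R])
  have "(\<lambda>x. - g x) \<in> carrier R" using carrier_scale[of g wt "-1"] fg by (simp add: R)
  then have "\<ominus>\<^bsub>R\<^esub> g = (\<lambda>x. - g x)" using fg by (intro minus_equality) (simp_all add: R)
  then show ?thesis by (simp add: a_minus_def R)
qed

end

lemma graded_extend_simps:
  "carrier (graded_alg.extend A \<lparr>diff = d\<rparr>) = carrier A"
  "monoid.mult (graded_alg.extend A \<lparr>diff = d\<rparr>) = monoid.mult A"
  "one (graded_alg.extend A \<lparr>diff = d\<rparr>) = one A"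
  "ring.zero (graded_alg.extend A \<lparr>diff = d\<rparr>) = ring.zero A"
  "add (graded_alg.extend A \<lparr>diff = d\<rparr>) = add A"
  "module.smult (graded_alg.extend A \<lparr>diff = d\<rparr>) = module.smult A"
  "grade (graded_alg.extend A \<lparr>diff = d\<rparr>) = grade A"
  "diff (graded_alg.extend A \<lparr>diff = d\<rparr>) = d"
  by (simp_all add: graded_alg.extend_def)

context derivation_data begin

lemma der_carrier:
  assumes "f \<in> carrier (path_algebra Q wt)" shows "dd f \<in> carrier (path_algebra Q wt)"
proof -
  have "path_degree wt ` {x. dd f x \<noteq> 0} \<subseteq> (\<lambda>n. n + 1) ` path_degree wt ` {x. f x \<noteq> 0}"
  proof clarify
    fix u p assume "dd f (u, p) \<noteq> 0"
    then obtain y where "f y \<noteq> 0" "path_degree wt (u, p) = path_degree wt y + 1"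
      using assms der_nonzeroE unfolding carrier_path_algebra by blast
    then show "path_degree wt (u, p) \<in> (\<lambda>n. n + 1) ` path_degree wt ` {x. f x \<noteq> 0}" by blast
  qed
  moreover have "finite (path_degree wt ` {x. f x \<noteq> 0})" using assms by (simp add: carrier_path_algebra)
  ultimately have "finite (path_degree wt ` {x. dd f x \<noteq> 0})" by (metis finite_imageI finite_subset)
  with assms show ?thesis by (simp add: carrier_path_algebra)
qed

lemma der_grade:
  assumes "f \<in> grade (path_algebra Q wt) n" shows "dd f \<in> grade (path_algebra Q wt) (n + 1)"
  using assms by (auto simp: grade_path_algebra elim!: der_nonzeroE)

lemma sign_twist_grade: "f \<in> grade (path_algebra Q wt) n \<Longrightarrow> sg f = (\<lambda>x. (-1) powi n * f x)"
  unfolding sign_twist_def grade_path_algebra by (metis mult_zero_right)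

text \<open>Continuity plays no role here: the residuals of \<open>f\<close> determine \<open>d f\<close> one coefficient at a
  time.\<close>

lemma der_unique:
  assumes add: "\<And>f g. f \<in> carrier (path_algebra Q wt) \<Longrightarrow> g \<in> carrier (path_algebra Q wt) \<Longrightarrow>
      d' (\<lambda>x. f x + g x) = (\<lambda>x. d' f x + d' g x)"
    and scale: "\<And>a f. f \<in> carrier (path_algebra Q wt) \<Longrightarrow> d' (\<lambda>x. a * f x) = (\<lambda>x. a * d' f x)"
    and vertex: "\<And>i. i \<in> verts Q \<Longrightarrow> d' (path_elt (i, [])) = (\<lambda>x. 0)"
    and mult: "\<And>n f c. f \<in> grade (path_algebra Q wt) n \<Longrightarrow> c \<in> arcs Q \<Longrightarrow>
      d' (pmul Q f (arrow_elt Q c)) = (\<lambda>x. pmul Q (d' f) (arrow_elt Q c) x + (-1) powi n * pmul Q f (D c) x)"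
    and f: "f \<in> carrier (path_algebra Q wt)"
  shows "d' f = dd f"
proof -
  let ?C = "carrier (path_algebra Q wt)"
  have zero: "d' (\<lambda>x. 0) = (\<lambda>x. 0)" using scale[OF carrier_zero, of 0] by simp
  have sum: "d' (\<lambda>x. \<Sum>i\<in>I. h i x) = (\<lambda>x. \<Sum>i\<in>I. d' (h i) x)"
    if "finite I" "\<And>i. i \<in> I \<Longrightarrow> h i \<in> ?C" for I :: "'i set" and h :: "'i \<Rightarrow> _"
    using that by (induction I rule: finite_induct) (simp_all add: zero add carrier_sum)
  \<comment> \<open>Residuals of a homogeneous series are homogeneous, so the product rule for right
    multiplication by an arrow applies to each summand of the decomposition, and the signs assemble
    to \<open>sg\<close>.\<close>
  have step: "d' f x = dp f x + (\<Sum>c\<in>arcs Q. pmul Q (d' (residual Q c f)) (arrow_elt Q c) x)"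
    if f: "f \<in> grade (path_algebra Q wt) n" for f n x
  proof -
    note res = grade_residual[OF f]
    have C: "residual Q c f \<in> ?C" "arrow_elt Q b \<in> ?C" if "b \<in> arcs Q" for b c
      using res grade_arrow[OF that, of wt] grade_subset by blast+
    have "supported Q f" using f by (simp add: grade_path_algebra)
    then have "f = (\<lambda>x. (\<Sum>i\<in>verts Q. f (i, []) * path_elt (i, []) x)
        + (\<Sum>c\<in>arcs Q. pmul Q (residual Q c f) (arrow_elt Q c) x))"
      by (intro ext residual_decomposition)
    then have "d' f = d' (\<lambda>x. (\<Sum>i\<in>verts Q. f (i, []) * path_elt (i, []) x)
        + (\<Sum>c\<in>arcs Q. pmul Q (residual Q c f) (arrow_elt Q c) x))"
      by (rule arg_cong)
    also have "\<dots> = (\<lambda>x. d' (\<lambda>x. \<Sum>i\<in>verts Q. f (i, []) * path_elt (i, []) x) x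
        + d' (\<lambda>x. \<Sum>c\<in>arcs Q. pmul Q (residual Q c f) (arrow_elt Q c) x) x)"
      by (intro add carrier_sum carrier_scale carrier_vertex carrier_pmul C) auto
    also have "d' (\<lambda>x. \<Sum>i\<in>verts Q. f (i, []) * path_elt (i, []) x) = (\<lambda>x. 0)"
      by (subst sum) (simp_all add: carrier_scale carrier_vertex scale vertex)
    also have "d' (\<lambda>x. \<Sum>c\<in>arcs Q. pmul Q (residual Q c f) (arrow_elt Q c) x) =
      (\<lambda>x. \<Sum>c\<in>arcs Q. pmul Q (d' (residual Q c f)) (arrow_elt Q c) x
        + pmul Q (sg (residual Q c f)) (D c) x)"
      by (subst sum)
        (simp_all add: carrier_pmul C mult[OF res] sign_twist_grade[OF res] pmul_scale_left)
    finally show ?thesis by (simp add: sum.distrib dpart_def)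
  qed
  have homog: "d' f (u, p) = dd f (u, p)" if "f \<in> grade (path_algebra Q wt) n" for f n u p
    using that
  proof (induction p arbitrary: f n u)
    case (Nil f n u)
    then show ?case by (simp add: step[OF Nil] der_Nil pmul_arrow_right)
  next
    case (Cons c q f n u)
    have "supported Q f" using Cons.prems by (simp add: grade_path_algebra)
    then have "dd (residual Q c f) = (\<lambda>x. 0)" if "c \<notin> arcs Q"
      using that by (simp add: residual_not_arc)
    moreover have "(\<Sum>b\<in>arcs Q. pmul Q (d' (residual Q b f)) (arrow_elt Q b) (u, c # q)) =
      (\<Sum>b\<in>arcs Q. if b = c then (if u = tail Q c then d' (residual Q c f) (head Q c, q) else 0) else 0)"
      by (intro sum.cong) (auto simp: pmul_arrow_right)
    ultimately show ?case
      using Cons.IH[OF grade_residual[OF Cons.prems]]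
      by (simp add: step[OF Cons.prems] der_Cons sum.delta)
  qed
  define h where "h n = (\<lambda>x. if path_degree wt x = n then f x else 0)" for n
  have h: "h n \<in> grade (path_algebra Q wt) n" for n
    using f by (auto simp: h_def grade_path_algebra carrier_path_algebra supported_def)
  let ?I = "path_degree wt ` {x. f x \<noteq> 0}"
  have fin: "finite ?I" using f by (simp add: carrier_path_algebra)
  have "f = (\<lambda>x. \<Sum>n\<in>?I. h n x)"
    by (rule ext) (use fin in \<open>auto simp: h_def sum.delta\<close>)
  moreover have "d' (\<lambda>x. \<Sum>n\<in>?I. h n x) = dd (\<lambda>x. \<Sum>n\<in>?I. h n x)"
    using h grade_subset by (subst sum[OF fin]) (auto simp: der_sum[OF fin] homog[OF h] intro!: path_ext)
  ultimately show ?thesis by metis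
qed

text \<open>The map \<open>d\<close> has to agree with the derivation on the carrier only: the
  differential of a Ginzburg algebra is obtained from \<open>THE\<close> and is
  \<open>undefined\<close> elsewhere.\<close>

lemma path_dg_algebra:
  assumes D0: "\<And>b. b \<in> arcs Q \<Longrightarrow> dd (D b) = (\<lambda>x. 0)"
    and d: "\<And>f. f \<in> carrier (path_algebra Q wt) \<Longrightarrow> d f = dd f"
  shows "dg_algebra (graded_alg.extend (path_algebra Q wt) \<lparr>diff = d\<rparr>)" (is "dg_algebra ?A")
proof -
  note [simp] = graded_extend_simps path_algebra_simps
  have ab: "abelian_group ?A" by (rule path_abelian_group[of _ wt]) simp_all
  have mon: "monoid ?A"
    by (rule monoidI)
      (simp_all add: carrier_pmul carrier_pone pmul_assoc carrier_path_algebra[THEN iffD1])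
  have ring: "ring ?A"
    by (rule ringI[OF ab mon]) (simp_all add: pmul_add_left pmul_add_right)
  have cr: "cring (ring_of_type_algebra :: 'k ring)" by (rule cring_from_type_algebra)
  have mod: "module (ring_of_type_algebra :: 'k ring) ?A"
    by (rule moduleI[OF cr ab])
      (simp_all add: carrier_scale ring_of_type_algebra_def algebra_simps)
  have finsum: "(\<Oplus>\<^bsub>?A\<^esub>i\<in>I. h i) = (\<lambda>x. \<Sum>i\<in>I. h i x)"
    if "finite I" "\<And>i. i \<in> I \<Longrightarrow> h i \<in> carrier (path_algebra Q wt)" for I :: "int set" and h
    using that by (intro path_finsum[of _ wt]) simp_all
  show ?thesis
  proof (intro dg_algebra.intro ring mod dg_algebra_axioms.intro)
    fix n
    show "submodule (grade ?A n) (ring_of_type_algebra :: 'k ring) ?A"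
    proof (rule module.submoduleI[OF mod])
      fix f assume f: "f \<in> grade ?A n"
      then have fc: "f \<in> carrier ?A" using grade_subset[of wt n] by auto
      have "\<ominus>\<^bsub>?A\<^esub> f = (\<lambda>x. 0 - f x)"
        using path_minus[of ?A wt "\<lambda>x. 0" f] fc carrier_zero[of wt]
          abelian_group.a_inv_closed[OF ab fc] abelian_group.axioms(1)[OF ab]
        by (simp add: a_minus_def)
      then show "\<ominus>\<^bsub>?A\<^esub> f \<in> grade ?A n"
        using f by (auto simp: grade_path_algebra supported_uminus)
    next
      fix f g assume "f \<in> grade ?A n" "g \<in> grade ?A n"
      then show "f \<oplus>\<^bsub>?A\<^esub> g \<in> grade ?A n"
        by (auto simp: grade_path_algebra supported_add) (metis add_0)
    qed (use grade_subset[of wt n] in \<open>auto simp: grade_path_algebra supported_scale\<close>)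
  next
    fix f assume "f \<in> carrier ?A"
    then have f: "f \<in> carrier (path_algebra Q wt)" by simp
    define h where "h n = (\<lambda>x. if path_degree wt x = n then f x else 0)" for n
    have h: "h n \<in> grade (path_algebra Q wt) n" for n
      using f by (auto simp: h_def grade_path_algebra carrier_path_algebra supported_def)
    let ?I = "path_degree wt ` {x. f x \<noteq> 0}"
    have fin: "finite ?I" using f by (simp add: carrier_path_algebra)
    have I: "{n. h n \<noteq> (\<lambda>x. 0)} = ?I"
      by (auto simp: h_def fun_eq_iff)
    have sum_eq: "(\<Oplus>\<^bsub>?A\<^esub>n\<in>{n. h n \<noteq> \<zero>\<^bsub>?A\<^esub>}. h n) = (\<lambda>x. \<Sum>n\<in>{n. h n \<noteq> (\<lambda>x. 0)}. h n x)"
      if "\<And>n. h n \<in> grade ?A n" "finite {n. h n \<noteq> \<zero>\<^bsub>?A\<^esub>}" for h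
      using that grade_subset[of wt] by (subst finsum) auto
    show "\<exists>!h. (\<forall>n. h n \<in> grade ?A n) \<and> finite {n. h n \<noteq> \<zero>\<^bsub>?A\<^esub>} \<and>
        f = (\<Oplus>\<^bsub>?A\<^esub>n\<in>{n. h n \<noteq> \<zero>\<^bsub>?A\<^esub>}. h n)"
    proof (rule ex1I[of _ h])
      have "f = (\<lambda>x. \<Sum>n\<in>?I. h n x)"
        by (rule ext) (use fin in \<open>auto simp: h_def sum.delta\<close>)
      then show "(\<forall>n. h n \<in> grade ?A n) \<and> finite {n. h n \<noteq> \<zero>\<^bsub>?A\<^esub>} \<and>
        f = (\<Oplus>\<^bsub>?A\<^esub>n\<in>{n. h n \<noteq> \<zero>\<^bsub>?A\<^esub>}. h n)"
        using h fin by (subst sum_eq) (simp_all add: I)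
    next
      fix h' assume h': "(\<forall>n. h' n \<in> grade ?A n) \<and> finite {n. h' n \<noteq> \<zero>\<^bsub>?A\<^esub>} \<and>
        f = (\<Oplus>\<^bsub>?A\<^esub>n\<in>{n. h' n \<noteq> \<zero>\<^bsub>?A\<^esub>}. h' n)"
      have fin': "finite {n. h' n \<noteq> (\<lambda>x. 0)}" using h' by simp
      have fx: "f x = (\<Sum>n\<in>{n. h' n \<noteq> (\<lambda>x. 0)}. h' n x)" for x
        using h' sum_eq[of h'] by metis
      \<comment> \<open>At a path \<open>x\<close> only the component indexed by the degree of
        \<open>x\<close> can be nonzero, so a decomposition is read off from \<open>f\<close> path
        by path.\<close>
      have "h' n x = h n x" for n x
      proof -
        have "h' m x = 0" if "m \<noteq> path_degree wt x" for m
          using h' that by (simp add: grade_path_algebra del: split_paired_All) blast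
        then have "f x = (\<Sum>m\<in>{m. h' m \<noteq> (\<lambda>x. 0)}. if m = path_degree wt x then h' (path_degree wt x) x else 0)"
          unfolding fx by (intro sum.cong) auto
        also have "\<dots> = h' (path_degree wt x) x" using fin' by (auto simp: sum.delta)
        finally show ?thesis using \<open>\<And>m. m \<noteq> path_degree wt x \<Longrightarrow> h' m x = 0\<close>
          by (auto simp: h_def)
      qed
      then show "h' = h" by blast
    qed
  next
    show "\<one>\<^bsub>?A\<^esub> \<in> grade ?A 0"
      using supported_pone by (auto simp: grade_path_algebra) (auto simp: pone_def split: if_splits)
  next
    fix f g m n assume "f \<in> grade ?A m" "g \<in> grade ?A n"
    then have fg: "supported Q f" "supported Q g" "\<And>x. f x \<noteq> 0 \<Longrightarrow> path_degree wt x = m"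
      "\<And>x. g x \<noteq> 0 \<Longrightarrow> path_degree wt x = n" by (auto simp: grade_path_algebra)
    have "path_degree wt x = m + n" if "pmul Q f g x \<noteq> 0" for x
      using that
    proof (rule pmul_nonzeroE)
      fix v p q assume *: "f (v, q) \<noteq> 0" "g (fst x, p) \<noteq> 0" "snd x = p @ q"
      have "path_degree wt x = path_degree wt (v, q) + path_degree wt (fst x, p)"
        using *(3) by (simp add: path_degree_def)
      with * fg show ?thesis by simp
    qed
    with fg show "f \<otimes>\<^bsub>?A\<^esub> g \<in> grade ?A (m + n)" by (simp add: grade_path_algebra)
  next
    fix f n assume "f \<in> grade ?A n"
    then have f: "f \<in> grade (path_algebra Q wt) n" by simp
    then have fc: "f \<in> carrier (path_algebra Q wt)" using grade_subset by blast
    show "diff ?A f \<in> grade ?A (n + 1)"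
      using der_grade[OF f] d[OF fc] by simp
    fix g assume "g \<in> carrier ?A"
    then show "diff ?A (f \<otimes>\<^bsub>?A\<^esub> g) = diff ?A f \<otimes>\<^bsub>?A\<^esub> g \<oplus>\<^bsub>?A\<^esub> ((-1) powi n) \<odot>\<^bsub>?A\<^esub> (f \<otimes>\<^bsub>?A\<^esub> diff ?A g)"
      using fc carrier_pmul[OF fc] sign_twist_grade[OF f]
      by (simp add: d der_pmul carrier_path_algebra[THEN iffD1] pmul_scale_left)
  qed (simp_all add: d carrier_add carrier_scale der_carrier der_add der_scale pmul_scale_left
      pmul_scale_right der_der[OF _ D0] carrier_path_algebra[THEN iffD1])
qed

end

section \<open>Cyclic symmetrisation of potentials\<close>

text \<open>The sum of the coefficients of \<open>S\<close> at the rotations of \<open>w\<close>. The cyclic derivatives of \<open>S\<close>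
  are the residuals of this symmetrisation.\<close>

definition cyclic_sum :: "('v, 'a) pre_digraph \<Rightarrow> ('v, 'a, 'k::field) pelt \<Rightarrow> 'a list \<Rightarrow> 'k" where
  "cyclic_sum Q S w = (\<Sum>l<length w. S (tail Q (hd (rotate l w)), rotate l w))"

lemma sum_rotate_shift:
  fixes h :: "'a list \<Rightarrow> 'k::ab_group_add"
  shows "(\<Sum>l<length w. h (rotate (Suc l) w)) = (\<Sum>l<length w. h (rotate l w))"
proof -
  have "(\<Sum>l<Suc (length w). h (rotate l w)) = h (rotate 0 w) + (\<Sum>l<length w. h (rotate (Suc l) w))"
    by (rule sum.lessThan_Suc_shift)
  moreover have "rotate (length w) w = w" by (rule rotate_id) simp
  ultimately show ?thesis by simp
qed

lemma cyclic_sum_rotate1: "cyclic_sum Q S (rotate1 w) = cyclic_sum Q S w"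
  using sum_rotate_shift[of "\<lambda>w. S (tail Q (hd w), w)" w]
  by (simp add: cyclic_sum_def rotate1_rotate_swap)

lemma cyclic_sum_snoc: "cyclic_sum Q S (w @ [c]) = cyclic_sum Q S (c # w)"
  using cyclic_sum_rotate1[of Q S "c # w"] by simp

context quiver begin

lemma cycles_start: "(u, p) \<in> cycles Q \<Longrightarrow> u = tail Q (hd p)"
  by (cases p) (auto simp: cycles_def awalk_Cons_iff)

lemma cycles_Cons: "(u, c # p) \<in> cycles Q \<longleftrightarrow> c \<in> arcs Q \<and> u = tail Q c \<and> awalk (head Q c) p (tail Q c)"
  by (auto simp: cycles_def awalk_Cons_iff)

lemma cycles_closed: "(u, p) \<in> cycles Q \<Longrightarrow> u = head Q (last p)"
  by (cases p rule: rev_cases) (auto simp: cycles_def awalk_Cons_iff awalk_Nil_iff)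

lemma cycles_rotate1: "(tail Q (hd w), w) \<in> cycles Q \<Longrightarrow> (tail Q (hd (rotate1 w)), rotate1 w) \<in> cycles Q"
proof (cases w)
  case (Cons c q)
  assume "(tail Q (hd w), w) \<in> cycles Q"
  then have "c \<in> arcs Q" "awalk (head Q c) q (tail Q c)" by (auto simp: Cons cycles_Cons)
  then have "awalk (head Q c) (q @ [c]) (head Q c)"
    by (intro awalk_appendI) (auto simp: awalk_Cons_iff awalk_Nil_iff)
  then have "(head Q c, q @ [c]) \<in> cycles Q" by (simp add: cycles_def)
  then show ?thesis using cycles_start by (fastforce simp: Cons)
qed (simp add: cycles_def)

lemma cycles_rotate:
  "(tail Q (hd (rotate l w)), rotate l w) \<in> cycles Q \<longleftrightarrow> (tail Q (hd w), w) \<in> cycles Q"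
proof
  show *: "(tail Q (hd (rotate l w)), rotate l w) \<in> cycles Q" if "(tail Q (hd w), w) \<in> cycles Q" for l w
    using that by (induction l) (auto intro: cycles_rotate1)
  assume "(tail Q (hd (rotate l w)), rotate l w) \<in> cycles Q"
  then have "(tail Q (hd (rotate k (rotate l w))), rotate k (rotate l w)) \<in> cycles Q" for k
    by (rule *)
  moreover obtain k where "rotate k (rotate l w) = w"
  proof (cases w)
    case (Cons c q)
    \<comment> \<open>After \<open>l\<close> rotations, \<open>l * length q\<close> further ones
      complete \<open>l\<close> full turns.\<close>
    then have "l * length q + l = l * length w" by simp
    then have "(l * length q + l) mod length w = 0" by (metis mod_mult_self2_is_0)
    then show ?thesis by (intro that[of "l * length q"]) (simp add: rotate_rotate rotate_id)
  qed simp
  ultimately show "(tail Q (hd w), w) \<in> cycles Q" by metis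
qed

end

locale potential = quiver Q for Q :: "('v, 'a) pre_digraph" +
  fixes S :: "('v, 'a, 'k::field) pelt"
  assumes S_cycles: "S x \<noteq> 0 \<Longrightarrow> x \<in> cycles Q"
begin

lemma cyclic_sum_nonzero: "cyclic_sum Q S w \<noteq> 0 \<Longrightarrow> (tail Q (hd w), w) \<in> cycles Q"
  unfolding cyclic_sum_def
  by (metis (no_types, lifting) sum.not_neutral_contains_not_neutral S_cycles cycles_rotate)

text \<open>The factorisation of \<open>p\<close> at position \<open>l\<close> corresponds to the
  rotation of \<open>\<alpha> # p\<close> by \<open>l + 1\<close>; over a full period the shift by
  one is immaterial. If \<open>p\<close> does not lead back to the tail of \<alpha>, both sides
  vanish because \<open>S\<close> is supported on cycles.\<close>

lemma cyclic_derivative_eq: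
  assumes "\<alpha> \<in> arcs Q"
  shows "cyclic_derivative Q \<alpha> S (b, p) = (if b = head Q \<alpha> then cyclic_sum Q S (\<alpha> # p) else 0)"
proof (cases "b = head Q \<alpha>")
  case b: True
  show ?thesis
  proof (cases "awalk b p (tail Q \<alpha>)")
    case True
    have "awlast b (take l p) = tail Q (hd (drop l p @ [\<alpha>]))" for l
    proof -
      have "awalk (awlast b (take l p)) (drop l p) (tail Q \<alpha>)"
        using True by (metis append_take_drop_id awalk_append_iff)
      then show ?thesis by (cases "drop l p") (auto simp: awalk_Nil_iff awalk_Cons_iff)
    qed
    moreover have "tail Q (hd (drop l p @ [\<alpha>])) = tail Q (hd (drop l p @ \<alpha> # take l p))" for l
      by (cases "drop l p") auto
    moreover have "drop l p @ \<alpha> # take l p = rotate (Suc l) (\<alpha> # p)" if "l \<le> length p" for l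
    proof -
      have "take l p @ (drop l p @ [\<alpha>]) = p @ [\<alpha>]" by (metis append_assoc append_take_drop_id)
      with rotate_append[of "take l p" "drop l p @ [\<alpha>]"] that show ?thesis
        by (simp del: append_take_drop_id add: rotate1_rotate_swap)
    qed
    ultimately have "cyclic_derivative Q \<alpha> S (b, p) =
      (\<Sum>l<length (\<alpha> # p). S (tail Q (hd (rotate (Suc l) (\<alpha> # p))), rotate (Suc l) (\<alpha> # p)))"
      using True b by (simp add: cyclic_derivative_def lessThan_Suc_atMost)
    also have "\<dots> = cyclic_sum Q S (\<alpha> # p)"
      unfolding cyclic_sum_def by (rule sum_rotate_shift[where h = "\<lambda>w. S (tail Q (hd w), w)"])
    finally show ?thesis using b by simp
  next
    case False
    then have "cyclic_sum Q S (\<alpha> # p) = 0"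
      using cyclic_sum_nonzero[of "\<alpha> # p"] b by (auto simp: cycles_Cons)
    with False show ?thesis by (simp add: cyclic_derivative_def)
  qed
qed (simp add: cyclic_derivative_def)

end

section \<open>The differential of the Ginzburg algebra\<close>

text \<open>The coefficients of the prescribed differential of the loop at \<open>i\<close>. Arrows
  are listed in the order of traversal, so \<alpha> times its dual is the list
  \<open>[Dual a, Orig a]\<close>, a cycle at the head of \<open>a\<close>.\<close>

definition loop_differential ::
  "('v, 'a) pre_digraph \<Rightarrow> 'v \<Rightarrow> ('v, ('v, 'a) ginzburg_arrow, 'k::field) pelt" where
  "loop_differential Q i = (\<lambda>(u, p). \<Sum>a\<in>arcs Q.
     of_bool (u = i \<and> head Q a = i \<and> p = [Dual a, Orig a])
     - of_bool (u = i \<and> tail Q a = i \<and> p = [Orig a, Dual a]))"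

lemma loop_differential_nonzero:
  assumes "loop_differential Q i (u, p) \<noteq> (0::'k::field)"
  obtains a where "a \<in> arcs Q" "u = i"
    "head Q a = i \<and> p = [Dual a, Orig a] \<or> tail Q a = i \<and> p = [Orig a, Dual a]"
proof -
  from assms obtain a where "a \<in> arcs Q"
    "of_bool (u = i \<and> head Q a = i \<and> p = [Dual a, Orig a])
     - of_bool (u = i \<and> tail Q a = i \<and> p = [Orig a, Dual a]) \<noteq> (0::'k)"
    unfolding loop_differential_def prod.case by (meson sum.not_neutral_contains_not_neutral)
  then show thesis by (intro that[of a]) (auto simp: of_bool_def split: if_splits)
qed

primrec ginzburg_values ::
  "('v, 'a) pre_digraph \<Rightarrow> ('v, 'a, 'k::field) pelt \<Rightarrow> ('v, 'a) ginzburg_arrow \<Rightarrow>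
   ('v, ('v, 'a) ginzburg_arrow, 'k) pelt" where
  "ginzburg_values Q S (Orig \<alpha>) = (\<lambda>x. 0)"
| "ginzburg_values Q S (Dual \<alpha>) = incl_ginzburg (cyclic_derivative Q \<alpha> S)"
| "ginzburg_values Q S (Loop i) = loop_differential Q i"

lemma ginzburg_quiver_simps [simp]:
  "verts (ginzburg_quiver Q) = verts Q"
  "arcs (ginzburg_quiver Q) = Orig ` arcs Q \<union> Dual ` arcs Q \<union> Loop ` verts Q"
  "tail (ginzburg_quiver Q) (Orig a) = tail Q a"
  "tail (ginzburg_quiver Q) (Dual a) = head Q a"
  "tail (ginzburg_quiver Q) (Loop i) = i"
  "head (ginzburg_quiver Q) (Orig a) = head Q a"
  "head (ginzburg_quiver Q) (Dual a) = tail Q a"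
  "head (ginzburg_quiver Q) (Loop i) = i"
  by (simp_all add: ginzburg_quiver_def)

context quiver begin

lemma quiver_ginzburg: "quiver (ginzburg_quiver Q)"
proof (unfold_locales)
  fix e assume e: "e \<in> arcs (ginzburg_quiver Q)"
  show "tail (ginzburg_quiver Q) e \<in> verts (ginzburg_quiver Q)" using e by auto
  show "head (ginzburg_quiver Q) e \<in> verts (ginzburg_quiver Q)" using e by auto
qed auto

lemma ginzburg_paths_Orig:
  "(u, map Orig p) \<in> quiver_paths (ginzburg_quiver Q) \<longleftrightarrow> (u, p) \<in> quiver_paths Q"
proof -
  interpret G: quiver "ginzburg_quiver Q" by (rule quiver_ginzburg)
  show ?thesis by (induction p arbitrary: u) auto
qed

lemma ginzburg_awlast_Orig:
  "pre_digraph.awlast (ginzburg_quiver Q) u (map Orig p) = awlast u p"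
  by (cases p rule: rev_cases) (simp_all add: pre_digraph.awalk_verts_conv)

lemma incl_ginzburg_Orig [simp]: "incl_ginzburg f (u, map Orig p) = f (u, p)"
  by (auto simp: incl_ginzburg_def comp_def)

lemma incl_ginzburg_nonzero:
  assumes "incl_ginzburg f (u, p) \<noteq> 0"
  obtains q where "p = map Orig q" "f (u, q) \<noteq> 0"
proof -
  have "set p \<subseteq> range Orig" using assms by (auto simp: incl_ginzburg_def split: if_splits)
  then have "p = map Orig (map orig p)" by (induction p) auto
  with assms show thesis using that by (metis incl_ginzburg_Orig)
qed

lemma supported_incl_ginzburg:
  "supported Q f \<Longrightarrow> supported (ginzburg_quiver Q) (incl_ginzburg f)"
  unfolding supported_def using ginzburg_paths_Orig by (auto elim!: incl_ginzburg_nonzero)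

lemma path_degree_Orig: "path_degree ginzburg_degree (u, map Orig q) = 0"
  by (induction q) (simp_all add: path_degree_def)

lemma pmul_arrow_left:
  "pmul Q (arrow_elt Q c) g (u, []) = 0"
  "pmul Q (arrow_elt Q c) g (u, q @ [c']) = (if c' = c \<and> awlast u q = tail Q c then g (u, q) else 0)"
proof -
  show "pmul Q (arrow_elt Q c) g (u, []) = 0"
    by (simp add: pmul_Nil arrow_elt_def path_elt_def)
  have "pmul Q (arrow_elt Q c) g (u, q @ [c']) = (\<Sum>l\<le>length (q @ [c']).
      if l = length q then (if c' = c \<and> awlast u q = tail Q c then g (u, q) else 0) else 0)"
    unfolding pmul_def prod.case
  proof (intro sum.cong[OF refl])
    fix l assume "l \<in> {..length (q @ [c'])}"
    then consider "l < length q" | "l = length q" | "l = Suc (length q)" by fastforce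
    then show "arrow_elt Q c (awlast u (take l (q @ [c'])), drop l (q @ [c'])) * g (u, take l (q @ [c'])) =
      (if l = length q then if c' = c \<and> awlast u q = tail Q c then g (u, q) else 0 else 0)"
      by cases (auto simp: arrow_elt_def path_elt_def append_eq_Cons_conv)
  qed
  then show "pmul Q (arrow_elt Q c) g (u, q @ [c']) = (if c' = c \<and> awlast u q = tail Q c then g (u, q) else 0)"
    by (simp add: sum.delta del: sum.atMost_Suc)
qed

lemma pmul_arrows:
  assumes "head Q c = tail Q b"
  shows "pmul Q (arrow_elt Q b) (arrow_elt Q c) (u, p) = of_bool (u = tail Q c \<and> p = [c, b])"
  by (cases p) (use assms in \<open>simp_all add: pmul_arrow_right, auto simp: arrow_elt_def path_elt_def\<close>)

end

context potential begin

sublocale G: quiver "ginzburg_quiver Q" by (rule quiver_ginzburg)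

lemma supported_cyclic_derivative: "\<alpha> \<in> arcs Q \<Longrightarrow> supported Q (cyclic_derivative Q \<alpha> S)"
  by (auto simp: supported_def cyclic_derivative_def quiver_paths_def)

sublocale G: derivation_data "ginzburg_quiver Q" ginzburg_degree "ginzburg_values Q S"
proof unfold_locales
  fix b assume b: "b \<in> arcs (ginzburg_quiver Q)"
  show "supported (ginzburg_quiver Q) (ginzburg_values Q S b)"
  proof (cases b)
    case (Loop i)
    then have "i \<in> verts Q" using b by auto
    then have "(u, p) \<in> quiver_paths (ginzburg_quiver Q)" if "loop_differential Q i (u, p) \<noteq> (0::'k)" for u p
      using that by (auto elim!: loop_differential_nonzero)
    then show ?thesis by (simp add: Loop supported_def)
  qed (use b in \<open>auto simp: supported_incl_ginzburg supported_cyclic_derivative\<close>)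
  fix u p assume nz: "ginzburg_values Q S b (u, p) \<noteq> 0"
  show "u = tail (ginzburg_quiver Q) b \<and>
    pre_digraph.awlast (ginzburg_quiver Q) u p = head (ginzburg_quiver Q) b"
  proof (cases b)
    case (Orig a) then show ?thesis using nz by simp
  next
    case (Dual a)
    with nz obtain q where q: "p = map Orig q" "cyclic_derivative Q a S (u, q) \<noteq> 0"
      by (auto elim: incl_ginzburg_nonzero)
    then have "u = head Q a" "awalk u q (tail Q a)" by (auto simp: cyclic_derivative_def split: if_splits)
    then show ?thesis using q(1) by (auto simp: Dual ginzburg_awlast_Orig)
  next
    case (Loop i)
    then show ?thesis using nz
      by (auto elim!: loop_differential_nonzero simp: pre_digraph.awalk_verts.simps)
  qed
next
  fix b x assume b: "b \<in> arcs (ginzburg_quiver Q)" and nz: "ginzburg_values Q S b x \<noteq> 0"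
  show "path_degree ginzburg_degree x = ginzburg_degree b + 1"
  proof (cases b)
    case (Orig a) then show ?thesis using nz by simp
  next
    case (Dual a)
    then show ?thesis using nz
      by (cases x) (auto elim!: incl_ginzburg_nonzero simp: path_degree_Orig)
  next
    case (Loop i)
    then show ?thesis using nz
      by (cases x) (auto elim!: loop_differential_nonzero simp: path_degree_def)
  qed
qed

end

lemma potentialI: "quiver_with_potential Q S \<Longrightarrow> potential Q S"
  by (simp add: quiver_with_potential_def potential_def quiver_def potential_axioms_def)

section \<open>Existence and uniqueness of the Ginzburg differential\<close>

context potential begin

abbreviation "GQ \<equiv> ginzburg_quiver Q"
abbreviation "gdiff \<equiv> der GQ ginzburg_degree (ginzburg_values Q S)"

lemma ginzburg_path_degree_le: "path_degree ginzburg_degree (x :: ('u, ('w, 'c) ginzburg_arrow) path) \<le> 0"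
proof -
  have "ginzburg_degree b \<le> 0" for b :: "('w, 'c) ginzburg_arrow" by (cases b) auto
  then have "sum_list (map ginzburg_degree p) \<le> 0" for p :: "('w, 'c) ginzburg_arrow list"
    by (induction p) (auto simp: add_nonpos_nonpos)
  then show ?thesis by (simp add: path_degree_def)
qed

text \<open>All arrows of the Ginzburg quiver have degree at most \<open>0\<close>. A graded
  differential therefore kills degree \<open>0\<close>, in particular the idempotents and the cyclic
  derivatives.\<close>

lemma grade_positive:
  assumes "f \<in> grade (ginzburg_graded Q) n" "n > 0" shows "f = (\<lambda>x. 0)"
  using assms ginzburg_path_degree_le unfolding G.grade_path_algebra
  by (metis ext leD)

lemma gdiff_grade_0: "f \<in> grade (ginzburg_graded Q) 0 \<Longrightarrow> gdiff f = (\<lambda>x. 0)"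
  using G.der_grade[of f 0] by (intro grade_positive[of _ 1]) simp_all

lemma incl_grade_0: "supported Q f \<Longrightarrow> incl_ginzburg f \<in> grade (ginzburg_graded Q) 0"
  by (auto simp: G.grade_path_algebra supported_incl_ginzburg path_degree_Orig elim!: incl_ginzburg_nonzero)

lemma loop_differential_eq:
  "loop_differential Q i x = (\<Sum>a\<in>arcs Q.
     of_bool (head Q a = i) * pmul GQ (arrow_elt GQ (Orig a)) (arrow_elt GQ (Dual a)) x
     - of_bool (tail Q a = i) * pmul GQ (arrow_elt GQ (Dual a)) (arrow_elt GQ (Orig a)) x)"
  by (cases x) (auto simp: loop_differential_def G.pmul_arrows intro!: sum.cong)

text \<open>This reads off, at one path, the component at \<open>i\<close> of the sum of the
  products of \<alpha> with the cyclic derivative at \<alpha>. Moving the last arrow to the front is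
  a rotation, which does not change the symmetrised coefficient; \<open>loop_image_right\<close>
  arrives at the same coefficient.\<close>

lemma loop_image_left:
  "(\<Sum>a\<in>arcs Q. of_bool (head Q a = i) *
      pmul GQ (arrow_elt GQ (Orig a)) (incl_ginzburg (cyclic_derivative Q a S)) (u, p)) =
   (if set p \<subseteq> range Orig \<and> p \<noteq> [] \<and> u = i \<and> u = head Q (orig (last p))
    then cyclic_sum Q S (map orig p) else 0)"
proof (cases p rule: rev_cases)
  case Nil
  then show ?thesis by (simp add: G.pmul_arrow_left cyclic_sum_def)
next
  case (snoc q c')
  show ?thesis
  proof (cases "set p \<subseteq> range Orig")
    case True
    then obtain r c where q: "q = map Orig r" and c': "c' = Orig c"
      unfolding snoc using ex_map_conv[of q Orig] by auto
    have "(\<Sum>a\<in>arcs Q. of_bool (head Q a = i) *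
        pmul GQ (arrow_elt GQ (Orig a)) (incl_ginzburg (cyclic_derivative Q a S)) (u, p)) =
      (\<Sum>a\<in>arcs Q. if a = c then (if u = i \<and> u = head Q c then cyclic_sum Q S (r @ [c]) else 0) else 0)"
    proof (intro sum.cong[OF refl])
      fix a assume a: "a \<in> arcs Q"
      have *: "cyclic_sum Q S (a # r) \<noteq> 0 \<Longrightarrow> u = head Q a \<Longrightarrow> awlast u r = tail Q a"
        using cyclic_sum_nonzero[of "a # r"] by (auto simp: cycles_Cons)
      show "of_bool (head Q a = i) *
          pmul GQ (arrow_elt GQ (Orig a)) (incl_ginzburg (cyclic_derivative Q a S)) (u, p) =
        (if a = c then (if u = i \<and> u = head Q c then cyclic_sum Q S (r @ [c]) else 0) else 0)"
        using * a cyclic_sum_nonzero[of "a # r"]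
        by (auto simp: snoc q c' G.pmul_arrow_left ginzburg_awlast_Orig cyclic_derivative_eq cyclic_sum_snoc
            cycles_Cons)
    qed
    also have "\<dots> = (if u = i \<and> u = head Q c then cyclic_sum Q S (r @ [c]) else 0)"
      using cyclic_sum_nonzero[of "c # r"] by (auto simp: sum.delta cyclic_sum_snoc cycles_Cons)
    finally show ?thesis using True unfolding snoc q c' by (auto simp: comp_def)
  next
    case False
    have "pmul GQ (arrow_elt GQ (Orig a)) (incl_ginzburg (cyclic_derivative Q a S)) (u, p) = 0" for a
      using False by (auto simp: snoc G.pmul_arrow_left incl_ginzburg_def)
    with False show ?thesis by auto
  qed
qed

lemma loop_image_right:
  "(\<Sum>a\<in>arcs Q. of_bool (tail Q a = i) *
      pmul GQ (incl_ginzburg (cyclic_derivative Q a S)) (arrow_elt GQ (Orig a)) (u, p)) =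
   (if set p \<subseteq> range Orig \<and> p \<noteq> [] \<and> u = i \<and> u = tail Q (orig (hd p))
    then cyclic_sum Q S (map orig p) else 0)"
proof (cases p)
  case Nil
  then show ?thesis by (simp add: G.pmul_arrow_right)
next
  case (Cons c' q)
  show ?thesis
  proof (cases "set p \<subseteq> range Orig")
    case True
    then obtain r c where q: "q = map Orig r" and c': "c' = Orig c"
      unfolding Cons using ex_map_conv[of q Orig] by auto
    have "(\<Sum>a\<in>arcs Q. of_bool (tail Q a = i) *
        pmul GQ (incl_ginzburg (cyclic_derivative Q a S)) (arrow_elt GQ (Orig a)) (u, p)) =
      (\<Sum>a\<in>arcs Q. if a = c then (if u = i \<and> u = tail Q c then cyclic_sum Q S (c # r) else 0) else 0)"
      by (intro sum.cong[OF refl])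
        (auto simp: Cons q c' G.pmul_arrow_right cyclic_derivative_eq)
    also have "\<dots> = (if u = i \<and> u = tail Q c then cyclic_sum Q S (c # r) else 0)"
      using cyclic_sum_nonzero[of "c # r"] by (auto simp: sum.delta cycles_Cons)
    finally show ?thesis using True unfolding Cons q c' by (auto simp: comp_def)
  next
    case False
    have "pmul GQ (incl_ginzburg (cyclic_derivative Q a S)) (arrow_elt GQ (Orig a)) (u, p) = 0" for a
      using False by (auto simp: Cons G.pmul_arrow_right incl_ginzburg_def)
    with False show ?thesis by auto
  qed
qed

text \<open>Original arrows have degree \<open>0\<close>, so no sign appears, and the claim becomes
  that the products of the arrows with their cyclic derivatives have the same sum at
  \<open>i\<close> in both orders.\<close>

lemma gdiff_loop:
  assumes i: "i \<in> verts Q"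
  shows "gdiff (loop_differential Q i) = (\<lambda>x. 0)"
proof (rule path_ext)
  fix u p
  let ?I = "\<lambda>a. incl_ginzburg (cyclic_derivative Q a S)"
  let ?O = "\<lambda>a. arrow_elt GQ (Orig a)" and ?D = "\<lambda>a. arrow_elt GQ (Dual a)"
  have sgO: "sign_twist ginzburg_degree (?O a) = ?O a" for a
    by (auto simp: sign_twist_def arrow_elt_def path_elt_def path_degree_def intro!: ext)
  have OD: "gdiff (pmul GQ (?O a) (?D a)) = pmul GQ (?O a) (?I a)"
    and DO: "gdiff (pmul GQ (?D a) (?O a)) = pmul GQ (?I a) (?O a)" if "a \<in> arcs Q" for a
    using that by (simp_all add: G.der_pmul G.der_arrow sgO)
  have split: "loop_differential Q i = (\<lambda>x. \<Sum>a\<in>arcs Q.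
     (\<lambda>x. of_bool (head Q a = i) * pmul GQ (?O a) (?D a) x
       + (- of_bool (tail Q a = i)) * pmul GQ (?D a) (?O a) x) x)"
    by (simp add: loop_differential_eq fun_eq_iff)
  have "gdiff (loop_differential Q i) (u, p) =
    (\<Sum>a\<in>arcs Q. of_bool (head Q a = i) * pmul GQ (?O a) (?I a) (u, p)
      + (- of_bool (tail Q a = i)) * pmul GQ (?I a) (?O a) (u, p))"
    unfolding split
    by (subst G.der_sum)
      (simp_all only: finite_arcs G.der_add G.der_scale, intro sum.cong, simp_all add: OD DO)
  also have "\<dots> = (\<Sum>a\<in>arcs Q. of_bool (head Q a = i) * pmul GQ (?O a) (?I a) (u, p))
    - (\<Sum>a\<in>arcs Q. of_bool (tail Q a = i) * pmul GQ (?I a) (?O a) (u, p))"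
    by (simp add: sum_subtractf)
  also have "\<dots> = 0"
  proof -
    \<comment> \<open>One sum is restricted by the end of \<open>p\<close>, the other by its start.
      A nonzero symmetrised coefficient makes \<open>p\<close> a cycle, so the two restrictions
      coincide.\<close>
    have "tail Q (orig (hd p)) = head Q (orig (last p))" if "cyclic_sum Q S (map orig p) \<noteq> 0" "p \<noteq> []"
      using cycles_closed[OF cyclic_sum_nonzero[OF that(1)]] that(2) by (simp add: hd_map last_map)
    then show ?thesis unfolding loop_image_left loop_image_right by auto
  qed
  finally show "gdiff (loop_differential Q i) (u, p) = 0" .
qed

lemma gdiff_values: "b \<in> arcs GQ \<Longrightarrow> gdiff (ginzburg_values Q S b) = (\<lambda>x. 0)"
  by (cases b) (auto simp: gdiff_loop gdiff_grade_0 incl_grade_0 supported_cyclic_derivative)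

lemma loop_value:
  "i \<in> verts Q \<Longrightarrow> vertex_elt i \<otimes>\<^bsub>ginzburg_graded Q\<^esub>
     (\<Oplus>\<^bsub>ginzburg_graded Q\<^esub>\<alpha>\<in>arcs Q.
        arrow_elt GQ (Orig \<alpha>) \<otimes>\<^bsub>ginzburg_graded Q\<^esub> arrow_elt GQ (Dual \<alpha>)
        \<ominus>\<^bsub>ginzburg_graded Q\<^esub> arrow_elt GQ (Dual \<alpha>) \<otimes>\<^bsub>ginzburg_graded Q\<^esub> arrow_elt GQ (Orig \<alpha>))
     \<otimes>\<^bsub>ginzburg_graded Q\<^esub> vertex_elt i = (loop_differential Q i :: (_, _, 'k) pelt)"
proof -
  let ?A = "ginzburg_graded Q :: ('k, _) graded_alg"
  have arr: "arrow_elt GQ b \<in> carrier ?A" if "b \<in> arcs GQ" for b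
    using G.grade_arrow[OF that] G.grade_subset by blast
  have c: "pmul GQ (arrow_elt GQ (Orig a)) (arrow_elt GQ (Dual a)) \<in> carrier ?A"
    "pmul GQ (arrow_elt GQ (Dual a)) (arrow_elt GQ (Orig a)) \<in> carrier ?A" if "a \<in> arcs Q" for a
    using that by (auto intro!: G.carrier_pmul arr)
  have c': "(\<lambda>x. pmul GQ (arrow_elt GQ (Orig a)) (arrow_elt GQ (Dual a)) x
      - pmul GQ (arrow_elt GQ (Dual a)) (arrow_elt GQ (Orig a)) x) \<in> carrier ?A" if "a \<in> arcs Q" for a
    using G.carrier_add[OF c(1)[OF that] G.carrier_scale[OF c(2)[OF that], of "-1"]] by simp
  have m: "pmul GQ (arrow_elt GQ (Orig a)) (arrow_elt GQ (Dual a))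
      \<ominus>\<^bsub>?A\<^esub> pmul GQ (arrow_elt GQ (Dual a)) (arrow_elt GQ (Orig a)) =
    (\<lambda>x. pmul GQ (arrow_elt GQ (Orig a)) (arrow_elt GQ (Dual a)) x
      - pmul GQ (arrow_elt GQ (Dual a)) (arrow_elt GQ (Orig a)) x)" if "a \<in> arcs Q" for a
    by (rule G.path_minus[OF _ _ _ c[OF that]]) (simp_all add: G.path_algebra_simps)
  have "(\<Oplus>\<^bsub>?A\<^esub>\<alpha>\<in>arcs Q. pmul GQ (arrow_elt GQ (Orig \<alpha>)) (arrow_elt GQ (Dual \<alpha>))
        \<ominus>\<^bsub>?A\<^esub> pmul GQ (arrow_elt GQ (Dual \<alpha>)) (arrow_elt GQ (Orig \<alpha>))) =
    (\<lambda>x. \<Sum>a\<in>arcs Q. (pmul GQ (arrow_elt GQ (Orig a)) (arrow_elt GQ (Dual a))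
      \<ominus>\<^bsub>?A\<^esub> pmul GQ (arrow_elt GQ (Dual a)) (arrow_elt GQ (Orig a))) x)"
    by (rule G.path_finsum) (auto simp: G.path_algebra_simps m intro!: c')
  also have "\<dots> = (\<lambda>x. \<Sum>a\<in>arcs Q. pmul GQ (arrow_elt GQ (Orig a)) (arrow_elt GQ (Dual a)) x
      - pmul GQ (arrow_elt GQ (Dual a)) (arrow_elt GQ (Orig a)) x)"
    by (intro ext sum.cong) (simp_all add: m)
  finally show ?thesis
    unfolding G.path_algebra_simps
    by (intro path_ext) (auto simp: G.pmul_vertex_left G.pmul_vertex_right G.pmul_arrows
        loop_differential_def pre_digraph.awalk_verts.simps of_bool_def intro!: sum.cong sum.neutral)
qed

lemma is_ginzburg_differential_gdiff:
  "is_ginzburg_differential Q S (restrict gdiff (carrier (ginzburg_graded Q)))"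
proof -
  let ?A = "ginzburg_graded Q :: ('k, _) graded_alg"
  let ?d = "restrict gdiff (carrier ?A)"
  have sub: "f \<in> grade ?A n \<Longrightarrow> f \<in> carrier ?A" for f n using G.grade_subset by blast
  have arr: "arrow_elt GQ b \<in> carrier ?A" if "b \<in> arcs GQ" for b
    using sub[OF G.grade_arrow[OF that]] .
  have supp: "f \<in> carrier ?A \<Longrightarrow> supported GQ f" for f by (simp add: G.carrier_path_algebra)
  have "\<exists>N. \<forall>f\<in>grade ?A n. (\<forall>w. length (snd w) < N \<longrightarrow> f w = 0) \<longrightarrow>
      (\<forall>w. length (snd w) < M \<longrightarrow> ?d f w = 0)" for n M
  proof (intro exI[of _ "Suc M"] ballI impI allI)
    fix f and w :: "('v, ('v, 'a) ginzburg_arrow) path"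
    assume f: "f \<in> grade ?A n" "\<forall>w. length (snd w) < Suc M \<longrightarrow> f w = 0" "length (snd w) < M"
    have "gdiff f (fst w, snd w) = 0" by (rule G.der_short) (use f in auto)
    then show "?d f w = 0" using sub[OF f(1)] by simp
  qed
  moreover have "?d (f \<otimes>\<^bsub>?A\<^esub> g) = ?d f \<otimes>\<^bsub>?A\<^esub> g \<oplus>\<^bsub>?A\<^esub> ((-1) powi n) \<odot>\<^bsub>?A\<^esub> (f \<otimes>\<^bsub>?A\<^esub> ?d g)"
    if "f \<in> grade ?A n" "g \<in> carrier ?A" for f g n
    using that sub[OF that(1)] G.sign_twist_grade[OF that(1)]
    by (simp add: G.path_algebra_simps G.carrier_pmul G.der_pmul supp pmul_scale_left)
  ultimately show ?thesis
    unfolding is_ginzburg_differential_def Let_def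
    by (auto simp: G.path_algebra_simps G.carrier_add G.carrier_scale G.der_add G.der_scale
        G.der_grade sub arr G.der_arrow loop_value[unfolded G.path_algebra_simps])
qed

text \<open>The definition prescribes values on the arrows only; on the idempotents the differential
  vanishes for reasons of degree. Then \<open>der_unique\<close> applies.\<close>

lemma ginzburg_differential_unique:
  assumes "is_ginzburg_differential Q S d"
  shows "d = restrict gdiff (carrier (ginzburg_graded Q))"
proof (rule extensionalityI)
  let ?A = "ginzburg_graded Q :: ('k, _) graded_alg"
  note d = assms[unfolded is_ginzburg_differential_def Let_def]
  show "d \<in> extensional (carrier ?A)" using d by blast
  fix f assume f: "f \<in> carrier ?A"
  have sub: "f \<in> grade ?A n \<Longrightarrow> f \<in> carrier ?A" for f n using G.grade_subset by blast
  have arr: "arrow_elt GQ b \<in> carrier ?A" if "b \<in> arcs GQ" for b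
    using sub[OF G.grade_arrow[OF that]] .
  have add: "d (\<lambda>x. f x + g x) = (\<lambda>x. d f x + d g x)" if "f \<in> carrier ?A" "g \<in> carrier ?A" for f g
    using d that by (simp add: G.path_algebra_simps)
  have scale: "d (\<lambda>x. a * f x) = (\<lambda>x. a * d f x)" if "f \<in> carrier ?A" for a f
    using d that by (simp add: G.path_algebra_simps)
  have grade: "d f \<in> grade ?A (n + 1)" if "f \<in> grade ?A n" for f n
    using d that by blast
  have zero: "d f = (\<lambda>x. 0)" if "f \<in> grade ?A 0" for f
    using grade[OF that] by (intro grade_positive[of _ 1]) simp_all
  have mult: "d (pmul GQ f g) = (\<lambda>x. pmul GQ (d f) g x + (-1) powi n * pmul GQ f (d g) x)"
    if "f \<in> grade ?A n" "g \<in> carrier ?A" for f g n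
    using d that by (simp add: G.path_algebra_simps)
  have vals: "d (arrow_elt GQ b) = ginzburg_values Q S b" if "b \<in> arcs GQ" for b
  proof (cases b)
    case (Orig a)
    then show ?thesis using d that by (auto simp: G.path_algebra_simps)
  next
    case (Dual a)
    then show ?thesis using d that by auto
  next
    case (Loop i)
    then have "i \<in> verts Q" using that by auto
    with d have "d (arrow_elt GQ (Loop i)) = loop_differential Q i"
      by (subst loop_value[symmetric]) auto
    then show ?thesis by (simp add: Loop)
  qed
  have "d f = gdiff f"
    by (rule G.der_unique[OF add scale _ _ f])
      (simp_all only: zero G.grade_vertex mult arr vals)
  then show "d f = restrict gdiff (carrier ?A) f" using f by simp
qed auto

lemma diff_ginzburg:
  "f \<in> carrier (ginzburg_graded Q) \<Longrightarrow> diff (ginzburg_dg_algebra Q S) f = gdiff f"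
proof -
  assume f: "f \<in> carrier (ginzburg_graded Q)"
  have "(THE d. is_ginzburg_differential Q S d) = restrict gdiff (carrier (ginzburg_graded Q))"
    by (intro the_equality is_ginzburg_differential_gdiff ginzburg_differential_unique)
  with f show ?thesis by (simp add: ginzburg_dg_algebra_def graded_extend_simps)
qed

lemma ginzburg_simps:
  "carrier (ginzburg_dg_algebra Q S) = carrier (ginzburg_graded Q)"
  "monoid.mult (ginzburg_dg_algebra Q S) = pmul GQ"
  "one (ginzburg_dg_algebra Q S) = pone GQ"
  "ring.zero (ginzburg_dg_algebra Q S) = (\<lambda>x. 0)"
  "add (ginzburg_dg_algebra Q S) = (\<lambda>f g x. f x + g x)"
  "module.smult (ginzburg_dg_algebra Q S) = (\<lambda>c f x. c * f x)"
  "grade (ginzburg_dg_algebra Q S) = grade (ginzburg_graded Q)"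
  by (simp_all add: ginzburg_dg_algebra_def graded_extend_simps G.path_algebra_simps)

lemma dg_algebra_ginzburg: "dg_algebra (ginzburg_dg_algebra Q S)"
proof -
  have "(THE d. is_ginzburg_differential Q S d) f = gdiff f"
    if "f \<in> carrier (ginzburg_graded Q)" for f
    using diff_ginzburg[OF that] by (simp add: ginzburg_dg_algebra_def graded_extend_simps)
  then show ?thesis
    unfolding ginzburg_dg_algebra_def by (intro G.path_dg_algebra gdiff_values)
qed

end

section \<open>Involutions of quivers\<close>

context quiver begin

text \<open>For a single cycle \<open>p\<close> the symmetrised coefficient at \<open>w\<close>
  counts the rotations of \<open>w\<close> equal to \<open>p\<close>. Rotating \<open>p\<close>
  shifts the index of this count.\<close>

lemma cyclic_sum_path_elt:
  assumes "v \<in> cycles Q"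
  shows "cyclic_sum Q (path_elt (rotate_cycle Q v)) w = (cyclic_sum Q (path_elt v) w :: 'k::field)"
proof -
  obtain u p where v: "v = (u, p)" by (cases v)
  have u: "u = tail Q (hd p)" and p: "(tail Q (hd p), p) \<in> cycles Q"
    using assms cycles_start unfolding v by blast+
  then have "p \<noteq> []" by (auto simp: cycles_def)
  then have rot: "rotate_cycle Q v = (head Q (hd p), rotate1 p)"
    by (cases p) (simp_all add: v rotate_cycle_def)
  have "head Q (hd p) = tail Q (hd (rotate1 p))"
    using cycles_closed[OF cycles_rotate1[OF p]] \<open>p \<noteq> []\<close> by (cases p) auto
  then have "path_elt (rotate_cycle Q v) (tail Q (hd w'), w') = (of_bool (w' = rotate1 p) :: 'k)"
    and "path_elt v (tail Q (hd w'), w') = (of_bool (w' = p) :: 'k)" for w'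
    unfolding rot by (auto simp: path_elt_def v u)
  then show ?thesis
    using sum_rotate_shift[of "\<lambda>w'. of_bool (w' = rotate1 p) :: 'k" w]
    by (simp add: cyclic_sum_def inj_eq[OF inj_rotate1])
qed

text \<open>All rotations of \<open>w\<close> have the length of \<open>w\<close>, so the finite
  approximation of the difference up to that length suffices, and each of its terms has zero
  symmetrised coefficient.\<close>

lemma cyclically_equivalent_cyclic_sum:
  assumes "cyclically_equivalent Q S T" shows "cyclic_sum Q S w = cyclic_sum Q T w"
proof -
  obtain F c where F: "F \<subseteq> cycles Q" and eq: "\<And>x. length (snd x) < Suc (length w) \<Longrightarrow>
      S x - T x = (\<Sum>v\<in>F. c v * (path_elt v x - path_elt (rotate_cycle Q v) x))"
    using assms unfolding cyclically_equivalent_def by meson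
  have "cyclic_sum Q S w - cyclic_sum Q T w =
    (\<Sum>l<length w. \<Sum>v\<in>F. c v * (path_elt v (tail Q (hd (rotate l w)), rotate l w)
      - path_elt (rotate_cycle Q v) (tail Q (hd (rotate l w)), rotate l w)))"
    by (simp add: cyclic_sum_def sum_subtractf[symmetric] eq)
  also have "\<dots> = (\<Sum>v\<in>F. c v * (cyclic_sum Q (path_elt v) w - cyclic_sum Q (path_elt (rotate_cycle Q v)) w))"
    by (subst sum.swap) (simp add: cyclic_sum_def sum_distrib_left sum_subtractf right_diff_distrib)
  also have "\<dots> = 0"
    using F by (intro sum.neutral) (auto simp: cyclic_sum_path_elt subset_iff)
  finally show ?thesis by simp
qed

end

text \<open>This is \<open>path_action\<close> at \<sigma>, which is its own inverse. The
  restriction to paths makes the result supported, whatever \<tau> and \<rho> do outside the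
  quiver.\<close>

definition pact :: "('v, 'b) pre_digraph \<Rightarrow> ('v \<Rightarrow> 'v) \<Rightarrow> ('b \<Rightarrow> 'b) \<Rightarrow>
    ('v, 'b, 'k::field) pelt \<Rightarrow> ('v, 'b, 'k) pelt" where
  "pact Q \<tau> \<rho> f = (\<lambda>(u, p). if (u, p) \<in> quiver_paths Q then f (\<tau> u, map \<rho> p) else 0)"

locale quiver_involution = quiver Q for Q :: "('v, 'b) pre_digraph" +
  fixes \<tau> :: "'v \<Rightarrow> 'v" and \<rho> :: "'b \<Rightarrow> 'b"
  assumes tau_verts [simp]: "u \<in> verts Q \<Longrightarrow> \<tau> u \<in> verts Q"
    and tau_tau [simp]: "u \<in> verts Q \<Longrightarrow> \<tau> (\<tau> u) = u"
    and rho_arcs [simp]: "c \<in> arcs Q \<Longrightarrow> \<rho> c \<in> arcs Q"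
    and rho_rho [simp]: "c \<in> arcs Q \<Longrightarrow> \<rho> (\<rho> c) = c"
    and tail_rho [simp]: "c \<in> arcs Q \<Longrightarrow> tail Q (\<rho> c) = \<tau> (tail Q c)"
    and head_rho [simp]: "c \<in> arcs Q \<Longrightarrow> head Q (\<rho> c) = \<tau> (head Q c)"
begin

abbreviation "act \<equiv> pact Q \<tau> \<rho>"

lemma tau_eq_iff: "u \<in> verts Q \<Longrightarrow> v \<in> verts Q \<Longrightarrow> \<tau> u = v \<longleftrightarrow> u = \<tau> v"
  by auto

lemma tau_inj: "u \<in> verts Q \<Longrightarrow> v \<in> verts Q \<Longrightarrow> \<tau> u = \<tau> v \<longleftrightarrow> u = v"
  by (metis tau_tau)

lemma rho_inj: "c \<in> arcs Q \<Longrightarrow> c' \<in> arcs Q \<Longrightarrow> \<rho> c = \<rho> c' \<longleftrightarrow> c = c'"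
  by (metis rho_rho)

lemma sum_rho: "(\<Sum>c\<in>arcs Q. h (\<rho> c)) = (\<Sum>c\<in>arcs Q. h c)"
  by (rule sum.reindex_bij_witness[of _ \<rho> \<rho>]) auto

lemma paths_map: "(u, p) \<in> quiver_paths Q \<Longrightarrow> (\<tau> u, map \<rho> p) \<in> quiver_paths Q"
  by (induction p arbitrary: u) auto

lemma map_rho_rho: "set p \<subseteq> arcs Q \<Longrightarrow> map \<rho> (map \<rho> p) = p"
  by (induction p) auto

lemma paths_arcs: "(u, p) \<in> quiver_paths Q \<Longrightarrow> set p \<subseteq> arcs Q"
  by (induction p arbitrary: u) auto

lemma awlast_map: "(u, p) \<in> quiver_paths Q \<Longrightarrow> awlast (\<tau> u) (map \<rho> p) = \<tau> (awlast u p)"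
  by (induction p arbitrary: u) auto

lemma act_path: "(u, p) \<in> quiver_paths Q \<Longrightarrow> act f (u, p) = f (\<tau> u, map \<rho> p)"
  by (simp add: pact_def)

lemma supported_act [simp]: "supported Q (act f)"
  by (auto simp: supported_def pact_def)

lemma supported_eqI:
  assumes "supported Q f" "supported Q g" "\<And>u p. (u, p) \<in> quiver_paths Q \<Longrightarrow> f (u, p) = g (u, p)"
  shows "f = g"
  using assms unfolding supported_def by (metis path_ext)

lemma act_act: "supported Q f \<Longrightarrow> act (act f) = f"
  by (rule supported_eqI) (simp_all add: act_path paths_map paths_start map_rho_rho[OF paths_arcs] del: map_map)

lemma act_zero [simp]: "act (\<lambda>x. 0) = (\<lambda>x. 0)"
  by (auto simp: pact_def intro!: ext)

lemma act_add: "act (\<lambda>x. f x + g x) = (\<lambda>x. act f x + act g x)"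
  by (auto simp: pact_def intro!: ext)

lemma act_scale: "act (\<lambda>x. a * f x) = (\<lambda>x. a * act f x)"
  by (auto simp: pact_def intro!: ext)

lemma act_sum: "act (\<lambda>x. \<Sum>i\<in>I. f i x) = (\<lambda>x. \<Sum>i\<in>I. act (f i) x)"
  by (auto simp: pact_def intro!: ext)

lemma act_pone [simp]: "act (pone Q) = pone Q"
  by (rule supported_eqI, simp, simp, auto simp: act_path pone_def dest: paths_start)

lemma act_vertex: "i \<in> verts Q \<Longrightarrow> act (path_elt (i, [])) = path_elt (\<tau> i, [])"
  by (rule supported_eqI, simp, simp, auto simp: act_path path_elt_def tau_eq_iff dest: paths_start)

lemma act_arrow: "c \<in> arcs Q \<Longrightarrow> act (arrow_elt Q c) = arrow_elt Q (\<rho> c)"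
proof (rule supported_eqI)
  fix u p assume "c \<in> arcs Q" and "(u, p) \<in> quiver_paths Q"
  then show "act (arrow_elt Q c) (u, p) = arrow_elt Q (\<rho> c) (u, p)"
    by (cases p) (auto simp: act_path path_elt_def arrow_elt_def)
qed simp_all

lemma residual_act:
  assumes "supported Q f" "c \<in> arcs Q"
  shows "residual Q c (act f) = act (residual Q (\<rho> c) f)"
proof (rule supported_eqI)
  fix u p assume "(u, p) \<in> quiver_paths Q"
  with assms show "residual Q c (act f) (u, p) = act (residual Q (\<rho> c) f) (u, p)"
    by (auto simp: act_path residual_def tau_inj paths_start)
qed (simp_all add: assms)

lemma act_pmul:
  assumes "supported Q f" "supported Q g"
  shows "act (pmul Q f g) = pmul Q (act f) (act g)"
proof (rule supported_eqI)
  fix u p assume "(u, p) \<in> quiver_paths Q"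
  then show "act (pmul Q f g) (u, p) = pmul Q (act f) (act g) (u, p)"
    using assms(2)
  proof (induction p arbitrary: u g)
    case Nil
    then show ?case by (simp add: act_path pmul_Nil)
  next
    case (Cons c q)
    then have c: "c \<in> arcs Q" "u = tail Q c" "(head Q c, q) \<in> quiver_paths Q" by auto
    have "act (pmul Q f (residual Q (\<rho> c) g)) (head Q c, q) =
      pmul Q (act f) (act (residual Q (\<rho> c) g)) (head Q c, q)"
      using Cons.prems by (intro Cons.IH c(3)) simp
    with c Cons.prems assms show ?case
      by (simp add: act_path pmul_Cons residual_act)
  qed
qed (simp_all add: assms)

end

locale weighted_involution = quiver_involution Q \<tau> \<rho>
  for Q :: "('v, 'b) pre_digraph" and \<tau> \<rho> +
  fixes wt :: "'b \<Rightarrow> int"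
  assumes wt_rho: "c \<in> arcs Q \<Longrightarrow> wt (\<rho> c) = wt c"
begin

lemma path_degree_map: "(u, p) \<in> quiver_paths Q \<Longrightarrow> path_degree wt (\<tau> u, map \<rho> p) = path_degree wt (u, p)"
  by (induction p arbitrary: u) (auto simp: path_degree_def wt_rho)

lemma sign_twist_act: "sign_twist wt (act f) = act (sign_twist wt f)"
  by (rule supported_eqI, simp add: supported_sign_twist, simp)
    (simp add: sign_twist_def act_path path_degree_map)

lemma act_grade: "f \<in> grade (path_algebra Q wt) n \<Longrightarrow> act f \<in> grade (path_algebra Q wt) n"
proof -
  assume f: "f \<in> grade (path_algebra Q wt) n"
  have "path_degree wt (u, p) = n" if "act f (u, p) \<noteq> 0" for u p
  proof -
    from that have "(u, p) \<in> quiver_paths Q" "f (\<tau> u, map \<rho> p) \<noteq> 0"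
      by (auto simp: pact_def split: if_splits)
    with f show ?thesis unfolding grade_path_algebra by (metis path_degree_map)
  qed
  then show ?thesis by (auto simp: grade_path_algebra)
qed

lemma act_carrier: "f \<in> carrier (path_algebra Q wt) \<Longrightarrow> act f \<in> carrier (path_algebra Q wt)"
proof -
  assume f: "f \<in> carrier (path_algebra Q wt)"
  have "path_degree wt ` {x. act f x \<noteq> 0} \<subseteq> path_degree wt ` {x. f x \<noteq> 0}"
  proof clarify
    fix u p assume "act f (u, p) \<noteq> 0"
    then have "(u, p) \<in> quiver_paths Q" "f (\<tau> u, map \<rho> p) \<noteq> 0"
      by (auto simp: pact_def split: if_splits)
    then show "path_degree wt (u, p) \<in> path_degree wt ` {x. f x \<noteq> 0}"
      by (metis (mono_tags) image_eqI mem_Collect_eq path_degree_map)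
  qed
  with f show ?thesis by (auto simp: carrier_path_algebra intro: finite_subset)
qed

end

locale graded_involution = weighted_involution Q \<tau> \<rho> wt + derivation_data Q wt D
  for Q :: "('v, 'b) pre_digraph" and \<tau> \<rho> and wt :: "'b \<Rightarrow> int"
    and D :: "'b \<Rightarrow> ('v, 'b, 'k::field) pelt" +
  assumes D_rho: "c \<in> arcs Q \<Longrightarrow> act (D (\<rho> c)) = D c"
begin

lemma dpart_act: assumes "supported Q f" shows "dp (act f) = act (dp f)"
proof -
  have "dp (act f) = (\<lambda>x. \<Sum>b\<in>arcs Q. act (pmul Q (sg (residual Q (\<rho> b) f)) (D (\<rho> b))) x)"
    unfolding dpart_def using assms
    by (intro ext sum.cong)
      (simp_all add: residual_act sign_twist_act act_pmul supported_sign_twist D_supported D_rho)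
  also have "\<dots> = (\<lambda>x. \<Sum>b\<in>arcs Q. act (pmul Q (sg (residual Q b f)) (D b)) x)"
    by (intro ext sum_rho)
  finally show ?thesis unfolding dpart_def act_sum .
qed

text \<open>Equivariance on the arrows suffices: the involution exchanges the residuals at
  \<open>c\<close> and at \<open>\<rho> c\<close>, and the sums over all arrows absorb this
  reindexing.\<close>

lemma der_act:
  assumes "supported Q f" shows "dd (act f) = act (dd f)"
proof (rule supported_eqI)
  fix u p assume "(u, p) \<in> quiver_paths Q"
  then show "dd (act f) (u, p) = act (dd f) (u, p)"
    using assms
  proof (induction p arbitrary: u f)
    case Nil
    then show ?case by (simp add: der_Nil dpart_act act_path)
  next
    case (Cons c q)
    then have c: "c \<in> arcs Q" "u = tail Q c" "(head Q c, q) \<in> quiver_paths Q" by auto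
    have "dd (act (residual Q (\<rho> c) f)) (head Q c, q) = act (dd (residual Q (\<rho> c) f)) (head Q c, q)"
      using Cons.prems by (intro Cons.IH c(3)) simp
    with c Cons.prems show ?case
      by (simp add: der_Cons dpart_act residual_act act_path)
  qed
qed (simp_all add: assms)

end

text \<open>Invariance is assumed for the symmetrised coefficients, which is all that cyclic
  equivalence of \<open>S\<close> with its image provides. They determine the cyclic derivatives and
  hence the differential.\<close>

locale invariant_potential = quiver_involution Q \<tau> \<rho> + potential Q S
  for Q :: "('v, 'a) pre_digraph" and \<tau> \<rho> and S :: "('v, 'a, 'k::field) pelt" +
  assumes cyclic_sum_map: "set w \<subseteq> arcs Q \<Longrightarrow> cyclic_sum Q S (map \<rho> w) = cyclic_sum Q S w"
begin

abbreviation "grho \<equiv> map_ginzburg_arrow \<tau> \<rho>"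

sublocale GI: quiver_involution GQ \<tau> grho
proof unfold_locales
  fix c assume c: "c \<in> arcs GQ"
  show "grho c \<in> arcs GQ" "grho (grho c) = c" "tail GQ (grho c) = \<tau> (tail GQ c)"
    "head GQ (grho c) = \<tau> (head GQ c)"
    using c by auto
qed auto

sublocale GI: graded_involution GQ \<tau> grho ginzburg_degree "ginzburg_values Q S"
proof unfold_locales
  fix c assume c: "c \<in> arcs GQ"
  show "ginzburg_degree (grho c) = ginzburg_degree c" by (cases c) auto
  show "GI.act (ginzburg_values Q S (grho c)) = ginzburg_values Q S c"
  proof (rule GI.supported_eqI)
    fix u p assume up: "(u, p) \<in> quiver_paths GQ"
    have u: "u \<in> verts Q" using G.paths_start[OF up] by simp
    have arcs: "set p \<subseteq> arcs GQ" using GI.paths_arcs[OF up] .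
    show "GI.act (ginzburg_values Q S (grho c)) (u, p) = ginzburg_values Q S c (u, p)"
    proof (cases c)
      case (Orig a)
      then show ?thesis by simp
    next
      case (Dual a)
      then have a: "a \<in> arcs Q" using c by auto
      show ?thesis
      proof (cases "set p \<subseteq> range Orig")
        case True
        then obtain q where q: "p = map Orig q" using ex_map_conv[of p Orig] by auto
        then have "set q \<subseteq> arcs Q" using arcs by auto
        \<comment> \<open>Here the invariance of the potential enters the equivariance of the
          differential; the values at the loops involve only the quiver.\<close>
        then have "cyclic_sum Q S (\<rho> a # map \<rho> q) = cyclic_sum Q S (a # q)"
          using cyclic_sum_map[of "a # q"] a by simp
        moreover have "map grho p = map Orig (map \<rho> q)" by (simp add: q comp_def)
        moreover have "\<tau> u = \<tau> (head Q a) \<longleftrightarrow> u = head Q a" using a u by (simp add: tau_inj)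
        moreover have "cyclic_derivative Q (\<rho> a) S (\<tau> u, map \<rho> q) =
          (if \<tau> u = \<tau> (head Q a) then cyclic_sum Q S (\<rho> a # map \<rho> q) else 0)"
          using cyclic_derivative_eq[OF rho_arcs[OF a]] a by simp
        ultimately have "cyclic_derivative Q (\<rho> a) S (\<tau> u, map \<rho> q) = cyclic_derivative Q a S (u, q)"
          using cyclic_derivative_eq[OF a] by (simp only:)
        then show ?thesis
          unfolding Dual ginzburg_values.simps ginzburg_arrow.map GI.act_path[OF up]
            \<open>map grho p = map Orig (map \<rho> q)\<close>
          by (simp only: q incl_ginzburg_Orig)
      next
        case False
        then have "\<not> set (map grho p) \<subseteq> range Orig"
        proof -
          from False obtain b where "b \<in> set p" "b \<notin> range Orig" by auto
          from this(2) have "grho b \<notin> range Orig" by (cases b) auto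
          moreover have "grho b \<in> set (map grho p)" using \<open>b \<in> set p\<close> by simp
          ultimately show ?thesis by blast
        qed
        with False up show ?thesis by (simp add: Dual GI.act_path incl_ginzburg_def)
      qed
    next
      case (Loop i)
      then have i: "i \<in> verts Q" using c by auto
      have inv: "map grho p = map grho r \<longleftrightarrow> p = r" if "set r \<subseteq> arcs GQ" for r
        using arg_cong[of "map grho p" "map grho r" "map grho"]
        unfolding GI.map_rho_rho[OF arcs] GI.map_rho_rho[OF that] by auto
      have "loop_differential Q (\<tau> i) (\<tau> u, map grho p) = (\<Sum>a\<in>arcs Q.
         of_bool (\<tau> u = \<tau> i \<and> head Q (\<rho> a) = \<tau> i \<and> map grho p = [Dual (\<rho> a), Orig (\<rho> a)])
         - of_bool (\<tau> u = \<tau> i \<and> tail Q (\<rho> a) = \<tau> i \<and> map grho p = [Orig (\<rho> a), Dual (\<rho> a)]))"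
        unfolding loop_differential_def prod.case by (rule sum_rho[symmetric])
      also have "\<dots> = loop_differential Q i (u, p)"
        unfolding loop_differential_def prod.case
      proof (intro sum.cong[OF refl])
        fix a assume a: "a \<in> arcs Q"
        show "of_bool (\<tau> u = \<tau> i \<and> head Q (\<rho> a) = \<tau> i \<and> map grho p = [Dual (\<rho> a), Orig (\<rho> a)])
         - of_bool (\<tau> u = \<tau> i \<and> tail Q (\<rho> a) = \<tau> i \<and> map grho p = [Orig (\<rho> a), Dual (\<rho> a)]) =
         of_bool (u = i \<and> head Q a = i \<and> p = [Dual a, Orig a])
         - of_bool (u = i \<and> tail Q a = i \<and> p = [Orig a, Dual a])"
        proof -
          have "\<tau> u = \<tau> i \<longleftrightarrow> u = i" "head Q (\<rho> a) = \<tau> i \<longleftrightarrow> head Q a = i"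
            "tail Q (\<rho> a) = \<tau> i \<longleftrightarrow> tail Q a = i"
            using a i u by (simp_all add: tau_inj)
          moreover have "map grho p = [Dual (\<rho> a), Orig (\<rho> a)] \<longleftrightarrow> p = [Dual a, Orig a]"
            "map grho p = [Orig (\<rho> a), Dual (\<rho> a)] \<longleftrightarrow> p = [Orig a, Dual a]"
            using inv[of "[Dual a, Orig a]"] inv[of "[Orig a, Dual a]"] a by simp_all
          ultimately show ?thesis by (simp only:)
        qed
      qed
      finally show ?thesis
        unfolding Loop ginzburg_values.simps ginzburg_arrow.map GI.act_path[OF up] .
    qed
  next
    show "supported GQ (GI.act (ginzburg_values Q S (grho c)))" by (rule GI.supported_act)
    show "supported GQ (ginzburg_values Q S c)" by (rule G.D_supported[OF c])
  qed
qed

end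

section \<open>The quiver of the skew group algebra\<close>

lemma signs_cases: "s \<in> {Plus, Minus}" by (cases s) auto

lemma sign_val_square [simp]: "sign_val s * sign_val s = (1::'k::field)"
  by (cases s) auto

lemma sign_val_square' [simp]: "sign_val s * (sign_val s * x) = (x::'k::field)"
  by (cases s) auto

abbreviation "signs \<equiv> {Plus, Minus}"

text \<open>\<open>\<pi> b\<close> is a representative of the orbit of arrows of \<open>R\<close> underlying the arrow \<open>b\<close> of \<open>T\<close>, and \<open>sv u s\<close>
  is the vertex of \<open>T\<close> over \<open>u\<close> with sign \<open>s\<close>. The locale is used both for the given quiver and for its
  Ginzburg quiver; the scalars \<open>\<kappa>\<close> rescale the arrows.\<close>

locale skew_cover = quiver_involution R \<tau> \<rho> + T: quiver T
  for R :: "('v, 'b) pre_digraph" and \<tau> \<rho> and T :: "('v \<times> sign, 'e) pre_digraph" +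
  fixes \<pi> :: "'e \<Rightarrow> 'b" and \<kappa> :: "'e \<Rightarrow> 'k::field" and sv :: "'v \<Rightarrow> sign \<Rightarrow> 'v \<times> sign"
  assumes two_neq_0: "(2::'k) \<noteq> 0"
    and kappa_neq_0: "b \<in> arcs T \<Longrightarrow> \<kappa> b \<noteq> 0"
    and sv_verts: "u \<in> verts R \<Longrightarrow> \<tau> u = u \<or> s = Plus \<Longrightarrow> sv u s \<in> verts T"
    and snd_sv: "u \<in> verts R \<Longrightarrow> \<tau> u = u \<or> s = Plus \<Longrightarrow> snd (sv u s) = s"
    and fst_sv: "u \<in> verts R \<Longrightarrow> \<tau> u = u \<or> s = Plus \<Longrightarrow> fst (sv u s) = u \<or> fst (sv u s) = \<tau> u"
    and sv_tau: "u \<in> verts R \<Longrightarrow> sv (\<tau> u) s = sv u s"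
    and verts_T: "x \<in> verts T \<Longrightarrow>
      fst x \<in> verts R \<and> (\<tau> (fst x) = fst x \<or> snd x = Plus) \<and> sv (fst x) (snd x) = x"
    and pi_arcs: "b \<in> arcs T \<Longrightarrow> \<pi> b \<in> arcs R"
    and tail_T: "b \<in> arcs T \<Longrightarrow> tail T b = sv (tail R (\<pi> b)) (snd (tail T b)) \<and>
      (\<tau> (tail R (\<pi> b)) = tail R (\<pi> b) \<or> snd (tail T b) = Plus)"
    and head_T: "b \<in> arcs T \<Longrightarrow> head T b = sv (head R (\<pi> b)) (snd (head T b)) \<and>
      (\<tau> (head R (\<pi> b)) = head R (\<pi> b) \<or> snd (head T b) = Plus)"
    and fixed_sign: "b \<in> arcs T \<Longrightarrow> \<rho> (\<pi> b) = \<pi> b \<Longrightarrow> snd (tail T b) = snd (head T b)"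
    and arrow_ex1: "c \<in> arcs R \<Longrightarrow> \<tau> (tail R c) = tail R c \<or> s = Plus \<Longrightarrow>
      \<tau> (head R c) = head R c \<or> r = Plus \<Longrightarrow> (\<rho> c = c \<Longrightarrow> s = r) \<Longrightarrow>
      \<exists>!b. b \<in> arcs T \<and> (\<pi> b = c \<or> \<pi> b = \<rho> c) \<and> snd (tail T b) = s \<and> snd (head T b) = r"
    and fixed_arrow: "c \<in> arcs R \<Longrightarrow> \<tau> (tail R c) = tail R c \<Longrightarrow> \<tau> (head R c) = head R c \<Longrightarrow> \<rho> c = c"
begin

section \<open>Orthogonality relations between coefficients and coordinates of arrows\<close>

abbreviation "s1 b \<equiv> snd (tail T b)"
abbreviation "s2 b \<equiv> snd (head T b)"

definition ok :: "'v \<Rightarrow> sign \<Rightarrow> bool" where "ok u s \<longleftrightarrow> \<tau> u = u \<or> s = Plus"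

definition chi :: "sign \<Rightarrow> sign \<Rightarrow> 'k" where "chi s t = sign_val s * sign_val t"

text \<open>The size of the orbit of \<open>u\<close>, and therefore the factor by which \<iota>'
  differs from \<iota>.\<close>

definition nu :: "'v \<Rightarrow> 'k" where "nu u = (if \<tau> u = u then 1 else 2)"

definition eps :: "'e \<Rightarrow> 'b \<Rightarrow> 'k" where
  "eps b c = of_bool (c = \<pi> b) + chi (s1 b) (s2 b) * of_bool (c = \<rho> (\<pi> b))"

text \<open>The normalisation that makes \<open>Lf\<close> dual to \<open>kf\<close>. For a moved
  arrow, both members of the orbit have a given head if that head is fixed, and only one if it is
  not, which explains \<open>nu\<close>. For a fixed arrow \<open>eps\<close> equals
  \<open>2\<close>, which explains the half.\<close>

definition cc :: "'e \<Rightarrow> 'k" where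
  "cc b = nu (head R (\<pi> b)) * (if \<rho> (\<pi> b) = \<pi> b then 1 / 2 else 1)"

text \<open>\<open>kf b\<close> gives the coefficients of the matrix of \<open>b\<close>, and \<open>Lf b\<close> the dual coordinates.\<close>

definition kf :: "'e \<Rightarrow> 'b \<Rightarrow> 'k" where "kf b c = \<kappa> b / 2 * eps b c"

definition Lf :: "'e \<Rightarrow> 'b \<Rightarrow> 'k" where "Lf b c = cc b / \<kappa> b * eps b c"

lemma chi_simps [simp]: "chi s s = 1" "chi s t * chi s t = 1" "chi s t * (chi s t * x) = x"
  "chi t r * chi r s = chi t s" "chi t r * (chi r s * x) = chi t s * x"
  by (cases s; cases t; cases r; simp add: chi_def)+

lemma chi_commute: "chi s t = chi t s" by (simp add: chi_def mult.commute)

lemma chi_neq_0: "chi s t \<noteq> 0"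
  using chi_simps(2) by (metis mult_zero_left zero_neq_one)

lemma minus_one_neq_one: "(-1::'k) \<noteq> 1"
  using two_neq_0 by (metis add.right_inverse one_add_one)

lemma four_neq_0: "(4::'k) \<noteq> 0"
proof -
  have "(4::'k) = 2 * 2" by simp
  then show ?thesis using two_neq_0 by (metis mult_eq_0_iff)
qed

lemma two_powers: "(8::'k) \<noteq> 0" "(16::'k) \<noteq> 0" "(32::'k) \<noteq> 0"
proof -
  have "(8::'k) = 2 * 4" "(16::'k) = 4 * 4" "(32::'k) = 2 * (4 * 4)" by simp_all
  then show "(8::'k) \<noteq> 0" "(16::'k) \<noteq> 0" "(32::'k) \<noteq> 0" using two_neq_0 four_neq_0 by (metis mult_eq_0_iff)+
qed

lemma half_half: "(1::'k) / 2 + 1 / 2 = 1"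
  using two_neq_0 by (simp add: add_divide_distrib[symmetric])

lemma chi_eq_1 [simp]: "chi s t = 1 \<longleftrightarrow> s = t"
  using minus_one_neq_one by (cases s; cases t) (auto simp: chi_def)

lemma ok_tau: "u \<in> verts R \<Longrightarrow> ok (\<tau> u) s = ok u s"
  by (auto simp: ok_def)

lemma nu_tau: "u \<in> verts R \<Longrightarrow> nu (\<tau> u) = nu u"
  by (auto simp: nu_def)

lemma nu_neq_0: "nu u \<noteq> 0" using two_neq_0 by (simp add: nu_def)

lemma ok_tail: "b \<in> arcs T \<Longrightarrow> ok (tail R (\<pi> b)) (s1 b)"
  and ok_head: "b \<in> arcs T \<Longrightarrow> ok (head R (\<pi> b)) (s2 b)"
  using tail_T head_T by (auto simp: ok_def)

lemma eps_nonzero: "eps b c \<noteq> 0 \<Longrightarrow> c = \<pi> b \<or> c = \<rho> (\<pi> b)"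
  by (auto simp: eps_def split: if_splits)

lemma eps_zero: "c \<noteq> \<pi> b \<Longrightarrow> c \<noteq> \<rho> (\<pi> b) \<Longrightarrow> eps b c = 0"
  by (simp add: eps_def)

lemma eps_over:
  assumes "b \<in> arcs T" "eps b c \<noteq> 0"
  shows "c \<in> arcs R" "tail T b = sv (tail R c) (s1 b)" "head T b = sv (head R c) (s2 b)"
    "ok (tail R c) (s1 b)" "ok (head R c) (s2 b)" "\<pi> b = c \<or> \<pi> b = \<rho> c"
proof -
  note pb = pi_arcs[OF assms(1)]
  consider "c = \<pi> b" | "c = \<rho> (\<pi> b)" using eps_nonzero[OF assms(2)] by blast
  then have "c \<in> arcs R \<and> tail T b = sv (tail R c) (s1 b) \<and> head T b = sv (head R c) (s2 b) \<and>
    ok (tail R c) (s1 b) \<and> ok (head R c) (s2 b) \<and> (\<pi> b = c \<or> \<pi> b = \<rho> c)"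
    by cases (use pb tail_T[OF assms(1)] head_T[OF assms(1)] in
      \<open>auto simp: ok_tau ok_tail[OF assms(1)] ok_head[OF assms(1)] sv_tau\<close>)
  then show "c \<in> arcs R" "tail T b = sv (tail R c) (s1 b)" "head T b = sv (head R c) (s2 b)"
    "ok (tail R c) (s1 b)" "ok (head R c) (s2 b)" "\<pi> b = c \<or> \<pi> b = \<rho> c" by blast+
qed

lemma eps_fixed: "b \<in> arcs T \<Longrightarrow> \<rho> (\<pi> b) = \<pi> b \<Longrightarrow> eps b c = 2 * of_bool (c = \<pi> b)"
  using fixed_sign by (auto simp: eps_def)

lemma eps_moved:
  assumes "b \<in> arcs T" "\<rho> (\<pi> b) \<noteq> \<pi> b"
  shows "eps b (\<pi> b) = 1" "eps b (\<rho> (\<pi> b)) = chi (s1 b) (s2 b)"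
  using assms by (auto simp: eps_def)

lemma eps_rho:
  assumes "b \<in> arcs T" "c \<in> arcs R" shows "eps b (\<rho> c) = chi (s1 b) (s2 b) * eps b c"
proof -
  have "\<rho> c = \<pi> b \<longleftrightarrow> c = \<rho> (\<pi> b)" "\<rho> c = \<rho> (\<pi> b) \<longleftrightarrow> c = \<pi> b"
    using rho_rho[OF assms(2)] rho_rho[OF pi_arcs[OF assms(1)]] by metis+
  then show ?thesis by (simp add: eps_def algebra_simps)
qed

lemma arrow_unique:
  assumes "a \<in> arcs T" "b \<in> arcs T" "\<pi> b = \<pi> a \<or> \<pi> b = \<rho> (\<pi> a)" "s1 a = s1 b" "s2 a = s2 b"
  shows "a = b"
  using arrow_ex1[OF pi_arcs[OF assms(1)], of "s1 a" "s2 a"] assms ok_tail[OF assms(1)] ok_head[OF assms(1)]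
    fixed_sign[OF assms(1)] unfolding ok_def by metis

lemma sum_over_arcs:
  assumes b: "b \<in> arcs T" and h: "\<And>c. c \<in> arcs R \<Longrightarrow> eps b c = 0 \<Longrightarrow> h c = (0::'k)"
  shows "(\<Sum>c\<in>arcs R. h c) = (if \<rho> (\<pi> b) = \<pi> b then h (\<pi> b) else h (\<pi> b) + h (\<rho> (\<pi> b)))"
proof -
  have "(\<Sum>c\<in>arcs R. h c) = (\<Sum>c\<in>{\<pi> b, \<rho> (\<pi> b)}. h c)"
    using pi_arcs[OF b] h eps_nonzero by (intro sum.mono_neutral_right) auto
  then show ?thesis by auto
qed

lemma Lf_kf: "b \<in> arcs T \<Longrightarrow> Lf b c * kf b c = cc b / 2 * (eps b c * eps b c)"
  using kappa_neq_0 by (simp add: Lf_def kf_def)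

text \<open>First orthogonality relation, which holds separately for each possible head
  \<open>v\<close>. Different arrows over one orbit with the same tail have opposite signs at the
  head, so their two contributions cancel; arrows over different orbits have disjoint
  coefficients.\<close>

lemma Lf_kf_sum:
  assumes a: "a \<in> arcs T" and b: "b \<in> arcs T" and tails: "tail T a = tail T b"
  shows "(\<Sum>c\<in>arcs R. of_bool (head R c = v) * (Lf a c * kf b c)) =
    of_bool (a = b \<and> (v = head R (\<pi> a) \<or> v = \<tau> (head R (\<pi> a))))"
proof -
  note pa = pi_arcs[OF a] and pb = pi_arcs[OF b]
  let ?h = "\<lambda>c. of_bool (head R c = v) * (Lf a c * kf b c)"
  have sum: "(\<Sum>c\<in>arcs R. ?h c) = (if \<rho> (\<pi> a) = \<pi> a then ?h (\<pi> a) else ?h (\<pi> a) + ?h (\<rho> (\<pi> a)))"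
    by (rule sum_over_arcs[OF a]) (simp add: Lf_def)
  show ?thesis
  proof (cases "a = b")
    case True
    show ?thesis
    proof (cases "\<rho> (\<pi> a) = \<pi> a")
      case fixed: True
      then have "\<tau> (head R (\<pi> a)) = head R (\<pi> a)" using pa by (metis head_rho)
      have "Lf a (\<pi> a) * kf b (\<pi> a) = 1"
        using two_neq_0 four_neq_0 fixed \<open>\<tau> (head R (\<pi> a)) = head R (\<pi> a)\<close>
        by (simp add: True Lf_kf[OF b] cc_def nu_def eps_fixed[OF b])
      then show ?thesis
        unfolding sum using fixed True \<open>\<tau> (head R (\<pi> a)) = head R (\<pi> a)\<close> by auto
    next
      case moved: False
      then have m: "\<rho> (\<pi> b) \<noteq> \<pi> b" using True by simp
      have e: "Lf a (\<pi> a) * kf b (\<pi> a) = nu (head R (\<pi> a)) / 2"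
        "Lf a (\<rho> (\<pi> a)) * kf b (\<rho> (\<pi> a)) = nu (head R (\<pi> a)) / 2"
        using m by (simp_all add: True Lf_kf[OF b] cc_def eps_moved[OF b m])
      show ?thesis
        using moved pa two_neq_0 half_half unfolding sum e
        by (cases "\<tau> (head R (\<pi> a)) = head R (\<pi> a)") (auto simp: nu_def True)
    qed
  next
    case False
    show ?thesis
    proof (cases "\<pi> b = \<pi> a \<or> \<pi> b = \<rho> (\<pi> a)")
      case True
      then have s2: "s2 a \<noteq> s2 b" using arrow_unique[OF a b] False tails by auto
      have moved: "\<rho> (\<pi> a) \<noteq> \<pi> a"
      proof
        assume "\<rho> (\<pi> a) = \<pi> a"
        then show False using True s2 fixed_sign[OF a] fixed_sign[OF b] tails by auto
      qed
      have "head R (\<pi> b) = head R (\<pi> a) \<or> head R (\<pi> b) = \<tau> (head R (\<pi> a))" using True pa by auto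
      then have "ok (head R (\<pi> a)) (s2 b)" using ok_head[OF b] pa by (auto simp: ok_tau)
      \<comment> \<open>A head that carries both signs is fixed. Hence both arrows of the orbit end
        there, and both of the cancelling summands are present.\<close>
      with s2 ok_head[OF a] have hd: "\<tau> (head R (\<pi> a)) = head R (\<pi> a)"
        unfolding ok_def by metis
      have "eps a (\<pi> a) * eps b (\<pi> a) + eps a (\<rho> (\<pi> a)) * eps b (\<rho> (\<pi> a)) = 0"
        using s2 tails
        by (simp add: eps_moved[OF a moved] eps_rho[OF b pa])
          (cases "s1 b"; cases "s2 a"; cases "s2 b"; simp add: chi_def)
      moreover have "Lf a (\<pi> a) * kf b (\<pi> a) + Lf a (\<rho> (\<pi> a)) * kf b (\<rho> (\<pi> a)) = cc a / \<kappa> a * (\<kappa> b / 2)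
          * (eps a (\<pi> a) * eps b (\<pi> a) + eps a (\<rho> (\<pi> a)) * eps b (\<rho> (\<pi> a)))"
        unfolding Lf_def kf_def by (simp only: distrib_left ac_simps)
      ultimately have "Lf a (\<pi> a) * kf b (\<pi> a) + Lf a (\<rho> (\<pi> a)) * kf b (\<rho> (\<pi> a)) = 0" by simp
      then show ?thesis using sum moved hd False pa by simp
    next
      case neq: False
      have "\<pi> a \<noteq> \<rho> (\<pi> b)" using neq pb by (metis rho_rho)
      then have "kf b (\<pi> a) = 0" "kf b (\<rho> (\<pi> a)) = 0"
        using neq pa pb by (auto simp: kf_def eps_def rho_inj)
      then show ?thesis using sum False by simp
    qed
  qed
qed

definition adm :: "'b \<Rightarrow> sign \<Rightarrow> sign \<Rightarrow> bool" where
  "adm c s r \<longleftrightarrow> ok (tail R c) s \<and> ok (head R c) r \<and> (\<rho> c = c \<longrightarrow> s = r)"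

definition arr :: "'b \<Rightarrow> sign \<Rightarrow> sign \<Rightarrow> 'e" where
  "arr c s r = (THE b. b \<in> arcs T \<and> (\<pi> b = c \<or> \<pi> b = \<rho> c) \<and> s1 b = s \<and> s2 b = r)"

lemma arr:
  assumes "c \<in> arcs R" "adm c s r"
  shows "arr c s r \<in> arcs T" "\<pi> (arr c s r) = c \<or> \<pi> (arr c s r) = \<rho> c"
    "s1 (arr c s r) = s" "s2 (arr c s r) = r"
  using theI'[OF arrow_ex1[OF assms(1), of s r]] assms(2) unfolding adm_def ok_def arr_def by blast+

text \<open>Once the orbit of \<open>c\<close> and the sign at the tail are given, an arrow of
  \<open>T\<close> is determined by its sign at the head. The sum thus has at most two
  terms.\<close>

lemma sum_arrows_over:
  assumes c: "c \<in> arcs R" and s: "ok (tail R c) s"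
  shows "(\<Sum>b\<in>arcs T. of_bool (tail T b = sv (tail R c) s) * (eps b c * h b)) =
    (\<Sum>r\<in>signs. if adm c s r then eps (arr c s r) c * h (arr c s r) else 0)"
proof -
  let ?B = "{b \<in> arcs T. tail T b = sv (tail R c) s \<and> eps b c \<noteq> 0}"
  have s1: "s1 b = s" if "tail T b = sv (tail R c) s" for b
    using that s c by (simp add: snd_sv ok_def)
  have "(\<Sum>b\<in>arcs T. of_bool (tail T b = sv (tail R c) s) * (eps b c * h b)) = (\<Sum>b\<in>?B. eps b c * h b)"
    by (rule sum.mono_neutral_cong_right) auto
  also have "\<dots> = (\<Sum>r\<in>{r. adm c s r}. eps (arr c s r) c * h (arr c s r))"
  proof (rule sum.reindex_bij_witness[of _ "arr c s" s2])
    fix b assume b: "b \<in> ?B"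
    then have bT: "b \<in> arcs T" and e: "eps b c \<noteq> 0" and "s1 b = s" using s1 by auto
    note ov = eps_over[OF bT e]
    have fix1: "s1 b = s2 b" if "\<rho> c = c" using fixed_sign[OF bT] ov(6) that by auto
    show "s2 b \<in> {r. adm c s r}" using ov \<open>s1 b = s\<close> fix1 by (auto simp: adm_def)
    then have ad: "adm c s (s2 b)" by simp
    have "\<pi> b = \<pi> (arr c s (s2 b)) \<or> \<pi> b = \<rho> (\<pi> (arr c s (s2 b)))"
      using ov(6) arr(2)[OF c ad] c by auto
    then show "arr c s (s2 b) = b"
      using arrow_unique[OF arr(1)[OF c ad] bT] arr(3,4)[OF c ad] \<open>s1 b = s\<close> by simp
    then show "eps (arr c s (s2 b)) c * h (arr c s (s2 b)) = eps b c * h b" by simp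
  next
    fix r assume "r \<in> {r. adm c s r}"
    then have ad: "adm c s r" by simp
    note ar = arr[OF c ad]
    show "s2 (arr c s r) = r" by (rule ar(4))
    have e: "eps (arr c s r) c \<noteq> 0"
    proof (cases "\<rho> (\<pi> (arr c s r)) = \<pi> (arr c s r)")
      case True
      then have "\<pi> (arr c s r) = c" using ar(2) c by (metis rho_rho)
      then show ?thesis using eps_fixed[OF ar(1) True] two_neq_0 by simp
    next
      case False
      then have "eps (arr c s r) (\<pi> (arr c s r)) \<noteq> 0" "eps (arr c s r) (\<rho> (\<pi> (arr c s r))) \<noteq> 0"
        using eps_moved[OF ar(1) False] chi_neq_0 by simp_all
      then show ?thesis using ar(2) c by auto
    qed
    show "arr c s r \<in> ?B" using ar(1,3) eps_over[OF ar(1) e] e by simp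
  qed
  also have "\<dots> = (\<Sum>r\<in>signs. if adm c s r then eps (arr c s r) c * h (arr c s r) else 0)"
    using signs_cases by (intro sum.mono_neutral_cong_left) auto
  finally show ?thesis .
qed

text \<open>Second orthogonality relation. If the common head is fixed and \<open>c\<close> is
  moved, both signs occur at the head and cancel for \<open>c' = \<rho> c\<close>. If the head is
  moved, only \<open>Plus\<close> occurs, but then \<open>\<rho> c\<close> has a different head and
  is excluded.\<close>

lemma kf_Lf_sum:
  assumes c: "c \<in> arcs R" and c': "c' \<in> arcs R" and heads: "head R c = head R c'" and s: "ok (tail R c) s"
  shows "(\<Sum>b\<in>arcs T. of_bool (tail T b = sv (tail R c) s) * (kf b c * Lf b c')) = of_bool (c = c')"
proof -
  define hc where "hc b = cc b / 2" for b
  have "kf b c * Lf b c' = eps b c * (hc b * eps b c')" if "b \<in> arcs T" for b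
    using kappa_neq_0[OF that] by (simp add: kf_def Lf_def hc_def)
  then have "(\<Sum>b\<in>arcs T. of_bool (tail T b = sv (tail R c) s) * (kf b c * Lf b c')) =
      (\<Sum>b\<in>arcs T. of_bool (tail T b = sv (tail R c) s) * (eps b c * (hc b * eps b c')))"
    by (intro sum.cong) (simp_all only:)
  also have "\<dots> = (\<Sum>r\<in>signs. if adm c s r
      then eps (arr c s r) c * (hc (arr c s r) * eps (arr c s r) c') else 0)"
    by (rule sum_arrows_over[OF c s])
  also have "\<dots> = of_bool (c = c')"
  proof (cases "\<rho> c = c")
    case True
    have tau: "\<tau> (head R c) = head R c" "\<tau> (tail R c) = tail R c"
      using True c by (metis head_rho, metis tail_rho)
    have ad: "adm c s r \<longleftrightarrow> r = s" for r using tau True by (auto simp: adm_def ok_def)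
    have sum: "(\<Sum>r\<in>signs. if adm c s r then F r else 0) = F s" for F :: "sign \<Rightarrow> 'k"
      using ad[of Plus] ad[of Minus] by (cases s) simp_all
    have ad': "adm c s s" using ad by simp
    have pi: "\<pi> (arr c s s) = c" using arr(2)[OF c ad'] True by auto
    show ?thesis unfolding sum
      using eps_fixed[OF arr(1)[OF c ad']] pi True tau two_neq_0 four_neq_0
      by (auto simp: hc_def cc_def nu_def)
  next
    case moved: False
    have e: "eps (arr c s r) c * eps (arr c s r) c = 1" "hc (arr c s r) = nu (head R c) / 2"
      if "adm c s r" for r
    proof -
      note ar = arr[OF c that]
      have m: "\<rho> (\<pi> (arr c s r)) \<noteq> \<pi> (arr c s r)" using ar(2) moved c by auto
      show "eps (arr c s r) c * eps (arr c s r) c = 1"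
        using ar(2) eps_moved[OF ar(1) m] c by auto
      show "hc (arr c s r) = nu (head R c) / 2" using m ar(2) c by (auto simp: hc_def cc_def nu_tau)
    qed
    show ?thesis
    proof (cases "\<tau> (head R c) = head R c")
      case False
      then have ad: "adm c s r \<longleftrightarrow> r = Plus" for r using s moved by (auto simp: adm_def ok_def)
      have sum: "(\<Sum>r\<in>signs. if adm c s r then F r else 0) = F Plus" for F :: "sign \<Rightarrow> 'k"
        by (simp add: ad)
      have adP: "adm c s Plus" using ad by simp
      have "\<rho> c \<noteq> c'" using heads False c by (metis head_rho)
      have "eps (arr c s Plus) c' = 0" if "c \<noteq> c'"
        by (rule eps_zero) (use arr(2)[OF c adP] that c \<open>\<rho> c \<noteq> c'\<close> in auto)
      then show ?thesis unfolding sum e(2)[OF adP]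
        using e(1)[OF adP] False two_neq_0 by (cases "c = c'") (simp_all add: nu_def)
    next
      case True
      have ad: "adm c s r" for r using s moved True by (simp add: adm_def ok_def)
      have sum: "(\<Sum>r\<in>signs. if adm c s r then F r else 0) = F Plus + F Minus" for F :: "sign \<Rightarrow> 'k"
        by (simp add: ad)
      have hc: "hc (arr c s r) = 1 / 2" for r using e(2)[OF ad] True by (simp add: nu_def)
      consider "c' = c" | "c' = \<rho> c" | "c' \<noteq> c" "c' \<noteq> \<rho> c" by blast
      then show ?thesis
      proof cases
        case 1
        have *: "eps (arr c s r) c * (1 / 2 * eps (arr c s r) c) = 1 / 2" for r
          using e(1)[OF ad[of r]] by (metis mult.left_commute mult.right_neutral)
        show ?thesis unfolding sum hc 1 * half_half by simp
      next
        case 2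
        have "eps (arr c s r) c * eps (arr c s r) (\<rho> c) = chi s r" for r
          using e(1)[OF ad[of r]] arr[OF c ad[of r]] c by (simp add: eps_rho mult.left_commute)
        then have "eps (arr c s r) c * (1 / 2 * eps (arr c s r) (\<rho> c)) = chi s r * (1 / 2)" for r
          by (metis mult.left_commute mult.commute)
        then have *: "eps (arr c s Plus) c * (1 / 2 * eps (arr c s Plus) (\<rho> c))
            + eps (arr c s Minus) c * (1 / 2 * eps (arr c s Minus) (\<rho> c)) = 0"
          by (simp only:) (simp add: chi_def)
        show ?thesis unfolding sum hc 2 using * moved by auto
      next
        case 3
        have "eps (arr c s r) c' = 0" for r
          by (rule eps_zero) (use arr(2)[OF c ad[of r]] c 3 in auto)
        with 3 show ?thesis by simp
      qed
    qed
  qed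
  finally show ?thesis .
qed

end

declare sum_of_bool_mult_eq [simp del] sum_mult_of_bool_eq [simp del]

section \<open>From series on the new quiver to matrices\<close>

context skew_cover begin

text \<open>The multiplicative extension of the matrices of the arrows, organised along the path of
  \<open>R\<close> at which an entry is evaluated. The infinite sum over the paths of
  \<open>T\<close> thus becomes a finite sum over arrows at each step. The lists come first only to
  allow primitive recursion.\<close>

primrec psil :: "'b list \<Rightarrow> ('v \<times> sign, 'e, 'k) pelt \<Rightarrow> sign \<Rightarrow> sign \<Rightarrow> 'v \<Rightarrow> 'k" where
  "psil [] f t s u = of_bool (t = s \<and> u \<in> verts R \<and> ok u s) * f (sv u s, [])"
| "psil (c # w) f t s u = of_bool (u = tail R c \<and> ok u s) *
     (\<Sum>b\<in>arcs T. of_bool (tail T b = sv u s) * (kf b c * psil w (residual T b f) t (s2 b) (head R c)))"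

definition Psi :: "('v \<times> sign, 'e, 'k) pelt \<Rightarrow> sign \<Rightarrow> sign \<Rightarrow> ('v, 'b, 'k) pelt" where
  "Psi f t s = (\<lambda>(u, w). psil w f t s u)"

lemma Psi_Nil: "Psi f t s (u, []) = of_bool (t = s \<and> u \<in> verts R \<and> ok u s) * f (sv u s, [])"
  by (simp add: Psi_def)

lemma Psi_Cons: "Psi f t s (u, c # w) = of_bool (u = tail R c \<and> ok u s) *
     (\<Sum>b\<in>arcs T. of_bool (tail T b = sv u s) * (kf b c * Psi (residual T b f) t (s2 b) (head R c, w)))"
  by (simp add: Psi_def)

lemma Psi_add: "Psi (\<lambda>x. f x + g x) t s = (\<lambda>x. Psi f t s x + Psi g t s x)"
proof (rule path_ext)
  fix u p show "Psi (\<lambda>x. f x + g x) t s (u, p) = Psi f t s (u, p) + Psi g t s (u, p)"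
    by (induction p arbitrary: u f g s)
      (simp_all only: Psi_Nil Psi_Cons residual_add distrib_left sum.distrib)
qed

lemma Psi_scale: "Psi (\<lambda>x. a * f x) t s = (\<lambda>x. a * Psi f t s x)"
proof (rule path_ext)
  fix u p show "Psi (\<lambda>x. a * f x) t s (u, p) = a * Psi f t s (u, p)"
    by (induction p arbitrary: u f s)
      (simp_all add: Psi_Nil Psi_Cons residual_scale sum_distrib_left mult.left_commute)
qed

lemma Psi_zero [simp]: "Psi (\<lambda>x. 0) t s = (\<lambda>x. 0)"
  using Psi_scale[of 0 "\<lambda>x. 0"] by simp

lemma Psi_sum: "finite I \<Longrightarrow> Psi (\<lambda>x. \<Sum>i\<in>I. f i x) t s = (\<lambda>x. \<Sum>i\<in>I. Psi (f i) t s x)"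
  by (induction I rule: finite_induct) (simp_all add: Psi_add)

lemma Psi_nonzero:
  assumes "Psi f t s (u, w) \<noteq> 0"
  shows "(u, w) \<in> quiver_paths R" "ok u s" "ok (awlast u w) t"
proof -
  have "(u, w) \<in> quiver_paths R \<and> ok u s \<and> ok (awlast u w) t"
    using assms
  proof (induction w arbitrary: u f s)
    case Nil
    then show ?case by (auto simp: Psi_Nil split: if_splits)
  next
    case (Cons c w)
    then have us: "u = tail R c" "ok u s" unfolding Psi_Cons by (simp_all split: split_of_bool_asm)
    have "(\<Sum>b\<in>arcs T. of_bool (tail T b = sv u s) *
        (kf b c * Psi (residual T b f) t (s2 b) (head R c, w))) \<noteq> 0"
      using Cons.prems unfolding Psi_Cons by (metis mult_zero_right)
    then obtain b where b: "b \<in> arcs T"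
      "of_bool (tail T b = sv u s) * (kf b c * Psi (residual T b f) t (s2 b) (head R c, w)) \<noteq> 0"
      by (rule sum.not_neutral_contains_not_neutral)
    then have e: "eps b c \<noteq> 0" and nz: "Psi (residual T b f) t (s2 b) (head R c, w) \<noteq> 0"
      by (simp_all add: kf_def)
    show ?case using Cons.IH[OF nz] us eps_over(1)[OF b(1) e] by simp
  qed
  then show "(u, w) \<in> quiver_paths R" "ok u s" "ok (awlast u w) t" by blast+
qed

lemma supported_Psi [simp]: "supported R (Psi f t s)"
  using Psi_nonzero(1) by (auto simp: supported_def)

lemma Psi_start_zero: "(\<And>p. f (sv u s, p) = 0) \<Longrightarrow> Psi f t s (u, w) = 0"
proof (induction w arbitrary: u f s)
  case (Cons c w)
  have "residual T b f = (\<lambda>x. 0)" if "tail T b = sv u s" for b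
    using Cons.prems that by (auto simp: residual_def)
  then show ?case by (auto simp: Psi_Cons intro!: sum.neutral)
qed (simp add: Psi_Nil)

lemma kf_rho: "b \<in> arcs T \<Longrightarrow> c \<in> arcs R \<Longrightarrow> kf b (\<rho> c) = chi (s1 b) (s2 b) * kf b c"
  by (simp add: kf_def eps_rho)

text \<open>The coefficients of \<open>b\<close> are multiplied under \<rho> by the product of the
  signs at its ends. Along a path the intermediate signs telescope.\<close>

lemma Psi_eigen: "act (Psi f t s) = (\<lambda>x. chi t s * Psi f t s x)"
proof (rule supported_eqI)
  fix u w assume "(u, w) \<in> quiver_paths R"
  then have "Psi f t s (\<tau> u, map \<rho> w) = chi t s * Psi f t s (u, w)"
  proof (induction w arbitrary: u f s)
    case Nil
    then show ?case by (auto simp: Psi_Nil ok_tau sv_tau)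
  next
    case (Cons c w)
    then have c: "c \<in> arcs R" "u = tail R c" "(head R c, w) \<in> quiver_paths R" by auto
    show ?case
    proof (cases "ok u s")
      case True
      have "Psi f t s (\<tau> u, map \<rho> (c # w)) =
        (\<Sum>b\<in>arcs T. of_bool (tail T b = sv u s) *
          (kf b (\<rho> c) * Psi (residual T b f) t (s2 b) (\<tau> (head R c), map \<rho> w)))"
        using c True by (simp add: Psi_Cons ok_tau sv_tau)
      also have "\<dots> = (\<Sum>b\<in>arcs T. chi t s * (of_bool (tail T b = sv u s) *
          (kf b c * Psi (residual T b f) t (s2 b) (head R c, w))))"
      proof (intro sum.cong[OF refl])
        fix b assume b: "b \<in> arcs T"
        show "of_bool (tail T b = sv u s) * (kf b (\<rho> c) * Psi (residual T b f) t (s2 b) (\<tau> (head R c), map \<rho> w)) =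
          chi t s * (of_bool (tail T b = sv u s) * (kf b c * Psi (residual T b f) t (s2 b) (head R c, w)))"
        proof (cases "tail T b = sv u s")
          case t: True
          then have "s1 b = s" using True c by (simp add: snd_sv ok_def)
          then have "chi (s1 b) (s2 b) * chi t (s2 b) = chi t s"
            by (cases t; cases s; cases "s2 b") (simp_all add: chi_def)
          moreover have "kf b (\<rho> c) * Psi (residual T b f) t (s2 b) (\<tau> (head R c), map \<rho> w) =
            (chi (s1 b) (s2 b) * chi t (s2 b)) * (kf b c * Psi (residual T b f) t (s2 b) (head R c, w))"
            unfolding kf_rho[OF b c(1)] Cons.IH[OF c(3)] by (simp only: ac_simps)
          ultimately show ?thesis by (simp add: t)
        qed simp
      qed
      finally show ?thesis using c True by (simp add: Psi_Cons sum_distrib_left)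
    next
      case False
      then show ?thesis using c by (simp add: Psi_Cons ok_tau)
    qed
  qed
  then show "act (Psi f t s) (u, w) = chi t s * Psi f t s (u, w)"
    using \<open>(u, w) \<in> quiver_paths R\<close> by (simp add: act_path)
qed (simp_all add: supported_scale)

definition mmul :: "(sign \<Rightarrow> sign \<Rightarrow> ('v, 'b, 'k) pelt) \<Rightarrow> (sign \<Rightarrow> sign \<Rightarrow> ('v, 'b, 'k) pelt) \<Rightarrow>
    sign \<Rightarrow> sign \<Rightarrow> ('v, 'b, 'k) pelt" where
  "mmul M N t s = (\<lambda>x. pmul R (M t Plus) (N Plus s) x + pmul R (M t Minus) (N Minus s) x)"

lemma mmul_sum: "mmul M N t s x = (\<Sum>r\<in>signs. pmul R (M t r) (N r s) x)"
  by (simp add: mmul_def)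

text \<open>Splitting off the first arrow gives the two terms of \<open>T.residual_pmul\<close>. The
  one with a residual of \<open>g\<close> is covered by the induction hypothesis, the one with the
  trivial coefficient of \<open>g\<close> is the first term of \<open>pmul_Cons\<close>.\<close>

lemma Psi_pmul:
  assumes f: "supported T f" and g: "supported T g"
  shows "Psi (pmul T f g) = mmul (Psi f) (Psi g)"
proof (rule ext, rule ext, rule path_ext)
  fix t s u w
  show "Psi (pmul T f g) t s (u, w) = mmul (Psi f) (Psi g) t s (u, w)"
    using g
  proof (induction w arbitrary: u s g)
    case Nil
    show ?case unfolding mmul_def pmul_Nil Psi_Nil by (cases s; cases t) simp_all
  next
    case (Cons c w)
    note g = Cons.prems
    show ?case
    proof (cases "u = tail R c \<and> ok u s")
      case True
      then have us: "u = tail R c" "ok (tail R c) s" by auto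
      let ?B = "\<lambda>b. of_bool (tail T b = sv u s) :: 'k"
      have "Psi (pmul T f g) t s (u, c # w) = (\<Sum>b\<in>arcs T. ?B b *
          (kf b c * Psi (residual T b (pmul T f g)) t (s2 b) (head R c, w)))"
        using us by (simp add: Psi_Cons)
      also have "\<dots> = (\<Sum>b\<in>arcs T. ?B b * (kf b c *
          (g (sv u s, []) * Psi (residual T b f) t (s2 b) (head R c, w)
           + mmul (Psi f) (Psi (residual T b g)) t (s2 b) (head R c, w))))"
      proof (intro sum.cong[OF refl])
        fix b
        show "?B b * (kf b c * Psi (residual T b (pmul T f g)) t (s2 b) (head R c, w)) =
          ?B b * (kf b c * (g (sv u s, []) * Psi (residual T b f) t (s2 b) (head R c, w)
             + mmul (Psi f) (Psi (residual T b g)) t (s2 b) (head R c, w)))"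
          by (cases "tail T b = sv u s")
            (simp_all add: T.residual_pmul[OF f g] Psi_add Psi_scale Cons.IH[OF T.supported_residual[OF g]])
      qed
      also have "\<dots> = g (sv u s, []) * (\<Sum>b\<in>arcs T. ?B b * (kf b c * Psi (residual T b f) t (s2 b) (head R c, w)))
        + (\<Sum>b\<in>arcs T. ?B b * (kf b c * mmul (Psi f) (Psi (residual T b g)) t (s2 b) (head R c, w)))"
        by (simp add: sum.distrib distrib_left sum_distrib_left mult.left_commute)
      finally have split: "Psi (pmul T f g) t s (u, c # w) =
        g (sv u s, []) * (\<Sum>b\<in>arcs T. ?B b * (kf b c * Psi (residual T b f) t (s2 b) (head R c, w)))
        + (\<Sum>b\<in>arcs T. ?B b * (kf b c * mmul (Psi f) (Psi (residual T b g)) t (s2 b) (head R c, w)))" .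
      have left: "(\<Sum>b\<in>arcs T. ?B b * (kf b c * Psi (residual T b f) t (s2 b) (head R c, w))) =
          Psi f t s (u, c # w)"
        using us by (simp add: Psi_Cons)
      have right: "(\<Sum>b\<in>arcs T. ?B b * (kf b c * mmul (Psi f) (Psi (residual T b g)) t (s2 b) (head R c, w))) =
          (\<Sum>r\<in>signs. pmul R (Psi f t r) (residual R c (Psi g r s)) (head R c, w))"
      proof -
        have "pmul R (Psi f t r) (residual R c (Psi g r s)) (head R c, w) =
          (\<Sum>b\<in>arcs T. ?B b * (kf b c * pmul R (Psi f t r) (Psi (residual T b g) r (s2 b)) (head R c, w)))" for r
        proof -
          have "pmul R (Psi f t r) (residual R c (Psi g r s)) (head R c, w) =
            pmul R (Psi f t r) (\<lambda>x. \<Sum>b\<in>arcs T. ?B b * (kf b c * Psi (residual T b g) r (s2 b) x)) (head R c, w)"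
            using us by (intro pmul_start_cong) (simp add: Psi_Cons)
          then show ?thesis by (simp add: pmul_sum_right pmul_scale_right)
        qed
        then show ?thesis
          unfolding mmul_sum by (simp only: sum_distrib_left) (rule sum.swap)
      qed
      \<comment> \<open>On trivial paths the matrix of \<open>g\<close> is diagonal, so the sum over
        the intermediate sign reduces to \<open>r = s\<close>.\<close>
      have start: "g (sv u s, []) * Psi f t s (u, c # w) = (\<Sum>r\<in>signs. Psi f t r (u, c # w) * Psi g r s (u, []))"
      proof -
        have "Psi f t r (u, c # w) * Psi g r s (u, []) =
          (if r = s then g (sv u s, []) * Psi f t s (u, c # w) else 0)" for r
        proof (cases "r = s \<and> Psi f t s (u, c # w) \<noteq> 0")
          case nz: True
          then have "u \<in> verts R" using Psi_nonzero(1)[of f t s u "c # w"] paths_start by blast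
          with nz us show ?thesis by (simp add: Psi_Nil)
        next
          case False
          then show ?thesis by (cases "r = s") (simp_all add: Psi_Nil)
        qed
        then have "(\<Sum>r\<in>signs. Psi f t r (u, c # w) * Psi g r s (u, [])) =
          (\<Sum>r\<in>signs. if r = s then g (sv u s, []) * Psi f t s (u, c # w) else 0)"
          by (simp only:)
        also have "\<dots> = g (sv u s, []) * Psi f t s (u, c # w)"
          using signs_cases[of s] by (simp only: sum.delta finite.intros if_True)
        finally show ?thesis by (rule sym)
      qed
      show ?thesis
        unfolding split left right start using us by (simp add: mmul_def pmul_Cons)
    next
      case False
      have "pmul R (Psi f t r) (Psi g r s) (u, c # w) = 0" for r
      proof (cases "u = tail R c")
        case True
        with False have "\<not> ok u s" by blast
        then have "Psi g r s (u, p) = 0" for p using Psi_nonzero(2)[of g r s u p] by blast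
        then show ?thesis by (rule pmul_start_zero)
      qed (simp add: pmul_Cons)
      with False show ?thesis by (auto simp: mmul_def Psi_Cons)
    qed
  qed
qed

section \<open>From matrices back to series\<close>

definition mres :: "'e \<Rightarrow> (sign \<Rightarrow> sign \<Rightarrow> ('v, 'b, 'k) pelt) \<Rightarrow> sign \<Rightarrow> sign \<Rightarrow> ('v, 'b, 'k) pelt" where
  "mres b M t r = (\<lambda>x. of_bool (r = s2 b) * (\<Sum>c\<in>arcs R. Lf b c * residual R c (M t (s1 b)) x))"

text \<open>At a trivial path the values at the two vertices of the orbit are averaged. For matrices
  of the corner they agree; the average treats fixed and moved vertices alike and needs no
  representative.\<close>

primrec thl :: "'e list \<Rightarrow> (sign \<Rightarrow> sign \<Rightarrow> ('v, 'b, 'k) pelt) \<Rightarrow> 'v \<times> sign \<Rightarrow> 'k" where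
  "thl [] M x = of_bool (x \<in> verts T) *
     ((M (snd x) (snd x) (fst x, []) + M (snd x) (snd x) (\<tau> (fst x), [])) / 2)"
| "thl (b # p) M x = of_bool (b \<in> arcs T \<and> x = tail T b) * thl p (mres b M) (head T b)"

definition Theta :: "(sign \<Rightarrow> sign \<Rightarrow> ('v, 'b, 'k) pelt) \<Rightarrow> ('v \<times> sign, 'e, 'k) pelt" where
  "Theta M = (\<lambda>(x, p). thl p M x)"

lemma Theta_Nil: "Theta M (x, []) = of_bool (x \<in> verts T) *
     ((M (snd x) (snd x) (fst x, []) + M (snd x) (snd x) (\<tau> (fst x), [])) / 2)"
  by (simp add: Theta_def)

lemma Theta_Cons:
  "Theta M (x, b # p) = of_bool (b \<in> arcs T \<and> x = tail T b) * Theta (mres b M) (head T b, p)"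
  by (simp add: Theta_def)

lemma supported_Theta [simp]: "supported T (Theta M)"
proof -
  have "(x, p) \<in> quiver_paths T" if "Theta M (x, p) \<noteq> 0" for x p
    using that
  proof (induction p arbitrary: x M)
    case Nil
    then show ?case by (cases "x \<in> verts T") (simp_all add: Theta_Nil)
  next
    case (Cons b p)
    then show ?case by (cases "b \<in> arcs T \<and> x = tail T b") (simp_all add: Theta_Cons)
  qed
  then show ?thesis by (auto simp: supported_def)
qed

lemma half_double: "(a + a) / 2 = (a::'k)"
proof -
  have "(a + a) / 2 = (2 * a) / 2" by (simp only: mult_2)
  then show ?thesis using two_neq_0 by simp
qed

lemma Psi_residual_nonzero:
  assumes b: "b \<in> arcs T" and nz: "Psi (residual T b f) t r (v, q) \<noteq> 0"
  shows "r = s2 b" "v = head R (\<pi> b) \<or> v = \<tau> (head R (\<pi> b))"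
proof -
  have v: "v \<in> verts R" and ok: "ok v r" using Psi_nonzero[OF nz] paths_start by blast+
  have eq: "sv v r = head T b"
  proof (rule ccontr)
    assume "sv v r \<noteq> head T b"
    then have "Psi (residual T b f) t r (v, q) = 0" by (intro Psi_start_zero) simp
    with nz show False by simp
  qed
  have "snd (sv v r) = r" using v ok by (intro snd_sv) (simp_all add: ok_def)
  then show "r = s2 b" by (simp add: eq)
  have h: "head R (\<pi> b) \<in> verts R" using pi_arcs[OF b] by simp
  have "fst (sv v r) = v \<or> fst (sv v r) = \<tau> v"
    using v ok by (intro fst_sv) (simp_all add: ok_def)
  moreover have "fst (head T b) = head R (\<pi> b) \<or> fst (head T b) = \<tau> (head R (\<pi> b))"
    using fst_sv[OF h, of "s2 b"] head_T[OF b] by metis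
  ultimately show "v = head R (\<pi> b) \<or> v = \<tau> (head R (\<pi> b))"
    unfolding eq using v h by (metis tau_tau)
qed

text \<open>The first orthogonality relation isolates \<open>b\<close> among the arrows with the
  same tail, so \<open>mres\<close> does for matrices what \<open>residual\<close> does for
  series.\<close>

lemma mres_Psi:
  assumes b: "b \<in> arcs T"
  shows "mres b (Psi f) = Psi (residual T b f)"
proof (rule ext, rule ext, rule path_ext)
  fix t r v q
  let ?P = "\<lambda>a. Psi (residual T a f) t (s2 a) (v, q)"
  let ?over = "v = head R (\<pi> b) \<or> v = \<tau> (head R (\<pi> b))"
  have "(\<Sum>c\<in>arcs R. Lf b c * residual R c (Psi f t (s1 b)) (v, q)) =
    (\<Sum>c\<in>arcs R. \<Sum>a\<in>arcs T. of_bool (tail T a = tail T b) *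
      (of_bool (head R c = v) * (Lf b c * kf a c) * ?P a))"
  proof (intro sum.cong[OF refl])
    fix c assume c: "c \<in> arcs R"
    show "Lf b c * residual R c (Psi f t (s1 b)) (v, q) =
      (\<Sum>a\<in>arcs T. of_bool (tail T a = tail T b) * (of_bool (head R c = v) * (Lf b c * kf a c) * ?P a))"
    proof (cases "Lf b c = 0 \<or> v \<noteq> head R c")
      case True
      then show ?thesis by auto
    next
      case False
      then have e: "eps b c \<noteq> 0" and v: "v = head R c" by (auto simp: Lf_def)
      note ov = eps_over[OF b e]
      have "residual R c (Psi f t (s1 b)) (v, q) =
        (\<Sum>a\<in>arcs T. of_bool (tail T a = tail T b) * (kf a c * ?P a))"
        unfolding v residual_simps(1) Psi_Cons ov(2)[symmetric] using ov(4) by simp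
      then show ?thesis by (simp add: v sum_distrib_left mult_ac)
    qed
  qed
  also have "\<dots> = (\<Sum>a\<in>arcs T. of_bool (tail T a = tail T b) *
      ((\<Sum>c\<in>arcs R. of_bool (head R c = v) * (Lf b c * kf a c)) * ?P a))"
    by (subst sum.swap) (simp add: sum_distrib_left sum_distrib_right)
  also have "\<dots> = (\<Sum>a\<in>arcs T. if a = b then of_bool ?over * ?P b else 0)"
  proof (intro sum.cong[OF refl])
    fix a assume a: "a \<in> arcs T"
    show "of_bool (tail T a = tail T b) * ((\<Sum>c\<in>arcs R. of_bool (head R c = v) * (Lf b c * kf a c)) * ?P a)
      = (if a = b then of_bool ?over * ?P b else 0)"
    proof (cases "tail T a = tail T b")
      case True
      show ?thesis unfolding Lf_kf_sum[OF b a True[symmetric]] using True by auto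
    qed auto
  qed
  also have "\<dots> = of_bool ?over * ?P b" using b by (simp add: sum.delta)
  finally have *: "mres b (Psi f) t r (v, q) = of_bool (r = s2 b) * (of_bool ?over * ?P b)"
    by (simp add: mres_def)
  show "mres b (Psi f) t r (v, q) = Psi (residual T b f) t r (v, q)"
  proof (cases "Psi (residual T b f) t r (v, q) = 0")
    case True
    then show ?thesis unfolding * by (cases "r = s2 b") simp_all
  next
    case False
    have "of_bool ?over = (1::'k)" using Psi_residual_nonzero(2)[OF b False] by simp
    with Psi_residual_nonzero(1)[OF b False] show ?thesis unfolding * by simp
  qed
qed

lemma Theta_Psi:
  assumes "supported T f" shows "Theta (Psi f) = f"
proof (rule path_ext)
  fix x p show "Theta (Psi f) (x, p) = f (x, p)"
    using assms
  proof (induction p arbitrary: x f)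
    case Nil
    show ?case
    proof (cases "x \<in> verts T")
      case True
      note x = verts_T[OF True]
      have "Psi f (snd x) (snd x) (fst x, []) = f (x, [])"
        "Psi f (snd x) (snd x) (\<tau> (fst x), []) = f (x, [])"
        using x by (auto simp: Psi_Nil sv_tau ok_def)
      then show ?thesis using True two_neq_0 by (simp add: Theta_Nil half_double)
    next
      case False
      then show ?thesis using Nil by (simp add: Theta_Nil T.supported_vert)
    qed
  next
    case (Cons b p)
    show ?case
    proof (cases "b \<in> arcs T \<and> x = tail T b")
      case True
      then show ?thesis
        using Cons.IH[OF T.supported_residual[OF Cons.prems]] by (simp add: Theta_Cons mres_Psi)
    next
      case False
      then have "f (x, b # p) = 0" by (intro T.supported_Cons[OF Cons.prems]) blast
      with False show ?thesis by (auto simp: Theta_Cons)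
    qed
  qed
qed

definition corner_matrix :: "(sign \<Rightarrow> sign \<Rightarrow> ('v, 'b, 'k) pelt) \<Rightarrow> bool" where
  "corner_matrix M \<longleftrightarrow> (\<forall>t s. supported R (M t s) \<and> act (M t s) = (\<lambda>x. chi t s * M t s x) \<and>
     (\<forall>u w. M t s (u, w) \<noteq> 0 \<longrightarrow> ok u s \<and> ok (awlast u w) t))"

lemma corner_matrixD:
  assumes "corner_matrix M"
  shows "supported R (M t s)" "act (M t s) = (\<lambda>x. chi t s * M t s x)"
    "M t s (u, w) \<noteq> 0 \<Longrightarrow> ok u s" "M t s (u, w) \<noteq> 0 \<Longrightarrow> ok (awlast u w) t"
  using assms by (auto simp: corner_matrix_def)

lemma corner_matrix_eigen:
  assumes "corner_matrix M" "(u, w) \<in> quiver_paths R"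
  shows "M t s (\<tau> u, map \<rho> w) = chi t s * M t s (u, w)"
  using act_path[OF assms(2), of "M t s"] corner_matrixD(2)[OF assms(1), of t s] by simp

lemma corner_Psi: "corner_matrix (Psi f)"
  using Psi_nonzero by (auto simp: corner_matrix_def Psi_eigen)

lemma Lf_rho: "b \<in> arcs T \<Longrightarrow> c \<in> arcs R \<Longrightarrow> Lf b (\<rho> c) = chi (s1 b) (s2 b) * Lf b c"
  by (simp add: Lf_def eps_rho)

text \<open>Needed to apply the induction hypothesis of \<open>Psi_Theta\<close> to
  \<open>mres b M\<close>. The eigenvalue is right because \<rho> multiplies the coordinates
  \<open>Lf b\<close> by the signs of \<open>b\<close>, which replaces the sign at the tail by the
  one at the head.\<close>

lemma corner_mres:
  assumes M: "corner_matrix M" and b: "b \<in> arcs T"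
  shows "corner_matrix (mres b M)"
  unfolding corner_matrix_def
proof (intro allI conjI impI)
  fix t r
  show supp: "supported R (mres b M t r)" unfolding mres_def
    by (intro supported_scale supported_sum supported_residual corner_matrixD(1)[OF M])
  show "act (mres b M t r) = (\<lambda>x. chi t r * mres b M t r x)"
  proof (rule supported_eqI)
    fix v q assume p: "(v, q) \<in> quiver_paths R"
    have "Lf b (\<rho> c) * residual R (\<rho> c) (M t (s1 b)) (\<tau> v, map \<rho> q) =
      chi t (s2 b) * (Lf b c * residual R c (M t (s1 b)) (v, q))" if c: "c \<in> arcs R" for c
    proof (cases "v = head R c")
      case True
      have "(tail R c, c # q) \<in> quiver_paths R" using p c True by simp
      from corner_matrix_eigen[OF M this, of t "s1 b"]
      have "M t (s1 b) (\<tau> (tail R c), \<rho> c # map \<rho> q) = chi t (s1 b) * M t (s1 b) (tail R c, c # q)" by simp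
      then have "Lf b (\<rho> c) * residual R (\<rho> c) (M t (s1 b)) (\<tau> v, map \<rho> q) =
        (chi (s1 b) (s2 b) * chi t (s1 b)) * (Lf b c * residual R c (M t (s1 b)) (v, q))"
        using True c by (simp add: residual_def Lf_rho[OF b c] mult_ac)
      moreover have "chi (s1 b) (s2 b) * chi t (s1 b) = chi t (s2 b)"
        by (cases t; cases "s1 b"; cases "s2 b") (simp_all add: chi_def)
      ultimately show ?thesis by simp
    next
      case False
      then show ?thesis using c p by (simp add: residual_def tau_inj paths_start)
    qed
    then have "(\<Sum>c\<in>arcs R. Lf b (\<rho> c) * residual R (\<rho> c) (M t (s1 b)) (\<tau> v, map \<rho> q)) =
      chi t (s2 b) * (\<Sum>c\<in>arcs R. Lf b c * residual R c (M t (s1 b)) (v, q))"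
      by (simp add: sum_distrib_left)
    then show "act (mres b M t r) (v, q) = chi t r * mres b M t r (v, q)"
      unfolding sum_rho[where h = "\<lambda>c. Lf b c * residual R c (M t (s1 b)) (\<tau> v, map \<rho> q)"]
      by (cases "r = s2 b") (simp_all add: act_path[OF p] mres_def)
  qed (use supp in \<open>simp_all add: supported_scale\<close>)
  fix v q assume "mres b M t r (v, q) \<noteq> 0"
  then have r: "r = s2 b" and "(\<Sum>c\<in>arcs R. Lf b c * residual R c (M t (s1 b)) (v, q)) \<noteq> 0"
    by (simp_all add: mres_def)
  from this(2) obtain c where "c \<in> arcs R" "Lf b c * residual R c (M t (s1 b)) (v, q) \<noteq> 0"
    by (rule sum.not_neutral_contains_not_neutral)
  then have e: "eps b c \<noteq> 0" and v: "v = head R c" and nz: "M t (s1 b) (tail R c, c # q) \<noteq> 0"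
    by (auto simp: Lf_def residual_def split: if_splits)
  show "ok v r" using eps_over(5)[OF b e] by (simp add: r v)
  show "ok (awlast v q) t" using corner_matrixD(4)[OF M nz] by (simp add: v)
qed

lemma Psi_start_cong:
  "(\<And>p. f (sv u s, p) = g (sv u s, p)) \<Longrightarrow> Psi f t s (u, w) = Psi g t s (u, w)"
proof (cases w)
  case (Cons c q)
  assume eq: "\<And>p. f (sv u s, p) = g (sv u s, p)"
  have "of_bool (tail T b = sv u s) * (kf b c * Psi (residual T b f) t (s2 b) (head R c, q)) =
    of_bool (tail T b = sv u s) * (kf b c * Psi (residual T b g) t (s2 b) (head R c, q))" for b
  proof (cases "tail T b = sv u s")
    case True
    then have "residual T b f = residual T b g" by (auto simp: residual_def eq intro!: ext)
    then show ?thesis by simp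
  qed simp
  then show ?thesis unfolding Cons Psi_Cons by (simp only:)
qed (simp add: Psi_Nil)

text \<open>The second orthogonality relation recovers the residual of an entry at \<open>c\<close>
  from the coordinates along the arrows over \<open>c\<close>.\<close>

lemma Psi_Theta:
  assumes "corner_matrix M" shows "Psi (Theta M) = M"
proof (rule ext, rule ext, rule path_ext)
  fix t s u w
  show "Psi (Theta M) t s (u, w) = M t s (u, w)"
    using assms
  proof (induction w arbitrary: u s M)
    case Nil
    note M = Nil.prems
    show ?case
    proof (cases "u \<in> verts R \<and> ok u s")
      case True
      then have p: "(u, []) \<in> quiver_paths R" by simp
      have e: "M t' s (\<tau> u, []) = chi t' s * M t' s (u, [])" for t'
        using corner_matrix_eigen[OF M p] by simp
      show ?thesis
      proof (cases "t = s")
        case ts: True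
        have sv: "sv u s \<in> verts T" "snd (sv u s) = s" "fst (sv u s) = u \<or> fst (sv u s) = \<tau> u"
          using True sv_verts snd_sv fst_sv unfolding ok_def by blast+
        have "M s s (fst (sv u s), []) + M s s (\<tau> (fst (sv u s)), []) = M s s (u, []) + M s s (u, [])"
          using sv(3) e[of s] True by auto
        then show ?thesis using True sv ts two_neq_0 by (simp add: Psi_Nil Theta_Nil half_double)
      next
        case False
        \<comment> \<open>A nonzero value off the diagonal requires both signs at \<open>u\<close>,
          so \<open>u\<close> is fixed. The entry is then equal to \<open>chi t s\<close> times
          itself, and this factor is not \<open>1\<close>.\<close>
        have "M t s (u, []) = 0"
        proof (rule ccontr)
          assume nz: "M t s (u, []) \<noteq> 0"
          then have "ok u t" using corner_matrixD(4)[OF M nz] by simp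
          with True False have "\<tau> u = u" unfolding ok_def by blast
          then have "M t s (u, []) = chi t s * M t s (u, [])" using e[of t] by simp
          with nz False show False by simp
        qed
        with False show ?thesis by (simp add: Psi_Nil)
      qed
    next
      case False
      then have "M t s (u, []) = 0"
        using corner_matrixD(3)[OF M, of t s u "[]"] supported_vert[OF corner_matrixD(1)[OF M]] by blast
      moreover have "Psi (Theta M) t s (u, []) = 0" using False by (auto simp: Psi_Nil)
      ultimately show ?thesis by simp
    qed
  next
    case (Cons c w)
    note M = Cons.prems
    show ?case
    proof (cases "c \<in> arcs R \<and> u = tail R c \<and> ok u s")
      case True
      then have c: "c \<in> arcs R" and u: "u = tail R c" and ok: "ok (tail R c) s" by auto
      have "Psi (Theta M) t s (u, c # w) = (\<Sum>b\<in>arcs T. \<Sum>c'\<in>arcs R.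
          of_bool (tail T b = sv (tail R c) s) * (kf b c * Lf b c') * residual R c' (M t s) (head R c, w))"
        unfolding u Psi_Cons using ok
      proof (simp only: simp_thms of_bool_eq mult_1, intro sum.cong[OF refl])
        fix b assume b: "b \<in> arcs T"
        show "of_bool (tail T b = sv (tail R c) s) *
            (kf b c * Psi (residual T b (Theta M)) t (s2 b) (head R c, w)) =
          (\<Sum>c'\<in>arcs R. of_bool (tail T b = sv (tail R c) s) * (kf b c * Lf b c') *
            residual R c' (M t s) (head R c, w))"
        proof (cases "tail T b = sv (tail R c) s \<and> kf b c \<noteq> 0")
          case True
          then have e: "eps b c \<noteq> 0" by (simp add: kf_def)
          have s1: "s1 b = s" using True c ok by (simp add: snd_sv ok_def)
          have "Psi (residual T b (Theta M)) t (s2 b) (head R c, w) =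
            Psi (Theta (mres b M)) t (s2 b) (head R c, w)"
          proof (rule Psi_start_cong)
            fix p
            have "sv (head R c) (s2 b) = head T b" by (rule eps_over(3)[OF b e, symmetric])
            then show "residual T b (Theta M) (sv (head R c) (s2 b), p) =
              Theta (mres b M) (sv (head R c) (s2 b), p)"
              using b by (simp add: Theta_Cons)
          qed
          also have "\<dots> = mres b M t (s2 b) (head R c, w)"
            by (rule Cons.IH[OF corner_mres[OF M b]])
          also have "\<dots> = (\<Sum>c'\<in>arcs R. Lf b c' * residual R c' (M t s) (head R c, w))"
            by (simp add: mres_def s1)
          finally show ?thesis using True by (simp add: sum_distrib_left mult_ac)
        next
          case False
          then show ?thesis by auto
        qed
      qed
      also have "\<dots> = (\<Sum>c'\<in>arcs R. (\<Sum>b\<in>arcs T. of_bool (tail T b = sv (tail R c) s) * (kf b c * Lf b c'))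
          * residual R c' (M t s) (head R c, w))"
        by (subst sum.swap) (simp add: sum_distrib_right)
      also have "\<dots> = (\<Sum>c'\<in>arcs R. if c' = c then M t s (u, c # w) else 0)"
      proof (intro sum.cong[OF refl])
        fix c' assume c': "c' \<in> arcs R"
        show "(\<Sum>b\<in>arcs T. of_bool (tail T b = sv (tail R c) s) * (kf b c * Lf b c'))
          * residual R c' (M t s) (head R c, w) = (if c' = c then M t s (u, c # w) else 0)"
        proof (cases "head R c = head R c'")
          case True
          show ?thesis unfolding kf_Lf_sum[OF c c' True ok] by (simp add: u)
        qed auto
      qed
      also have "\<dots> = M t s (u, c # w)" using c by (simp add: sum.delta)
      finally show ?thesis .
    next
      case False
      have "M t s (u, c # w) = 0"
        using False corner_matrixD(3)[OF M, of t s u "c # w"]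
          supported_Cons[OF corner_matrixD(1)[OF M], of c u] by blast
      moreover have "Psi (Theta M) t s (u, c # w) = 0"
        using False Psi_nonzero[of "Theta M" t s u "c # w"] paths_Cons by blast
      ultimately show ?thesis by simp
    qed
  qed
qed

section \<open>A closed formula for the coordinates of a matrix\<close>

definition arc_lists :: "nat \<Rightarrow> 'b list set" where
  "arc_lists n = {w. set w \<subseteq> arcs R \<and> length w = n}"

text \<open>Coordinates multiply along a path. Since \<open>map2\<close> truncates, the lists are
  kept at equal length by \<open>arc_lists\<close>.\<close>

definition Lprod :: "'e list \<Rightarrow> 'b list \<Rightarrow> 'k" where
  "Lprod p w = prod_list (map2 Lf p w)"

lemma arc_lists_0 [simp]: "arc_lists 0 = {[]}"
  by (auto simp: arc_lists_def)

lemma finite_arc_lists [simp]: "finite (arc_lists n)"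
  unfolding arc_lists_def by (rule finite_lists_length_eq) simp

lemma sum_arc_lists_Suc: "(\<Sum>w\<in>arc_lists (Suc n). h w) = (\<Sum>c\<in>arcs R. \<Sum>w\<in>arc_lists n. h (c # w))"
proof -
  have "(\<Sum>w\<in>arc_lists (Suc n). h w) = (\<Sum>(c, w)\<in>arcs R \<times> arc_lists n. h (c # w))"
    by (rule sum.reindex_bij_witness[of _ "\<lambda>(c, w). c # w" "\<lambda>w. (hd w, tl w)"])
      (auto simp: arc_lists_def length_Suc_conv)
  then show ?thesis by (simp add: sum.cartesian_product)
qed

lemma Lprod_simps [simp]: "Lprod [] w = 1" "Lprod (b # p) (c # w) = Lf b c * Lprod p w"
  by (simp_all add: Lprod_def)

lemma orbit_sum_start:
  assumes "supported R f" and "tail R c = i \<or> tail R c = \<tau> i"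
  shows "(\<Sum>u\<in>{i, \<tau> i}. f (u, c # w)) = f (tail R c, c # w)"
proof -
  have "(\<Sum>u\<in>{i, \<tau> i}. f (u, c # w)) = (\<Sum>u\<in>{i, \<tau> i}. if u = tail R c then f (tail R c, c # w) else 0)"
    by (intro sum.cong) (auto simp: supported_Cons[OF assms(1)])
  then show ?thesis using assms(2) by (auto simp: sum.delta)
qed

lemma Lf_orbit:
  assumes b: "b \<in> arcs T" and "Lf b c \<noteq> 0"
  shows "tail R c = fst (tail T b) \<or> tail R c = \<tau> (fst (tail T b))"
    "head R c = fst (head T b) \<or> head R c = \<tau> (fst (head T b))"
proof -
  have e: "eps b c \<noteq> 0" using assms(2) by (auto simp: Lf_def)
  note ov = eps_over[OF b e]
  have t: "tail R c \<in> verts R" and h: "head R c \<in> verts R" using ov(1) by auto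
  show "tail R c = fst (tail T b) \<or> tail R c = \<tau> (fst (tail T b))"
    using fst_sv[OF t, of "s1 b"] ov(2,4) t unfolding ok_def by (metis tau_tau)
  show "head R c = fst (head T b) \<or> head R c = \<tau> (fst (head T b))"
    using fst_sv[OF h, of "s2 b"] ov(3,5) h unfolding ok_def by (metis tau_tau)
qed

text \<open>This unrolls the recursion. The division by the size of the orbit at the end
  \<open>y\<close> is the average taken at the trivial path where the recursion stops. For nonempty
  \<open>w\<close> at most one of the two starting vertices \<open>u\<close> contributes, namely the
  tail of the first arrow.\<close>

lemma Theta_formula:
  assumes "(x, p) \<in> quiver_paths T" and "\<And>t s. supported R (M t s)"
    and "y = pre_digraph.awlast T x p"
  shows "Theta M (x, p) = (\<Sum>u\<in>{fst x, \<tau> (fst x)}. \<Sum>w\<in>arc_lists (length p).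
    Lprod p w * M (snd y) (snd x) (u, w)) / nu (fst y)"
  using assms
proof (induction p arbitrary: x M)
  case Nil
  then show ?case by (cases "\<tau> (fst x) = fst x") (simp_all add: Theta_Nil nu_def half_double two_neq_0)
next
  case (Cons b p)
  then have b: "b \<in> arcs T" and x: "x = tail T b" and p: "(head T b, p) \<in> quiver_paths T"
    and y: "y = pre_digraph.awlast T (head T b) p" by auto
  let ?M = "M (snd y) (s1 b)"
  have supp: "\<And>t s. supported R (mres b M t s)"
    unfolding mres_def by (intro supported_scale supported_sum supported_residual Cons.prems(2))
  have IH: "Theta (mres b M) (head T b, p) = (\<Sum>v\<in>{fst (head T b), \<tau> (fst (head T b))}.
      \<Sum>w\<in>arc_lists (length p). Lprod p w * mres b M (snd y) (s2 b) (v, w)) / nu (fst y)"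
    by (rule Cons.IH[OF p supp y])
  have mres: "mres b M t (s2 b) z = (\<Sum>c\<in>arcs R. Lf b c * residual R c (M t (s1 b)) z)" for t z
    by (simp add: mres_def)
  have "Theta M (x, b # p) = (\<Sum>v\<in>{fst (head T b), \<tau> (fst (head T b))}. \<Sum>w\<in>arc_lists (length p).
      Lprod p w * (\<Sum>c\<in>arcs R. Lf b c * residual R c ?M (v, w))) / nu (fst y)"
    using b x by (simp add: Theta_Cons IH mres)
  also have "(\<Sum>v\<in>{fst (head T b), \<tau> (fst (head T b))}. \<Sum>w\<in>arc_lists (length p).
      Lprod p w * (\<Sum>c\<in>arcs R. Lf b c * residual R c ?M (v, w))) =
    (\<Sum>c\<in>arcs R. \<Sum>w\<in>arc_lists (length p). \<Sum>v\<in>{fst (head T b), \<tau> (fst (head T b))}.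
      (Lf b c * Lprod p w) * residual R c ?M (v, w))"
  proof -
    have "(\<Sum>v\<in>V. \<Sum>w\<in>W. P w * (\<Sum>c\<in>C. L c * F c v w)) =
      (\<Sum>c\<in>C. \<Sum>w\<in>W. \<Sum>v\<in>V. (L c * P w) * F c v w)"
      for V :: "'v set" and W :: "'b list set" and C :: "'b set" and P L and F :: "_ \<Rightarrow> _ \<Rightarrow> _ \<Rightarrow> 'k"
    proof -
      have "(\<Sum>v\<in>V. \<Sum>w\<in>W. P w * (\<Sum>c\<in>C. L c * F c v w)) = (\<Sum>v\<in>V. \<Sum>w\<in>W. \<Sum>c\<in>C. (L c * P w) * F c v w)"
        by (simp add: sum_distrib_left mult_ac)
      also have "\<dots> = (\<Sum>w\<in>W. \<Sum>v\<in>V. \<Sum>c\<in>C. (L c * P w) * F c v w)" by (rule sum.swap)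
      also have "\<dots> = (\<Sum>w\<in>W. \<Sum>c\<in>C. \<Sum>v\<in>V. (L c * P w) * F c v w)"
        by (intro sum.cong[OF refl] sum.swap)
      also have "\<dots> = (\<Sum>c\<in>C. \<Sum>w\<in>W. \<Sum>v\<in>V. (L c * P w) * F c v w)" by (rule sum.swap)
      finally show ?thesis .
    qed
    then show ?thesis .
  qed
  also have "\<dots> = (\<Sum>c\<in>arcs R. \<Sum>w\<in>arc_lists (length p). \<Sum>u\<in>{fst x, \<tau> (fst x)}.
      (Lf b c * Lprod p w) * ?M (u, c # w))"
  proof (intro sum.cong[OF refl])
    fix c w assume c: "c \<in> arcs R"
    show "(\<Sum>v\<in>{fst (head T b), \<tau> (fst (head T b))}. (Lf b c * Lprod p w) * residual R c ?M (v, w)) =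
      (\<Sum>u\<in>{fst x, \<tau> (fst x)}. (Lf b c * Lprod p w) * ?M (u, c # w))"
    proof (cases "Lf b c = 0")
      case False
      have "(\<Sum>v\<in>{fst (head T b), \<tau> (fst (head T b))}. residual R c ?M (v, w)) = ?M (tail R c, c # w)"
        using Lf_orbit(2)[OF b False] by (auto simp: residual_def)
      moreover have "(\<Sum>u\<in>{fst x, \<tau> (fst x)}. ?M (u, c # w)) = ?M (tail R c, c # w)"
        by (rule orbit_sum_start[OF Cons.prems(2)]) (use Lf_orbit(1)[OF b False] x in simp)
      ultimately show ?thesis by (simp only: sum_distrib_left[symmetric])
    qed simp
  qed
  also have "\<dots> = (\<Sum>w\<in>arc_lists (Suc (length p)). \<Sum>u\<in>{fst x, \<tau> (fst x)}. Lprod (b # p) w * ?M (u, w))"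
    by (simp only: sum_arc_lists_Suc Lprod_simps)
  also have "\<dots> = (\<Sum>u\<in>{fst x, \<tau> (fst x)}. \<Sum>w\<in>arc_lists (Suc (length p)). Lprod (b # p) w * ?M (u, w))"
    by (rule sum.swap)
  finally show ?case by (simp add: x)
qed

end

section \<open>The skew group algebra as an algebra of matrices\<close>

text \<open>Used twice: with zero weights for the complete path algebra, in which the new potential
  is identified, and with the Ginzburg degrees for the dg algebra.\<close>

locale skew_group = skew_cover R \<tau> \<rho> T \<pi> \<kappa> sv + weighted_involution R \<tau> \<rho> wt + group G
  for R :: "('v, 'b) pre_digraph" and \<tau> \<rho> and T :: "('v \<times> sign, 'e) pre_digraph"
    and \<pi> and \<kappa> :: "'e \<Rightarrow> 'k::field" and sv and wt :: "'b \<Rightarrow> int"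
    and G :: "('g, 'm) monoid_scheme" +
  fixes \<sigma> :: 'g and gact :: "'g \<Rightarrow> ('v, 'b, 'k) pelt \<Rightarrow> ('v, 'b, 'k) pelt" and vact :: "'g \<Rightarrow> 'v \<Rightarrow> 'v"
  assumes carrier_G: "carrier G = {\<one>\<^bsub>G\<^esub>, \<sigma>}" and sigma_neq: "\<sigma> \<noteq> \<one>\<^bsub>G\<^esub>"
    and gact_one: "supported R f \<Longrightarrow> gact \<one>\<^bsub>G\<^esub> f = f"
    and gact_sigma: "gact \<sigma> f = act f"
    and vact_sigma: "vact \<sigma> = \<tau>"
    and sv_fixed: "\<tau> i = i \<Longrightarrow> sv i s = (i, s)"
begin

abbreviation "PA \<equiv> path_algebra R wt :: ('k, ('v, 'b, 'k) pelt) graded_alg"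
abbreviation "BG \<equiv> skew_algebra G gact PA"

lemma sigma_in: "\<sigma> \<in> carrier G" by (simp add: carrier_G)

lemma sigma_sigma: "\<sigma> \<otimes>\<^bsub>G\<^esub> \<sigma> = \<one>\<^bsub>G\<^esub>"
proof -
  have "\<sigma> \<otimes>\<^bsub>G\<^esub> \<sigma> \<in> {\<one>\<^bsub>G\<^esub>, \<sigma>}" using sigma_in m_closed carrier_G by metis
  moreover have "\<sigma> \<otimes>\<^bsub>G\<^esub> \<sigma> \<noteq> \<sigma>" using sigma_in sigma_neq by (metis r_cancel_one')
  ultimately show ?thesis by blast
qed

lemma inv_sigma: "inv\<^bsub>G\<^esub> \<sigma> = \<sigma>"
  using inv_equality[OF sigma_sigma] sigma_in by simp

lemma skew_simps:
  "carrier BG = carrier G \<rightarrow>\<^sub>E carrier PA"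
  "ring.zero BG = (\<lambda>g\<in>carrier G. \<lambda>x. 0)"
  "add BG = (\<lambda>F H. \<lambda>g\<in>carrier G. \<lambda>x. F g x + H g x)"
  "module.smult BG = (\<lambda>c F. \<lambda>g\<in>carrier G. \<lambda>x. c * F g x)"
  by (simp_all add: skew_algebra_def path_algebra_simps)

lemma skew_carrier:
  "F \<in> carrier BG \<longleftrightarrow> F \<in> extensional {\<one>\<^bsub>G\<^esub>, \<sigma>} \<and> F \<one>\<^bsub>G\<^esub> \<in> carrier PA \<and> F \<sigma> \<in> carrier PA"
  by (auto simp: skew_simps carrier_G PiE_def)

lemma skew_supported:
  assumes "F \<in> carrier BG" shows "supported R (F \<one>\<^bsub>G\<^esub>)" "supported R (F \<sigma>)"
  using assms by (auto simp: skew_carrier carrier_path_algebra)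

lemma skew_eqI:
  assumes "F \<in> carrier BG" "H \<in> carrier BG" "F \<one>\<^bsub>G\<^esub> = H \<one>\<^bsub>G\<^esub>" "F \<sigma> = H \<sigma>"
  shows "F = H"
  using assms by (intro extensionalityI[of _ "{\<one>\<^bsub>G\<^esub>, \<sigma>}"]) (auto simp: skew_carrier)

lemma gact_carrier: "f \<in> carrier PA \<Longrightarrow> h \<in> carrier G \<Longrightarrow> gact h f \<in> carrier PA"
  by (auto simp: carrier_G gact_one gact_sigma act_carrier carrier_path_algebra[THEN iffD1])

lemma skew_mult:
  assumes F: "F \<in> carrier BG" and H: "H \<in> carrier BG"
  shows "(F \<otimes>\<^bsub>BG\<^esub> H) \<one>\<^bsub>G\<^esub> =
      (\<lambda>x. pmul R (F \<one>\<^bsub>G\<^esub>) (H \<one>\<^bsub>G\<^esub>) x + pmul R (F \<sigma>) (act (H \<sigma>)) x)"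
    and "(F \<otimes>\<^bsub>BG\<^esub> H) \<sigma> =
      (\<lambda>x. pmul R (F \<one>\<^bsub>G\<^esub>) (H \<sigma>) x + pmul R (F \<sigma>) (act (H \<one>\<^bsub>G\<^esub>)) x)"
    and "F \<otimes>\<^bsub>BG\<^esub> H \<in> carrier BG"
proof -
  have Hc: "H g \<in> carrier PA" "F g \<in> carrier PA" if "g \<in> carrier G" for g
    using F H that by (auto simp: skew_carrier carrier_G)
  have fs: "(\<Oplus>\<^bsub>PA\<^esub>h\<in>carrier G. F h \<otimes>\<^bsub>PA\<^esub> gact h (H (inv\<^bsub>G\<^esub> h \<otimes>\<^bsub>G\<^esub> g))) =
    (\<lambda>x. \<Sum>h\<in>carrier G. pmul R (F h) (gact h (H (inv\<^bsub>G\<^esub> h \<otimes>\<^bsub>G\<^esub> g))) x)" if "g \<in> carrier G" for g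
    unfolding path_algebra_simps
  proof (rule path_finsum)
    show "finite (carrier G)" by (simp add: carrier_G)
    fix h assume "h \<in> carrier G"
    then show "pmul R (F h) (gact h (H (inv\<^bsub>G\<^esub> h \<otimes>\<^bsub>G\<^esub> g))) \<in> carrier PA"
      using that by (intro carrier_pmul Hc gact_carrier m_closed inv_closed)
  qed (simp_all add: path_algebra_simps)
  have val: "(F \<otimes>\<^bsub>BG\<^esub> H) g =
    (\<lambda>x. \<Sum>h\<in>carrier G. pmul R (F h) (gact h (H (inv\<^bsub>G\<^esub> h \<otimes>\<^bsub>G\<^esub> g))) x)" if "g \<in> carrier G" for g
    using that fs[OF that] by (simp add: skew_algebra_def)
  note supp = skew_supported[OF F] skew_supported[OF H]
  show 1: "(F \<otimes>\<^bsub>BG\<^esub> H) \<one>\<^bsub>G\<^esub> =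
      (\<lambda>x. pmul R (F \<one>\<^bsub>G\<^esub>) (H \<one>\<^bsub>G\<^esub>) x + pmul R (F \<sigma>) (act (H \<sigma>)) x)"
    using sigma_neq sigma_in supp by (subst val) (auto simp: carrier_G gact_one gact_sigma inv_sigma)
  show 2: "(F \<otimes>\<^bsub>BG\<^esub> H) \<sigma> =
      (\<lambda>x. pmul R (F \<one>\<^bsub>G\<^esub>) (H \<sigma>) x + pmul R (F \<sigma>) (act (H \<one>\<^bsub>G\<^esub>)) x)"
    using sigma_neq sigma_in supp
    by (subst val) (auto simp: carrier_G gact_one gact_sigma inv_sigma sigma_sigma)
  have "F \<otimes>\<^bsub>BG\<^esub> H \<in> extensional {\<one>\<^bsub>G\<^esub>, \<sigma>}"
    by (simp add: skew_algebra_def carrier_G)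
  then show "F \<otimes>\<^bsub>BG\<^esub> H \<in> carrier BG"
    unfolding skew_carrier 1 2 using F H
    by (auto simp: skew_carrier intro!: carrier_add carrier_pmul act_carrier)
qed

text \<open>The skew group algebra acts on the right by \<open>\<sigma>\<close> with eigenvalues \<open>\<plusminus>1\<close>; decomposing with respect
  to \<open>(1 \<plusminus> \<sigma>) / 2\<close> on both sides identifies it with the two by two matrices whose entry \<open>(t, s)\<close> is
  an eigenvector of \<open>\<sigma>\<close> with eigenvalue \<open>t s\<close>.\<close>

definition toM :: "('g \<Rightarrow> ('v, 'b, 'k) pelt) \<Rightarrow> sign \<Rightarrow> sign \<Rightarrow> ('v, 'b, 'k) pelt" where
  "toM F t s = (\<lambda>x. (F \<one>\<^bsub>G\<^esub> x + chi t s * act (F \<one>\<^bsub>G\<^esub>) x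
     + sign_val s * F \<sigma> x + sign_val t * act (F \<sigma>) x) / 2)"

text \<open>Character orthogonality for the group of order two: the sum of the four entries is twice
  the coefficient of the unit, and their sum weighted by the column sign is twice the coefficient of
  \<sigma>.\<close>

definition fromM :: "(sign \<Rightarrow> sign \<Rightarrow> ('v, 'b, 'k) pelt) \<Rightarrow> 'g \<Rightarrow> ('v, 'b, 'k) pelt" where
  "fromM M = (\<lambda>g\<in>carrier G. \<lambda>x. if g = \<one>\<^bsub>G\<^esub>
     then (M Plus Plus x + M Plus Minus x + M Minus Plus x + M Minus Minus x) / 2
     else (M Plus Plus x - M Plus Minus x + M Minus Plus x - M Minus Minus x) / 2)"

lemma fromM_one: "fromM M \<one>\<^bsub>G\<^esub> = (\<lambda>x. (M Plus Plus x + M Plus Minus x + M Minus Plus x + M Minus Minus x) / 2)"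
  and fromM_sigma: "fromM M \<sigma> = (\<lambda>x. (M Plus Plus x - M Plus Minus x + M Minus Plus x - M Minus Minus x) / 2)"
  using sigma_neq by (simp_all add: fromM_def carrier_G)

definition eigen_matrix :: "(sign \<Rightarrow> sign \<Rightarrow> ('v, 'b, 'k) pelt) \<Rightarrow> bool" where
  "eigen_matrix M \<longleftrightarrow> (\<forall>t s. M t s \<in> carrier PA \<and> act (M t s) = (\<lambda>x. chi t s * M t s x))"

lemma act_divide: "act (\<lambda>x. f x / a) = (\<lambda>x. act f x / a)"
  using act_scale[of "1 / a" f] by simp

lemma toM_carrier: "F \<in> carrier BG \<Longrightarrow> toM F t s \<in> carrier PA"
  using carrier_scale[of "\<lambda>x. F \<one>\<^bsub>G\<^esub> x + chi t s * act (F \<one>\<^bsub>G\<^esub>) x + sign_val s * F \<sigma> x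
    + sign_val t * act (F \<sigma>) x" wt "1 / 2"]
  by (simp add: toM_def skew_carrier carrier_add carrier_scale act_carrier)

lemma toM_eigen: assumes "F \<in> carrier BG" shows "eigen_matrix (toM F)"
proof -
  have "act (toM F t s) = (\<lambda>x. chi t s * toM F t s x)" for t s
    unfolding toM_def act_divide act_add act_scale using skew_supported[OF assms]
    by (cases t; cases s; intro ext; simp add: act_act chi_def algebra_simps)
  with toM_carrier[OF assms] show ?thesis by (auto simp: eigen_matrix_def)
qed

lemma fromM_carrier:
  assumes "\<And>t s. M t s \<in> carrier PA" shows "fromM M \<in> carrier BG"
proof -
  have h: "(\<lambda>x. f x / 2) \<in> carrier PA" if "f \<in> carrier PA" for f
    using carrier_scale[OF that, of "1 / 2"] by simp
  have d: "(\<lambda>x. f x - g x) \<in> carrier PA" if "f \<in> carrier PA" "g \<in> carrier PA" for f g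
    using carrier_add[OF that(1) carrier_scale[OF that(2), of "-1"]] by simp
  show ?thesis unfolding skew_carrier fromM_one fromM_sigma
    by (auto intro!: h carrier_add d assms) (simp add: fromM_def carrier_G)
qed

lemma fromM_toM:
  assumes F: "F \<in> carrier BG" shows "fromM (toM F) = F"
proof (rule skew_eqI[OF fromM_carrier F])
  show "fromM (toM F) \<one>\<^bsub>G\<^esub> = F \<one>\<^bsub>G\<^esub>" "fromM (toM F) \<sigma> = F \<sigma>"
    unfolding fromM_one fromM_sigma toM_def using two_neq_0 four_neq_0 two_powers
    by (simp_all add: chi_def field_simps)
qed (rule toM_carrier[OF F])

lemma toM_fromM:
  assumes "eigen_matrix M" shows "toM (fromM M) = M"
proof (rule ext, rule ext, rule ext)
  fix t s x
  have e: "act (M t s) = (\<lambda>x. chi t s * M t s x)" for t s using assms by (simp add: eigen_matrix_def)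
  have d: "act (\<lambda>x. f x - g x) = (\<lambda>x. act f x - act g x)" for f g :: "('v, 'b, 'k) pelt"
    by (auto simp: pact_def intro!: ext)
  show "toM (fromM M) t s x = M t s x"
    unfolding toM_def fromM_one fromM_sigma act_divide act_add d e
    using two_neq_0 four_neq_0 two_powers by (cases t; cases s; simp add: chi_def field_simps)
qed

lemma toM_inj: "F \<in> carrier BG \<Longrightarrow> H \<in> carrier BG \<Longrightarrow> toM F = toM H \<Longrightarrow> F = H"
  by (metis fromM_toM)

lemma toM_mult:
  assumes F: "F \<in> carrier BG" and H: "H \<in> carrier BG"
  shows "toM (F \<otimes>\<^bsub>BG\<^esub> H) = mmul (toM F) (toM H)"
proof (rule ext, rule ext, rule ext)
  fix t s x
  note supp = skew_supported[OF F] skew_supported[OF H]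
  have d: "pmul R (\<lambda>x. f x / 2) g = (\<lambda>x. pmul R f g x / 2)" "pmul R g (\<lambda>x. f x / 2) = (\<lambda>x. pmul R g f x / 2)"
    for f g :: "('v, 'b, 'k) pelt"
    using pmul_scale_left[of R "1 / 2" f g] pmul_scale_right[of R g "1 / 2" f] by simp_all
  define N where "N F t s = (\<lambda>x. F \<one>\<^bsub>G\<^esub> x + chi t s * act (F \<one>\<^bsub>G\<^esub>) x
     + sign_val s * F \<sigma> x + sign_val t * act (F \<sigma>) x)" for F :: "'g \<Rightarrow> ('v, 'b, 'k) pelt" and t s
  have toM_N: "toM F t s = (\<lambda>x. N F t s x / 2)" for F t s by (simp add: toM_def N_def)
  \<comment> \<open>Clears the denominators, one factor \<open>1 / 2\<close> on the left against two
    on the right; what remains is a bilinear identity, checked for the four pairs of signs.\<close>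
  have half: "a / 2 = b / 2 / 2 + c / 2 / 2" if "2 * a = b + c" for a b c :: 'k
    using that two_neq_0 four_neq_0 by (simp add: add_divide_distrib[symmetric] that[symmetric])
  show "toM (F \<otimes>\<^bsub>BG\<^esub> H) t s x = mmul (toM F) (toM H) t s x"
    unfolding toM_N mmul_def d
  proof (rule half)
    show "2 * N (F \<otimes>\<^bsub>BG\<^esub> H) t s x =
      pmul R (N F t Plus) (N H Plus s) x + pmul R (N F t Minus) (N H Minus s) x"
      unfolding N_def skew_mult[OF F H] pmul_add_left pmul_add_right pmul_scale_left
        pmul_scale_right act_add
      using supp by (cases t; cases s; simp add: act_pmul act_act chi_def algebra_simps)
  qed
qed

text \<open>The matrix of the idempotent that defines the corner, by \<open>skew_ebar_eq\<close>,
  and also the matrix of the unit of the series, by \<open>Psi_pone\<close>.\<close>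

definition ident :: "sign \<Rightarrow> sign \<Rightarrow> ('v, 'b, 'k) pelt" where
  "ident t s = (\<lambda>(u, p). of_bool (t = s \<and> p = [] \<and> u \<in> verts R \<and> ok u s))"

lemma ident_eq: "ident t s = (\<lambda>x. \<Sum>i\<in>verts R. of_bool (t = s \<and> ok i s) * path_elt (i, []) x)"
proof (rule path_ext)
  fix u and p :: "'b list"
  have "(\<Sum>i\<in>verts R. of_bool (t = s \<and> ok i s) * path_elt (i, []) (u, p)) =
    (\<Sum>i\<in>verts R. if i = u then of_bool (t = s \<and> ok u s \<and> p = []) else 0 :: 'k)"
    by (intro sum.cong) (auto simp: path_elt_def)
  then show "ident t s (u, p) = (\<Sum>i\<in>verts R. of_bool (t = s \<and> ok i s) * path_elt (i, []) (u, p))"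
    by (auto simp: ident_def sum.delta)
qed

lemma pmul_ident_left:
  "supported R f \<Longrightarrow> pmul R (ident t s) f (u, w) = of_bool (t = s \<and> ok (awlast u w) s) * f (u, w)"
proof -
  assume f: "supported R f"
  have "pmul R (ident t s) f (u, w) =
      (\<Sum>i\<in>verts R. of_bool (t = s \<and> ok i s) * (if awlast u w = i then f (u, w) else 0))"
    unfolding ident_eq by (simp add: pmul_sum_left pmul_scale_left pmul_vertex_left)
  also have "\<dots> = (\<Sum>i\<in>verts R. if i = awlast u w then of_bool (t = s \<and> ok (awlast u w) s) * f (u, w) else 0)"
    by (intro sum.cong) auto
  also have "\<dots> = of_bool (t = s \<and> ok (awlast u w) s) * f (u, w)"
  proof (cases "f (u, w) = 0")
    case False
    then have "(u, w) \<in> quiver_paths R" using f by (simp add: supported_def)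
    then have "awlast u w \<in> verts R" by (auto simp: quiver_paths_def)
    then show ?thesis by (simp add: sum.delta)
  qed (simp add: sum.delta)
  finally show ?thesis .
qed

lemma pmul_ident_right:
  "supported R f \<Longrightarrow> pmul R f (ident t s) (u, w) = of_bool (t = s \<and> ok u s) * f (u, w)"
proof -
  assume f: "supported R f"
  have "pmul R f (ident t s) (u, w) =
      (\<Sum>i\<in>verts R. of_bool (t = s \<and> ok i s) * (if u = i then f (u, w) else 0))"
    unfolding ident_eq by (simp add: pmul_sum_right pmul_scale_right pmul_vertex_right)
  also have "\<dots> = (\<Sum>i\<in>verts R. if i = u then of_bool (t = s \<and> ok u s) * f (u, w) else 0)"
    by (intro sum.cong) auto
  also have "\<dots> = of_bool (t = s \<and> ok u s) * f (u, w)"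
    by (cases "u \<in> verts R") (simp_all add: sum.delta supported_vert[OF f])
  finally show ?thesis .
qed

text \<open>Multiplication by \<open>ident\<close> on both sides keeps precisely the coefficients
  that \<open>corner_matrix\<close> allows.\<close>

lemma mmul_ident:
  assumes "\<And>t s. supported R (M t s)"
  shows "mmul (mmul ident M) ident t s (u, w) = of_bool (ok (awlast u w) t \<and> ok u s) * M t s (u, w)"
proof -
  have l: "mmul ident M t s = (\<lambda>(u, w). of_bool (ok (awlast u w) t) * M t s (u, w))" for t s
    by (rule path_ext, cases t) (simp_all add: mmul_def pmul_ident_left[OF assms])
  have supp: "supported R (mmul ident M t s)" for t s
    unfolding l using assms by (auto simp: supported_def)
  have "mmul (mmul ident M) ident t s (u, w) = of_bool (ok u s) * mmul ident M t s (u, w)"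
    by (cases s) (simp_all add: mmul_def[of "mmul ident M"] pmul_ident_right[OF supp])
  then show ?thesis by (auto simp: l)
qed

end

section \<open>Transport of dg algebra structures\<close>

text \<open>The axioms are known for \<open>A\<close> and are carried along \<open>f\<close>, so
  that those of a corner of a skew group algebra need no separate verification. The isomorphism of
  the conclusion is the inverse of \<open>f\<close>.\<close>

lemma dg_transport:
  fixes A :: "('k::field, 'a, 'm) dg_alg_scheme" and B :: "('k, 'b, 'n) dg_alg_scheme"
  assumes A: "dg_algebra A" and inj: "inj_on f (carrier A)" and carr: "carrier B = f ` carrier A"
    and mult: "\<And>x y. x \<in> carrier A \<Longrightarrow> y \<in> carrier A \<Longrightarrow> f (x \<otimes>\<^bsub>A\<^esub> y) = f x \<otimes>\<^bsub>B\<^esub> f y"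
    and add: "\<And>x y. x \<in> carrier A \<Longrightarrow> y \<in> carrier A \<Longrightarrow> f (x \<oplus>\<^bsub>A\<^esub> y) = f x \<oplus>\<^bsub>B\<^esub> f y"
    and one: "f \<one>\<^bsub>A\<^esub> = \<one>\<^bsub>B\<^esub>" and zero: "f \<zero>\<^bsub>A\<^esub> = \<zero>\<^bsub>B\<^esub>"
    and smult: "\<And>c x. x \<in> carrier A \<Longrightarrow> f (c \<odot>\<^bsub>A\<^esub> x) = c \<odot>\<^bsub>B\<^esub> f x"
    and grade: "\<And>n. grade B n = f ` grade A n"
    and diff: "\<And>x. x \<in> carrier A \<Longrightarrow> f (diff A x) = diff B (f x)"
  shows "dg_isomorphic B A"
proof -
  note A_smult_mult_left = dg_algebra.smult_mult_left[OF A]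
    and A_smult_mult_right = dg_algebra.smult_mult_right[OF A]
    and A_grade_submodule = dg_algebra.grade_submodule[OF A]
    and A_grade_decomposition = dg_algebra.grade_decomposition[OF A]
    and A_grade_one = dg_algebra.grade_one[OF A]
    and A_grade_mult = dg_algebra.grade_mult[OF A]
    and A_diff_add = dg_algebra.diff_add[OF A]
    and A_diff_smult = dg_algebra.diff_smult[OF A]
    and A_diff_grade = dg_algebra.diff_grade[OF A]
    and A_diff_diff = dg_algebra.diff_diff[OF A]
    and A_diff_mult = dg_algebra.diff_mult[OF A]
  interpret RA: ring A by (rule dg_algebra.axioms(1)[OF A])
  interpret MA: module "ring_of_type_algebra :: 'k ring" A by (rule dg_algebra.axioms(2)[OF A])
  have k: "c \<odot>\<^bsub>A\<^esub> x \<in> carrier A" "(a + b) \<odot>\<^bsub>A\<^esub> x = a \<odot>\<^bsub>A\<^esub> x \<oplus>\<^bsub>A\<^esub> b \<odot>\<^bsub>A\<^esub> x"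
    "(a * b) \<odot>\<^bsub>A\<^esub> x = a \<odot>\<^bsub>A\<^esub> (b \<odot>\<^bsub>A\<^esub> x)" "1 \<odot>\<^bsub>A\<^esub> x = x" if "x \<in> carrier A" for a b c x
    using that MA.smult_closed[of c x] MA.smult_l_distr[of a b x] MA.smult_assoc1[of a b x] MA.smult_one[of x]
    by (simp_all add: ring_of_type_algebra_def)
  have k2: "c \<odot>\<^bsub>A\<^esub> (x \<oplus>\<^bsub>A\<^esub> y) = c \<odot>\<^bsub>A\<^esub> x \<oplus>\<^bsub>A\<^esub> c \<odot>\<^bsub>A\<^esub> y"
    if "x \<in> carrier A" "y \<in> carrier A" for c x y
    using that MA.smult_r_distr[of c x y] by (simp add: ring_of_type_algebra_def)
  have subm: "submodule (grade A n) (ring_of_type_algebra :: 'k ring) A" for n by (rule A_grade_submodule)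
  have sg: "subgroup (grade A n) (add_monoid A)" for n
    using subm[of n] by (rule submodule.axioms(1))
  have sub: "grade A n \<subseteq> carrier A" for n using subgroup.subset[OF sg[of n]] by simp
  have g0: "\<zero>\<^bsub>A\<^esub> \<in> grade A n" for n using subgroup.one_closed[OF sg[of n]] by simp
  have gadd: "x \<oplus>\<^bsub>A\<^esub> y \<in> grade A n" if "x \<in> grade A n" "y \<in> grade A n" for x y n
    using subgroup.m_closed[OF sg[of n] that] by simp
  have gsm: "c \<odot>\<^bsub>A\<^esub> x \<in> grade A n" if "x \<in> grade A n" for x c n
    using submodule.smult_closed[OF subm[of n] _ that, of c] by (simp add: ring_of_type_algebra_def)
  \<comment> \<open>The axioms state closure under the differential for homogeneous elements; the
    general case uses the finite decomposition.\<close>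
  have dcl: "diff A x \<in> carrier A" if x: "x \<in> carrier A" for x
  proof -
    obtain h where h: "\<And>n. h n \<in> grade A n" "finite {n. h n \<noteq> \<zero>\<^bsub>A\<^esub>}"
      "x = (\<Oplus>\<^bsub>A\<^esub>n\<in>{n. h n \<noteq> \<zero>\<^bsub>A\<^esub>}. h n)"
      using A_grade_decomposition[OF x] by (elim ex1E conjE) blast
    have "diff A (\<Oplus>\<^bsub>A\<^esub>n\<in>I. h n) \<in> carrier A" if "finite I" for I
      using that
    proof (induction I rule: finite_induct)
      case empty
      show ?case using A_diff_grade[OF g0[of 0]] sub by auto
    next
      case (insert n I)
      have c: "h n \<in> carrier A" "h \<in> I \<rightarrow> carrier A" using h(1) sub by blast+
      have "diff A (h n) \<in> carrier A" using A_diff_grade[OF h(1)] sub by blast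
      then show ?case using insert c by (simp add: RA.finsum_insert A_diff_add RA.finsum_closed)
    qed
    then show ?thesis using h by blast
  qed
  have iso: "f \<in> ring_iso A B"
    unfolding ring_iso_def bij_betw_def using inj carr
    by (auto intro!: ring_hom_memI simp: mult add one)
  \<comment> \<open>Transport along a ring isomorphism replaces the zero of \<open>B\<close> by the
    image of the zero of \<open>A\<close>, which is the same element.\<close>
  have "ring (B\<lparr>zero := f \<zero>\<^bsub>A\<^esub>\<rparr>)" by (rule RA.ring_iso_imp_img_ring[OF iso])
  then have ring: "ring B" by (simp add: zero)
  interpret RB: ring B by (rule ring)
  have hom: "ring_hom_ring A B f"
    by (rule ring_hom_ringI2[OF RA.ring_axioms ring]) (use iso in \<open>simp add: ring_iso_def\<close>)
  have mod: "module (ring_of_type_algebra :: 'k ring) B"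
  proof (rule moduleI)
    show "cring (ring_of_type_algebra :: 'k ring)" by (rule cring_from_type_algebra)
    show "abelian_group B" by (rule RB.is_abelian_group)
  next
    fix a b x assume "x \<in> carrier B"
    then obtain x' where x: "x = f x'" "x' \<in> carrier A" unfolding carr by auto
    show "a \<odot>\<^bsub>B\<^esub> x \<in> carrier B" using x k(1)[OF x(2)] by (simp add: smult[symmetric] carr)
    show "(a \<oplus>\<^bsub>ring_of_type_algebra\<^esub> b) \<odot>\<^bsub>B\<^esub> x = a \<odot>\<^bsub>B\<^esub> x \<oplus>\<^bsub>B\<^esub> b \<odot>\<^bsub>B\<^esub> x"
      using x k(1,2)[OF x(2)] by (simp add: smult[symmetric] add[symmetric] ring_of_type_algebra_def)
    show "(a \<otimes>\<^bsub>ring_of_type_algebra\<^esub> b) \<odot>\<^bsub>B\<^esub> x = a \<odot>\<^bsub>B\<^esub> (b \<odot>\<^bsub>B\<^esub> x)"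
      using x k(1,3)[OF x(2)] by (simp add: smult[symmetric] ring_of_type_algebra_def)
    show "\<one>\<^bsub>ring_of_type_algebra\<^esub> \<odot>\<^bsub>B\<^esub> x = x"
      using x k(4)[OF x(2)] by (simp add: smult[symmetric] ring_of_type_algebra_def)
    fix y assume "y \<in> carrier B"
    then obtain y' where y: "y = f y'" "y' \<in> carrier A" unfolding carr by auto
    show "a \<odot>\<^bsub>B\<^esub> (x \<oplus>\<^bsub>B\<^esub> y) = a \<odot>\<^bsub>B\<^esub> x \<oplus>\<^bsub>B\<^esub> a \<odot>\<^bsub>B\<^esub> y"
      using x y k(1) k2[OF x(2) y(2)] by (simp add: smult[symmetric] add[symmetric])
  qed
  have dgB: "dg_algebra B"
  proof (intro dg_algebra.intro ring mod dg_algebra_axioms.intro)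
    fix c x y assume "x \<in> carrier B" "y \<in> carrier B"
    then obtain x' y' where xy: "x = f x'" "y = f y'" "x' \<in> carrier A" "y' \<in> carrier A"
      unfolding carr by auto
    then show "(c \<odot>\<^bsub>B\<^esub> x) \<otimes>\<^bsub>B\<^esub> y = c \<odot>\<^bsub>B\<^esub> (x \<otimes>\<^bsub>B\<^esub> y)"
      "x \<otimes>\<^bsub>B\<^esub> (c \<odot>\<^bsub>B\<^esub> y) = c \<odot>\<^bsub>B\<^esub> (x \<otimes>\<^bsub>B\<^esub> y)"
      using A_smult_mult_left[OF xy(3,4)] A_smult_mult_right[OF xy(3,4)]
      by (simp_all add: smult[symmetric] mult[symmetric] k)
    show "diff B (x \<oplus>\<^bsub>B\<^esub> y) = diff B x \<oplus>\<^bsub>B\<^esub> diff B y"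
      using xy A_diff_add[OF xy(3,4)] by (simp add: add[symmetric] diff[symmetric] dcl)
  next
    fix c x assume "x \<in> carrier B"
    then obtain x' where x: "x = f x'" "x' \<in> carrier A" unfolding carr by auto
    then show "diff B (c \<odot>\<^bsub>B\<^esub> x) = c \<odot>\<^bsub>B\<^esub> diff B x"
      using A_diff_smult[OF x(2)] by (simp add: smult[symmetric] diff[symmetric] dcl k)
    show "diff B (diff B x) = \<zero>\<^bsub>B\<^esub>"
      using x A_diff_diff[OF x(2)] zero by (simp add: diff[symmetric] dcl)
  next
    fix n
    show "submodule (grade B n) (ring_of_type_algebra :: 'k ring) B"
    proof (rule module.submoduleI[OF mod])
      show "grade B n \<subseteq> carrier B" using sub by (auto simp: grade carr)
      show "\<zero>\<^bsub>B\<^esub> \<in> grade B n" unfolding grade zero[symmetric] by (rule imageI[OF g0])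
    next
      fix a assume "a \<in> grade B n"
      then obtain x where x: "a = f x" "x \<in> grade A n" unfolding grade by auto
      then have xc: "x \<in> carrier A" using sub by auto
      have "\<ominus>\<^bsub>B\<^esub> a = f (\<ominus>\<^bsub>A\<^esub> x)"
      proof -
        interpret H: ring_hom_ring A B f by (rule hom)
        show ?thesis using x xc by simp
      qed
      moreover have "\<ominus>\<^bsub>A\<^esub> x \<in> grade A n"
        using subgroup.m_inv_closed[OF sg[of n] x(2)] by (simp add: a_inv_def)
      ultimately show "\<ominus>\<^bsub>B\<^esub> a \<in> grade B n" by (simp add: grade)
    next
      fix a b assume "a \<in> grade B n" "b \<in> grade B n"
      then obtain x y where "a = f x" "x \<in> grade A n" "b = f y" "y \<in> grade A n" unfolding grade by auto
      moreover from this have "x \<in> carrier A" "y \<in> carrier A" using sub by auto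
      ultimately show "a \<oplus>\<^bsub>B\<^esub> b \<in> grade B n"
        by (simp add: grade add[symmetric] gadd)
    next
      fix c a assume "a \<in> grade B n"
      then obtain x where "a = f x" "x \<in> grade A n" unfolding grade by auto
      moreover from this have "x \<in> carrier A" using sub by auto
      ultimately show "c \<odot>\<^bsub>B\<^esub> a \<in> grade B n" by (simp add: grade smult[symmetric] gsm)
    qed
  next
    fix x assume "x \<in> carrier B"
    then obtain y where y: "x = f y" "y \<in> carrier A" unfolding carr by auto
    \<comment> \<open>Injectivity identifies the index sets of the nonzero components on both sides,
      so that decompositions correspond.\<close>
    have f0: "f z = \<zero>\<^bsub>B\<^esub> \<longleftrightarrow> z = \<zero>\<^bsub>A\<^esub>" if "z \<in> carrier A" for z
      using inj that unfolding zero[symmetric] by (auto dest: inj_onD)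
    have fsum: "f (\<Oplus>\<^bsub>A\<^esub>n\<in>{n. h n \<noteq> \<zero>\<^bsub>A\<^esub>}. h n) = (\<Oplus>\<^bsub>B\<^esub>n\<in>{n. f (h n) \<noteq> \<zero>\<^bsub>B\<^esub>}. f (h n))"
      if "\<And>n. h n \<in> grade A n" for h :: "int \<Rightarrow> 'a"
    proof -
      interpret H: ring_hom_ring A B f by (rule hom)
      have hc: "h n \<in> carrier A" for n using that sub by blast
      then have "{n. f (h n) \<noteq> \<zero>\<^bsub>B\<^esub>} = {n. h n \<noteq> \<zero>\<^bsub>A\<^esub>}" using f0 by auto
      then show ?thesis using hc by (simp add: H.hom_finsum comp_def Pi_iff)
    qed
    obtain h where h: "\<And>n. h n \<in> grade A n" "finite {n. h n \<noteq> \<zero>\<^bsub>A\<^esub>}"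
      "y = (\<Oplus>\<^bsub>A\<^esub>n\<in>{n. h n \<noteq> \<zero>\<^bsub>A\<^esub>}. h n)"
      and uniq: "\<And>h'. (\<forall>n. h' n \<in> grade A n) \<and> finite {n. h' n \<noteq> \<zero>\<^bsub>A\<^esub>} \<and>
         y = (\<Oplus>\<^bsub>A\<^esub>n\<in>{n. h' n \<noteq> \<zero>\<^bsub>A\<^esub>}. h' n) \<Longrightarrow> h' = h"
      using A_grade_decomposition[OF y(2)] by (elim ex1E conjE) blast
    show "\<exists>!h. (\<forall>n. h n \<in> grade B n) \<and> finite {n. h n \<noteq> \<zero>\<^bsub>B\<^esub>} \<and>
         x = (\<Oplus>\<^bsub>B\<^esub>n\<in>{n. h n \<noteq> \<zero>\<^bsub>B\<^esub>}. h n)"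
    proof (rule ex1I[of _ "\<lambda>n. f (h n)"])
      have "h n \<in> carrier A" for n using h(1) sub by blast
      then have "{n. f (h n) \<noteq> \<zero>\<^bsub>B\<^esub>} = {n. h n \<noteq> \<zero>\<^bsub>A\<^esub>}" using f0 by auto
      then show "(\<forall>n. f (h n) \<in> grade B n) \<and> finite {n. f (h n) \<noteq> \<zero>\<^bsub>B\<^esub>} \<and>
         x = (\<Oplus>\<^bsub>B\<^esub>n\<in>{n. f (h n) \<noteq> \<zero>\<^bsub>B\<^esub>}. f (h n))"
        using h fsum[OF h(1)] y(1) by (auto simp: grade)
    next
      fix h' assume h': "(\<forall>n. h' n \<in> grade B n) \<and> finite {n. h' n \<noteq> \<zero>\<^bsub>B\<^esub>} \<and>
         x = (\<Oplus>\<^bsub>B\<^esub>n\<in>{n. h' n \<noteq> \<zero>\<^bsub>B\<^esub>}. h' n)"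
      then obtain k where k: "\<And>n. k n \<in> grade A n" "\<And>n. h' n = f (k n)"
        unfolding grade image_iff by metis
      have kc: "k n \<in> carrier A" for n using k sub by blast
      have fin: "finite {n. k n \<noteq> \<zero>\<^bsub>A\<^esub>}" using h' f0[OF kc] by (simp add: k(2))
      have "f y = f (\<Oplus>\<^bsub>A\<^esub>n\<in>{n. k n \<noteq> \<zero>\<^bsub>A\<^esub>}. k n)"
        using h' fsum[OF k(1)] y(1) by (simp add: k(2)[abs_def])
      then have "y = (\<Oplus>\<^bsub>A\<^esub>n\<in>{n. k n \<noteq> \<zero>\<^bsub>A\<^esub>}. k n)"
        using inj y(2) kc by (auto dest!: inj_onD intro: RA.finsum_closed)
      then have "k = h" using uniq[of k] k(1) fin by blast
      then show "h' = (\<lambda>n. f (h n))" using k(2) by auto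
    qed
  next
    show "\<one>\<^bsub>B\<^esub> \<in> grade B 0" unfolding grade one[symmetric] by (rule imageI[OF A_grade_one])
  next
    fix x y m n assume "x \<in> grade B m" "y \<in> grade B n"
    then obtain x' y' where xy: "x = f x'" "x' \<in> grade A m" "y = f y'" "y' \<in> grade A n"
      unfolding grade by auto
    then have "x' \<in> carrier A" "y' \<in> carrier A" using sub by auto
    then show "x \<otimes>\<^bsub>B\<^esub> y \<in> grade B (m + n)"
      using xy A_grade_mult[OF xy(2,4)] by (simp add: grade mult[symmetric])
  next
    fix x n assume "x \<in> grade B n"
    then obtain x' where x: "x = f x'" "x' \<in> grade A n" unfolding grade by auto
    then have xc: "x' \<in> carrier A" using sub by auto
    show "diff B x \<in> grade B (n + 1)"
      using x xc A_diff_grade[OF x(2)] by (simp add: grade diff[symmetric])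
    fix y assume "y \<in> carrier B"
    then obtain y' where y: "y = f y'" "y' \<in> carrier A" unfolding carr by auto
    show "diff B (x \<otimes>\<^bsub>B\<^esub> y) = diff B x \<otimes>\<^bsub>B\<^esub> y \<oplus>\<^bsub>B\<^esub> ((-1) powi n) \<odot>\<^bsub>B\<^esub> (x \<otimes>\<^bsub>B\<^esub> diff B y)"
      using x xc y A_diff_mult[OF x(2) y(2)]
      by (simp add: mult[symmetric] diff[symmetric] add[symmetric] smult[symmetric] dcl k)
  qed
  have "inv_into (carrier A) f \<in> ring_iso B A"
    by (rule ring_iso_set_sym[OF RA.ring_axioms iso])
  then have iso: "inv_into (carrier A) f \<in> dg_iso B A"
    unfolding dg_iso_def
  proof (intro CollectI conjI allI ballI)
    fix c x assume "x \<in> carrier B"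
    then obtain y where y: "y \<in> carrier A" "x = f y" using carr by auto
    show "inv_into (carrier A) f (c \<odot>\<^bsub>B\<^esub> x) = c \<odot>\<^bsub>A\<^esub> inv_into (carrier A) f x"
      using y inj k(1) by (simp add: smult[symmetric])
  next
    fix x assume "x \<in> carrier B"
    then obtain y where y: "y \<in> carrier A" "x = f y" using carr by auto
    show "inv_into (carrier A) f (diff B x) = diff A (inv_into (carrier A) f x)"
      using y inj dcl by (simp add: diff[symmetric])
  next
    fix n show "inv_into (carrier A) f ` grade B n \<subseteq> grade A n"
      using sub inj by (auto simp: grade)
  qed
  show ?thesis using A dgB iso by (auto simp: dg_isomorphic_def)
qed

section \<open>Series on the new quiver as the corner of the skew group algebra\<close>

context skew_group begin

abbreviation "PT \<equiv> path_algebra T (\<lambda>b. wt (\<pi> b)) :: ('k, ('v \<times> sign, 'e, 'k) pelt) graded_alg"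

definition skew_corner :: "('g \<Rightarrow> ('v, 'b, 'k) pelt) set" where
  "skew_corner = {F \<in> carrier BG. corner_matrix (toM F)}"

definition Upsilon :: "('v \<times> sign, 'e, 'k) pelt \<Rightarrow> 'g \<Rightarrow> ('v, 'b, 'k) pelt" where
  "Upsilon f = fromM (Psi f)"

lemma wt_eps:
  assumes "b \<in> arcs T" "eps b c \<noteq> 0" shows "wt c = wt (\<pi> b)"
  using eps_nonzero[OF assms(2)] wt_rho[OF pi_arcs[OF assms(1)]] by auto

text \<open>An arrow of \<open>T\<close> has the weight of the arrows below it, so passing to
  matrices preserves length and degree. The degree gives compatibility with the gradings, the length
  is used in \<open>Upsilon_length_cong\<close>.\<close>

lemma Psi_nonzero_path:
  assumes "Psi f t s (u, w) \<noteq> 0"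
  obtains p where "f (sv u s, p) \<noteq> 0" "length p = length w"
    "sum_list (map (\<lambda>b. wt (\<pi> b)) p) = sum_list (map wt w)"
proof -
  have "\<exists>p. f (sv u s, p) \<noteq> 0 \<and> length p = length w \<and>
    sum_list (map (\<lambda>b. wt (\<pi> b)) p) = sum_list (map wt w)"
    using assms
  proof (induction w arbitrary: u s f)
    case Nil
    then show ?case by (intro exI[of _ "[]"]) (auto simp: Psi_Nil)
  next
    case (Cons c w)
    have "(\<Sum>b\<in>arcs T. of_bool (tail T b = sv u s) *
        (kf b c * Psi (residual T b f) t (s2 b) (head R c, w))) \<noteq> 0"
      using Cons.prems unfolding Psi_Cons by (metis mult_zero_right)
    then obtain b where b: "b \<in> arcs T"
      "of_bool (tail T b = sv u s) * (kf b c * Psi (residual T b f) t (s2 b) (head R c, w)) \<noteq> 0"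
      by (rule sum.not_neutral_contains_not_neutral)
    then have e: "eps b c \<noteq> 0" and nz: "Psi (residual T b f) t (s2 b) (head R c, w) \<noteq> 0"
      and tl: "tail T b = sv u s" by (auto simp: kf_def)
    obtain p where p: "residual T b f (sv (head R c) (s2 b), p) \<noteq> 0" "length p = length w"
      "sum_list (map (\<lambda>b. wt (\<pi> b)) p) = sum_list (map wt w)"
      using Cons.IH[OF nz] by blast
    have "f (sv u s, b # p) \<noteq> 0" using p(1) tl by (auto simp: residual_def split: if_splits)
    then show ?case using p(2,3) wt_eps[OF b(1) e] by (intro exI[of _ "b # p"]) simp
  qed
  then show thesis using that by blast
qed

lemma Theta_nonzero_path:
  assumes "Theta M (x, p) \<noteq> 0"
  obtains t s u w where "M t s (u, w) \<noteq> 0" "length p = length w"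
    "sum_list (map (\<lambda>b. wt (\<pi> b)) p) = sum_list (map wt w)"
proof -
  have "\<exists>t s u w. M t s (u, w) \<noteq> 0 \<and> length p = length w \<and>
    sum_list (map (\<lambda>b. wt (\<pi> b)) p) = sum_list (map wt w)"
    using assms
  proof (induction p arbitrary: x M)
    case Nil
    then have "M (snd x) (snd x) (fst x, []) \<noteq> 0 \<or> M (snd x) (snd x) (\<tau> (fst x), []) \<noteq> 0"
      by (auto simp: Theta_Nil)
    then show ?case by fastforce
  next
    case (Cons b p)
    then have b: "b \<in> arcs T" and nz: "Theta (mres b M) (head T b, p) \<noteq> 0"
      by (auto simp: Theta_Cons)
    from Cons.IH[OF nz] obtain t r v w where *: "mres b M t r (v, w) \<noteq> 0" "length p = length w"
      "sum_list (map (\<lambda>b. wt (\<pi> b)) p) = sum_list (map wt w)" by blast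
    then have "(\<Sum>c\<in>arcs R. Lf b c * residual R c (M t (s1 b)) (v, w)) \<noteq> 0" by (auto simp: mres_def)
    then obtain c where c: "c \<in> arcs R" "Lf b c * residual R c (M t (s1 b)) (v, w) \<noteq> 0"
      by (rule sum.not_neutral_contains_not_neutral)
    then have e: "eps b c \<noteq> 0" and "M t (s1 b) (tail R c, c # w) \<noteq> 0"
      by (auto simp: Lf_def residual_def split: if_splits)
    then show ?case using *(2,3) wt_eps[OF b e]
      by (intro exI[of _ t] exI[of _ "s1 b"] exI[of _ "tail R c"] exI[of _ "c # w"]) simp
  qed
  then show thesis using that by blast
qed

lemma Psi_carrier: assumes "f \<in> carrier PT" shows "Psi f t s \<in> carrier PA"
proof -
  let ?d = "path_degree (\<lambda>b. wt (\<pi> b)) ` {x. f x \<noteq> 0}"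
  have "path_degree wt ` {x. Psi f t s x \<noteq> 0} \<subseteq> ?d"
  proof clarify
    fix u w assume "Psi f t s (u, w) \<noteq> 0"
    then obtain p where "f (sv u s, p) \<noteq> 0" "sum_list (map (\<lambda>b. wt (\<pi> b)) p) = sum_list (map wt w)"
      by (rule Psi_nonzero_path)
    then show "path_degree wt (u, w) \<in> ?d"
      by (intro image_eqI[of _ _ "(sv u s, p)"]) (simp_all add: path_degree_def)
  qed
  moreover have "finite ?d" using assms by (simp add: T.carrier_path_algebra)
  ultimately show ?thesis by (auto simp: carrier_path_algebra intro: finite_subset)
qed

lemma Psi_grade: assumes "f \<in> grade PT n" shows "Psi f t s \<in> grade PA n"
proof -
  have "path_degree wt (u, w) = n" if nz: "Psi f t s (u, w) \<noteq> 0" for u w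
  proof -
    obtain p where p: "f (sv u s, p) \<noteq> 0" "sum_list (map (\<lambda>b. wt (\<pi> b)) p) = sum_list (map wt w)"
      using Psi_nonzero_path[OF nz] by blast
    then have "path_degree (\<lambda>b. wt (\<pi> b)) (sv u s, p) = n"
      using assms unfolding T.grade_path_algebra by blast
    then show ?thesis using p(2) by (simp add: path_degree_def)
  qed
  then show ?thesis by (auto simp: grade_path_algebra)
qed

lemma Theta_carrier: assumes "\<And>t s. M t s \<in> carrier PA" shows "Theta M \<in> carrier PT"
proof -
  let ?D = "\<Union>t\<in>signs. \<Union>s\<in>signs. path_degree wt ` {x. M t s x \<noteq> 0}"
  have "path_degree (\<lambda>b. wt (\<pi> b)) ` {x. Theta M x \<noteq> 0} \<subseteq> ?D"
  proof clarify
    fix x p assume "Theta M ((x :: 'v \<times> sign), p) \<noteq> 0"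
    then obtain t s u w where "M t s (u, w) \<noteq> 0" "sum_list (map (\<lambda>b. wt (\<pi> b)) p) = sum_list (map wt w)"
      by (rule Theta_nonzero_path)
    then have "path_degree (\<lambda>b. wt (\<pi> b)) (x, p) \<in> path_degree wt ` {x. M t s x \<noteq> 0}"
      by (intro image_eqI[of _ _ "(u, w)"]) (simp_all add: path_degree_def)
    then show "path_degree (\<lambda>b. wt (\<pi> b)) (x, p) \<in> ?D" using signs_cases by blast
  qed
  moreover have "finite ?D" using assms by (simp add: carrier_path_algebra)
  ultimately show ?thesis by (auto simp: T.carrier_path_algebra intro: finite_subset)
qed

lemma Theta_grade: assumes "\<And>t s. M t s \<in> grade PA n" shows "Theta M \<in> grade PT n"
proof -
  have "path_degree (\<lambda>b. wt (\<pi> b)) (x, p) = n" if nz: "Theta M (x, p) \<noteq> 0" for x p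
  proof -
    obtain t s u w where w: "M t s (u, w) \<noteq> 0" "length p = length w"
      "sum_list (map (\<lambda>b. wt (\<pi> b)) p) = sum_list (map wt w)"
      by (rule Theta_nonzero_path[OF nz])
    have "path_degree wt (u, w) = n"
      using assms[of t s] w(1) unfolding grade_path_algebra by blast
    then show ?thesis using w(3) by (simp add: path_degree_def)
  qed
  then show ?thesis by (auto simp: T.grade_path_algebra)
qed

lemma Psi_eigen_matrix: "f \<in> carrier PT \<Longrightarrow> eigen_matrix (Psi f)"
  by (simp add: eigen_matrix_def Psi_carrier Psi_eigen)

lemma toM_Upsilon: "f \<in> carrier PT \<Longrightarrow> toM (Upsilon f) = Psi f"
  unfolding Upsilon_def by (rule toM_fromM[OF Psi_eigen_matrix])

lemma Upsilon_carrier: "f \<in> carrier PT \<Longrightarrow> Upsilon f \<in> carrier BG"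
  unfolding Upsilon_def by (intro fromM_carrier Psi_carrier)

lemma Upsilon_Theta_toM: "F \<in> skew_corner \<Longrightarrow> Upsilon (Theta (toM F)) = F"
  unfolding Upsilon_def skew_corner_def by (simp add: Psi_Theta fromM_toM)

lemma bij_Upsilon: "bij_betw Upsilon (carrier PT) skew_corner"
proof (rule bij_betw_byWitness[of _ "\<lambda>F. Theta (toM F)"])
  show "\<forall>f\<in>carrier PT. Theta (toM (Upsilon f)) = f"
    by (simp add: toM_Upsilon Theta_Psi T.carrier_path_algebra[THEN iffD1])
  show "\<forall>F\<in>skew_corner. Upsilon (Theta (toM F)) = F" by (simp add: Upsilon_Theta_toM)
  show "Upsilon ` carrier PT \<subseteq> skew_corner"
    by (auto simp: skew_corner_def Upsilon_carrier toM_Upsilon corner_Psi)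
  show "(\<lambda>F. Theta (toM F)) ` skew_corner \<subseteq> carrier PT"
    by (auto simp: skew_corner_def intro!: Theta_carrier toM_carrier)
qed

lemma Upsilon_mult:
  assumes "f \<in> carrier PT" "g \<in> carrier PT"
  shows "Upsilon (pmul T f g) = Upsilon f \<otimes>\<^bsub>BG\<^esub> Upsilon g"
proof (rule toM_inj)
  note c = Upsilon_carrier[OF assms(1)] Upsilon_carrier[OF assms(2)]
  show "Upsilon (pmul T f g) \<in> carrier BG" by (intro Upsilon_carrier T.carrier_pmul assms)
  show "Upsilon f \<otimes>\<^bsub>BG\<^esub> Upsilon g \<in> carrier BG" by (rule skew_mult(3)[OF c])
  have "supported T f" "supported T g" using assms by (simp_all add: T.carrier_path_algebra)
  then show "toM (Upsilon (pmul T f g)) = toM (Upsilon f \<otimes>\<^bsub>BG\<^esub> Upsilon g)"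
    by (simp add: toM_Upsilon T.carrier_pmul assms toM_mult[OF c] Psi_pmul)
qed

lemma Psi_pone: "Psi (pone T) = ident"
proof (rule ext, rule ext, rule path_ext)
  fix t s u w
  show "Psi (pone T) t s (u, w) = ident t s (u, w)"
    by (cases w) (auto simp: Psi_Nil Psi_Cons ident_def ok_def sv_verts)
qed

lemma ident_carrier: "ident t s \<in> carrier PA"
  using Psi_carrier[OF T.carrier_pone] by (simp add: Psi_pone)

lemma eigen_ident: "eigen_matrix ident"
  using Psi_eigen_matrix[OF T.carrier_pone] by (simp add: Psi_pone)

text \<open>In terms of matrices, \<open>E F E\<close> multiplies each coefficient of
  \<open>F\<close> by an indicator. The corner thus consists of the elements that this operation
  leaves unchanged.\<close>

lemma corner_carrier:
  assumes E: "E \<in> carrier BG" "toM E = ident"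
  shows "{E \<otimes>\<^bsub>BG\<^esub> F \<otimes>\<^bsub>BG\<^esub> E | F. F \<in> carrier BG} = skew_corner"
proof
  have val: "toM (E \<otimes>\<^bsub>BG\<^esub> F \<otimes>\<^bsub>BG\<^esub> E) t s (u, w) =
      of_bool (ok (awlast u w) t \<and> ok u s) * toM F t s (u, w)"
    "E \<otimes>\<^bsub>BG\<^esub> F \<otimes>\<^bsub>BG\<^esub> E \<in> carrier BG" if F: "F \<in> carrier BG" for F t s u w
  proof -
    show "E \<otimes>\<^bsub>BG\<^esub> F \<otimes>\<^bsub>BG\<^esub> E \<in> carrier BG" by (intro skew_mult(3) E F)
    have supp: "supported R (toM F t s)" for t s
      using toM_carrier[OF F] by (simp add: carrier_path_algebra)
    show "toM (E \<otimes>\<^bsub>BG\<^esub> F \<otimes>\<^bsub>BG\<^esub> E) t s (u, w) =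
      of_bool (ok (awlast u w) t \<and> ok u s) * toM F t s (u, w)"
      by (simp add: toM_mult E F skew_mult(3) mmul_ident[OF supp] del: of_bool_conj)
  qed
  show "{E \<otimes>\<^bsub>BG\<^esub> F \<otimes>\<^bsub>BG\<^esub> E | F. F \<in> carrier BG} \<subseteq> skew_corner"
  proof clarify
    fix F assume F: "F \<in> carrier BG"
    let ?E = "E \<otimes>\<^bsub>BG\<^esub> F \<otimes>\<^bsub>BG\<^esub> E"
    have "eigen_matrix (toM ?E)" by (rule toM_eigen[OF val(2)[OF F]])
    moreover have "ok u s" "ok (awlast u w) t" if "toM ?E t s (u, w) \<noteq> 0" for t s u w
      using that unfolding val(1)[OF F] by (auto split: if_splits)
    ultimately show "?E \<in> skew_corner"
      unfolding skew_corner_def corner_matrix_def eigen_matrix_def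
      using val(2)[OF F] by (auto simp: carrier_path_algebra)
  qed
  show "skew_corner \<subseteq> {E \<otimes>\<^bsub>BG\<^esub> F \<otimes>\<^bsub>BG\<^esub> E | F. F \<in> carrier BG}"
  proof
    fix F assume "F \<in> skew_corner"
    then have F: "F \<in> carrier BG" and M: "corner_matrix (toM F)" by (auto simp: skew_corner_def)
    have "toM (E \<otimes>\<^bsub>BG\<^esub> F \<otimes>\<^bsub>BG\<^esub> E) = toM F"
    proof (rule ext, rule ext, rule path_ext)
      fix t s u w
      show "toM (E \<otimes>\<^bsub>BG\<^esub> F \<otimes>\<^bsub>BG\<^esub> E) t s (u, w) = toM F t s (u, w)"
        unfolding val(1)[OF F] using corner_matrixD(3,4)[OF M, of t s u w] by (cases "toM F t s (u, w) = 0") auto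
    qed
    then have "E \<otimes>\<^bsub>BG\<^esub> F \<otimes>\<^bsub>BG\<^esub> E = F" by (rule toM_inj[OF val(2)[OF F] F])
    then show "F \<in> {E \<otimes>\<^bsub>BG\<^esub> F \<otimes>\<^bsub>BG\<^esub> E | F. F \<in> carrier BG}" using F by (intro CollectI exI[of _ F]) simp
  qed
qed

text \<open>The skew group algebra and its dg version are different records with the same additive
  structure; the idempotent is defined by sums in either of them.\<close>

lemma skew_finsum:
  fixes A :: "('g \<Rightarrow> ('v, 'b, 'k) pelt, 'z) ring_scheme"
  assumes A: "carrier A = carrier BG" "add A = add BG" "ring.zero A = ring.zero BG"
    and "finite I" "\<And>i. i \<in> I \<Longrightarrow> h i \<in> carrier BG"
  shows "(\<Oplus>\<^bsub>A\<^esub>i\<in>I. h i) = (\<lambda>g\<in>carrier G. \<lambda>x. \<Sum>i\<in>I. h i g x)"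
proof -
  have cl: "(\<lambda>g\<in>carrier G. \<lambda>x. F g x + H g x) \<in> carrier BG" if "F \<in> carrier BG" "H \<in> carrier BG" for F H
    using that by (auto simp: skew_simps carrier_add PiE_iff)
  interpret abelian_monoid A
  proof (rule abelian_monoidI; (unfold A)?)
    fix F H K assume F: "F \<in> carrier BG" and H: "H \<in> carrier BG" and K: "K \<in> carrier BG"
    show "F \<oplus>\<^bsub>BG\<^esub> H \<in> carrier BG" using cl[OF F H] by (simp add: skew_simps)
    show "F \<oplus>\<^bsub>BG\<^esub> H \<oplus>\<^bsub>BG\<^esub> K = F \<oplus>\<^bsub>BG\<^esub> (H \<oplus>\<^bsub>BG\<^esub> K)"
      by (auto simp: skew_simps add.assoc intro!: ext)
    show "F \<oplus>\<^bsub>BG\<^esub> H = H \<oplus>\<^bsub>BG\<^esub> F" by (auto simp: skew_simps add.commute intro!: ext)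
    show "\<zero>\<^bsub>BG\<^esub> \<oplus>\<^bsub>BG\<^esub> F = F" using F by (auto simp: skew_simps PiE_iff extensional_def intro!: ext)
  qed (simp add: skew_simps carrier_zero)
  show ?thesis using assms(4,5)
  proof (induction I rule: finite_induct)
    case empty
    then show ?case by (simp add: A skew_simps)
  next
    case (insert i I)
    then show ?case by (simp add: finsum_insert A Pi_iff) (auto simp: skew_simps intro!: ext)
  qed
qed

end

lemma path_elt_Cons [simp]: "path_elt (i, []) (u, c # p) = 0"
  by (simp add: path_elt_def)

lemma path_elt_Nil: "path_elt (i, []) (u, []) = of_bool (u = i)"
  by (simp add: path_elt_def)

context skew_group begin

lemma Upsilon_add: "Upsilon (\<lambda>x. f x + g x) = Upsilon f \<oplus>\<^bsub>BG\<^esub> Upsilon g"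
  using half_double two_neq_0
  by (auto simp: Upsilon_def fromM_def skew_simps Psi_add add_divide_distrib diff_divide_distrib
      intro!: ext)

lemma Upsilon_smult: "Upsilon (\<lambda>x. c * f x) = c \<odot>\<^bsub>BG\<^esub> Upsilon f"
  by (auto simp: Upsilon_def fromM_def skew_simps Psi_scale algebra_simps intro!: ext)

lemma Upsilon_zero: "Upsilon (\<lambda>x. 0) = \<zero>\<^bsub>BG\<^esub>"
  by (auto simp: Upsilon_def fromM_def skew_simps intro!: ext)

lemma grade_half: "f \<in> grade PA n \<Longrightarrow> (\<lambda>x. f x / 2) \<in> grade PA n"
  using two_neq_0 by (auto simp: grade_path_algebra supported_def)

lemma grade_add: "f \<in> grade PA n \<Longrightarrow> g \<in> grade PA n \<Longrightarrow> (\<lambda>x. f x + g x) \<in> grade PA n"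
  unfolding grade_path_algebra using supported_add by (metis add_0)

lemma grade_scale: "f \<in> grade PA n \<Longrightarrow> (\<lambda>x. c * f x) \<in> grade PA n"
  by (auto simp: grade_path_algebra supported_scale)

lemma Upsilon_grade:
  "Upsilon ` grade PT n = (carrier G \<rightarrow>\<^sub>E grade PA n) \<inter> skew_corner"
proof
  show "Upsilon ` grade PT n \<subseteq> (carrier G \<rightarrow>\<^sub>E grade PA n) \<inter> skew_corner"
  proof
    fix F assume "F \<in> Upsilon ` grade PT n"
    then obtain f where F: "F = Upsilon f" and f: "f \<in> grade PT n" by auto
    have d: "(\<lambda>x. f x - g x) \<in> grade PA n" if "f \<in> grade PA n" "g \<in> grade PA n" for f g
      using grade_add[OF that(1) grade_scale[OF that(2), of "-1"]] by simp
    have "fromM (Psi f) \<one>\<^bsub>G\<^esub> \<in> grade PA n" "fromM (Psi f) \<sigma> \<in> grade PA n"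
      unfolding fromM_one fromM_sigma by (intro grade_half grade_add d Psi_grade f)+
    then have "F \<in> carrier G \<rightarrow>\<^sub>E grade PA n"
      by (auto simp: F Upsilon_def carrier_G PiE_iff) (simp add: fromM_def carrier_G)
    moreover have "F \<in> skew_corner"
      using bij_Upsilon f T.grade_subset unfolding F bij_betw_def by blast
    ultimately show "F \<in> (carrier G \<rightarrow>\<^sub>E grade PA n) \<inter> skew_corner" by blast
  qed
  show "(carrier G \<rightarrow>\<^sub>E grade PA n) \<inter> skew_corner \<subseteq> Upsilon ` grade PT n"
  proof
    fix F assume F: "F \<in> (carrier G \<rightarrow>\<^sub>E grade PA n) \<inter> skew_corner"
    then have g: "F \<one>\<^bsub>G\<^esub> \<in> grade PA n" "F \<sigma> \<in> grade PA n" by (auto simp: carrier_G)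
    have "toM F t s \<in> grade PA n" for t s
      unfolding toM_def by (intro grade_half grade_add grade_scale act_grade g)
    then have "Theta (toM F) \<in> grade PT n" by (rule Theta_grade)
    then show "F \<in> Upsilon ` grade PT n" using Upsilon_Theta_toM[of F] F by (metis IntD2 image_eqI)
  qed
qed

lemma skew_idem_value:
  fixes B :: "('k, ('v, 'b, 'k) pelt, 'n) module_scheme"
  assumes "module.smult B = (\<lambda>c f x. c * f x)" "add B = (\<lambda>f g x. f x + g x)"
  shows "skew_idem G B vact \<sigma> (i, s) = (\<lambda>g\<in>carrier G. \<lambda>x.
    (of_bool (g = \<one>\<^bsub>G\<^esub>) + sign_val s * of_bool (g = \<sigma>)) *
      (1 / 2 * (if \<tau> i = i then path_elt (i, []) x else path_elt (i, []) x + path_elt (\<tau> i, []) x)))"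
  by (auto simp: skew_idem_def skew_tensor_def grp_elt_def assms vact_sigma of_bool_def intro!: ext)

lemma skew_idem_carrier:
  fixes B :: "('k, ('v, 'b, 'k) pelt, 'n) module_scheme"
  assumes B: "module.smult B = (\<lambda>c f x. c * f x)" "add B = (\<lambda>f g x. f x + g x)"
    and i: "i \<in> verts R"
  shows "skew_idem G B vact \<sigma> (i, s) \<in> carrier BG"
proof -
  have "(\<lambda>x. if \<tau> i = i then path_elt (i, []) x else path_elt (i, []) x + path_elt (\<tau> i, []) x) \<in> carrier PA"
    by (cases "\<tau> i = i") (simp_all add: carrier_vertex carrier_add i)
  then show ?thesis
    unfolding skew_idem_value[OF B] skew_simps restrict_PiE_iff by (intro ballI carrier_scale)
qed

lemma toM_skew_idem:
  fixes B :: "('k, ('v, 'b, 'k) pelt, 'n) module_scheme"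
  assumes B: "module.smult B = (\<lambda>c f x. c * f x)" "add B = (\<lambda>f g x. f x + g x)"
    and x: "x \<in> verts T"
  shows "toM (skew_idem G B vact \<sigma> x) = Psi (path_elt (x, []))"
proof (rule ext, rule ext, rule path_ext)
  obtain i s0 where xi: "x = (i, s0)" by (cases x)
  have i: "i \<in> verts R" "ok i s0" "sv i s0 = (i, s0)"
    using verts_T[OF x] by (auto simp: xi ok_def)
  define f :: "('v, 'b, 'k) pelt" where "f = (\<lambda>x. 1 / 2 * (if \<tau> i = i then path_elt (i, []) x
    else path_elt (i, []) x + path_elt (\<tau> i, []) x))"
  have F: "skew_idem G B vact \<sigma> x \<one>\<^bsub>G\<^esub> = f" "skew_idem G B vact \<sigma> x \<sigma> = (\<lambda>x. sign_val s0 * f x)"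
    unfolding xi skew_idem_value[OF B] f_def using sigma_neq by (auto simp: carrier_G)
  have actf: "act f = f"
  proof (cases "\<tau> i = i")
    case True
    then have f: "f = (\<lambda>x. 1 / 2 * path_elt (i, []) x)" by (simp add: f_def)
    show ?thesis unfolding f act_scale act_vertex[OF i(1)] True ..
  next
    case False
    then have f: "f = (\<lambda>x. 1 / 2 * (path_elt (i, []) x + path_elt (\<tau> i, []) x))" by (simp add: f_def)
    have "act f = (\<lambda>x. 1 / 2 * (path_elt (\<tau> i, []) x + path_elt (i, []) x))"
      unfolding f act_scale act_add act_vertex[OF i(1)] act_vertex[OF tau_verts[OF i(1)]] tau_tau[OF i(1)] ..
    then show ?thesis unfolding f by (simp only: add.commute)
  qed
  fix t s u w
  \<comment> \<open>The sign factor is the product of \<open>1 + t s0\<close> and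
    \<open>1 + s s0\<close>. It vanishes unless \<open>t = s = s0\<close>, where it equals
    \<open>4\<close> and turns the half in \<open>f\<close> into \<open>1\<close>.\<close>
  have val: "toM (skew_idem G B vact \<sigma> x) t s (u, w) =
      (1 + chi t s + sign_val s * sign_val s0 + sign_val t * sign_val s0) * f (u, w) / 2"
    unfolding toM_def F act_scale actf by (simp add: algebra_simps)
  show "toM (skew_idem G B vact \<sigma> x) t s (u, w) = Psi (path_elt (x, [])) t s (u, w)"
  proof (cases w)
    case (Cons c q)
    have "residual T b (path_elt (x, [])) = (\<lambda>x. 0 :: 'k)" for b by (rule T.residual_vertex)
    then show ?thesis unfolding val unfolding Cons Psi_Cons by (simp add: f_def)
  next
    case Nil
    show ?thesis
    proof (cases "\<tau> i = i")
      case True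
      have "sv u s = x \<longleftrightarrow> u = i \<and> s = s0" if "u \<in> verts R" "ok u s"
      proof
        assume sv: "sv u s = x"
        have "u = i" using fst_sv[of u s] that sv True i by (auto simp: xi ok_def)
        then show "u = i \<and> s = s0" using snd_sv[of u s] that sv by (auto simp: xi ok_def)
      qed (use i xi in auto)
      then have "Psi (path_elt (x, [])) t s (u, []) = of_bool (t = s \<and> u = i \<and> s = s0)"
        using i True by (auto simp: Psi_Nil path_elt_Nil ok_def)
      then show ?thesis unfolding val unfolding Nil using True two_neq_0 four_neq_0
        by (cases t; cases s; cases s0) (auto simp: chi_def f_def path_elt_Nil)
    next
      case False
      then have s0: "s0 = Plus" using i(2) by (simp add: ok_def)
      have "sv u s = x \<longleftrightarrow> s = Plus \<and> (u = i \<or> u = \<tau> i)" if "u \<in> verts R" "ok u s"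
      proof
        assume sv: "sv u s = x"
        have "u = i \<or> u = \<tau> i" using fst_sv[of u s] that sv i by (auto simp: xi ok_def)
        then show "s = Plus \<and> (u = i \<or> u = \<tau> i)" using snd_sv[of u s] that sv s0 by (auto simp: xi ok_def)
      qed (use i xi s0 in \<open>auto simp: sv_tau\<close>)
      then have "Psi (path_elt (x, [])) t s (u, []) = of_bool (t = Plus \<and> s = Plus \<and> (u = i \<or> u = \<tau> i))"
        using i False by (auto simp: Psi_Nil path_elt_Nil ok_def)
      then show ?thesis unfolding val unfolding Nil s0 using False two_neq_0 four_neq_0
        by (cases t; cases s) (auto simp: chi_def f_def path_elt_Nil)
    qed
  qed
qed

text \<open>All terms are supported on trivial paths, so two coefficients at each vertex have to be
  compared. The records \<open>B\<close> and \<open>A\<close> are left open because the same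
  idempotent is formed over the path algebra and over the Ginzburg algebra.\<close>

lemma skew_ebar_eq:
  fixes B :: "('k, ('v, 'b, 'k) pelt, 'n) module_scheme"
    and A :: "('k, 'g \<Rightarrow> ('v, 'b, 'k) pelt, 'l) module_scheme"
  assumes B: "module.smult B = (\<lambda>c f x. c * f x)" "add B = (\<lambda>f g x. f x + g x)"
    and A: "carrier A = carrier BG" "add A = add BG" "ring.zero A = ring.zero BG"
    and Q0: "verts Q0 = verts R"
    and oW: "oW \<subseteq> {u \<in> verts R. \<tau> u \<noteq> u}"
      "\<And>u. u \<in> verts R \<Longrightarrow> \<tau> u \<noteq> u \<Longrightarrow> u \<in> oW \<longleftrightarrow> \<tau> u \<notin> oW"
  shows "skew_ebar G Q0 B A vact \<sigma> oW = fromM ident"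
proof -
  let ?V = "{i \<in> verts R. \<tau> i = i}"
  let ?I = "skew_idem G B vact \<sigma>"
  have V: "invariants (verts Q0) vact \<sigma> = ?V" by (simp add: invariants_def Q0 vact_sigma)
  have finW: "finite oW" using oW(1) by (rule finite_subset) simp
  have I: "?I (i, s) \<in> carrier BG" if "i \<in> verts R" for i s
    by (rule skew_idem_carrier[OF B that])
  have "skew_ebar G Q0 B A vact \<sigma> oW = (\<lambda>g\<in>carrier G. \<lambda>x.
    (\<Sum>i\<in>?V. (?I (i, Plus) \<oplus>\<^bsub>A\<^esub> ?I (i, Minus)) g x) + (\<Sum>j\<in>oW. ?I (j, Plus) g x))"
  proof -
    have s1: "(\<Oplus>\<^bsub>A\<^esub>i\<in>?V. ?I (i, Plus) \<oplus>\<^bsub>A\<^esub> ?I (i, Minus)) =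
      (\<lambda>g\<in>carrier G. \<lambda>x. \<Sum>i\<in>?V. (?I (i, Plus) \<oplus>\<^bsub>A\<^esub> ?I (i, Minus)) g x)"
    proof (rule skew_finsum[OF A])
      fix i assume "i \<in> ?V"
      then have "i \<in> verts R" by simp
      from I[OF this, of Plus] I[OF this, of Minus] show "?I (i, Plus) \<oplus>\<^bsub>A\<^esub> ?I (i, Minus) \<in> carrier BG"
        by (auto simp: A skew_simps carrier_add PiE_iff)
    qed simp
    have s2: "(\<Oplus>\<^bsub>A\<^esub>j\<in>oW. ?I (j, Plus)) = (\<lambda>g\<in>carrier G. \<lambda>x. \<Sum>j\<in>oW. ?I (j, Plus) g x)"
      using oW(1) by (intro skew_finsum[OF A] finW I) auto
    show ?thesis unfolding skew_ebar_def V s1 s2 by (auto simp: A skew_simps intro!: ext)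
  qed
  also have "\<dots> = fromM ident"
  proof (rule ext)
    fix g
    show "(\<lambda>g\<in>carrier G. \<lambda>x. (\<Sum>i\<in>?V. (?I (i, Plus) \<oplus>\<^bsub>A\<^esub> ?I (i, Minus)) g x)
        + (\<Sum>j\<in>oW. ?I (j, Plus) g x)) g = fromM ident g"
    proof (cases "g \<in> carrier G")
      case True
      define a :: 'k where "a = of_bool (g = \<one>\<^bsub>G\<^esub>)"
      define b :: 'k where "b = of_bool (g = \<sigma>)"
      have ab: "a = 1 \<and> b = 0 \<and> g = \<one>\<^bsub>G\<^esub> \<or> a = 0 \<and> b = 1 \<and> g = \<sigma>"
        using True sigma_neq by (auto simp: carrier_G a_def b_def)
      have "(\<Sum>i\<in>?V. (?I (i, Plus) \<oplus>\<^bsub>A\<^esub> ?I (i, Minus)) g (u, p)) + (\<Sum>j\<in>oW. ?I (j, Plus) g (u, p))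
        = fromM ident g (u, p)" for u p
      proof (cases p)
        case (Cons c q)
        then have "?I (i, s) g (u, p) = 0" for i s
          unfolding skew_idem_value[OF B] using True by simp
        moreover have "fromM ident g (u, p) = 0"
          using True by (simp add: fromM_def ident_def Cons)
        ultimately show ?thesis using True by (simp add: A skew_simps)
      next
        case Nil
        \<comment> \<open>The two idempotents of a fixed vertex add up to
          \<open>e_i \<otimes> 1\<close>: the parts with \<sigma> cancel and only \<open>a\<close>
          remains.\<close>
        have "(?I (i, Plus) \<oplus>\<^bsub>A\<^esub> ?I (i, Minus)) g (u, []) = (if i = u then a else 0)" if "i \<in> ?V" for i
          unfolding skew_idem_value[OF B] A(2) skew_simps(3) using True that half_half ab
          by (auto simp: path_elt_Nil a_def[symmetric] b_def[symmetric])
        then have S1: "(\<Sum>i\<in>?V. (?I (i, Plus) \<oplus>\<^bsub>A\<^esub> ?I (i, Minus)) g (u, [])) =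
            a * of_bool (u \<in> verts R \<and> \<tau> u = u)"
          by (simp add: sum.delta)
        \<comment> \<open>A representative contributes one half at each of the two vertices of its
          orbit, for both group elements.\<close>
        have "?I (j, Plus) g (u, []) = (if j = u then (a + b) / 2 else 0) + (if j = \<tau> u \<and> u \<in> verts R then (a + b) / 2 else 0)"
          if "j \<in> oW" for j
        proof -
          have j: "j \<in> verts R" "\<tau> j \<noteq> j" using that oW(1) by auto
          then show ?thesis
            unfolding skew_idem_value[OF B] using True
            by (auto simp: path_elt_Nil a_def[symmetric] b_def[symmetric])
        qed
        then have "(\<Sum>j\<in>oW. ?I (j, Plus) g (u, [])) = (\<Sum>j\<in>oW. if j = u then (a + b) / 2 else 0)
            + (\<Sum>j\<in>oW. if j = \<tau> u then of_bool (u \<in> verts R) * ((a + b) / 2) else 0)"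
          unfolding sum.distrib[symmetric] by (intro sum.cong) auto
        also have "\<dots> = (if u \<in> oW then (a + b) / 2 else 0) + (if \<tau> u \<in> oW then of_bool (u \<in> verts R) * ((a + b) / 2) else 0)"
          using finW by (simp add: sum.delta)
        also have "\<dots> = (a + b) / 2 * of_bool (u \<in> verts R \<and> \<tau> u \<noteq> u)"
        proof -
          consider "u \<notin> verts R" | "u \<in> verts R" "\<tau> u = u" | "u \<in> verts R" "\<tau> u \<noteq> u" "u \<in> oW" "\<tau> u \<notin> oW"
            | "u \<in> verts R" "\<tau> u \<noteq> u" "u \<notin> oW" "\<tau> u \<in> oW"
            using oW(2)[of u] by blast
          then show ?thesis
          proof cases
            case 1
            then have "u \<notin> oW" using oW(1) by blast
            with 1 show ?thesis by simp
          next
            case 2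
            then have "u \<notin> oW" using oW(1) by blast
            with 2 show ?thesis by simp
          qed simp_all
        qed
        finally have S2: "(\<Sum>j\<in>oW. ?I (j, Plus) g (u, [])) = (a + b) / 2 * of_bool (u \<in> verts R \<and> \<tau> u \<noteq> u)" .
        have "fromM ident g (u, []) = of_bool (u \<in> verts R) * (if \<tau> u = u then a else (a + b) / 2)"
          using ab half_half sigma_neq True
          by (auto simp: fromM_def ident_def ok_def add_divide_distrib diff_divide_distrib)
        then show ?thesis unfolding Nil S1 S2 by auto
      qed
      then show ?thesis using True by (auto intro!: path_ext)
    qed (simp add: fromM_def)
  qed
  finally show ?thesis .
qed

end

section \<open>Compatibility of the matrices with derivations\<close>

locale skew_derivation = skew_group R \<tau> \<rho> T \<pi> \<kappa> sv wt G \<sigma> gact vact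
    + RD: graded_involution R \<tau> \<rho> wt D + TD: derivation_data T "\<lambda>b. wt (\<pi> b)" E
  for R :: "('v, 'b) pre_digraph" and \<tau> \<rho> and T :: "('v \<times> sign, 'e) pre_digraph"
    and \<pi> and \<kappa> :: "'e \<Rightarrow> 'k::field" and sv and wt :: "'b \<Rightarrow> int"
    and G :: "('g, 'm) monoid_scheme" and \<sigma> gact vact
    and D :: "'b \<Rightarrow> ('v, 'b, 'k) pelt" and E :: "'e \<Rightarrow> ('v \<times> sign, 'e, 'k) pelt" +
  assumes Psi_E: "b \<in> arcs T \<Longrightarrow>
    Psi (E b) t s = (\<lambda>x. of_bool (t = s2 b \<and> s = s1 b) * (\<Sum>c\<in>arcs R. kf b c * D c x))"
begin

lemma path_degree_pi:
  "eps b c \<noteq> 0 \<Longrightarrow> b \<in> arcs T \<Longrightarrow> wt (\<pi> b) = wt c"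
  using wt_eps by simp

lemma Psi_sign_twist: "Psi (sign_twist (\<lambda>b. wt (\<pi> b)) f) t s = sign_twist wt (Psi f t s)"
proof (rule path_ext)
  fix u w
  show "Psi (sign_twist (\<lambda>b. wt (\<pi> b)) f) t s (u, w) = sign_twist wt (Psi f t s) (u, w)"
  proof (induction w arbitrary: u s f)
    case Nil
    then show ?case by (simp add: Psi_Nil sign_twist_def)
  next
    case (Cons c w)
    have "kf b c * Psi (residual T b (sign_twist (\<lambda>b. wt (\<pi> b)) f)) t (s2 b) (head R c, w) =
      (-1) powi wt c * (kf b c * sign_twist wt (Psi (residual T b f) t (s2 b)) (head R c, w))"
      if "b \<in> arcs T" for b
    proof (cases "kf b c = 0")
      case False
      then have "wt (\<pi> b) = wt c" using that path_degree_pi by (simp add: kf_def)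
      then show ?thesis by (simp add: residual_sign_twist Psi_scale Cons.IH)
    qed simp
    then have "(\<Sum>b\<in>arcs T. of_bool (tail T b = sv u s) *
        (kf b c * Psi (residual T b (sign_twist (\<lambda>b. wt (\<pi> b)) f)) t (s2 b) (head R c, w))) =
      (\<Sum>b\<in>arcs T. of_bool (tail T b = sv u s) * ((-1) powi wt c *
        (kf b c * sign_twist wt (Psi (residual T b f) t (s2 b)) (head R c, w))))"
      by (intro sum.cong[OF refl]) (simp only:)
    then have "Psi (sign_twist (\<lambda>b. wt (\<pi> b)) f) t s (u, c # w) = of_bool (u = tail R c \<and> ok u s) *
      (\<Sum>b\<in>arcs T. of_bool (tail T b = sv u s) * ((-1) powi wt c *
        (kf b c * sign_twist wt (Psi (residual T b f) t (s2 b)) (head R c, w))))"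
      unfolding Psi_Cons by (simp only:)
    also have "\<dots> = (-1) powi path_degree wt (u, c # w) * Psi f t s (u, c # w)"
      unfolding Psi_Cons path_degree_Cons[of wt u c w "head R c"]
      by (simp add: sign_twist_def power_int_add sum_distrib_left mult_ac)
    finally show ?case by (simp add: sign_twist_def)
  qed
qed

lemma residual_Psi:
  assumes "ok (tail R c) s"
  shows "residual R c (Psi f t s) (head R c, w) = (\<Sum>b\<in>arcs T. of_bool (tail T b = sv (tail R c) s) *
    (kf b c * Psi (residual T b f) t (s2 b) (head R c, w)))"
  using assms by (simp add: Psi_Cons)

text \<open>\<open>Psi_E\<close> handles the derivative of the first arrow and multiplicativity of
  \<open>Psi\<close> the remaining factor. Exchanging the sum over the arrows \<open>b\<close> with
  the sum over the arrows \<open>c\<close> below them gives the residuals of the matrix.\<close>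

lemma Psi_dpart:
  assumes f: "supported T f"
  shows "Psi (dpart T (\<lambda>b. wt (\<pi> b)) E f) t s (u, w) = dpart R wt D (Psi f t s) (u, w)"
proof (cases "ok u s \<and> u \<in> verts R")
  case False
  then have "Psi g t' s (u, p) = 0" for g t' p
    using Psi_nonzero(1,2)[of g t' s u p] paths_start by blast
  moreover have "dpart R wt D (Psi f t s) (u, w) = 0"
    unfolding dpart_def
  proof (intro sum.neutral ballI)
    fix c assume c: "c \<in> arcs R"
    show "pmul R (sign_twist wt (residual R c (Psi f t s))) (D c) (u, w) = 0"
    proof (cases "u = tail R c")
      case True
      then have "residual R c (Psi f t s) = (\<lambda>x. 0)"
        using \<open>\<And>g t' p. Psi g t' s (u, p) = 0\<close> by (auto simp: residual_def)
      then show ?thesis by simp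
    next
      case False
      then show ?thesis using RD.D_ends[OF c] by (intro pmul_start_zero) blast
    qed
  qed
  ultimately show ?thesis by simp
next
  case True
  let ?sg = "sign_twist wt" and ?P = "\<lambda>b. Psi (residual T b f) t (s2 b)"
  have "Psi (dpart T (\<lambda>b. wt (\<pi> b)) E f) t s (u, w) =
    (\<Sum>b\<in>arcs T. Psi (pmul T (sign_twist (\<lambda>b. wt (\<pi> b)) (residual T b f)) (E b)) t s (u, w))"
    unfolding dpart_def by (simp add: Psi_sum)
  also have "\<dots> = (\<Sum>b\<in>arcs T. \<Sum>c\<in>arcs R. of_bool (tail T b = sv u s) *
      (kf b c * pmul R (?sg (?P b)) (D c) (u, w)))"
  proof (intro sum.cong[OF refl])
    fix b assume b: "b \<in> arcs T"
    have "Psi (pmul T (sign_twist (\<lambda>b. wt (\<pi> b)) (residual T b f)) (E b)) t s (u, w) =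
      mmul (Psi (sign_twist (\<lambda>b. wt (\<pi> b)) (residual T b f))) (Psi (E b)) t s (u, w)"
      using f b by (simp add: Psi_pmul supported_sign_twist TD.D_supported)
    also have "\<dots> = (\<Sum>r\<in>signs. pmul R (?sg (Psi (residual T b f) t r))
        (\<lambda>x. of_bool (r = s2 b \<and> s = s1 b) * (\<Sum>c\<in>arcs R. kf b c * D c x)) (u, w))"
      unfolding mmul_sum Psi_E[OF b] Psi_sign_twist by (rule refl)
    also have "\<dots> = (\<Sum>r\<in>signs. of_bool (r = s2 b \<and> s = s1 b) *
        (\<Sum>c\<in>arcs R. kf b c * pmul R (?sg (Psi (residual T b f) t r)) (D c) (u, w)))"
      unfolding pmul_scale_right pmul_sum_right by (rule refl)
    also have "\<dots> = of_bool (s = s1 b) * (\<Sum>c\<in>arcs R. kf b c * pmul R (?sg (?P b)) (D c) (u, w))"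
      by (cases "s2 b") simp_all
    also have "\<dots> = (\<Sum>c\<in>arcs R. of_bool (tail T b = sv u s) *
      (kf b c * pmul R (?sg (?P b)) (D c) (u, w)))"
      unfolding sum_distrib_left
    proof (intro sum.cong[OF refl])
      fix c assume c: "c \<in> arcs R"
      show "of_bool (s = s1 b) * (kf b c * pmul R (?sg (?P b)) (D c) (u, w)) =
        of_bool (tail T b = sv u s) * (kf b c * pmul R (?sg (?P b)) (D c) (u, w))"
      proof (cases "kf b c = 0 \<or> u \<noteq> tail R c")
        case z: True
        have "kf b c * pmul R (?sg (?P b)) (D c) (u, w) = 0"
        proof (cases "kf b c = 0")
          case False
          then have "u \<noteq> tail R c" using z by blast
          then have "pmul R (?sg (?P b)) (D c) (u, w) = 0"
            using RD.D_ends[OF c] by (intro pmul_start_zero) blast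
          then show ?thesis by simp
        qed simp
        then show ?thesis by simp
      next
        case nz: False
        then have e: "eps b c \<noteq> 0" by (simp add: kf_def)
        \<comment> \<open>\<open>Psi_E\<close> records only the sign at the tail of
          \<open>b\<close>, whereas the residual of a matrix asks for the vertex itself. For
          \<open>b\<close> over an arrow \<open>c\<close> starting at \<open>u\<close> these
          conditions agree.\<close>
        have "tail T b = sv u s \<longleftrightarrow> s = s1 b"
        proof
          assume "tail T b = sv u s"
          then show "s = s1 b" using True by (simp add: snd_sv ok_def)
        next
          assume "s = s1 b"
          then show "tail T b = sv u s" using eps_over(2)[OF b e] nz by metis
        qed
        then show ?thesis by simp
      qed
    qed
    finally show "Psi (pmul T (sign_twist (\<lambda>b. wt (\<pi> b)) (residual T b f)) (E b)) t s (u, w) =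
      (\<Sum>c\<in>arcs R. of_bool (tail T b = sv u s) * (kf b c * pmul R (?sg (?P b)) (D c) (u, w)))" .
  qed
  also have "\<dots> = (\<Sum>c\<in>arcs R. \<Sum>b\<in>arcs T. of_bool (tail T b = sv u s) *
      (kf b c * pmul R (?sg (?P b)) (D c) (u, w)))"
    by (rule sum.swap)
  also have "\<dots> = dpart R wt D (Psi f t s) (u, w)"
    unfolding dpart_def
  proof (intro sum.cong[OF refl])
    fix c assume c: "c \<in> arcs R"
    show "(\<Sum>b\<in>arcs T. of_bool (tail T b = sv u s) * (kf b c * pmul R (?sg (?P b)) (D c) (u, w))) =
      pmul R (?sg (residual R c (Psi f t s))) (D c) (u, w)"
    proof (cases "u = tail R c")
      case u: True
      have "pmul R (?sg (residual R c (Psi f t s))) (D c) (u, w) =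
        pmul R (\<lambda>x. \<Sum>b\<in>arcs T. of_bool (tail T b = sv u s) * (kf b c * ?sg (?P b) x)) (D c) (u, w)"
        unfolding pmul_def prod.case
      proof (intro sum.cong[OF refl])
        fix l
        show "?sg (residual R c (Psi f t s)) (awlast u (take l w), drop l w) * D c (u, take l w) =
          (\<Sum>b\<in>arcs T. of_bool (tail T b = sv u s) *
            (kf b c * ?sg (?P b) (awlast u (take l w), drop l w))) * D c (u, take l w)"
        proof (cases "D c (u, take l w) = 0")
          case False
          then have hd: "awlast u (take l w) = head R c" using RD.D_ends[OF c] by blast
          have "ok (tail R c) s" using True u by simp
          from residual_Psi[OF this, of f t "drop l w"]
          show ?thesis unfolding hd sign_twist_def
            by (simp add: u sum_distrib_left mult_ac)
        qed simp
      qed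
      also have "\<dots> = (\<Sum>b\<in>arcs T. of_bool (tail T b = sv u s) * (kf b c * pmul R (?sg (?P b)) (D c) (u, w)))"
        by (simp add: pmul_sum_left pmul_scale_left)
      finally show ?thesis by (rule sym)
    next
      case False
      then have "pmul R h (D c) (u, w) = 0" for h
        using RD.D_ends[OF c] by (intro pmul_start_zero) blast
      then show ?thesis by simp
    qed
  qed
  finally show ?thesis .
qed

text \<open>Both derivations satisfy the same recursion along the path, the derivative of a residual
  plus the contribution of the first arrow. Agreement on arrows, assumed in \<open>Psi_E\<close>,
  therefore propagates to all series.\<close>

lemma Psi_der:
  assumes "supported T f"
  shows "Psi (der T (\<lambda>b. wt (\<pi> b)) E f) t s = der R wt D (Psi f t s)"
proof (rule path_ext)
  fix u w
  show "Psi (der T (\<lambda>b. wt (\<pi> b)) E f) t s (u, w) = der R wt D (Psi f t s) (u, w)"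
    using assms
  proof (induction w arbitrary: u s f)
    case Nil
    have "Psi (der T (\<lambda>b. wt (\<pi> b)) E f) t s (u, []) = Psi (dpart T (\<lambda>b. wt (\<pi> b)) E f) t s (u, [])"
      by (simp add: Psi_Nil TD.der_Nil)
    then show ?case by (simp add: RD.der_Nil Psi_dpart Nil)
  next
    case (Cons c w)
    note f = Cons.prems
    let ?d = "der T (\<lambda>b. wt (\<pi> b)) E" and ?p = "dpart T (\<lambda>b. wt (\<pi> b)) E"
    have "Psi (?d f) t s (u, c # w) = of_bool (u = tail R c \<and> ok u s) *
      (\<Sum>b\<in>arcs T. of_bool (tail T b = sv u s) * (kf b c * der R wt D (Psi (residual T b f) t (s2 b)) (head R c, w)))
      + Psi (?p f) t s (u, c # w)"
      unfolding Psi_Cons TD.residual_der Psi_add Cons.IH[OF T.supported_residual[OF f]]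
      by (simp add: distrib_left sum.distrib del: of_bool_conj)
    also have "of_bool (u = tail R c \<and> ok u s) *
      (\<Sum>b\<in>arcs T. of_bool (tail T b = sv u s) * (kf b c * der R wt D (Psi (residual T b f) t (s2 b)) (head R c, w)))
      = (if u = tail R c then der R wt D (residual R c (Psi f t s)) (head R c, w) else 0)"
    proof (cases "u = tail R c \<and> ok u s")
      case True
      then have us: "u = tail R c" "ok (tail R c) s" by auto
      have "der R wt D (residual R c (Psi f t s)) (head R c, w) =
        der R wt D (\<lambda>x. \<Sum>b\<in>arcs T. of_bool (tail T b = sv u s) * (kf b c * Psi (residual T b f) t (s2 b) x)) (head R c, w)"
        using residual_Psi[OF us(2)] by (intro RD.der_start_cong) (simp add: us)
      also have "\<dots> = (\<Sum>b\<in>arcs T. of_bool (tail T b = sv u s) *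
          (kf b c * der R wt D (Psi (residual T b f) t (s2 b)) (head R c, w)))"
        by (simp add: RD.der_sum RD.der_scale)
      finally show ?thesis using us by simp
    next
      case False
      have "residual R c (Psi f t s) = (\<lambda>x. 0)" if "u = tail R c"
        using False that by (auto simp: residual_def Psi_Cons)
      with False show ?thesis by auto
    qed
    finally show ?case by (simp add: RD.der_Cons Psi_dpart f)
  qed
qed

end

section \<open>The potential of the new quiver and its cyclic derivatives\<close>

context invariant_potential begin

lemma act_cyclic_derivative:
  assumes a: "a \<in> arcs Q"
  shows "act (cyclic_derivative Q (\<rho> a) S) = cyclic_derivative Q a S"
proof (rule supported_eqI)
  fix u p assume up: "(u, p) \<in> quiver_paths Q"
  have u: "u \<in> verts Q" by (rule paths_start[OF up])
  have "cyclic_sum Q S (\<rho> a # map \<rho> p) = cyclic_sum Q S (a # p)"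
    using cyclic_sum_map[of "a # p"] a paths_arcs[OF up] by simp
  moreover have "\<tau> u = head Q (\<rho> a) \<longleftrightarrow> u = head Q a" using a u by (simp add: tau_inj)
  ultimately show "act (cyclic_derivative Q (\<rho> a) S) (u, p) = cyclic_derivative Q a S (u, p)"
    unfolding act_path[OF up] cyclic_derivative_eq[OF a] cyclic_derivative_eq[OF rho_arcs[OF a]]
    by (simp only:)
qed (simp_all add: supported_cyclic_derivative a)

end

context skew_cover begin

text \<open>The signs of consecutive arrows telescope to those at the two ends of \<open>p\<close>.
  On a cycle the factor is \<open>1\<close>.\<close>

lemma Lprod_rho:
  assumes "(x, p) \<in> quiver_paths T" "w \<in> arc_lists (length p)" "y = T.awlast x p"
  shows "Lprod p (map \<rho> w) = chi (snd x) (snd y) * Lprod p w"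
  using assms
proof (induction p arbitrary: x w)
  case (Cons b p)
  then obtain c w' where w: "w = c # w'" "c \<in> arcs R" "w' \<in> arc_lists (length p)"
    by (cases w) (auto simp: arc_lists_def)
  have b: "b \<in> arcs T" and x: "x = tail T b" and p: "(head T b, p) \<in> quiver_paths T"
    and y: "y = T.awlast (head T b) p" using Cons.prems by auto
  have "Lprod (b # p) (map \<rho> w) = (chi (s1 b) (s2 b) * chi (s2 b) (snd y)) * (Lf b c * Lprod p w')"
    using Cons.IH[OF p w(3) y] by (simp add: w(1) Lf_rho[OF b w(2)] mult_ac)
  then show ?case by (simp add: x w(1))
qed (auto simp: arc_lists_def)

lemma Lprod_rotate1: "length p = length w \<Longrightarrow> Lprod (rotate1 p) (rotate1 w) = Lprod p w"
  by (cases p; cases w) (simp_all add: Lprod_def mult.commute)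

lemma Lprod_rotate: "length p = length w \<Longrightarrow> Lprod (rotate l p) (rotate l w) = Lprod p w"
  by (induction l) (simp_all add: Lprod_rotate1)

text \<open>A nonzero product of coordinates means that \<open>w\<close> lies below \<open>p\<close>
  arrow by arrow, so the end vertices lie above one another too.\<close>

lemma Lprod_end:
  assumes "(x, p) \<in> quiver_paths T" "Lprod p w \<noteq> 0" "length w = length p"
    "(u, w) \<in> quiver_paths R" "sv u (snd x) = x" "y = T.awlast x p"
  shows "sv (awlast u w) (snd y) = y"
  using assms
proof (induction p arbitrary: x u w)
  case (Cons b p)
  then obtain c w' where w: "w = c # w'" by (cases w) auto
  have b: "b \<in> arcs T" and p: "(head T b, p) \<in> quiver_paths T" using Cons.prems(1) by auto
  have nz: "Lf b c \<noteq> 0" "Lprod p w' \<noteq> 0" using Cons.prems(2) by (auto simp: w)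
  then have e: "eps b c \<noteq> 0" by (auto simp: Lf_def)
  have "sv (head R c) (s2 b) = head T b" by (rule eps_over(3)[OF b e, symmetric])
  then have "sv (awlast (head R c) w') (snd y) = y"
    using Cons.prems by (intro Cons.IH[OF p nz(2)]) (auto simp: w)
  then show ?case by (simp add: w)
qed simp

lemma sum_map_rho: "(\<Sum>w\<in>arc_lists n. h (map \<rho> w)) = (\<Sum>w\<in>arc_lists n. h w)"
  by (rule sum.reindex_bij_witness[of _ "map \<rho>" "map \<rho>"])
    (auto simp: arc_lists_def map_rho_rho simp del: map_map)

lemma sum_rotate_lists: "(\<Sum>w\<in>arc_lists n. h (rotate l w)) = (\<Sum>w\<in>arc_lists n. h w)"
proof (rule sum.reindex_bij_witness[of _ "rotate (l * (n - 1))" "rotate l"])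
  \<comment> \<open>The inverse of the rotation by \<open>l\<close> is the one by
    \<open>l * (n - 1)\<close>, as together they make \<open>l\<close> full turns.\<close>
  have rot: "rotate (l * (n - 1) + l) w = w" if "length w = n" for w :: "'b list"
  proof (cases n)
    case (Suc m)
    then have "l * (n - 1) + l = l * n" by simp
    then show ?thesis using that by (intro rotate_id) simp
  qed (use that in simp)
  fix w assume "w \<in> arc_lists n"
  then have w: "length w = n" "set w \<subseteq> arcs R" by (auto simp: arc_lists_def)
  show "rotate l (rotate (l * (n - 1)) w) = w" "rotate (l * (n - 1)) (rotate l w) = w"
    using rot[OF w(1)] by (simp_all add: rotate_rotate add.commute)
qed (auto simp: arc_lists_def)

end

locale skew_potential_cover = skew_cover R \<tau> \<rho> T \<pi> "\<lambda>_ :: 'e. 1 :: 'k" sv + invariant_potential R \<tau> \<rho> S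
  for R :: "('v, 'b) pre_digraph" and \<tau> \<rho> and T :: "('v \<times> sign, 'e) pre_digraph" and \<pi> sv
    and S :: "('v, 'b, 'k::field) pelt"
begin

text \<open>The matrix of \<iota>'(S), as \<open>skew_iota'\<close> confirms. The orbit size comes
  from \<iota>', the average of \<open>S\<close> and its image from the passage to matrices.\<close>

definition potential_matrix :: "sign \<Rightarrow> sign \<Rightarrow> ('v, 'b, 'k) pelt" where
  "potential_matrix t s = (\<lambda>(u, w). of_bool (ok u s \<and> ok (awlast u w) t) *
     (nu u / 2 * (S (u, w) + chi t s * act S (u, w))))"

definition cover_potential :: "('v \<times> sign, 'e, 'k) pelt" where
  "cover_potential = (\<lambda>x. if x \<in> cycles T then Theta potential_matrix x else 0)"

lemma supported_S: "supported R S"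
  using S_cycles by (auto simp: supported_def cycles_def quiver_paths_def)

lemma corner_potential_matrix: "corner_matrix potential_matrix"
  unfolding corner_matrix_def
proof (intro allI conjI impI)
  fix t s
  show supp: "supported R (potential_matrix t s)"
    unfolding supported_def
  proof (intro allI impI)
    fix x assume nz: "potential_matrix t s x \<noteq> 0"
    then have "S x \<noteq> 0 \<or> act S x \<noteq> 0" by (cases x) (auto simp: potential_matrix_def)
    then show "x \<in> quiver_paths R" using supported_S supported_act[of S] unfolding supported_def by blast
  qed
  show "act (potential_matrix t s) = (\<lambda>x. chi t s * potential_matrix t s x)"
  proof (rule supported_eqI)
    fix u w assume uw: "(u, w) \<in> quiver_paths R"
    have "act S (\<tau> u, map \<rho> w) = S (u, w)"
      using act_act[OF supported_S] act_path[OF uw, of "act S"] by simp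
    moreover have "awlast u w \<in> verts R" using uw by (auto simp: quiver_paths_def)
    ultimately show "act (potential_matrix t s) (u, w) = chi t s * potential_matrix t s (u, w)"
      using paths_start[OF uw]
      by (simp add: act_path[OF uw] potential_matrix_def ok_tau nu_tau awlast_map[OF uw] algebra_simps
          del: of_bool_conj)
  qed (use supp in \<open>simp_all add: supported_scale\<close>)
  fix u w assume "potential_matrix t s (u, w) \<noteq> 0"
  then show "ok u s" "ok (awlast u w) t" by (auto simp: potential_matrix_def)
qed

sublocale TP: potential T cover_potential
  by unfold_locales (auto simp: cover_potential_def split: if_splits)

text \<open>The orbit size inserted by \<iota>' cancels the one by which
  \<open>Theta_formula\<close> divides, since a cycle ends where it starts. By
  \<open>Lprod_rho\<close> the summands with \<open>S\<close> and with its image contribute equally,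
  which cancels the factor one half.\<close>

lemma cover_potential_eq:
  assumes "(x, p) \<in> cycles T"
  shows "cover_potential (x, p) = (\<Sum>w\<in>arc_lists (length p). Lprod p w * S (tail R (hd w), w))"
proof -
  have "T.awalk x p x" and "p \<noteq> []" using assms by (auto simp: cycles_def)
  then have path: "(x, p) \<in> quiver_paths T" and aw: "T.awlast x p = x" and pne: "p \<noteq> []"
    unfolding quiver_paths_def by blast+
  from pne obtain b p' where p: "p = b # p'" by (cases p) auto
  have b: "b \<in> arcs T" and x: "x = tail T b" using path by (auto simp: p)
  let ?s = "snd x"
  have start: "(\<Sum>u\<in>{fst x, \<tau> (fst x)}. Lprod p w * potential_matrix ?s ?s (u, w)) =
      nu (fst x) / 2 * (Lprod p w * S (tail R (hd w), w) + Lprod p w * S (tail R (hd (map \<rho> w)), map \<rho> w))"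
    if w: "w \<in> arc_lists (length p)" for w
  proof (cases "Lprod p w = 0")
    case False
    obtain c w' where cw: "w = c # w'" using w by (cases w) (auto simp: p arc_lists_def)
    have c: "c \<in> arcs R" using w by (simp add: cw arc_lists_def)
    have nz: "Lf b c \<noteq> 0" using False by (simp add: p cw)
    then have e: "eps b c \<noteq> 0" by (auto simp: Lf_def)
    have orb: "tail R c = fst x \<or> tail R c = \<tau> (fst x)" using Lf_orbit(1)[OF b nz] x by simp
    have fx: "fst x \<in> verts R" using path T.paths_start verts_T by blast
    have ok: "ok (tail R c) ?s" using eps_over(4)[OF b e] x by simp
    have nu: "nu (tail R c) = nu (fst x)" using orb fx by (auto simp: nu_tau)
    have actS: "act S (tail R c, w) = S (tail R (hd (map \<rho> w)), map \<rho> w)"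
    proof (cases "(tail R c, w) \<in> quiver_paths R")
      case True
      then show ?thesis using c by (simp add: act_path cw)
    next
      case False
      have "S (tail R (hd (map \<rho> w)), map \<rho> w) = 0"
      proof (rule ccontr)
        assume "S (tail R (hd (map \<rho> w)), map \<rho> w) \<noteq> 0"
        then have "(tail R (hd (map \<rho> w)), map \<rho> w) \<in> quiver_paths R"
          using supported_S unfolding supported_def by blast
        moreover have "tail R (hd (map \<rho> w)) = \<tau> (tail R c)" using c by (simp add: cw)
        ultimately have "(\<tau> (tail R c), map \<rho> w) \<in> quiver_paths R" by (simp only:)
        from paths_map[OF this] have "(tail R c, w) \<in> quiver_paths R"
          using c w map_rho_rho[of w] by (simp add: arc_lists_def del: map_map)
        with False show False by blast
      qed
      with False show ?thesis by (simp add: pact_def)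
    qed
    have "potential_matrix ?s ?s (tail R c, w) = nu (fst x) / 2 * (S (tail R c, w) + act S (tail R c, w))"
    proof (cases "S (tail R c, w) = 0 \<and> act S (tail R c, w) = 0")
      case False
      \<comment> \<open>\<open>S\<close> and its image are supported on cycles, so the sign
        condition at the end of \<open>w\<close> follows from the one at its start.\<close>
      have "awlast (tail R c) w = tail R c"
      proof (cases "S (tail R c, w) = 0")
        case True
        then have nz': "act S (tail R c, w) \<noteq> 0" using False by simp
        then have pth: "(tail R c, w) \<in> quiver_paths R" by (auto simp: pact_def split: if_splits)
        then have "S (\<tau> (tail R c), map \<rho> w) \<noteq> 0" using nz' by (simp add: act_path)
        then have "awlast (\<tau> (tail R c)) (map \<rho> w) = \<tau> (tail R c)"
          using S_cycles by (fastforce simp: cycles_def)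
        moreover have "awlast (tail R c) w \<in> verts R" using pth by (auto simp: quiver_paths_def)
        ultimately show ?thesis using c by (simp add: awlast_map[OF pth] tau_inj)
      next
        case False
        then show ?thesis using S_cycles by (fastforce simp: cycles_def)
      qed
      then show ?thesis using ok nu by (simp add: potential_matrix_def)
    qed (simp add: potential_matrix_def)
    moreover have "(\<Sum>u\<in>{fst x, \<tau> (fst x)}. potential_matrix ?s ?s (u, w)) = potential_matrix ?s ?s (tail R c, w)"
      unfolding cw by (rule orbit_sum_start[OF corner_matrixD(1)[OF corner_potential_matrix] orb])
    moreover have "tail R (hd w) = tail R c" by (simp add: cw)
    ultimately show ?thesis
      by (simp only: sum_distrib_left[symmetric] actS) (simp only: distrib_left ac_simps)
  qed simp
  have "cover_potential (x, p) = (\<Sum>u\<in>{fst x, \<tau> (fst x)}. \<Sum>w\<in>arc_lists (length p).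
      Lprod p w * potential_matrix ?s ?s (u, w)) / nu (fst x)"
    unfolding cover_potential_def using assms
      Theta_formula[OF path corner_matrixD(1)[OF corner_potential_matrix] refl] aw by simp
  also have "(\<Sum>u\<in>{fst x, \<tau> (fst x)}. \<Sum>w\<in>arc_lists (length p). Lprod p w * potential_matrix ?s ?s (u, w))
    = (\<Sum>w\<in>arc_lists (length p). \<Sum>u\<in>{fst x, \<tau> (fst x)}. Lprod p w * potential_matrix ?s ?s (u, w))"
    by (rule sum.swap)
  also have "\<dots> = nu (fst x) / 2 * ((\<Sum>w\<in>arc_lists (length p). Lprod p w * S (tail R (hd w), w))
      + (\<Sum>w\<in>arc_lists (length p). Lprod p w * S (tail R (hd (map \<rho> w)), map \<rho> w)))"
    by (subst sum.cong[OF refl start]) (simp_all only: sum.distrib sum_distrib_left[symmetric])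
  also have "(\<Sum>w\<in>arc_lists (length p). Lprod p w * S (tail R (hd (map \<rho> w)), map \<rho> w)) =
    (\<Sum>w\<in>arc_lists (length p). Lprod p (map \<rho> w) * S (tail R (hd (map \<rho> w)), map \<rho> w))"
    using Lprod_rho[OF path _ refl] aw by (intro sum.cong) simp_all
  also have "\<dots> = (\<Sum>w\<in>arc_lists (length p). Lprod p w * S (tail R (hd w), w))"
    by (rule sum_map_rho)
  finally show ?thesis using nu_neq_0[of "fst x"] half_double
    by (simp add: field_simps two_neq_0)
qed

text \<open>\<open>Lprod\<close> is unchanged when both lists are rotated simultaneously, so the sum
  over rotations passes from \<open>p\<close> to the lists below it.\<close>

lemma cyclic_sum_cover:
  assumes "(tail T (hd p), p) \<in> cycles T"
  shows "cyclic_sum T cover_potential p = (\<Sum>w\<in>arc_lists (length p). Lprod p w * cyclic_sum R S w)"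
proof -
  have "cyclic_sum T cover_potential p =
    (\<Sum>l<length p. \<Sum>w\<in>arc_lists (length p). Lprod (rotate l p) w * S (tail R (hd w), w))"
    unfolding cyclic_sum_def using assms T.cycles_rotate
    by (intro sum.cong) (simp_all add: cover_potential_eq)
  also have "\<dots> = (\<Sum>l<length p. \<Sum>w\<in>arc_lists (length p).
      Lprod (rotate l p) (rotate l w) * S (tail R (hd (rotate l w)), rotate l w))"
    by (intro sum.cong refl sum_rotate_lists[symmetric])
  also have "\<dots> = (\<Sum>w\<in>arc_lists (length p). \<Sum>l<length p.
      Lprod (rotate l p) (rotate l w) * S (tail R (hd (rotate l w)), rotate l w))"
    by (rule sum.swap)
  also have "\<dots> = (\<Sum>w\<in>arc_lists (length p). Lprod p w * cyclic_sum R S w)"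
    by (intro sum.cong) (simp_all add: Lprod_rotate arc_lists_def cyclic_sum_def sum_distrib_left)
  finally show ?thesis .
qed

text \<open>The right-hand side \<open>N\<close> is a matrix of the corner, so by
  \<open>Psi_Theta\<close> it suffices to compute \<open>Theta N\<close>. In the closed formula
  \<open>Lf a c\<close> completes \<open>Lprod p w\<close> to the product for the cycle
  \<open>a # p\<close>. The factor \<open>nu\<close> cancels the division by the orbit size at the
  end of \<open>p\<close>, which lies over the tail of \<open>a\<close>.\<close>

lemma Psi_cyclic_derivative:
  assumes a: "a \<in> arcs T"
  shows "Psi (cyclic_derivative T a cover_potential) t s = (\<lambda>x. of_bool (t = s1 a \<and> s = s2 a) *
    (nu (tail R (\<pi> a)) * (\<Sum>c\<in>arcs R. Lf a c * cyclic_derivative R c S x)))"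
proof -
  define N where "N t s = (\<lambda>x. of_bool (t = s1 a \<and> s = s2 a) *
    (nu (tail R (\<pi> a)) * (\<Sum>c\<in>arcs R. Lf a c * cyclic_derivative R c S x)))" for t s
  have supp: "supported R (N t s)" for t s
    unfolding N_def by (intro supported_scale supported_sum supported_cyclic_derivative)
  have corner: "corner_matrix N"
    unfolding corner_matrix_def
  proof (intro allI conjI impI)
    fix t s
    show "supported R (N t s)" by (rule supp)
    have "act (\<lambda>x. \<Sum>c\<in>arcs R. Lf a c * cyclic_derivative R c S x) =
      (\<lambda>x. \<Sum>c\<in>arcs R. Lf a (\<rho> c) * act (cyclic_derivative R (\<rho> c) S) x)"
      unfolding act_sum act_scale by (intro ext sum_rho[symmetric])
    also have "\<dots> = (\<lambda>x. chi (s1 a) (s2 a) * (\<Sum>c\<in>arcs R. Lf a c * cyclic_derivative R c S x))"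
      by (simp add: act_cyclic_derivative Lf_rho[OF a] sum_distrib_left mult.assoc cong: sum.cong)
    finally show "act (N t s) = (\<lambda>x. chi t s * N t s x)"
      unfolding N_def act_scale by (cases "t = s1 a \<and> s = s2 a") (auto simp: mult_ac)
    fix u w assume "N t s (u, w) \<noteq> 0"
    then have ts: "t = s1 a" "s = s2 a" and "(\<Sum>c\<in>arcs R. Lf a c * cyclic_derivative R c S (u, w)) \<noteq> 0"
      by (auto simp: N_def)
    from this(3) obtain c where c: "c \<in> arcs R" "Lf a c * cyclic_derivative R c S (u, w) \<noteq> 0"
      by (rule sum.not_neutral_contains_not_neutral)
    then have e: "eps a c \<noteq> 0" by (auto simp: Lf_def)
    have "u = head R c" "awlast u w = tail R c"
      using c(2) by (auto simp: cyclic_derivative_def split: if_splits)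
    then show "ok u s" "ok (awlast u w) t" using eps_over(4,5)[OF a e] ts by simp_all
  qed
  have eq: "Theta N = cyclic_derivative T a cover_potential"
  proof (rule path_ext)
    fix x p
    show "Theta N (x, p) = cyclic_derivative T a cover_potential (x, p)"
    proof (cases "(x, p) \<in> quiver_paths T")
      case False
      then show ?thesis
        using supported_Theta[of N] TP.supported_cyclic_derivative[OF a] unfolding supported_def by metis
    next
      case path: True
      define y where "y = T.awlast x p"
      have pa: "\<pi> a \<in> arcs R" by (rule pi_arcs[OF a])
      have x: "x \<in> verts T" by (rule T.paths_start[OF path])
      have walk: "T.awalk x p y" using path by (auto simp: quiver_paths_def y_def)
      have form: "Theta N (x, p) = (\<Sum>u\<in>{fst x, \<tau> (fst x)}. \<Sum>w\<in>arc_lists (length p).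
          Lprod p w * N (snd y) (snd x) (u, w)) / nu (fst y)"
        by (rule Theta_formula[OF path supp y_def])
      show ?thesis
      proof (cases "x = head T a \<and> y = tail T a")
        case True
        then have xa: "x = head T a" and ya: "y = tail T a" by auto
        have cyc: "(tail T (hd (a # p)), a # p) \<in> cycles T"
          using walk a xa ya by (simp add: T.cycles_Cons)
        have "(\<Sum>u\<in>{fst x, \<tau> (fst x)}. \<Sum>w\<in>arc_lists (length p). Lprod p w * N (snd y) (snd x) (u, w))
          = nu (tail R (\<pi> a)) * (\<Sum>c\<in>arcs R. \<Sum>w\<in>arc_lists (length p).
              \<Sum>u\<in>{fst x, \<tau> (fst x)}. Lprod p w * (Lf a c * cyclic_derivative R c S (u, w)))"
          (is "?lhs = _")
        proof -
          have "?lhs = nu (tail R (\<pi> a)) * (\<Sum>u\<in>{fst x, \<tau> (fst x)}. \<Sum>w\<in>arc_lists (length p).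
              \<Sum>c\<in>arcs R. Lprod p w * (Lf a c * cyclic_derivative R c S (u, w)))"
            unfolding N_def xa ya by (simp only: simp_thms of_bool_eq mult_1 sum_distrib_left mult.left_commute)
          also have "(\<Sum>u\<in>{fst x, \<tau> (fst x)}. \<Sum>w\<in>arc_lists (length p).
              \<Sum>c\<in>arcs R. Lprod p w * (Lf a c * cyclic_derivative R c S (u, w))) =
            (\<Sum>w\<in>arc_lists (length p). \<Sum>u\<in>{fst x, \<tau> (fst x)}.
              \<Sum>c\<in>arcs R. Lprod p w * (Lf a c * cyclic_derivative R c S (u, w)))" by (rule sum.swap)
          also have "\<dots> = (\<Sum>w\<in>arc_lists (length p). \<Sum>c\<in>arcs R.
              \<Sum>u\<in>{fst x, \<tau> (fst x)}. Lprod p w * (Lf a c * cyclic_derivative R c S (u, w)))"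
            by (intro sum.cong[OF refl] sum.swap)
          also have "\<dots> = (\<Sum>c\<in>arcs R. \<Sum>w\<in>arc_lists (length p).
              \<Sum>u\<in>{fst x, \<tau> (fst x)}. Lprod p w * (Lf a c * cyclic_derivative R c S (u, w)))"
            by (rule sum.swap)
          finally show ?thesis .
        qed
        also have "(\<Sum>c\<in>arcs R. \<Sum>w\<in>arc_lists (length p).
              \<Sum>u\<in>{fst x, \<tau> (fst x)}. Lprod p w * (Lf a c * cyclic_derivative R c S (u, w))) =
          (\<Sum>c\<in>arcs R. \<Sum>w\<in>arc_lists (length p). Lprod (a # p) (c # w) * cyclic_sum R S (c # w))"
        proof (intro sum.cong[OF refl])
          fix c w assume c: "c \<in> arcs R"
          show "(\<Sum>u\<in>{fst x, \<tau> (fst x)}. Lprod p w * (Lf a c * cyclic_derivative R c S (u, w))) =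
            Lprod (a # p) (c # w) * cyclic_sum R S (c # w)"
          proof (cases "Lf a c = 0")
            case False
            have "(\<Sum>u\<in>{fst x, \<tau> (fst x)}. cyclic_derivative R c S (u, w)) = cyclic_sum R S (c # w)"
              using Lf_orbit(2)[OF a False] xa by (auto simp: cyclic_derivative_eq[OF c])
            then show ?thesis by (simp only: sum_distrib_left[symmetric] Lprod_simps) (simp add: mult_ac)
          qed simp
        qed
        also have "\<dots> = cyclic_sum T cover_potential (a # p)"
          unfolding cyclic_sum_cover[OF cyc] list.size(4) One_nat_def add_Suc_right add_0_right
            sum_arc_lists_Suc by (rule refl)
        finally have "Theta N (x, p) = nu (tail R (\<pi> a)) * cyclic_sum T cover_potential (a # p) / nu (fst y)"
          unfolding form by simp
        moreover have "nu (fst y) = nu (tail R (\<pi> a))"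
          using fst_sv[of "tail R (\<pi> a)" "s1 a"] tail_T[OF a] pa unfolding ya by (metis nu_tau tail_in_verts)
        ultimately show ?thesis using nu_neq_0 xa by (simp add: TP.cyclic_derivative_eq[OF a])
      next
        case False
        have "cyclic_derivative T a cover_potential (x, p) = 0"
          using False TP.cyclic_sum_nonzero[of "a # p"] walk
          by (auto simp: TP.cyclic_derivative_eq[OF a] T.cycles_Cons dest: T.awalkE)
        moreover have "Theta N (x, p) = 0"
        proof -
          \<comment> \<open>A nonzero term comes from a path below \<open>p\<close> that joins the
            head to the tail of an arrow below \<open>a\<close>, with the signs of \<open>a\<close>.
            This forces \<open>x\<close> and \<open>y\<close> to be the ends of
            \<open>a\<close>.\<close>
          have "Lprod p w * N (snd y) (snd x) (u, w) = 0"
            if u: "u \<in> {fst x, \<tau> (fst x)}" and w: "w \<in> arc_lists (length p)" for u w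
          proof (rule ccontr)
            assume nz: "Lprod p w * N (snd y) (snd x) (u, w) \<noteq> 0"
            then have sg: "snd y = s1 a" "snd x = s2 a"
              and "(\<Sum>c\<in>arcs R. Lf a c * cyclic_derivative R c S (u, w)) \<noteq> 0"
              by (auto simp: N_def)
            from this(3) obtain c where c: "c \<in> arcs R" "Lf a c * cyclic_derivative R c S (u, w) \<noteq> 0"
              by (rule sum.not_neutral_contains_not_neutral)
            then have e: "eps a c \<noteq> 0" and cd: "cyclic_derivative R c S (u, w) \<noteq> 0" by (auto simp: Lf_def)
            from cd have uc: "u = head R c" and wk: "awalk u w (tail R c)"
              by (auto simp: cyclic_derivative_def split: if_splits)
            have fx: "fst x \<in> verts R" and svx: "sv (fst x) (snd x) = x" using verts_T[OF x] by auto
            have svu: "sv u (snd x) = x" using u svx fx by (auto simp: sv_tau)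
            then have "sv (head R c) (s2 a) = x" by (simp only: sg uc)
            then have "x = head T a" by (rule trans[OF eps_over(3)[OF a e], symmetric])
            moreover have "y = tail T a"
            proof -
              have "sv (awlast u w) (snd y) = y"
                using nz w wk svu by (intro Lprod_end[OF path _ _ _ _ y_def]) (auto simp: arc_lists_def quiver_paths_def)
              moreover have "awlast u w = tail R c" using wk by auto
              ultimately have "sv (tail R c) (s1 a) = y" by (simp only: sg)
              then show ?thesis by (rule trans[OF eps_over(2)[OF a e], symmetric])
            qed
            ultimately show False using False by blast
          qed
          then have "(\<Sum>u\<in>{fst x, \<tau> (fst x)}. \<Sum>w\<in>arc_lists (length p).
              Lprod p w * N (snd y) (snd x) (u, w)) = 0" by (intro sum.neutral ballI)
          then show ?thesis unfolding form by simp
        qed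
        ultimately show ?thesis by simp
      qed
    qed
  qed
  show ?thesis unfolding eq[symmetric] Psi_Theta[OF corner] N_def by (rule refl)
qed

end

lemma (in quiver) sum_ginzburg_arcs:
  "(\<Sum>b\<in>arcs (ginzburg_quiver Q). h b) =
    (\<Sum>a\<in>arcs Q. h (Orig a)) + (\<Sum>a\<in>arcs Q. h (Dual a)) + (\<Sum>i\<in>verts Q. h (Loop i))"
proof -
  have "(\<Sum>b\<in>arcs (ginzburg_quiver Q). h b) =
    (\<Sum>b\<in>Orig ` arcs Q \<union> Dual ` arcs Q. h b) + (\<Sum>b\<in>Loop ` verts Q. h b)"
    unfolding ginzburg_quiver_simps by (rule sum.union_disjoint) auto
  also have "(\<Sum>b\<in>Orig ` arcs Q \<union> Dual ` arcs Q. h b) = (\<Sum>b\<in>Orig ` arcs Q. h b) + (\<Sum>b\<in>Dual ` arcs Q. h b)"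
    by (rule sum.union_disjoint) auto
  finally show ?thesis by (simp add: sum.reindex inj_on_def)
qed

lemma (in quiver) loop_differential_pmul:
  "loop_differential Q i x = (\<Sum>a\<in>arcs Q.
     of_bool (head Q a = i) *
       pmul (ginzburg_quiver Q) (arrow_elt (ginzburg_quiver Q) (Orig a)) (arrow_elt (ginzburg_quiver Q) (Dual a)) x
     - of_bool (tail Q a = i) *
       pmul (ginzburg_quiver Q) (arrow_elt (ginzburg_quiver Q) (Dual a)) (arrow_elt (ginzburg_quiver Q) (Orig a)) x)"
proof -
  interpret G: quiver "ginzburg_quiver Q" by (rule quiver_ginzburg)
  obtain u p where x: "x = (u, p)" by (cases x)
  show ?thesis unfolding x loop_differential_def prod.case
    by (intro sum.cong[OF refl]) (auto simp: G.pmul_arrows)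
qed

context skew_cover begin

lemma Psi_arrow:
  assumes b: "b \<in> arcs T"
  shows "Psi (arrow_elt T b) t s =
    (\<lambda>x. of_bool (t = s2 b \<and> s = s1 b) * (\<Sum>c\<in>arcs R. kf b c * arrow_elt R c x))"
proof (rule path_ext)
  fix u w
  show "Psi (arrow_elt T b) t s (u, w) =
    of_bool (t = s2 b \<and> s = s1 b) * (\<Sum>c\<in>arcs R. kf b c * arrow_elt R c (u, w))"
  proof (cases w)
    case Nil
    then show ?thesis by (simp add: Psi_Nil arrow_elt_def path_elt_def)
  next
    case (Cons c q)
    have rhs: "(\<Sum>c\<in>arcs R. kf b c * arrow_elt R c (u, w)) = of_bool (c \<in> arcs R \<and> u = tail R c \<and> q = []) * kf b c"
    proof -
      have "(\<Sum>c'\<in>arcs R. kf b c' * arrow_elt R c' (u, w)) =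
        (\<Sum>c'\<in>arcs R. if c' = c then of_bool (u = tail R c \<and> q = []) * kf b c else 0)"
        by (intro sum.cong[OF refl]) (auto simp: arrow_elt_def path_elt_def Cons)
      then show ?thesis by simp
    qed
    have res: "residual T b' (arrow_elt T b) = (if b' = b then path_elt (head T b, []) else (\<lambda>x. 0 :: 'k))" for b'
      by (rule T.residual_arrow)
    have "(\<Sum>b'\<in>arcs T. of_bool (tail T b' = sv u s) *
        (kf b' c * Psi (residual T b' (arrow_elt T b)) t (s2 b') (head R c, q))) =
      (\<Sum>b'\<in>arcs T. if b' = b then of_bool (tail T b = sv u s) *
        (kf b c * Psi (path_elt (head T b, [])) t (s2 b) (head R c, q)) else 0)"
      by (intro sum.cong[OF refl]) (simp add: res)
    then have lhs: "Psi (arrow_elt T b) t s (u, w) = of_bool (u = tail R c \<and> ok u s \<and> tail T b = sv u s) *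
        (kf b c * Psi (path_elt (head T b, [])) t (s2 b) (head R c, q))"
      using b by (cases "u = tail R c") (simp_all add: Cons Psi_Cons)
    show ?thesis
    proof (cases "kf b c = 0")
      case False
      then have e: "eps b c \<noteq> 0" by (simp add: kf_def)
      note ov = eps_over[OF b e]
      have "Psi (path_elt (head T b, [])) t (s2 b) (head R c, q) = of_bool (t = s2 b \<and> q = [])"
      proof (cases q)
        case Nil
        then show ?thesis using ov(1,5) ov(3)[symmetric] by (simp add: Psi_Nil path_elt_def)
      next
        case (Cons c' q')
        have "residual T b' (path_elt (head T b, [])) = (\<lambda>x. 0 :: 'k)" for b' by (rule T.residual_vertex)
        with Cons show ?thesis by (simp add: Psi_Cons)
      qed
      moreover have "ok (tail R c) s \<and> tail T b = sv (tail R c) s \<longleftrightarrow> s = s1 b"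
      proof
        assume "s = s1 b"
        then show "ok (tail R c) s \<and> tail T b = sv (tail R c) s" using ov(2,4) by metis
      next
        assume "ok (tail R c) s \<and> tail T b = sv (tail R c) s"
        then show "s = s1 b" using snd_sv[OF tail_in_verts[OF ov(1)], of s] unfolding ok_def by metis
      qed
      ultimately show ?thesis unfolding lhs rhs using ov(1) by (auto simp: of_bool_def)
    qed (simp add: lhs rhs)
  qed
qed

end

lemma (in quiver) pmul_arrows_zero:
  "head Q c \<noteq> tail Q b \<Longrightarrow> pmul Q (arrow_elt Q b) (arrow_elt Q c) x = 0"
proof -
  assume ne: "head Q c \<noteq> tail Q b"
  obtain u p where x: "x = (u, p)" by (cases x)
  show ?thesis unfolding x
    by (cases p rule: rev_cases) (use ne in \<open>auto simp: pmul_arrow_left, auto simp: arrow_elt_def path_elt_def\<close>)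
qed

section \<open>The Ginzburg quivers and their differentials\<close>

context skew_potential_cover begin

abbreviation "GT \<equiv> ginzburg_quiver T"
abbreviation "gpi \<equiv> map_ginzburg_arrow fst \<pi>"

text \<open>These scalars are forced by the differentials of the dual arrows and of the loops.\<close>

primrec gkappa :: "('v \<times> sign, 'e) ginzburg_arrow \<Rightarrow> 'k" where
  "gkappa (Orig a) = 1"
| "gkappa (Dual a) = 2 * (nu (tail R (\<pi> a)) * cc a)"
| "gkappa (Loop x) = nu (fst x) * nu (fst x)"

lemma verts_TD: assumes "x \<in> verts T"
  shows "fst x \<in> verts R" "ok (fst x) (snd x)" "sv (fst x) (snd x) = x"
  using verts_T[OF assms] by (auto simp: ok_def)

lemma sv_eq: assumes "x \<in> verts T" "v \<in> verts R"
  shows "ok v (snd x) \<and> sv v (snd x) = x \<longleftrightarrow> v = fst x \<or> v = \<tau> (fst x)"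
proof
  assume "ok v (snd x) \<and> sv v (snd x) = x"
  then show "v = fst x \<or> v = \<tau> (fst x)"
    using fst_sv[OF assms(2), of "snd x"] tau_tau[OF assms(2)] unfolding ok_def by metis
next
  assume "v = fst x \<or> v = \<tau> (fst x)"
  then show "ok v (snd x) \<and> sv v (snd x) = x"
    using verts_TD[OF assms(1)] by (auto simp: sv_tau ok_tau)
qed

text \<open>For dual arrows the two signs are exchanged. For a loop the signs agree: either its
  vertex is fixed, and then so is the loop, or both signs are \<open>Plus\<close>.\<close>

lemma gpi_arrow_ex1:
  assumes c: "c \<in> arcs GQ" and s: "\<tau> (tail GQ c) = tail GQ c \<or> s = Plus"
    and r: "\<tau> (head GQ c) = head GQ c \<or> r = Plus" and fixed: "grho c = c \<Longrightarrow> s = r"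
  shows "\<exists>!b. b \<in> arcs GT \<and> (gpi b = c \<or> gpi b = grho c) \<and> snd (tail GT b) = s \<and> snd (head GT b) = r"
proof (cases c)
  case (Orig a)
  then have "\<exists>!b. b \<in> arcs T \<and> (\<pi> b = a \<or> \<pi> b = \<rho> a) \<and> s1 b = s \<and> s2 b = r"
    using c s r fixed by (intro arrow_ex1) auto
  then obtain b where b: "b \<in> arcs T" "\<pi> b = a \<or> \<pi> b = \<rho> a" "s1 b = s" "s2 b = r"
    and un: "\<And>b'. b' \<in> arcs T \<Longrightarrow> \<pi> b' = a \<or> \<pi> b' = \<rho> a \<Longrightarrow> s1 b' = s \<Longrightarrow> s2 b' = r \<Longrightarrow> b' = b"
    by blast
  show ?thesis
  proof (rule ex1I[of _ "Orig b"])
    fix b' assume "b' \<in> arcs GT \<and> (gpi b' = c \<or> gpi b' = grho c) \<and> snd (tail GT b') = s \<and> snd (head GT b') = r"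
    then show "b' = Orig b" using un by (cases b') (auto simp: Orig)
  qed (use b in \<open>simp add: Orig\<close>)
next
  case (Dual a)
  then have "\<exists>!b. b \<in> arcs T \<and> (\<pi> b = a \<or> \<pi> b = \<rho> a) \<and> s1 b = r \<and> s2 b = s"
    using c s r fixed by (intro arrow_ex1) auto
  then obtain b where b: "b \<in> arcs T" "\<pi> b = a \<or> \<pi> b = \<rho> a" "s1 b = r" "s2 b = s"
    and un: "\<And>b'. b' \<in> arcs T \<Longrightarrow> \<pi> b' = a \<or> \<pi> b' = \<rho> a \<Longrightarrow> s1 b' = r \<Longrightarrow> s2 b' = s \<Longrightarrow> b' = b"
    by blast
  show ?thesis
  proof (rule ex1I[of _ "Dual b"])
    fix b' assume "b' \<in> arcs GT \<and> (gpi b' = c \<or> gpi b' = grho c) \<and> snd (tail GT b') = s \<and> snd (head GT b') = r"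
    then show "b' = Dual b" using un by (cases b') (auto simp: Dual)
  qed (use b in \<open>simp add: Dual\<close>)
next
  case (Loop i)
  then have i: "i \<in> verts R" and oki: "\<tau> i = i \<or> s = Plus" using c s by auto
  have rs: "r = s" using s r fixed by (auto simp: Loop)
  show ?thesis
  proof (rule ex1I[of _ "Loop (sv i s)"])
    show "Loop (sv i s) \<in> arcs GT \<and> (gpi (Loop (sv i s)) = c \<or> gpi (Loop (sv i s)) = grho c) \<and>
        snd (tail GT (Loop (sv i s))) = s \<and> snd (head GT (Loop (sv i s))) = r"
      using sv_verts[OF i oki] snd_sv[OF i oki] fst_sv[OF i oki] by (auto simp: Loop rs)
    fix b assume b: "b \<in> arcs GT \<and> (gpi b = c \<or> gpi b = grho c) \<and> snd (tail GT b) = s \<and> snd (head GT b) = r"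
    then obtain x where x: "b = Loop x" "x \<in> verts T" "fst x = i \<or> fst x = \<tau> i" "snd x = s"
      by (cases b) (auto simp: Loop)
    then have "sv i s = x" using verts_TD(3)[OF x(2)] i by (auto simp: sv_tau)
    then show "b = Loop (sv i s)" using x(1) by simp
  qed
qed

text \<open>The Ginzburg quiver of \<open>T\<close> covers that of \<open>R\<close> in the same
  sense, so the correspondence between series and matrices applies to it directly, now with rescaled
  arrows.\<close>

sublocale GC: skew_cover GQ \<tau> grho GT gpi gkappa sv
proof unfold_locales
  fix b assume b: "b \<in> arcs GT"
  show "gkappa b \<noteq> 0"
  proof (cases b)
    case (Dual a)
    then show ?thesis using nu_neq_0 two_neq_0 by (simp add: cc_def)
  qed (use nu_neq_0 in simp_all)
  show "gpi b \<in> arcs GQ" using b pi_arcs verts_TD by (cases b) auto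
  show "tail GT b = sv (tail GQ (gpi b)) (snd (tail GT b)) \<and>
      (\<tau> (tail GQ (gpi b)) = tail GQ (gpi b) \<or> snd (tail GT b) = Plus)"
    using b tail_T head_T verts_T by (cases b) auto
  show "head GT b = sv (head GQ (gpi b)) (snd (head GT b)) \<and>
      (\<tau> (head GQ (gpi b)) = head GQ (gpi b) \<or> snd (head GT b) = Plus)"
    using b tail_T head_T verts_T by (cases b) auto
  show "snd (tail GT b) = snd (head GT b)" if "grho (gpi b) = gpi b"
    using b that fixed_sign by (cases b) auto
next
  fix c s r assume "c \<in> arcs GQ" "\<tau> (tail GQ c) = tail GQ c \<or> s = Plus"
    "\<tau> (head GQ c) = head GQ c \<or> r = Plus" "grho c = c \<Longrightarrow> s = r"
  then show "\<exists>!b. b \<in> arcs GT \<and> (gpi b = c \<or> gpi b = grho c) \<and> snd (tail GT b) = s \<and> snd (head GT b) = r"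
    by (rule gpi_arrow_ex1)
next
  fix c assume "c \<in> arcs GQ" "\<tau> (tail GQ c) = tail GQ c" "\<tau> (head GQ c) = head GQ c"
  then show "grho c = c" using fixed_arrow by (cases c) auto
qed (use two_neq_0 sv_verts snd_sv fst_sv sv_tau verts_T in simp_all)

text \<open>The scalar of a dual arrow turns its coefficients into those of
  \<open>Psi_cyclic_derivative\<close>. Duality also exchanges the two families: the coefficients of
  \<open>Dual a\<close> are the coordinates of \<open>a\<close> up to an orbit size, and
  conversely.\<close>

lemma gkf_simps:
  "GC.kf (Orig a) (Orig c) = kf a c" "GC.kf (Orig a) (Dual c) = 0" "GC.kf (Orig a) (Loop i) = 0"
  "GC.kf (Dual a) (Orig c) = 0" "GC.kf (Dual a) (Dual c) = nu (tail R (\<pi> a)) * Lf a c"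
  "GC.kf (Dual a) (Loop i) = 0" "GC.kf (Loop x) (Orig c) = 0" "GC.kf (Loop x) (Dual c) = 0"
  "GC.kf (Loop x) (Loop i) = nu (fst x) * nu (fst x) / 2 * (of_bool (i = fst x) + of_bool (i = \<tau> (fst x)))"
  "GC.Lf (Dual a) (Dual c) = kf a c / nu (head R (\<pi> a))"
proof -
  have [simp]: "chi (s2 a) (s1 a) = chi (s1 a) (s2 a)" by (rule chi_commute)
  show "GC.kf (Dual a) (Dual c) = nu (tail R (\<pi> a)) * Lf a c"
    using two_neq_0 by (simp add: GC.kf_def kf_def GC.eps_def eps_def Lf_def)
  show "GC.Lf (Dual a) (Dual c) = kf a c / nu (head R (\<pi> a))"
    using two_neq_0 nu_neq_0 four_neq_0
    by (simp add: GC.Lf_def kf_def GC.eps_def eps_def GC.cc_def cc_def)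
qed (simp_all add: GC.kf_def kf_def GC.eps_def eps_def)

lemma Psi_incl_ginzburg: "GC.Psi (incl_ginzburg f) t s = incl_ginzburg (Psi f t s)"
proof (rule path_ext)
  fix u w
  show "GC.Psi (incl_ginzburg f) t s (u, w) = incl_ginzburg (Psi f t s) (u, w)"
  proof (induction w arbitrary: u s f)
    case Nil
    show ?case by (simp add: GC.Psi_Nil Psi_Nil incl_ginzburg_def)
  next
    case (Cons c w)
    have res: "residual GT (Orig a) (incl_ginzburg f) = incl_ginzburg (residual T a f)"
      "residual GT (Dual a) (incl_ginzburg f) = (\<lambda>x. 0)" "residual GT (Loop x) (incl_ginzburg f) = (\<lambda>x. 0)" for a x
      by (rule path_ext, auto simp: incl_ginzburg_def residual_def)+
    have main: "GC.Psi (incl_ginzburg f) t s (u, c # w) = of_bool (u = tail GQ c \<and> ok u s) *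
      (\<Sum>a\<in>arcs T. of_bool (tail T a = sv u s) *
        (GC.kf (Orig a) c * incl_ginzburg (Psi (residual T a f) t (s2 a)) (head GQ c, w)))"
      by (simp add: GC.Psi_Cons T.sum_ginzburg_arcs res Cons.IH del: ginzburg_quiver_simps(2))
    show ?case
    proof (cases c)
      case (Orig c')
      show ?thesis
      proof (cases "set w \<subseteq> range Orig")
        case True
        then show ?thesis unfolding main by (simp add: Orig gkf_simps incl_ginzburg_def Psi_Cons)
      next
        case False
        then show ?thesis unfolding main by (simp add: incl_ginzburg_def)
      qed
    next
      case (Dual c')
      then show ?thesis unfolding main by (simp add: gkf_simps, auto simp: incl_ginzburg_def)
    next
      case (Loop i)
      then show ?thesis unfolding main by (simp add: gkf_simps, auto simp: incl_ginzburg_def)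
    qed
  qed
qed

text \<open>Each product of an arrow of \<open>T\<close> with its dual becomes a double sum over
  arrows \<open>c\<close>, \<open>c'\<close> below. Summing over the arrows at \<open>x\<close>, the
  orthogonality relations leave only \<open>c = c'\<close>, and these terms are the differentials of
  the loops below \<open>x\<close>, multiplied by the orbit size.\<close>

lemma Psi_loop_differential:
  assumes x: "x \<in> verts T"
  shows "GC.Psi (loop_differential T x) t s = (\<lambda>z. of_bool (t = snd x \<and> s = snd x) *
    (nu (fst x) * (\<Sum>i\<in>verts R. of_bool (i = fst x \<or> i = \<tau> (fst x)) * loop_differential R i z)))"
proof
  fix z
  let ?A = "arrow_elt GQ :: ('v, 'b) ginzburg_arrow \<Rightarrow> ('v, ('v, 'b) ginzburg_arrow, 'k) pelt" and ?in = "\<lambda>v. v = fst x \<or> v = \<tau> (fst x)"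
  have dec: "loop_differential T x = (\<lambda>y. \<Sum>a\<in>arcs T.
      of_bool (head T a = x) * pmul GT (arrow_elt GT (Orig a)) (arrow_elt GT (Dual a)) y
      + (- of_bool (tail T a = x)) * pmul GT (arrow_elt GT (Dual a)) (arrow_elt GT (Orig a)) y)"
    by (rule ext) (simp add: T.loop_differential_pmul)
  have prod: "GC.Psi (pmul GT (arrow_elt GT b) (arrow_elt GT b')) t s z =
      of_bool (t = snd (head GT b) \<and> s = snd (tail GT b') \<and> snd (tail GT b) = snd (head GT b')) *
      (\<Sum>c\<in>arcs GQ. \<Sum>c'\<in>arcs GQ. GC.kf b c * GC.kf b' c' * pmul GQ (?A c) (?A c') z)"
    if "b \<in> arcs GT" "b' \<in> arcs GT" for b b'
  proof -
    have sc: "pmul GQ (\<lambda>x. of_bool p * (\<Sum>c\<in>arcs GQ. GC.kf b c * ?A c x))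
        (\<lambda>x. of_bool q * (\<Sum>c\<in>arcs GQ. GC.kf b' c * ?A c x)) z = of_bool (p \<and> q) *
      (\<Sum>c\<in>arcs GQ. \<Sum>c'\<in>arcs GQ. GC.kf b c * GC.kf b' c' * pmul GQ (?A c) (?A c') z)" for p q
      unfolding pmul_scale_left pmul_scale_right pmul_sum_left pmul_sum_right
      by (simp add: sum_distrib_left mult.assoc mult.left_commute del: ginzburg_quiver_simps(2))
    show ?thesis
      unfolding GC.Psi_pmul[OF TP.G.supported_arrow[OF that(1)] TP.G.supported_arrow[OF that(2)]]
        GC.mmul_sum GC.Psi_arrow[OF that(1)] GC.Psi_arrow[OF that(2)] sc
      by (cases "snd (tail GT b)"; cases "snd (head GT b')") (simp_all del: ginzburg_quiver_simps(2))
  qed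
  define M1 where "M1 c c' = pmul GQ (?A (Orig c)) (?A (Dual c')) z" for c c'
  define M2 where "M2 c c' = pmul GQ (?A (Dual c)) (?A (Orig c')) z" for c c'
  have M1_zero: "M1 c c' = 0" if "tail R c \<noteq> tail R c'" for c c'
    unfolding M1_def by (rule G.pmul_arrows_zero) (use that in simp)
  have M2_zero: "M2 c c' = 0" if "head R c \<noteq> head R c'" for c c'
    unfolding M2_def by (rule G.pmul_arrows_zero) (use that in simp)
  have nu_in: "nu v = nu (fst x)" if "?in v" for v
    using that verts_TD(1)[OF x] by (auto simp: nu_tau)
  \<comment> \<open>Separates indicators from scalars: orbit sizes need to be compared only where
    the conditions on the vertices hold.\<close>
  have gen: "of_bool p * l = of_bool q * (of_bool q' * (nu (fst x) * (of_bool q'' * r)))"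
    if "p \<longleftrightarrow> q \<and> q' \<and> q''" and "q \<and> q' \<Longrightarrow> n = nu (fst x)" and "n = nu (fst x) \<Longrightarrow> l = nu (fst x) * r"
    for p q q' q'' and n l r :: 'k
    using that by auto
  \<comment> \<open>Arrows with a given head are dual arrows with a given tail, so the second
    orthogonality relation is applied in the Ginzburg quiver. It requires \<open>c\<close> and
    \<open>c'\<close> to have the same tail; otherwise the product of arrows vanishes.\<close>
  have key1: "(\<Sum>a\<in>arcs T. of_bool (head T a = x) * (kf a c * (nu (tail R (\<pi> a)) * Lf a c'))) * M1 c c' =
      of_bool (c = c') * (of_bool (?in (head R c)) * (nu (fst x) * M1 c c'))"
    if c: "c \<in> arcs R" and c': "c' \<in> arcs R" for c c'
  proof (cases "tail R c = tail R c'")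
    case tails: True
    have summand: "of_bool (head T a = x) * (kf a c * (nu (tail R (\<pi> a)) * Lf a c')) =
        of_bool (ok (head R c) (snd x)) * (of_bool (sv (head R c) (snd x) = x) * (nu (fst x) *
        (of_bool (head T a = sv (head R c) (snd x)) * (GC.kf (Dual a) (Dual c') * GC.Lf (Dual a) (Dual c)))))"
      if a: "a \<in> arcs T" for a
    proof (cases "kf a c = 0")
      case False
      then have e: "eps a c \<noteq> 0" by (simp add: kf_def)
      have hc: "head R (\<pi> a) = head R c \<or> head R (\<pi> a) = \<tau> (head R c)"
        using eps_over(6)[OF a e] c by auto
      have "head T a = x \<longleftrightarrow> ok (head R c) (snd x) \<and> sv (head R c) (snd x) = x \<and> head T a = sv (head R c) (snd x)"
        using eps_over(3,5)[OF a e] by metis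
      moreover have "nu (head R (\<pi> a)) = nu (fst x)" if "ok (head R c) (snd x) \<and> sv (head R c) (snd x) = x"
      proof -
        have "nu (head R c) = nu (fst x)" using that sv_eq[OF x head_in_verts[OF c]] by (intro nu_in) blast
        moreover have "nu (head R (\<pi> a)) = nu (head R c)" using hc nu_tau[OF head_in_verts[OF c]] by metis
        ultimately show ?thesis by (rule trans[rotated])
      qed
      ultimately show ?thesis
      proof (rule gen)
        assume eq: "nu (head R (\<pi> a)) = nu (fst x)"
        show "kf a c * (nu (tail R (\<pi> a)) * Lf a c') =
            nu (fst x) * (GC.kf (Dual a) (Dual c') * GC.Lf (Dual a) (Dual c))"
          unfolding gkf_simps eq using nu_neq_0[of "fst x"] by simp
      qed
    qed (simp add: gkf_simps)
    have "(\<Sum>a\<in>arcs T. of_bool (head T a = x) * (kf a c * (nu (tail R (\<pi> a)) * Lf a c'))) =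
        of_bool (ok (head R c) (snd x)) * (of_bool (sv (head R c) (snd x) = x) * (nu (fst x) *
        (\<Sum>a\<in>arcs T. of_bool (head T a = sv (head R c) (snd x)) * (GC.kf (Dual a) (Dual c') * GC.Lf (Dual a) (Dual c)))))"
      unfolding sum_distrib_left by (rule sum.cong[OF refl summand])
    also have "\<dots> = of_bool (ok (head R c) (snd x)) * (of_bool (sv (head R c) (snd x) = x) * (nu (fst x) * of_bool (c = c')))"
    proof (cases "ok (head R c) (snd x)")
      case True
      have swap: "GC.kf b (Dual c') * GC.Lf b (Dual c) = GC.kf b (Dual c) * GC.Lf b (Dual c')" for b
        by (simp add: GC.kf_def GC.Lf_def)
      have "(\<Sum>b\<in>arcs GT. of_bool (tail GT b = sv (tail GQ (Dual c)) (snd x)) * (GC.kf b (Dual c) * GC.Lf b (Dual c'))) =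
          of_bool (Dual c = (Dual c' :: ('v, 'b) ginzburg_arrow))"
        by (rule GC.kf_Lf_sum) (use True tails c c' in simp_all)
      then show ?thesis unfolding swap by (simp add: T.sum_ginzburg_arcs gkf_simps(1-4) gkf_simps(7,8) del: ginzburg_quiver_simps(2))
    qed simp
    finally show ?thesis using sv_eq[OF x head_in_verts[OF c]] by (auto simp: of_bool_def)
  next
    case False
    then show ?thesis using M1_zero by auto
  qed
  \<comment> \<open>Here the relation for \<open>T\<close> itself applies, with \<open>c\<close> and
    \<open>c'\<close> exchanged, and equality of the heads is what the product of arrows
    enforces.\<close>
  have key2: "(\<Sum>a\<in>arcs T. of_bool (tail T a = x) * (nu (tail R (\<pi> a)) * Lf a c * kf a c')) * M2 c c' =
      of_bool (c = c') * (of_bool (?in (tail R c)) * (nu (fst x) * M2 c c'))"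
    if c: "c \<in> arcs R" and c': "c' \<in> arcs R" for c c'
  proof (cases "head R c = head R c'")
    case heads: True
    have summand: "of_bool (tail T a = x) * (nu (tail R (\<pi> a)) * Lf a c * kf a c') =
        of_bool (ok (tail R c') (snd x)) * (of_bool (sv (tail R c') (snd x) = x) * (nu (fst x) *
        (of_bool (tail T a = sv (tail R c') (snd x)) * (kf a c' * Lf a c))))"
      if a: "a \<in> arcs T" for a
    proof (cases "kf a c' = 0")
      case False
      then have e: "eps a c' \<noteq> 0" by (simp add: kf_def)
      have hc: "tail R (\<pi> a) = tail R c' \<or> tail R (\<pi> a) = \<tau> (tail R c')"
        using eps_over(6)[OF a e] c' by auto
      have "tail T a = x \<longleftrightarrow> ok (tail R c') (snd x) \<and> sv (tail R c') (snd x) = x \<and> tail T a = sv (tail R c') (snd x)"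
        using eps_over(2,4)[OF a e] by metis
      moreover have "nu (tail R (\<pi> a)) = nu (fst x)" if "ok (tail R c') (snd x) \<and> sv (tail R c') (snd x) = x"
      proof -
        have "nu (tail R c') = nu (fst x)" using that sv_eq[OF x tail_in_verts[OF c']] by (intro nu_in) blast
        moreover have "nu (tail R (\<pi> a)) = nu (tail R c')" using hc nu_tau[OF tail_in_verts[OF c']] by metis
        ultimately show ?thesis by (rule trans[rotated])
      qed
      ultimately show ?thesis 
      proof (rule gen)
        assume eq: "nu (tail R (\<pi> a)) = nu (fst x)"
        show "nu (tail R (\<pi> a)) * Lf a c * kf a c' = nu (fst x) * (kf a c' * Lf a c)"
          unfolding eq by (simp only: ac_simps)
      qed
    qed simp
    have "(\<Sum>a\<in>arcs T. of_bool (tail T a = x) * (nu (tail R (\<pi> a)) * Lf a c * kf a c')) =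
        of_bool (ok (tail R c') (snd x)) * (of_bool (sv (tail R c') (snd x) = x) * (nu (fst x) *
        (\<Sum>a\<in>arcs T. of_bool (tail T a = sv (tail R c') (snd x)) * (kf a c' * Lf a c))))"
      unfolding sum_distrib_left by (rule sum.cong[OF refl summand])
    also have "\<dots> = of_bool (ok (tail R c') (snd x)) * (of_bool (sv (tail R c') (snd x) = x) * (nu (fst x) * of_bool (c' = c)))"
    proof (cases "ok (tail R c') (snd x)")
      case True
      then show ?thesis by (simp only: kf_Lf_sum[OF c' c heads[symmetric] True])
    qed simp
    finally show ?thesis using sv_eq[OF x tail_in_verts[OF c']] by (auto simp: of_bool_def)
  next
    case False
    then show ?thesis using M2_zero by auto
  qed
  have collapse: "(\<Sum>a\<in>arcs T. p a * (\<Sum>c\<in>arcs R. \<Sum>c'\<in>arcs R. h a c c' * M c c')) =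
      (\<Sum>c\<in>arcs R. of_bool (?in (v c)) * (nu (fst x) * M c c))"
    if "\<And>c c'. c \<in> arcs R \<Longrightarrow> c' \<in> arcs R \<Longrightarrow> (\<Sum>a\<in>arcs T. p a * h a c c') * M c c' =
      of_bool (c = c') * (of_bool (?in (v c)) * (nu (fst x) * M c c'))"
    for p :: "'e \<Rightarrow> 'k" and h M v
  proof -
    have "(\<Sum>a\<in>arcs T. p a * (\<Sum>c\<in>arcs R. \<Sum>c'\<in>arcs R. h a c c' * M c c')) =
        (\<Sum>a\<in>arcs T. \<Sum>c\<in>arcs R. \<Sum>c'\<in>arcs R. p a * h a c c' * M c c')"
      by (simp only: sum_distrib_left mult.assoc)
    also have "\<dots> = (\<Sum>c\<in>arcs R. \<Sum>a\<in>arcs T. \<Sum>c'\<in>arcs R. p a * h a c c' * M c c')" by (rule sum.swap)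
    also have "\<dots> = (\<Sum>c\<in>arcs R. \<Sum>c'\<in>arcs R. \<Sum>a\<in>arcs T. p a * h a c c' * M c c')"
      by (intro sum.cong[OF refl] sum.swap)
    also have "\<dots> = (\<Sum>c\<in>arcs R. \<Sum>c'\<in>arcs R. if c' = c then of_bool (?in (v c)) * (nu (fst x) * M c c) else 0)"
      unfolding sum_distrib_right[symmetric] by (intro sum.cong[OF refl]) (auto simp: that)
    finally show ?thesis by simp
  qed
  have P1: "GC.Psi (pmul GT (arrow_elt GT (Orig a)) (arrow_elt GT (Dual a))) t s z =
      of_bool (t = s2 a \<and> s = s2 a) *
      (\<Sum>c\<in>arcs R. \<Sum>c'\<in>arcs R. kf a c * (nu (tail R (\<pi> a)) * Lf a c') * M1 c c')" if "a \<in> arcs T" for a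
  proof -
    have "Orig a \<in> arcs GT" "Dual a \<in> arcs GT" using that by simp_all
    then show ?thesis by (simp add: prod sum_ginzburg_arcs gkf_simps M1_def del: ginzburg_quiver_simps(2))
  qed
  have P2: "GC.Psi (pmul GT (arrow_elt GT (Dual a)) (arrow_elt GT (Orig a))) t s z =
      of_bool (t = s1 a \<and> s = s1 a) *
      (\<Sum>c\<in>arcs R. \<Sum>c'\<in>arcs R. nu (tail R (\<pi> a)) * Lf a c * kf a c' * M2 c c')" if "a \<in> arcs T" for a
  proof -
    have "Orig a \<in> arcs GT" "Dual a \<in> arcs GT" using that by simp_all
    then show ?thesis by (simp add: prod sum_ginzburg_arcs gkf_simps M2_def del: ginzburg_quiver_simps(2))
  qed
  have pick: "(\<Sum>i\<in>verts R. of_bool (?in i) * (of_bool (h = i) * m - of_bool (l = i) * n)) =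
      of_bool (?in h) * m - of_bool (?in l) * n" if "h \<in> verts R" "l \<in> verts R" for h l and m n :: 'k
  proof -
    have "of_bool (?in i) * (of_bool (h = i) * m - of_bool (l = i) * n) =
        (if i = h then of_bool (?in h) * m else 0) - (if i = l then of_bool (?in l) * n else 0)" for i
      by (cases "i = h"; cases "i = l") simp_all
    then show ?thesis using that by (simp add: sum_subtractf)
  qed
  have total: "(\<Sum>c\<in>arcs R. of_bool (?in (head R c)) * (nu (fst x) * M1 c c))
      - (\<Sum>c\<in>arcs R. of_bool (?in (tail R c)) * (nu (fst x) * M2 c c)) =
      nu (fst x) * (\<Sum>i\<in>verts R. of_bool (?in i) * loop_differential R i z)"
  proof -
    have "(\<Sum>i\<in>verts R. of_bool (?in i) * loop_differential R i z) =
      (\<Sum>i\<in>verts R. \<Sum>c\<in>arcs R. of_bool (?in i) * (of_bool (head R c = i) * M1 c c - of_bool (tail R c = i) * M2 c c))"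
      by (simp only: loop_differential_pmul sum_distrib_left M1_def M2_def)
    also have "\<dots> = (\<Sum>c\<in>arcs R. \<Sum>i\<in>verts R. of_bool (?in i) * (of_bool (head R c = i) * M1 c c - of_bool (tail R c = i) * M2 c c))"
      by (rule sum.swap)
    also have "\<dots> = (\<Sum>c\<in>arcs R. of_bool (?in (head R c)) * M1 c c - of_bool (?in (tail R c)) * M2 c c)"
      by (rule sum.cong[OF refl], rule pick) simp_all
    finally have eq: "(\<Sum>i\<in>verts R. of_bool (?in i) * loop_differential R i z) =
      (\<Sum>c\<in>arcs R. of_bool (?in (head R c)) * M1 c c - of_bool (?in (tail R c)) * M2 c c)" .
    show ?thesis unfolding eq by (simp only: sum_subtractf sum_distrib_left right_diff_distrib mult.left_commute)
  qed
  have pull: "(\<Sum>a\<in>arcs T. b * (f a - g a)) = b * ((\<Sum>a\<in>arcs T. f a) - (\<Sum>a\<in>arcs T. g a))"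
    for b :: 'k and f g by (simp add: sum_subtractf sum_distrib_left right_diff_distrib)
  have "GC.Psi (loop_differential T x) t s z = (\<Sum>a\<in>arcs T.
      of_bool (head T a = x) * GC.Psi (pmul GT (arrow_elt GT (Orig a)) (arrow_elt GT (Dual a))) t s z
      + (- of_bool (tail T a = x)) * GC.Psi (pmul GT (arrow_elt GT (Dual a)) (arrow_elt GT (Orig a))) t s z)"
    unfolding dec GC.Psi_sum[OF T.finite_arcs] GC.Psi_add GC.Psi_scale by (rule refl)
  also have "\<dots> = (\<Sum>a\<in>arcs T. of_bool (t = snd x \<and> s = snd x) *
      (of_bool (head T a = x) * (\<Sum>c\<in>arcs R. \<Sum>c'\<in>arcs R. kf a c * (nu (tail R (\<pi> a)) * Lf a c') * M1 c c')
      - of_bool (tail T a = x) * (\<Sum>c\<in>arcs R. \<Sum>c'\<in>arcs R. nu (tail R (\<pi> a)) * Lf a c * kf a c' * M2 c c')))"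
    by (intro sum.cong[OF refl]) (simp add: P1 P2 of_bool_def)
  also have "\<dots> = of_bool (t = snd x \<and> s = snd x) *
      ((\<Sum>c\<in>arcs R. of_bool (?in (head R c)) * (nu (fst x) * M1 c c))
      - (\<Sum>c\<in>arcs R. of_bool (?in (tail R c)) * (nu (fst x) * M2 c c)))"
    unfolding pull by (simp only: collapse[of "\<lambda>a. of_bool (head T a = x)", OF key1]
      collapse[of "\<lambda>a. of_bool (tail T a = x)", OF key2])
  also have "\<dots> = of_bool (t = snd x \<and> s = snd x) *
    (nu (fst x) * (\<Sum>i\<in>verts R. of_bool (?in i) * loop_differential R i z))"
    unfolding total by (rule refl)
  finally show "GC.Psi (loop_differential T x) t s z = of_bool (t = snd x \<and> s = snd x) *
    (nu (fst x) * (\<Sum>i\<in>verts R. of_bool (?in i) * loop_differential R i z))" .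
qed

text \<open>This is the condition \<open>Psi_E\<close> for the two Ginzburg differentials. For a
  loop, \<open>nu * nu / 2\<close> becomes \<open>nu\<close> on the orbit, because the two
  indicators coincide exactly when the vertex is fixed.\<close>

lemma Psi_ginzburg_values:
  assumes b: "b \<in> arcs GT"
  shows "GC.Psi (ginzburg_values T cover_potential b) t s = (\<lambda>z. of_bool (t = snd (head GT b) \<and> s = snd (tail GT b)) *
    (\<Sum>c\<in>arcs GQ. GC.kf b c * ginzburg_values R S c z))"
proof (cases b)
  case (Orig a)
  then show ?thesis by (simp add: sum_ginzburg_arcs gkf_simps del: ginzburg_quiver_simps(2))
next
  case (Dual a)
  then have a: "a \<in> arcs T" using b by auto
  show ?thesis
  proof (rule path_ext)
    fix u p
    show "GC.Psi (ginzburg_values T cover_potential b) t s (u, p) =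
      of_bool (t = snd (head GT b) \<and> s = snd (tail GT b)) *
      (\<Sum>c\<in>arcs GQ. GC.kf b c * ginzburg_values R S c (u, p))"
      by (simp add: Dual Psi_incl_ginzburg Psi_cyclic_derivative[OF a] sum_ginzburg_arcs gkf_simps
          del: ginzburg_quiver_simps(2))
        (simp add: incl_ginzburg_def sum_distrib_left mult.assoc)
  qed
next
  case (Loop x)
  then have x: "x \<in> verts T" using b by auto
  have "GC.kf (Loop x) (Loop i) = nu (fst x) * of_bool (i = fst x \<or> i = \<tau> (fst x))" for i
    unfolding gkf_simps using two_neq_0 by (cases "\<tau> (fst x) = fst x") (auto simp: nu_def)
  then show ?thesis
    by (simp add: Loop Psi_loop_differential[OF x] sum_ginzburg_arcs gkf_simps(1-8) sum_distrib_left mult.assoc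
        del: ginzburg_quiver_simps(2))
qed

end

section \<open>The quiver of the theorem\<close>

locale skew_setting = group G + potential Q S
  for G :: "('g, 'm) monoid_scheme" and Q :: "('v, 'a) pre_digraph" and S :: "('v, 'a, 'k::field) pelt" +
  fixes \<sigma> :: 'g and vact :: "'g \<Rightarrow> 'v \<Rightarrow> 'v" and aact :: "'g \<Rightarrow> 'a \<Rightarrow> 'a"
    and oW :: "'v set" and oQ1 :: "'a set"
  assumes char: "CHAR('k) \<noteq> 2"
    and carrier_eq: "carrier G = {\<one>\<^bsub>G\<^esub>, \<sigma>}" and sigma_one: "\<sigma> \<noteq> \<one>\<^bsub>G\<^esub>"
    and action: "quiver_action G Q vact aact"
    and fixed_arrows: "\<alpha> \<in> arcs Q \<Longrightarrow> vact \<sigma> (tail Q \<alpha>) = tail Q \<alpha> \<Longrightarrow> vact \<sigma> (head Q \<alpha>) = head Q \<alpha> \<Longrightarrow>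
      aact \<sigma> \<alpha> = \<alpha>"
    and invariant: "cyclically_equivalent Q S (path_action G Q vact aact \<sigma> S)"
    and oW_rep: "orbit_representatives G vact (verts Q - invariants (verts Q) vact \<sigma>) oW"
    and oQ1_rep: "orbit_representatives G aact (arcs Q) oQ1"
begin

abbreviation "\<tau> \<equiv> vact \<sigma>"
abbreviation "\<rho> \<equiv> aact \<sigma>"
abbreviation "QG \<equiv> skew_quiver G Q vact \<sigma> oW oQ1"
abbreviation "sv \<equiv> skew_vertex G vact \<sigma> oW"

lemma sigma_carrier: "\<sigma> \<in> carrier G" by (simp add: carrier_eq)

lemma sigma_square: "\<sigma> \<otimes>\<^bsub>G\<^esub> \<sigma> = \<one>\<^bsub>G\<^esub>"
  using m_closed[OF sigma_carrier sigma_carrier] l_cancel_one[OF sigma_carrier sigma_carrier] sigma_one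
  by (auto simp: carrier_eq)

lemma inverse_sigma: "inv\<^bsub>G\<^esub> \<sigma> = \<sigma>"
  using inv_equality[OF sigma_square sigma_carrier sigma_carrier] .

lemma two: "(2::'k) \<noteq> 0"
proof
  assume "(2::'k) = 0"
  then have "(of_nat 2 :: 'k) = 0" by simp
  then have "CHAR('k) dvd 2" by (simp only: of_nat_eq_0_iff_char_dvd)
  then have "CHAR('k) \<le> 2" "CHAR('k) \<noteq> 0" by (auto dest: dvd_imp_le intro!: Nat.gr0I)
  with char have "CHAR('k) = 1" by linarith
  with of_nat_CHAR[where ?'a = 'k] show False by (simp only: of_nat_1 one_neq_zero)
qed

lemma group_action_verts: "group_action G (verts Q) vact" and group_action_arcs: "group_action G (arcs Q) aact"
  using action by (auto simp: quiver_action_def)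

lemma action_one: "u \<in> verts Q \<Longrightarrow> vact \<one>\<^bsub>G\<^esub> u = u" "a \<in> arcs Q \<Longrightarrow> aact \<one>\<^bsub>G\<^esub> a = a"
  using group_action.id_eq_one[OF group_action_verts] group_action.id_eq_one[OF group_action_arcs]
  by (metis restrict_apply')+

lemma orbits: "u \<in> verts Q \<Longrightarrow> orbit G vact u = {u, \<tau> u}" "a \<in> arcs Q \<Longrightarrow> orbit G aact a = {a, \<rho> a}"
proof -
  have "orbit G \<phi> x = {\<phi> \<one>\<^bsub>G\<^esub> x, \<phi> \<sigma> x}" for \<phi> :: "'g \<Rightarrow> 'c \<Rightarrow> 'c" and x
    unfolding orbit_def carrier_eq by blast
  note this[of vact u] this[of aact a]
  then show "u \<in> verts Q \<Longrightarrow> orbit G vact u = {u, \<tau> u}" "a \<in> arcs Q \<Longrightarrow> orbit G aact a = {a, \<rho> a}"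
    by (simp_all add: action_one)
qed

sublocale I: quiver_involution Q \<tau> \<rho>
proof unfold_locales
  show "\<tau> u \<in> verts Q" if "u \<in> verts Q" for u
    by (rule group_action.element_image[OF group_action_verts sigma_carrier that refl])
  show "\<tau> (\<tau> u) = u" if "u \<in> verts Q" for u
    using group_action.composition_rule[OF group_action_verts that sigma_carrier sigma_carrier] that
    by (simp add: sigma_square action_one)
  show "\<rho> a \<in> arcs Q" if "a \<in> arcs Q" for a
    by (rule group_action.element_image[OF group_action_arcs sigma_carrier that refl])
  show "\<rho> (\<rho> a) = a" if "a \<in> arcs Q" for a
    using group_action.composition_rule[OF group_action_arcs that sigma_carrier sigma_carrier] that
    by (simp add: sigma_square action_one)
qed (use action sigma_carrier in \<open>auto simp: quiver_action_def\<close>)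

lemma oW_moved: "oW \<subseteq> {u \<in> verts Q. \<tau> u \<noteq> u}"
  using oW_rep by (auto simp: orbit_representatives_def invariants_def)

lemma oW_ex1: "u \<in> verts Q \<Longrightarrow> \<tau> u \<noteq> u \<Longrightarrow> \<exists>!j. j \<in> oW \<and> j \<in> {u, \<tau> u}"
proof -
  assume u: "u \<in> verts Q" "\<tau> u \<noteq> u"
  then have "u \<in> verts Q - invariants (verts Q) vact \<sigma>" by (simp add: invariants_def)
  then have "\<exists>!j. j \<in> oW \<and> j \<in> orbit G vact u"
    using oW_rep unfolding orbit_representatives_def by blast
  then show "\<exists>!j. j \<in> oW \<and> j \<in> {u, \<tau> u}" by (simp only: orbits(1)[OF u(1)])
qed

lemma oW_iff: "u \<in> verts Q \<Longrightarrow> \<tau> u \<noteq> u \<Longrightarrow> u \<in> oW \<longleftrightarrow> \<tau> u \<notin> oW"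
  using oW_ex1[of u] by blast

lemma oQ1_ex1: "a \<in> arcs Q \<Longrightarrow> \<exists>!b. b \<in> oQ1 \<and> b \<in> {a, \<rho> a}"
proof -
  assume a: "a \<in> arcs Q"
  then have "\<exists>!b. b \<in> oQ1 \<and> b \<in> orbit G aact a"
    using oQ1_rep unfolding orbit_representatives_def by blast
  then show "\<exists>!b. b \<in> oQ1 \<and> b \<in> {a, \<rho> a}" by (simp only: orbits(2)[OF a])
qed

lemma oQ1_arcs: "oQ1 \<subseteq> arcs Q"
  using oQ1_rep by (simp add: orbit_representatives_def)

lemma sv_fixed: "\<tau> u = u \<Longrightarrow> sv u s = (u, s)"
  by (simp add: skew_vertex_def)

lemma sv_moved: "u \<in> verts Q \<Longrightarrow> \<tau> u \<noteq> u \<Longrightarrow> sv u s = (if u \<in> oW then u else \<tau> u, Plus)"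
proof -
  assume u: "u \<in> verts Q" "\<tau> u \<noteq> u"
  have "(THE j. j \<in> oW \<and> j \<in> orbit G vact u) = (if u \<in> oW then u else \<tau> u)"
  proof (rule the_equality)
    show "(if u \<in> oW then u else \<tau> u) \<in> oW \<and> (if u \<in> oW then u else \<tau> u) \<in> orbit G vact u"
      unfolding orbits(1)[OF u(1)] using oW_iff[OF u] by (simp split: if_split)
    show "j = (if u \<in> oW then u else \<tau> u)" if "j \<in> oW \<and> j \<in> orbit G vact u" for j
      using that oW_ex1[OF u] oW_iff[OF u] unfolding orbits(1)[OF u(1)] by (simp split: if_split) blast
  qed
  with u(2) show ?thesis by (simp add: skew_vertex_def)
qed

lemma skew_quiver_simps:
  "verts QG = {x. fst x \<in> verts Q \<and> \<tau> (fst x) = fst x} \<union> oW \<times> {Plus}"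
  "arcs QG = {b. fst b \<in> oQ1 \<and> (snd b = Plus \<or> \<tau> (tail Q (fst b)) = tail Q (fst b) \<or> \<tau> (head Q (fst b)) = head Q (fst b))}"
  "tail QG b = sv (tail Q (fst b)) (snd b)" "head QG b = sv (head Q (fst b)) (snd b)"
  using signs_cases by (auto simp: skew_quiver_def invariants_def split: prod.splits)

lemma sv_props:
  assumes u: "u \<in> verts Q"
  shows "sv u s \<in> verts QG" "snd (sv u s) = (if \<tau> u = u then s else Plus)" "fst (sv u s) = u \<or> fst (sv u s) = \<tau> u"
    "sv (\<tau> u) s = sv u s"
proof -
  have tt: "\<tau> (\<tau> u) = u" "\<tau> u \<in> verts Q" using u by simp_all
  have "sv u s \<in> verts QG \<and> snd (sv u s) = (if \<tau> u = u then s else Plus) \<and>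
    (fst (sv u s) = u \<or> fst (sv u s) = \<tau> u) \<and> sv (\<tau> u) s = sv u s"
  proof (cases "\<tau> u = u")
    case True
    then show ?thesis using u by (simp add: sv_fixed skew_quiver_simps)
  next
    case False
    then have F: "\<tau> (\<tau> u) \<noteq> \<tau> u" using tt(1) by simp
    show ?thesis
    proof (cases "u \<in> oW")
      case True
      then have "\<tau> u \<notin> oW" using oW_iff[OF u False] by blast
      with True show ?thesis
        unfolding sv_moved[OF u False] sv_moved[OF tt(2) F] tt(1) using False by (simp add: skew_quiver_simps)
    next
      case nin: False
      then have "\<tau> u \<in> oW" using oW_iff[OF u False] by blast
      with nin show ?thesis
        unfolding sv_moved[OF u False] sv_moved[OF tt(2) F] tt(1) using False by (simp add: skew_quiver_simps)
    qed
  qed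
  then show "sv u s \<in> verts QG" "snd (sv u s) = (if \<tau> u = u then s else Plus)" "fst (sv u s) = u \<or> fst (sv u s) = \<tau> u"
    "sv (\<tau> u) s = sv u s" by blast+
qed

lemma sv_sign:
  assumes u: "u \<in> verts Q"
  shows "sv u s = sv u (snd (sv u s)) \<and> (\<tau> u = u \<or> snd (sv u s) = Plus)"
proof (cases "\<tau> u = u")
  case True
  then show ?thesis by (simp add: sv_fixed)
next
  case False
  then show ?thesis by (simp add: sv_moved[OF u False])
qed

lemma quiver_skew: "quiver QG"
proof unfold_locales
  have "finite oW" using oW_moved by (rule finite_subset) simp
  then have "finite (Collect (\<lambda>u. u \<in> verts Q \<and> \<tau> u = u) \<times> {Plus, Minus} \<union> oW \<times> {Plus})" by simp
  then show "finite (verts QG)" by (simp add: skew_quiver_def invariants_def)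
  have "finite (oQ1 \<times> {Plus, Minus})" using finite_subset[OF oQ1_arcs] by simp
  moreover have "arcs QG \<subseteq> oQ1 \<times> {Plus, Minus}" using signs_cases by (auto simp: skew_quiver_simps)
  ultimately show "finite (arcs QG)" by (rule finite_subset[rotated])
  fix b assume "b \<in> arcs QG"
  then have "fst b \<in> arcs Q" using oQ1_arcs by (auto simp: skew_quiver_simps)
  then show "tail QG b \<in> verts QG" "head QG b \<in> verts QG"
    unfolding skew_quiver_simps(3,4) by (auto intro!: sv_props(1))
qed

text \<open>An arrow of the new quiver carries one sign, visible at its fixed ends, while a moved
  end shows \<open>Plus\<close>. If both ends are fixed, so is the arrow, and the prescribed signs
  coincide.\<close>

lemma skew_arrow_ex1:
  assumes c: "c \<in> arcs Q" and s: "\<tau> (tail Q c) = tail Q c \<or> s = Plus"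
    and r: "\<tau> (head Q c) = head Q c \<or> r = Plus" and fixed: "\<rho> c = c \<Longrightarrow> s = r"
  shows "\<exists>!b. b \<in> arcs QG \<and> (fst b = c \<or> fst b = \<rho> c) \<and> snd (tail QG b) = s \<and> snd (head QG b) = r"
proof -
  obtain a where a: "a \<in> oQ1" "a = c \<or> a = \<rho> c"
    and un: "\<And>a'. a' \<in> oQ1 \<Longrightarrow> a' = c \<or> a' = \<rho> c \<Longrightarrow> a' = a"
    using oQ1_ex1[OF c] by blast
  have fx: "\<tau> (\<tau> u) = \<tau> u \<longleftrightarrow> \<tau> u = u" if "u \<in> verts Q" for u using that by (metis I.tau_tau)
  have aQ: "a \<in> arcs Q" using a(1) oQ1_arcs by auto
  have t: "\<tau> (tail Q a) = tail Q a \<longleftrightarrow> \<tau> (tail Q c) = tail Q c"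
    and h: "\<tau> (head Q a) = head Q a \<longleftrightarrow> \<tau> (head Q c) = head Q c"
    using a(2) c fx by auto
  have both: "s = r" if "\<tau> (tail Q c) = tail Q c" "\<tau> (head Q c) = head Q c"
    using fixed fixed_arrows[OF c that] by blast
  have sn: "snd (tail QG (a, q)) = (if \<tau> (tail Q c) = tail Q c then q else Plus)"
    "snd (head QG (a, q)) = (if \<tau> (head Q c) = head Q c then q else Plus)" for q
    using aQ by (simp_all add: skew_quiver_simps sv_props t h)
  show ?thesis
  proof (rule ex1I[of _ "(a, if \<tau> (tail Q c) = tail Q c then s else r)"])
    show "(a, if \<tau> (tail Q c) = tail Q c then s else r) \<in> arcs QG \<and>
      (fst (a, if \<tau> (tail Q c) = tail Q c then s else r) = c \<or>
       fst (a, if \<tau> (tail Q c) = tail Q c then s else r) = \<rho> c) \<and>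
      snd (tail QG (a, if \<tau> (tail Q c) = tail Q c then s else r)) = s \<and>
      snd (head QG (a, if \<tau> (tail Q c) = tail Q c then s else r)) = r"
      unfolding sn using a s r both by (auto simp: skew_quiver_simps t h)
    fix b assume b: "b \<in> arcs QG \<and> (fst b = c \<or> fst b = \<rho> c) \<and> snd (tail QG b) = s \<and> snd (head QG b) = r"
    obtain a' q where bq: "b = (a', q)" by (cases b)
    have "a' = a" using b un by (auto simp: bq skew_quiver_simps)
    with b bq have bq: "b = (a, q)" by simp
    from b show "b = (a, if \<tau> (tail Q c) = tail Q c then s else r)"
      unfolding bq sn by (auto simp: skew_quiver_simps(2) t h split: if_splits)
  qed
qed

sublocale C: skew_cover Q \<tau> \<rho> QG fst "\<lambda>_ :: 'a \<times> sign. 1 :: 'k" sv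
proof (intro skew_cover.intro skew_cover_axioms.intro I.quiver_involution_axioms quiver_skew)
  show "(2::'k) \<noteq> 0" by (rule two)
  fix b assume b: "b \<in> arcs QG"
  then show f: "fst b \<in> arcs Q" using oQ1_arcs by (auto simp: skew_quiver_simps)
  show "tail QG b = sv (tail Q (fst b)) (snd (tail QG b)) \<and>
      (\<tau> (tail Q (fst b)) = tail Q (fst b) \<or> snd (tail QG b) = Plus)"
    unfolding skew_quiver_simps(3) by (rule sv_sign) (simp add: f)
  show "head QG b = sv (head Q (fst b)) (snd (head QG b)) \<and>
      (\<tau> (head Q (fst b)) = head Q (fst b) \<or> snd (head QG b) = Plus)"
    unfolding skew_quiver_simps(4) by (rule sv_sign) (simp add: f)
  assume "\<rho> (fst b) = fst b"
  then have "\<tau> (tail Q (fst b)) = tail Q (fst b)" "\<tau> (head Q (fst b)) = head Q (fst b)"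
    using f by (metis I.tail_rho, metis I.head_rho)
  then show "snd (tail QG b) = snd (head QG b)" using f by (simp add: skew_quiver_simps sv_props)
next
  fix x assume "x \<in> verts QG"
  then show "fst x \<in> verts Q \<and> (\<tau> (fst x) = fst x \<or> snd x = Plus) \<and> sv (fst x) (snd x) = x"
    using oW_moved by (cases x) (auto simp: skew_quiver_simps sv_fixed sv_moved)
next
  fix c s r assume "c \<in> arcs Q" "\<tau> (tail Q c) = tail Q c \<or> s = Plus" "\<tau> (head Q c) = head Q c \<or> r = Plus"
    "\<rho> c = c \<Longrightarrow> s = r"
  then show "\<exists>!b. b \<in> arcs QG \<and> (fst b = c \<or> fst b = \<rho> c) \<and> snd (tail QG b) = s \<and> snd (head QG b) = r"
    by (rule skew_arrow_ex1)
next
  fix u s assume u: "u \<in> verts Q" and s: "\<tau> u = u \<or> s = Plus"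
  show "sv u s \<in> verts QG" by (rule sv_props(1)[OF u])
  show "snd (sv u s) = s" using s by (auto simp: sv_props(2)[OF u])
  show "fst (sv u s) = u \<or> fst (sv u s) = \<tau> u" by (rule sv_props(3)[OF u])
qed (simp_all only: sv_props(4) fixed_arrows one_neq_zero simp_thms)

lemma path_action_sigma: "path_action G Q vact aact \<sigma> f = I.act f"
  unfolding path_action_def pact_def inverse_sigma by (rule refl)

lemma path_action_one: "supported Q f \<Longrightarrow> path_action G Q vact aact \<one>\<^bsub>G\<^esub> f = f"
proof (rule path_ext)
  fix u p assume f: "supported Q f"
  show "path_action G Q vact aact \<one>\<^bsub>G\<^esub> f (u, p) = f (u, p)"
  proof (cases "(u, p) \<in> quiver_paths Q")
    case True
    then have "map (aact \<one>\<^bsub>G\<^esub>) p = p" using I.paths_arcs[OF True] action_one(2) by (intro map_idI) auto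
    with True show ?thesis using paths_start[OF True] by (simp add: path_action_def action_one)
  next
    case False
    with f show ?thesis by (auto simp: path_action_def supported_def)
  qed
qed

text \<open>Cyclic equivalence becomes equality of symmetrised coefficients, and those of the image
  of \<open>S\<close> at \<open>w\<close> are those of \<open>S\<close> at
  \<open>map \<rho> w\<close>.\<close>

sublocale P: invariant_potential Q \<tau> \<rho> S
proof unfold_locales
  fix w assume w: "set w \<subseteq> arcs Q"
  have S: "supported Q S" using S_cycles by (auto simp: supported_def cycles_def quiver_paths_def)
  have act: "I.act S (tail Q (hd p), p) = S (tail Q (hd (map \<rho> p)), map \<rho> p)"
    if "set p \<subseteq> arcs Q" "p \<noteq> []" for p
  proof (cases "(tail Q (hd p), p) \<in> quiver_paths Q")
    case True
    then show ?thesis using that by (cases p) (simp_all add: I.act_path)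
  next
    case False
    have "(tail Q (hd (map \<rho> p)), map \<rho> p) \<notin> quiver_paths Q"
    proof
      assume "(tail Q (hd (map \<rho> p)), map \<rho> p) \<in> quiver_paths Q"
      then have "(\<tau> (tail Q (hd (map \<rho> p))), map \<rho> (map \<rho> p)) \<in> quiver_paths Q" by (rule I.paths_map)
      then show False using False that I.map_rho_rho[OF that(1)] by (cases p) (simp_all del: map_map)
    qed
    then have "S (tail Q (hd (map \<rho> p)), map \<rho> p) = 0" using S by (auto simp: supported_def)
    with False show ?thesis by (simp add: pact_def)
  qed
  have "cyclic_sum Q (I.act S) w = cyclic_sum Q S (map \<rho> w)"
    unfolding cyclic_sum_def length_map using w
    by (intro sum.cong[OF refl], subst act) (auto simp: rotate_map)
  then show "cyclic_sum Q S (map \<rho> w) = cyclic_sum Q S w"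
    using cyclically_equivalent_cyclic_sum[OF invariant[unfolded path_action_sigma], of w] by simp
qed

sublocale K: skew_potential_cover Q \<tau> \<rho> QG fst sv S ..

text \<open>The instance for complete path algebras, in which every path has degree
  \<open>0\<close>; it serves to compute the potential of the new quiver.\<close>

sublocale A: skew_group Q \<tau> \<rho> QG fst "\<lambda>_ :: 'a \<times> sign. 1 :: 'k" sv "\<lambda>_. 0" G \<sigma> "path_action G Q vact aact" vact
  by unfold_locales (simp_all add: carrier_eq sigma_one path_action_sigma path_action_one sv_fixed)

lemma ginzburg_action_sigma: "ginzburg_action G Q vact aact \<sigma> f = P.GI.act f"
  unfolding ginzburg_action_def path_action_def pact_def inverse_sigma by (rule refl)

lemma ginzburg_action_one: "supported GQ f \<Longrightarrow> ginzburg_action G Q vact aact \<one>\<^bsub>G\<^esub> f = f"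
proof (rule path_ext)
  fix u p assume f: "supported GQ f"
  show "ginzburg_action G Q vact aact \<one>\<^bsub>G\<^esub> f (u, p) = f (u, p)"
  proof (cases "(u, p) \<in> quiver_paths GQ")
    case True
    have "map (map_ginzburg_arrow (vact \<one>\<^bsub>G\<^esub>) (aact \<one>\<^bsub>G\<^esub>)) p = p"
      using P.GI.paths_arcs[OF True] action_one by (intro map_idI) auto
    with True show ?thesis using G.paths_start[OF True]
      by (simp add: ginzburg_action_def path_action_def action_one)
  next
    case False
    with f show ?thesis by (auto simp: ginzburg_action_def path_action_def supported_def)
  qed
qed

lemma ginzburg_degree_gpi: "ginzburg_degree (map_ginzburg_arrow f g b) = ginzburg_degree b"
  by (cases b) simp_all

text \<open>The instance for Ginzburg algebras, which carries the isomorphism of dg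
  algebras.\<close>

sublocale D: skew_derivation GQ \<tau> "map_ginzburg_arrow \<tau> \<rho>" K.GT K.gpi K.gkappa sv ginzburg_degree G \<sigma>
  "ginzburg_action G Q vact aact" vact "ginzburg_values Q S" "ginzburg_values QG K.cover_potential"
proof -
  interpret TD: derivation_data K.GT "\<lambda>b. ginzburg_degree (K.gpi b)" "ginzburg_values QG K.cover_potential"
    unfolding ginzburg_degree_gpi by (rule K.TP.G.derivation_data_axioms)
  show "skew_derivation GQ \<tau> (map_ginzburg_arrow \<tau> \<rho>) K.GT K.gpi K.gkappa sv ginzburg_degree G \<sigma>
    (ginzburg_action G Q vact aact) vact (ginzburg_values Q S) (ginzburg_values QG K.cover_potential)"
    by unfold_locales
      (simp_all add: carrier_eq sigma_one ginzburg_action_sigma ginzburg_action_one sv_fixed K.Psi_ginzburg_values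
        del: ginzburg_quiver_simps(2))
qed

end

section \<open>The prescribed identification of paths and potentials\<close>

lemma (in quiver) carrier_complete_path_algebra: "carrier (complete_path_algebra Q) = {f. supported Q f}"
proof -
  have "finite (path_degree (\<lambda>_. 0) ` {x. f x \<noteq> 0})" for f :: "('v, 'b, 'k::field) pelt"
    by (rule finite_subset[of _ "{0}"]) (auto simp: path_degree_def)
  then show ?thesis by (auto simp: carrier_path_algebra)
qed

context skew_cover begin

lemma Psi_vertex:
  "Psi (path_elt (x, [])) t s =
    (\<lambda>z. \<Sum>i\<in>verts R. of_bool (t = s \<and> ok i s \<and> sv i s = x) * path_elt (i, []) z)"
proof (rule path_ext)
  fix u w
  show "Psi (path_elt (x, [])) t s (u, w) =
    (\<Sum>i\<in>verts R. of_bool (t = s \<and> ok i s \<and> sv i s = x) * path_elt (i, []) (u, w))"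
  proof (cases w)
    case Nil
    have "(\<Sum>i\<in>verts R. of_bool (t = s \<and> ok i s \<and> sv i s = x) * path_elt (i, []) (u, w)) =
      (\<Sum>i\<in>verts R. if i = u then of_bool (t = s \<and> ok u s \<and> sv u s = x) else 0 :: 'k)"
      by (intro sum.cong[OF refl]) (auto simp: path_elt_def Nil)
    then show ?thesis by (simp add: Nil Psi_Nil path_elt_def)
  next
    case (Cons c q)
    have "residual T b (path_elt (x, [])) = (\<lambda>x. 0 :: 'k)" for b by (rule T.residual_vertex)
    then show ?thesis by (simp add: Cons Psi_Cons)
  qed
qed

lemma pmul_Psi_vertex_left:
  assumes f: "supported R f"
  shows "pmul R (Psi (path_elt (x, [])) t s) f (u, w) =
    of_bool (t = s \<and> ok (awlast u w) s \<and> sv (awlast u w) s = x) * f (u, w)"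
proof -
  let ?P = "\<lambda>i. t = s \<and> ok i s \<and> sv i s = x"
  have "pmul R (Psi (path_elt (x, [])) t s) f (u, w) =
      (\<Sum>i\<in>verts R. of_bool (?P i) * (if awlast u w = i then f (u, w) else 0))"
    unfolding Psi_vertex by (simp add: pmul_sum_left pmul_scale_left pmul_vertex_left)
  also have "\<dots> = (\<Sum>i\<in>verts R. if i = awlast u w then of_bool (?P (awlast u w)) * f (u, w) else 0)"
    by (intro sum.cong) auto
  also have "\<dots> = of_bool (?P (awlast u w)) * f (u, w)"
  proof (cases "f (u, w) = 0")
    case False
    then have "(u, w) \<in> quiver_paths R" using f by (simp add: supported_def)
    then have "awlast u w \<in> verts R" by (auto simp: quiver_paths_def)
    then show ?thesis by (simp add: sum.delta)
  qed (simp add: sum.delta)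
  finally show ?thesis .
qed

lemma pmul_Psi_vertex_right:
  assumes f: "supported R f"
  shows "pmul R f (Psi (path_elt (x, [])) t s) (u, w) = of_bool (t = s \<and> ok u s \<and> sv u s = x) * f (u, w)"
proof -
  let ?P = "\<lambda>i. t = s \<and> ok i s \<and> sv i s = x"
  have "pmul R f (Psi (path_elt (x, [])) t s) (u, w) =
      (\<Sum>i\<in>verts R. of_bool (?P i) * (if u = i then f (u, w) else 0))"
    unfolding Psi_vertex by (simp add: pmul_sum_right pmul_scale_right pmul_vertex_right)
  also have "\<dots> = (\<Sum>i\<in>verts R. if i = u then of_bool (?P u) * f (u, w) else 0)"
    by (intro sum.cong) auto
  also have "\<dots> = of_bool (?P u) * f (u, w)"
    by (cases "u \<in> verts R") (simp_all add: sum.delta supported_vert[OF f])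
  finally show ?thesis .
qed

lemma mmul_Psi_vertices:
  assumes M: "\<And>t s. supported R (M t s)"
  shows "mmul (mmul (Psi (path_elt (y, []))) M) (Psi (path_elt (x, []))) t s (u, w) =
    of_bool (ok u s \<and> sv u s = x \<and> ok (awlast u w) t \<and> sv (awlast u w) t = y) * M t s (u, w)"
proof -
  have inner: "mmul (Psi (path_elt (y, []))) M t r (u, w) =
      of_bool (ok (awlast u w) t \<and> sv (awlast u w) t = y) * M t r (u, w)" for r u w
    unfolding mmul_sum by (cases t) (simp_all add: pmul_Psi_vertex_left[OF M])
  have "supported R (mmul (Psi (path_elt (y, []))) M t r)" for r
    using M[of t r] unfolding supported_def by (auto simp: inner)
  then show ?thesis
    unfolding mmul_sum[of "mmul (Psi (path_elt (y, []))) M"]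
    by (cases s) (simp_all add: pmul_Psi_vertex_right inner)
qed

end

context skew_group begin

lemma toM_skew_tensor:
  fixes B :: "('k, ('v, 'b, 'k) pelt, 'n) module_scheme"
  assumes B: "module.smult B = (\<lambda>c f x. c * f x)"
  shows "toM (skew_tensor G B f (grp_elt \<one>\<^bsub>G\<^esub>)) t s = (\<lambda>x. (f x + chi t s * act f x) / 2)"
proof -
  have "skew_tensor G B f (grp_elt \<one>\<^bsub>G\<^esub>) \<one>\<^bsub>G\<^esub> = f" "skew_tensor G B f (grp_elt \<one>\<^bsub>G\<^esub>) \<sigma> = (\<lambda>x. 0)"
    using sigma_neq by (auto simp: skew_tensor_def grp_elt_def B carrier_G)
  then show ?thesis by (simp add: toM_def)
qed

lemma skew_tensor_carrier:
  fixes B :: "('k, ('v, 'b, 'k) pelt, 'n) module_scheme"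
  assumes B: "module.smult B = (\<lambda>c f x. c * f x)" and f: "f \<in> carrier PA"
  shows "skew_tensor G B f c \<in> carrier BG"
  unfolding skew_simps skew_tensor_def B by (auto intro: carrier_scale f)

text \<open>An arrow is prescribed as \<alpha> \<otimes> 1 cut by two idempotents. The second factor
  on the left is the entry of \<alpha> \<otimes> 1, which is present for all pairs of signs; the
  idempotents leave the one placed by the signs of \<open>b\<close>.\<close>

lemma toM_arrow_corner:
  assumes b: "b \<in> arcs T" and k: "\<kappa> b = 1"
  shows "of_bool (ok u s \<and> sv u s = tail T b \<and> ok (awlast u w) t \<and> sv (awlast u w) t = head T b) *
      ((arrow_elt R (\<pi> b) (u, w) + chi t s * arrow_elt R (\<rho> (\<pi> b)) (u, w)) / 2) =
    Psi (arrow_elt T b) t s (u, w)" (is "of_bool ?P * _ = _")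
proof -
  note pb = pi_arcs[OF b]
  have kf: "kf b c * x = (of_bool (c = \<pi> b) * x + chi (s1 b) (s2 b) * (of_bool (c = \<rho> (\<pi> b)) * x)) / 2" for c x
    by (simp add: kf_def k eps_def algebra_simps)
  have "(\<Sum>c\<in>arcs R. kf b c * arrow_elt R c (u, w)) =
      ((\<Sum>c\<in>arcs R. of_bool (c = \<pi> b) * arrow_elt R c (u, w)) +
      chi (s1 b) (s2 b) * (\<Sum>c\<in>arcs R. of_bool (c = \<rho> (\<pi> b)) * arrow_elt R c (u, w))) / 2"
    unfolding kf by (simp add: sum_divide_distrib[symmetric] sum.distrib sum_distrib_left)
  moreover have "(\<Sum>c\<in>arcs R. of_bool (c = d) * arrow_elt R c (u, w)) = (arrow_elt R d (u, w) :: 'k)"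
    if "d \<in> arcs R" for d
  proof -
    have "(\<Sum>c\<in>arcs R. of_bool (c = d) * arrow_elt R c (u, w)) =
        (\<Sum>c\<in>arcs R. if c = d then arrow_elt R d (u, w) else 0 :: 'k)"
      by (intro sum.cong[OF refl]) auto
    then show ?thesis using that by simp
  qed
  ultimately have rhs: "Psi (arrow_elt T b) t s (u, w) = of_bool (t = s2 b \<and> s = s1 b) *
      ((arrow_elt R (\<pi> b) (u, w) + chi (s1 b) (s2 b) * arrow_elt R (\<rho> (\<pi> b)) (u, w)) / 2)"
    using pb by (simp add: Psi_arrow[OF b])
  have iff: "?P \<longleftrightarrow> t = s2 b \<and> s = s1 b" if c: "c = \<pi> b \<or> c = \<rho> (\<pi> b)" and nz: "arrow_elt R c (u, w) \<noteq> (0 :: 'k)" for c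
  proof -
    have uw: "u = tail R c" "w = [c]" using nz by (auto simp: arrow_elt_def path_elt_def split: if_splits)
    have "eps b c \<noteq> 0"
      using c eps_fixed[OF b] eps_moved[OF b] two_neq_0 chi_neq_0 by (cases "\<rho> (\<pi> b) = \<pi> b") auto
    note ov = eps_over[OF b this]
    have last: "awlast u w = head R c" by (simp add: uw)
    show ?thesis
    proof
      assume P: ?P
      have "snd (sv u s) = s" using P uw(1) tail_in_verts[OF ov(1)] by (intro snd_sv) (auto simp: ok_def)
      moreover have "snd (sv (awlast u w) t) = t"
        using P last head_in_verts[OF ov(1)] by (intro snd_sv) (auto simp: ok_def)
      ultimately show "t = s2 b \<and> s = s1 b" using P by metis
    next
      assume ts: "t = s2 b \<and> s = s1 b"
      show ?P unfolding last unfolding uw(1) using ov(2-5) ts by metis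
    qed
  qed
  show ?thesis
  proof (cases "arrow_elt R (\<pi> b) (u, w) = (0 :: 'k) \<and> arrow_elt R (\<rho> (\<pi> b)) (u, w) = (0 :: 'k)")
    case True
    then show ?thesis unfolding rhs by simp
  next
    case False
    then have "?P \<longleftrightarrow> t = s2 b \<and> s = s1 b" using iff by blast
    then show ?thesis unfolding rhs by (cases "t = s2 b \<and> s = s1 b") (auto simp: chi_commute)
  qed
qed

lemma skew_arrow:
  assumes b: "b \<in> arcs T" and k: "\<kappa> b = 1"
  defines "F \<equiv> skew_idem G PA vact \<sigma> (head T b) \<otimes>\<^bsub>BG\<^esub>
      skew_tensor G PA (arrow_elt R (\<pi> b)) (grp_elt \<one>\<^bsub>G\<^esub>) \<otimes>\<^bsub>BG\<^esub> skew_idem G PA vact \<sigma> (tail T b)"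
  shows "F \<in> carrier BG" "toM F = Psi (arrow_elt T b)"
proof -
  note PA = path_algebra_simps(5)[of wt] path_algebra_simps(4)[of wt]
  have "arrow_elt R (\<pi> b) \<in> grade PA (wt (\<pi> b))"
    using pi_arcs[OF b] by (auto simp: grade_path_algebra arrow_elt_def path_elt_def path_degree_def supported_def)
  then have ac: "arrow_elt R (\<pi> b) \<in> carrier PA" using grade_subset by blast
  have idem: "skew_idem G PA vact \<sigma> x \<in> carrier BG" if "x \<in> verts T" for x
    using skew_idem_carrier[OF PA, of "fst x" "snd x"] verts_T[OF that] by simp
  have h: "head T b \<in> verts T" and tl: "tail T b \<in> verts T" using b by simp_all
  note tens = skew_tensor_carrier[OF PA(1) ac, of "grp_elt \<one>\<^bsub>G\<^esub>"]
  note prod = skew_mult(3)[OF idem[OF h] tens]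
  show "F \<in> carrier BG" unfolding F_def by (rule skew_mult(3)[OF prod idem[OF tl]])
  show "toM F = Psi (arrow_elt T b)"
  proof (rule ext, rule ext, rule path_ext)
    fix t s u w
    have supp: "supported R (toM (skew_tensor G PA (arrow_elt R (\<pi> b)) (grp_elt \<one>\<^bsub>G\<^esub>)) t s)" for t s
      using toM_carrier[OF tens] by (simp add: carrier_path_algebra)
    show "toM F t s (u, w) = Psi (arrow_elt T b) t s (u, w)"
      unfolding F_def toM_mult[OF prod idem[OF tl]] toM_mult[OF idem[OF h] tens] toM_skew_idem[OF PA h]
        toM_skew_idem[OF PA tl] mmul_Psi_vertices[OF supp] toM_skew_tensor[OF PA(1)] act_arrow[OF pi_arcs[OF b]]
      by (rule toM_arrow_corner[OF b k])
  qed
qed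

text \<open>Matrices preserve length, so subtracting from \<open>f\<close> its part on paths as long
  as \<open>y\<close> does not leave anything visible at \<open>y\<close>. This turns the finite sum
  in \<open>skew_identification\<close> into a value of \<open>Upsilon\<close>.\<close>

lemma Upsilon_length_cong:
  assumes f: "supported T f" and P: "finite P" "P = {x \<in> quiver_paths T. length (snd x) = length (snd y)}"
    and g: "g \<in> carrier G"
  shows "Upsilon f g y = (\<Sum>x\<in>P. f x * Upsilon (path_elt x) g y)"
proof -
  obtain u w where y: "y = (u, w)" by (cases y)
  define f' where "f' = (\<lambda>z. \<Sum>x\<in>P. f x * path_elt x z)"
  have f': "f' z = of_bool (z \<in> P) * f z" for z
  proof -
    have "f' z = (\<Sum>x\<in>P. if x = z then f z else 0)" unfolding f'_def by (intro sum.cong) (auto simp: path_elt_def)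
    then show ?thesis using P(1) by simp
  qed
  have "Psi (\<lambda>z. f z + (-1) * f' z) t s (u, w) = 0" for t s
  proof (rule ccontr)
    assume "Psi (\<lambda>z. f z + (-1) * f' z) t s (u, w) \<noteq> 0"
    then obtain p where "f (sv u s, p) + (-1) * f' (sv u s, p) \<noteq> 0" "length p = length w"
      by (rule Psi_nonzero_path)
    then have "f (sv u s, p) \<noteq> 0" "(sv u s, p) \<notin> P" by (auto simp: f')
    moreover from this(1) have "(sv u s, p) \<in> quiver_paths T" using f unfolding supported_def by blast
    ultimately show False using \<open>length p = length w\<close> by (simp add: P(2) y)
  qed
  then have "Psi f t s (u, w) = Psi f' t s (u, w)" for t s
    unfolding Psi_add Psi_scale by (simp add: add_eq_0_iff)
  moreover have "Psi f' t s (u, w) = (\<Sum>x\<in>P. f x * Psi (path_elt x) t s (u, w))" for t s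
    unfolding f'_def Psi_sum[OF P(1)] Psi_scale by (rule refl)
  ultimately have eq: "Psi f t s (u, w) = (\<Sum>x\<in>P. f x * Psi (path_elt x) t s (u, w))" for t s by simp
  show ?thesis
    using g unfolding Upsilon_def fromM_def y
    by (simp add: eq sum.distrib[symmetric] sum_subtractf[symmetric] sum_divide_distrib algebra_simps)
qed

end

context skew_derivation begin

lemma der_fromM: "g \<in> carrier G \<Longrightarrow> RD.dd (fromM M g) = fromM (\<lambda>t s. RD.dd (M t s)) g"
proof -
  assume g: "g \<in> carrier G"
  have 1: "(\<lambda>x. (a x + b x + c x + d x) / 2) = (\<lambda>x. (1 / 2) * (a x + b x + c x + d x))"
    "(\<lambda>x. (a x - b x + c x - d x) / 2) = (\<lambda>x. (1 / 2) * (a x + (-1) * b x + c x + (-1) * d x))"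
    for a b c d :: "('v, 'b, 'k) pelt" by (auto simp: field_simps)
  show ?thesis
    using g sigma_neq unfolding carrier_G
    by (elim insertE emptyE) (simp_all only: fromM_one fromM_sigma 1 RD.der_scale RD.der_add)
qed

end

context skew_setting begin

abbreviation "path_image \<equiv> skew_path_elt G Q vact aact \<sigma> oW oQ1 ::
  _ \<Rightarrow> 'g \<Rightarrow> ('v, 'a, 'k) pelt"

lemma skew_arrow_elt:
  assumes a: "a \<in> arcs QG"
  shows "skew_arrow_elt G Q vact aact \<sigma> oW oQ1 a \<in> carrier A.BG"
    "A.toM (skew_arrow_elt G Q vact aact \<sigma> oW oQ1 a) = C.Psi (arrow_elt QG a)"
  unfolding skew_arrow_elt_def Let_def by (rule A.skew_arrow[OF a refl])+

lemma skew_path_elt: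
  assumes "(x, p) \<in> quiver_paths QG"
  shows "path_image (x, p) \<in> carrier A.BG \<and> A.toM (path_image (x, p)) = C.Psi (path_elt (x, p))"
  using assms
proof (induction p arbitrary: x)
  case Nil
  then have x: "x \<in> verts QG" by simp
  have "path_image (x, []) \<in> carrier A.BG"
    using A.skew_idem_carrier[OF path_algebra_simps(5,4), where i = "fst x" and s = "snd x"] C.verts_T[OF x] by simp
  then show ?case by (simp add: A.toM_skew_idem[OF path_algebra_simps(5,4) x])
next
  case (Cons a p)
  then have a: "a \<in> arcs QG" and x: "x = tail QG a" and p: "(head QG a, p) \<in> quiver_paths QG" by auto
  note IH = Cons.IH[OF p]
  have mult: "path_elt (x, a # p) = (pmul QG (path_elt (head QG a, p)) (arrow_elt QG a) :: (_, _, 'k) pelt)"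
  proof (rule path_ext)
    fix u q show "path_elt (x, a # p) (u, q) = (pmul QG (path_elt (head QG a, p)) (arrow_elt QG a) (u, q) :: 'k)"
      by (cases q) (auto simp: C.T.pmul_arrow_right path_elt_def x)
  qed
  have "C.Psi (path_elt (x, a # p)) = C.mmul (C.Psi (path_elt (head QG a, p))) (C.Psi (arrow_elt QG a))"
    unfolding mult by (rule C.Psi_pmul) (simp_all add: C.T.supported_path_elt p C.T.supported_arrow a)
  then show ?case
    using A.skew_mult(3)[OF IH[THEN conjunct1] skew_arrow_elt(1)[OF a]]
      A.toM_mult[OF IH[THEN conjunct1] skew_arrow_elt(1)[OF a]] IH skew_arrow_elt(2)[OF a] by simp
qed

lemma finite_paths_of_length: "finite {x \<in> quiver_paths QG. length (snd x) = n}"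
proof (rule finite_subset)
  show "{x \<in> quiver_paths QG. length (snd x) = n} \<subseteq> verts QG \<times> {p. set p \<subseteq> arcs QG \<and> length p = n}"
    by (auto simp: quiver_paths_def)
  show "finite (verts QG \<times> {p. set p \<subseteq> arcs QG \<and> length p = n})"
    by (intro finite_cartesian_product finite_lists_length_eq) simp_all
qed

text \<open>The two maps agree on paths, by multiplicativity, and both are evaluated length by
  length.\<close>

lemma skew_identification:
  assumes f: "supported QG f"
  shows "skew_identification G Q vact aact \<sigma> oW oQ1 f = A.Upsilon f"
proof
  fix g
  have img: "path_image x = A.Upsilon (path_elt x)" if "x \<in> quiver_paths QG" for x
    using skew_path_elt[of "fst x" "snd x"] A.fromM_toM[of "path_image x"] that by (simp add: A.Upsilon_def)
  show "skew_identification G Q vact aact \<sigma> oW oQ1 f g = A.Upsilon f g"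
  proof (cases "g \<in> carrier G")
    case True
    have "skew_identification G Q vact aact \<sigma> oW oQ1 f g y = A.Upsilon f g y" for y
      using True unfolding A.Upsilon_length_cong[OF f finite_paths_of_length refl True]
      by (auto simp: skew_identification_def img intro!: sum.cong)
    then show ?thesis by (rule ext)
  next
    case False
    then show ?thesis by (simp add: skew_identification_def A.Upsilon_def A.fromM_def)
  qed
qed

lemma ebar_path_algebra: "skew_ebar G Q (complete_path_algebra Q) A.BG vact \<sigma> oW = A.fromM A.ident"
  by (rule A.skew_ebar_eq[OF path_algebra_simps(5,4) refl refl refl refl oW_moved oW_iff])

text \<open>In matrix form \<iota> becomes multiplication by \<open>ident\<close> on both sides of
  the entries of \<open>S \<otimes> 1\<close>, and the orbit size is constant on orbits.\<close>

lemma skew_iota': "skew_iota' G Q vact aact \<sigma> oW S = A.fromM K.potential_matrix"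
proof -
  define f where "f = (\<lambda>(u, p). (if \<tau> u = u then 1 else 2) * S (u, p))"
  have f: "f (u, p) = C.nu u * S (u, p)" for u p by (simp add: f_def C.nu_def)
  have supp: "supported Q f" using K.supported_S by (auto simp: supported_def f)
  let ?t = "skew_tensor G (complete_path_algebra Q) f (grp_elt \<one>\<^bsub>G\<^esub>)"
  have E: "A.fromM A.ident \<in> carrier A.BG" by (rule A.fromM_carrier[OF A.ident_carrier])
  have t: "?t \<in> carrier A.BG"
    by (rule A.skew_tensor_carrier[OF path_algebra_simps(5)]) (simp add: carrier_complete_path_algebra supp)
  note Et = A.skew_mult(3)[OF E t]
  have iota: "skew_iota' G Q vact aact \<sigma> oW S = A.fromM A.ident \<otimes>\<^bsub>A.BG\<^esub> ?t \<otimes>\<^bsub>A.BG\<^esub> A.fromM A.ident"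
    unfolding skew_iota'_def skew_iota_def Let_def ebar_path_algebra f_def by (rule refl)
  have tm: "supported Q (A.toM ?t t s)" for t s using A.toM_carrier[OF t] by (simp add: carrier_path_algebra)
  have "A.toM (skew_iota' G Q vact aact \<sigma> oW S) = K.potential_matrix"
  proof (rule ext, rule ext, rule path_ext)
    fix t s u w
    have val: "A.toM ?t t s (u, w) = C.nu u / 2 * (S (u, w) + C.chi t s * I.act S (u, w))"
    proof (cases "(u, w) \<in> quiver_paths Q")
      case True
      then show ?thesis unfolding A.toM_skew_tensor[OF path_algebra_simps(5)]
        by (simp add: I.act_path f C.nu_tau[OF paths_start[OF True]] algebra_simps add_divide_distrib)
    next
      case False
      then have "S (u, w) = 0" using K.supported_S by (auto simp: supported_def)
      with False show ?thesis unfolding A.toM_skew_tensor[OF path_algebra_simps(5)] by (simp add: f pact_def)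
    qed
    show "A.toM (skew_iota' G Q vact aact \<sigma> oW S) t s (u, w) = K.potential_matrix t s (u, w)"
      unfolding iota A.toM_mult[OF Et E] A.toM_mult[OF E t] A.toM_fromM[OF A.eigen_ident] A.mmul_ident[OF tm] val
      by (simp add: K.potential_matrix_def conj_commute)
  qed
  moreover have "skew_iota' G Q vact aact \<sigma> oW S \<in> carrier A.BG"
    unfolding iota by (rule A.skew_mult(3)[OF Et E])
  ultimately show ?thesis using A.fromM_toM by metis
qed

text \<open>The definition inverts the identification on the whole corner; \<open>Theta\<close>
  supplies the preimage explicitly.\<close>

lemma skew_potential: "skew_potential G Q vact aact \<sigma> oW oQ1 S = K.cover_potential"
proof -
  let ?f = "skew_identification G Q vact aact \<sigma> oW oQ1 :: (_, _, 'k) pelt \<Rightarrow> _"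
  let ?A = "carrier (complete_path_algebra QG) :: (_, _, 'k) pelt set"
  have eq: "?f f = A.Upsilon f" if "f \<in> ?A" for f
    using that by (simp add: skew_identification C.T.carrier_complete_path_algebra)
  have "inj_on A.Upsilon ?A" using A.bij_Upsilon by (simp add: bij_betw_def)
  then have inj: "inj_on ?f ?A" by (simp add: eq cong: inj_on_cong)
  have Th: "C.Theta K.potential_matrix \<in> ?A" by (simp add: C.T.carrier_complete_path_algebra)
  have "?f (C.Theta K.potential_matrix) = skew_iota' G Q vact aact \<sigma> oW S"
    unfolding eq[OF Th] A.Upsilon_def C.Psi_Theta[OF K.corner_potential_matrix] skew_iota' by (rule refl)
  then have "the_inv_into ?A ?f (skew_iota' G Q vact aact \<sigma> oW S) = C.Theta K.potential_matrix"
    by (rule the_inv_into_f_eq[OF inj _ Th])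
  then show ?thesis unfolding skew_potential_def K.cover_potential_def Let_def by (simp only:)
qed

section \<open>The group action and the isomorphism of dg algebras\<close>

abbreviation "\<Gamma> \<equiv> ginzburg_dg_algebra Q S"
abbreviation "gact \<equiv> ginzburg_action G Q vact aact ::
  'g \<Rightarrow> ('v, ('v, 'a) ginzburg_arrow, 'k) pelt \<Rightarrow> ('v, ('v, 'a) ginzburg_arrow, 'k) pelt"
abbreviation "\<Gamma>G \<equiv> skew_dg_algebra G gact \<Gamma>"

lemma carrier_supported: "f \<in> carrier \<Gamma> \<Longrightarrow> supported GQ f"
  by (simp add: ginzburg_simps G.carrier_path_algebra)

lemma gact_cases:
  assumes "g \<in> carrier G"
  obtains "g = \<one>\<^bsub>G\<^esub>" "\<And>f. f \<in> carrier \<Gamma> \<Longrightarrow> gact g f = f" | "g = \<sigma>" "\<And>f. gact g f = P.GI.act f"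
  using assms by (auto simp: carrier_eq ginzburg_action_one ginzburg_action_sigma carrier_supported)

lemma act_involution: "f \<in> carrier \<Gamma> \<Longrightarrow> P.GI.act (P.GI.act f) = f"
  by (simp add: P.GI.act_act carrier_supported)

lemma act_closed: "f \<in> carrier \<Gamma> \<Longrightarrow> P.GI.act f \<in> carrier \<Gamma>"
  by (simp add: ginzburg_simps P.GI.act_carrier)

lemma gact_bij: "g \<in> carrier G \<Longrightarrow> bij_betw (gact g) (carrier \<Gamma>) (carrier \<Gamma>)"
proof (erule gact_cases)
  assume "\<And>f. f \<in> carrier \<Gamma> \<Longrightarrow> gact g f = f"
  then show ?thesis by (simp cong: bij_betw_cong add: bij_betw_id[unfolded id_def])
next
  assume *: "\<And>f. gact g f = P.GI.act f"
  show ?thesis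
    by (rule bij_betw_byWitness[where f' = P.GI.act]) (auto simp: * act_involution act_closed)
qed

lemma gact_dg_iso: "g \<in> carrier G \<Longrightarrow> gact g \<in> dg_iso \<Gamma> \<Gamma>"
proof -
  assume g: "g \<in> carrier G"
  interpret dg: dg_algebra \<Gamma> by (rule dg_algebra_ginzburg)
  have sub: "grade \<Gamma> n \<subseteq> carrier \<Gamma>" for n
    by (simp add: ginzburg_simps G.grade_subset)
  have diff: "diff \<Gamma> f \<in> carrier \<Gamma>" "diff \<Gamma> f = gdiff f" if "f \<in> carrier \<Gamma>" for f
    using that diff_ginzburg[of f] G.der_carrier[of f] by (simp_all add: ginzburg_simps)
  have scale: "c \<odot>\<^bsub>\<Gamma>\<^esub> f \<in> carrier \<Gamma>" if "f \<in> carrier \<Gamma>" for c f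
    using that G.carrier_scale by (simp add: ginzburg_simps)
  from g show ?thesis
  proof (rule gact_cases)
    assume id: "\<And>f. f \<in> carrier \<Gamma> \<Longrightarrow> gact g f = f"
    have "gact g \<in> ring_hom \<Gamma> \<Gamma>" by (rule ring_hom_memI) (simp_all add: id)
    then show ?thesis
      using gact_bij[OF g] scale id[OF subsetD[OF sub]] by (auto simp: dg_iso_def ring_iso_def id diff(1))
  next
    assume act: "\<And>f. gact g f = P.GI.act f"
    have "gact g \<in> ring_hom \<Gamma> \<Gamma>"
      by (rule ring_hom_memI)
        (simp_all add: act act_closed, simp_all add: ginzburg_simps P.GI.act_add P.GI.act_pone P.GI.act_pmul
          G.carrier_path_algebra)
    moreover have "gact g f \<in> grade \<Gamma> n" if "f \<in> grade \<Gamma> n" for f n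
      using that by (simp add: act ginzburg_simps P.GI.act_grade)
    moreover have "gact g (diff \<Gamma> f) = diff \<Gamma> (gact g f)" if "f \<in> carrier \<Gamma>" for f
      using that P.GI.der_act[OF carrier_supported[OF that]] by (simp add: act diff act_closed)
    moreover have "gact g (c \<odot>\<^bsub>\<Gamma>\<^esub> f) = c \<odot>\<^bsub>\<Gamma>\<^esub> gact g f" for c f
      by (simp add: act ginzburg_simps P.GI.act_scale)
    ultimately show ?thesis
      using gact_bij[OF g] by (auto simp: dg_iso_def ring_iso_def)
  qed
qed

theorem acts_by_dg_automorphisms: "acts_by_dg_automorphisms G \<Gamma> gact"
proof -
  let ?C = "carrier \<Gamma>"
  let ?r = "\<lambda>g. restrict (gact g) ?C"
  have Bij: "?r g \<in> carrier (BijGroup ?C)" if "g \<in> carrier G" for g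
    using gact_bij[OF that] by (simp add: BijGroup_def Bij_def cong: bij_betw_cong)
  have comp: "gact (g \<otimes>\<^bsub>G\<^esub> h) f = gact g (gact h f)"
    if g: "g \<in> carrier G" and h: "h \<in> carrier G" and f: "f \<in> ?C" for g h f
    by (rule gact_cases[OF g]; rule gact_cases[OF h])
      (simp_all add: f act_closed act_involution sigma_square ginzburg_action_sigma ginzburg_action_one
        sigma_carrier carrier_supported)
  have "?r \<in> hom G (BijGroup ?C)"
  proof (rule homI[OF Bij])
    fix g h assume g: "g \<in> carrier G" and h: "h \<in> carrier G"
    have "?r (g \<otimes>\<^bsub>G\<^esub> h) = compose ?C (?r g) (?r h)"
      using bij_betwE[OF gact_bij[OF h]] by (auto simp: compose_def comp[OF g h] intro!: restrict_ext)
    then show "?r (g \<otimes>\<^bsub>G\<^esub> h) = ?r g \<otimes>\<^bsub>BijGroup ?C\<^esub> ?r h"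
      using Bij[OF g] Bij[OF h] by (simp add: BijGroup_def)
  qed
  then have "group_action G ?C ?r"
    by (simp add: group_action_def group_hom_def group_hom_axioms_def group_BijGroup is_group)
  then show ?thesis by (simp add: acts_by_dg_automorphisms_def dg_algebra_ginzburg gact_dg_iso)
qed

lemma skew_dg_simps:
  "carrier \<Gamma>G = carrier D.BG" "add \<Gamma>G = add D.BG" "ring.zero \<Gamma>G = ring.zero D.BG"
  "module.smult \<Gamma>G = module.smult D.BG" "grade \<Gamma>G = (\<lambda>n. carrier G \<rightarrow>\<^sub>E grade D.PA n)"
  "diff \<Gamma>G = (\<lambda>F. \<lambda>g\<in>carrier G. diff \<Gamma> (F g))"
  by (simp_all add: skew_dg_algebra_def module.extend_def D.skew_simps skew_algebra_def ginzburg_simps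
      G.path_algebra_simps)

text \<open>The two products sum over the group in different records; both sums are the sums of
  coefficients.\<close>

lemma skew_dg_mult:
  assumes F: "F \<in> carrier D.BG" and H: "H \<in> carrier D.BG"
  shows "F \<otimes>\<^bsub>\<Gamma>G\<^esub> H = F \<otimes>\<^bsub>D.BG\<^esub> H"
proof -
  have "(\<Oplus>\<^bsub>\<Gamma>\<^esub>h\<in>carrier G. pmul GQ (F h) (gact h (H (inv\<^bsub>G\<^esub> h \<otimes>\<^bsub>G\<^esub> g)))) =
      (\<Oplus>\<^bsub>D.PA\<^esub>h\<in>carrier G. pmul GQ (F h) (gact h (H (inv\<^bsub>G\<^esub> h \<otimes>\<^bsub>G\<^esub> g))))" if g: "g \<in> carrier G" for g
  proof -
    have fin: "finite (carrier G)" by (simp add: carrier_eq)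
    have cl: "pmul GQ (F h) (gact h (H (inv\<^bsub>G\<^esub> h \<otimes>\<^bsub>G\<^esub> g))) \<in> carrier D.PA" if "h \<in> carrier G" for h
      using F H that g by (intro G.carrier_pmul D.gact_carrier) (auto simp: D.skew_simps)
    have "(\<Oplus>\<^bsub>\<Gamma>\<^esub>h\<in>carrier G. pmul GQ (F h) (gact h (H (inv\<^bsub>G\<^esub> h \<otimes>\<^bsub>G\<^esub> g)))) =
        (\<lambda>x. \<Sum>h\<in>carrier G. pmul GQ (F h) (gact h (H (inv\<^bsub>G\<^esub> h \<otimes>\<^bsub>G\<^esub> g))) x)"
      by (rule G.path_finsum[OF _ _ _ fin]) (use cl in \<open>simp_all add: ginzburg_simps\<close>)
    moreover have "(\<Oplus>\<^bsub>D.PA\<^esub>h\<in>carrier G. pmul GQ (F h) (gact h (H (inv\<^bsub>G\<^esub> h \<otimes>\<^bsub>G\<^esub> g)))) =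
        (\<lambda>x. \<Sum>h\<in>carrier G. pmul GQ (F h) (gact h (H (inv\<^bsub>G\<^esub> h \<otimes>\<^bsub>G\<^esub> g))) x)"
      by (rule G.path_finsum[OF _ _ _ fin]) (use cl in \<open>simp_all add: G.path_algebra_simps\<close>)
    ultimately show ?thesis by simp
  qed
  then show ?thesis
    by (auto simp: skew_dg_algebra_def module.extend_def skew_algebra_def ginzburg_simps G.path_algebra_simps
        intro!: restrict_ext)
qed

lemma ebar_ginzburg: "skew_ebar G Q \<Gamma> \<Gamma>G vact \<sigma> oW = D.fromM D.ident"
  by (rule D.skew_ebar_eq[OF ginzburg_simps(6,5) skew_dg_simps(1-3)]) 
  (simp, use oW_moved in simp, rule oW_iff, simp_all)

lemma quiver_with_potential_cover: "quiver_with_potential QG K.cover_potential"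
  using K.TP.S_cycles C.T.fin_digraph_axioms by (simp add: quiver_with_potential_def)

text \<open>The structure is transported from the Ginzburg algebra of the new quiver, where the
  axioms are known, along \<open>D.Upsilon\<close>.\<close>

theorem corner_isomorphic:
  "dg_isomorphic (corner (D.fromM D.ident) \<Gamma>G) (ginzburg_dg_algebra QG K.cover_potential)"
proof -
  let ?e = "D.fromM D.ident" and ?A = "ginzburg_dg_algebra QG K.cover_potential"
  have e: "?e \<in> carrier D.BG" by (rule D.fromM_carrier[OF D.ident_carrier])
  have PT: "D.PT = ginzburg_graded QG" by (simp add: ginzburg_degree_gpi)
  have mult_eq: "?e \<otimes>\<^bsub>\<Gamma>G\<^esub> F \<otimes>\<^bsub>\<Gamma>G\<^esub> ?e = ?e \<otimes>\<^bsub>D.BG\<^esub> F \<otimes>\<^bsub>D.BG\<^esub> ?e" if "F \<in> carrier D.BG" for F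
    by (simp only: skew_dg_mult[OF e that] skew_dg_mult[OF D.skew_mult(3)[OF e that] e])
  have "{?e \<otimes>\<^bsub>\<Gamma>G\<^esub> F \<otimes>\<^bsub>\<Gamma>G\<^esub> ?e | F. F \<in> carrier \<Gamma>G} = {?e \<otimes>\<^bsub>D.BG\<^esub> F \<otimes>\<^bsub>D.BG\<^esub> ?e | F. F \<in> carrier D.BG}"
    by (simp only: skew_dg_simps(1) mult_eq cong: rev_conj_cong)
  also have "\<dots> = D.skew_corner" by (rule D.corner_carrier[OF e D.toM_fromM[OF D.eigen_ident]])
  finally have corner: "{?e \<otimes>\<^bsub>\<Gamma>G\<^esub> F \<otimes>\<^bsub>\<Gamma>G\<^esub> ?e | F. F \<in> carrier \<Gamma>G} = D.skew_corner" .
  note bij = D.bij_Upsilon[unfolded PT]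
  have Uc: "D.Upsilon f \<in> carrier D.BG" if "f \<in> carrier ?A" for f
    using D.Upsilon_carrier[unfolded PT, of f] that by (simp add: K.TP.ginzburg_simps)
  show ?thesis
  proof (rule dg_transport[of ?A D.Upsilon "corner ?e \<Gamma>G"]; (rule K.TP.dg_algebra_ginzburg)?)
    show "inj_on D.Upsilon (carrier ?A)" using bij by (simp add: K.TP.ginzburg_simps bij_betw_def)
    show "carrier (corner ?e \<Gamma>G) = D.Upsilon ` carrier ?A"
      using bij by (simp add: corner_def corner K.TP.ginzburg_simps bij_betw_def)
    show "D.Upsilon \<one>\<^bsub>?A\<^esub> = \<one>\<^bsub>corner ?e \<Gamma>G\<^esub>"
      by (simp add: corner_def K.TP.ginzburg_simps D.Upsilon_def D.Psi_pone)
    show "D.Upsilon \<zero>\<^bsub>?A\<^esub> = \<zero>\<^bsub>corner ?e \<Gamma>G\<^esub>"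
      by (simp add: corner_def K.TP.ginzburg_simps D.Upsilon_zero skew_dg_simps)
    show "grade (corner ?e \<Gamma>G) n = D.Upsilon ` grade ?A n" for n
      using D.Upsilon_grade[unfolded PT, of n] by (simp add: corner_def corner[unfolded skew_dg_simps(1)] K.TP.ginzburg_simps skew_dg_simps)
    fix f assume f: "f \<in> carrier ?A"
    show "D.Upsilon (c \<odot>\<^bsub>?A\<^esub> f) = c \<odot>\<^bsub>corner ?e \<Gamma>G\<^esub> D.Upsilon f" for c
      by (simp add: corner_def K.TP.ginzburg_simps D.Upsilon_smult skew_dg_simps)
    have supp: "supported K.GT f" using f by (simp add: K.TP.ginzburg_simps K.TP.G.carrier_path_algebra)
    show "D.Upsilon (diff ?A f) = diff (corner ?e \<Gamma>G) (D.Upsilon f)"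
    proof
      fix g
      show "D.Upsilon (diff ?A f) g = diff (corner ?e \<Gamma>G) (D.Upsilon f) g"
      proof (cases "g \<in> carrier G")
        case True
        then have "D.Upsilon f g \<in> carrier (ginzburg_graded Q)" using Uc[OF f] by (auto simp: D.skew_simps)
        then have "diff (corner ?e \<Gamma>G) (D.Upsilon f) g = gdiff (D.Upsilon f g)"
          using True by (simp add: corner_def skew_dg_simps diff_ginzburg)
        \<comment> \<open>The differential acts on each group coefficient separately. Being linear,
          it passes through \<open>fromM\<close> to the entries, where \<open>Psi_der\<close>
          applies.\<close>
        also have "\<dots> = D.fromM (\<lambda>t s. gdiff (K.GC.Psi f t s)) g"
          unfolding D.Upsilon_def by (rule D.der_fromM[OF True])
        also have "(\<lambda>t s. gdiff (K.GC.Psi f t s)) = K.GC.Psi (diff ?A f)"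
        proof (rule ext, rule ext)
          fix t s
          have "diff ?A f = K.TP.gdiff f" using f by (intro K.TP.diff_ginzburg) (simp add: K.TP.ginzburg_simps)
          then show "gdiff (K.GC.Psi f t s) = K.GC.Psi (diff ?A f) t s"
            using D.Psi_der[OF supp, of t s] by (simp only: ginzburg_degree_gpi)
        qed
        finally show ?thesis by (simp add: D.Upsilon_def)
      next
        case False
        then show ?thesis by (simp add: corner_def skew_dg_simps D.Upsilon_def D.fromM_def)
      qed
    qed
    fix h assume h: "h \<in> carrier ?A"
    show "D.Upsilon (f \<otimes>\<^bsub>?A\<^esub> h) = D.Upsilon f \<otimes>\<^bsub>corner ?e \<Gamma>G\<^esub> D.Upsilon h"
      using f h D.Upsilon_mult[unfolded PT, of f h]
      by (simp add: corner_def K.TP.ginzburg_simps skew_dg_mult Uc)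
    show "D.Upsilon (f \<oplus>\<^bsub>?A\<^esub> h) = D.Upsilon f \<oplus>\<^bsub>corner ?e \<Gamma>G\<^esub> D.Upsilon h"
      by (simp add: corner_def K.TP.ginzburg_simps D.Upsilon_add skew_dg_simps)
  qed
qed

end

theorem theorem2p6:
  fixes Q :: "('v, 'a) pre_digraph" and S :: "('v, 'a, 'k::field) pelt"
    and G :: "('g, 'm) monoid_scheme" and \<sigma> :: 'g
    and vact :: "'g \<Rightarrow> 'v \<Rightarrow> 'v" and aact :: "'g \<Rightarrow> 'a \<Rightarrow> 'a"
    and oW :: "'v set" and oQ1 :: "'a set"
  assumes "CHAR('k) \<noteq> 2"
    and "quiver_with_potential Q S"
    and "group G" and "carrier G = {\<one>\<^bsub>G\<^esub>, \<sigma>}" and "\<sigma> \<noteq> \<one>\<^bsub>G\<^esub>"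
    and "quiver_action G Q vact aact"
    and "\<forall>\<alpha>\<in>arcs Q. vact \<sigma> (tail Q \<alpha>) = tail Q \<alpha> \<and> vact \<sigma> (head Q \<alpha>) = head Q \<alpha> \<longrightarrow> aact \<sigma> \<alpha> = \<alpha>"
    and "cyclically_equivalent Q S (path_action G Q vact aact \<sigma> S)"
    and "orbit_representatives G vact (verts Q - invariants (verts Q) vact \<sigma>) oW"
    and "orbit_representatives G aact (arcs Q) oQ1"
  shows "acts_by_dg_automorphisms G (ginzburg_dg_algebra Q S) (ginzburg_action G Q vact aact) \<and>
         quiver_with_potential (skew_quiver G Q vact \<sigma> oW oQ1)
           (skew_potential G Q vact aact \<sigma> oW oQ1 S) \<and>
         (let \<Gamma> = ginzburg_dg_algebra Q S;
              \<Gamma>G = skew_dg_algebra G (ginzburg_action G Q vact aact) \<Gamma>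
          in dg_isomorphic (corner (skew_ebar G Q \<Gamma> \<Gamma>G vact \<sigma> oW) \<Gamma>G)
               (ginzburg_dg_algebra (skew_quiver G Q vact \<sigma> oW oQ1)
                  (skew_potential G Q vact aact \<sigma> oW oQ1 S)))"
proof -
  interpret potential Q S by (rule potentialI) fact
  interpret skew_setting G Q S \<sigma> vact aact oW oQ1
    by (intro skew_setting.intro skew_setting_axioms.intro potential_axioms) (use assms in \<open>simp_all\<close>)
  show ?thesis
    unfolding skew_potential Let_def ebar_ginzburg
    using acts_by_dg_automorphisms quiver_with_potential_cover corner_isomorphic by blast
qed

end
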